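(* Let $(X,\|\cdot\|,\tau)$ be a sequentially complete C-sequential Saks space with mixed topology $\gamma$, and for each $n\in\mathbb N$ let $(S_n(t))_{t\ge0}$ be a locally $\tau$-bi-continuous cosine family on $X$ with bi-generator $A_n$ such that $(S_n(t))_{n\in\mathbb N,t\ge0}$ is uniformly locally bi-equicontinuous. Let $\omega\ge0$ and $M\ge1$ be such that $\|S_n(t)\|_{\mathcal L(X)}\le Me^{\omega t}$ for all $t\ge0$ and $n\in\mathbb N$, and let $\lambda>\omega$. Consider the following assertions. (a) There exist a bi-densely defined linear operator $(A,D(A))$ and a bi-core $D\subseteq\bigcup_{k=1}^\infty\bigcap_{n=k}^\infty D(A_n)$ for $A$ such that $(A_nx)_{n\in\mathbb N}$ is $\|\cdot\|$-bounded and $A_nx\to Ax$ w.r.t. $\tau$ for all $x\in D$, and $\lambda^2-A$ has bi-dense range. (b) There exist a $\gamma$-densely defined linear operator $(A,D(A))$ and a $\gamma$-core $D\subseteq\bigcup_{k=1}^\infty\bigcap_{n=k}^\infty D(A_n)$ for $A$ such that $A_nx\to Ax$ w.r.t. $\gamma$ for all $x\in D$, and $\lambda^2-A$ has $\gamma$-dense range. (c) There exists $R\in\mathcal L(X)$ such that $R(\lambda^2,A_n)x\to Rx$ w.r.t. $\tau$ for all $x\in X$, and $R$ is injective and has bi-dense range. (d) There exists $R\in\mathcal L(X,\gamma)$ such that $R(\lambda^2,A_n)x\to Rx$ w.r.t. $\gamma$ for all $x\in X$, and $R$ is injective and has $\gamma$-dense range. (e) There exists a locally $\tau$-bi-continuous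 cosine family $(S(t))_{t\ge0}$ on $X$ such that $\|S(t)\|_{\mathcal L(X)}\le Me^{\omega t}$ for all $t\ge0$, and for all $x\in X$ we have $S_n(\cdot)x\to S(\cdot)x$ w.r.t. $\tau$ uniformly on compact subsets of $[0,\infty)$. Then (a)$\Rightarrow$(b)$\Rightarrow$(c)$\Leftrightarrow$(d)$\Leftrightarrow$(e). In particular, if (c) holds, then the bi-generator $B$ of $(S(t))_{t\ge0}$ fulfils $R(\lambda^2,B)=R$. If (b) holds, then $A$ is $\gamma$-closable and $B=\overline A^{\gamma}$. If (a) holds, then $B=\overline A^{\mathrm{bi}}$.
   Context: Linear spaces are over $\mathbb R$ or $\mathbb C$; $\mathbb N=\{1,2,\dots\}$. For a normed space $(X,\|\cdot\|)$, $\tau_{\|\cdot\|}$ is the norm topology and $\mathcal L(X)$ the bounded linear operators with the operator norm; $\mathcal L(X,\gamma)$ is the space of $\gamma$-continuous linear maps $X\to X$. $R(\mu,A):=(\mu-A)^{-1}$ denotes the resolvent of $A$. Saks space: a triple $(X,\|\cdot\|,\tau)$ where $(X,\|\cdot\|)$ is a normed space and $\tau\subseteq\tau_{\|\cdot\|}$ is a Hausdorff locally convex topology on $X$ such that some directed system of seminorms $\mathcal P_\tau$ generating $\tau$ satisfies $\|x\|=\sup_{p\in\mathcal P_\tau}p(x)$ for all $x\in X$. Its mixed topology $\gamma$ is the finest linear topology on $X$ that coincides with $\tau$ on $\|\cdot\|$-bounded sets and satisfies $\tau\subseteq\gamma\subseteq\tau_{\|\cdot\|}$; it is Hausdorff locally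 convex. The Saks space is sequentially complete if $(X,\gamma)$ is sequentially complete, and C-sequential if $(X,\gamma)$ is C-sequential, i.e. every convex sequentially open subset of $(X,\gamma)$ is open ($U$ is sequentially open if every sequence converging to a point of $U$ is eventually in $U$). A family $(T_j)_{j\in J}$ of linear maps $X\to X$ is bi-equicontinuous if for every $\|\cdot\|$-bounded sequence $(x_n)$ in $X$ and $x\in X$ with $x_n\to x$ w.r.t. $\tau$ one has $\tau$-$\lim_{n\to\infty}T_j(x_n-x)=0$ uniformly for $j\in J$. $(S_n(t))_{n\in\mathbb N,t\ge0}$ is uniformly locally bi-equicontinuous if $(S_n(t))_{(n,t)\in\mathbb N\times N}$ is bi-equicontinuous for every compact $N\subseteq[0,\infty)$. A cosine family $(S(t))_{t\ge0}$ on $X$ consists of linear maps with $S(0)=\mathrm{id}$, $2S(t)S(s)=S(t+s)+S(t-s)$ for $t\ge s\ge0$. It is locally $\tau$-bi-continuous if all $S(t)\in\mathcal L(X)$, $t\mapsto S(t)x$ is $\tau$-continuous for every $x\in X$, and for every compact $N\subseteq[0,\infty)$ one has $\sup_{t\in N}\|S(t)\|_{\mathcal L(X)}<\infty$ and $(S(t))_{t\in N}$ is bi-equicontinuous. Its bi-generator is the operator $Bx:=\tau\text{-}\lim_{t\to0+}\frac2{t^2}(S(t)x-x)$ with domain the set of all $x\in X$ such that this limit exists and $\sup_{t\in(0,1]}\frac2{t^2}\|S(t)x-x\|<\infty$. Let $(A,D(A))$ be a linear operator on $X$ and $D$ a linear subspace of $D(A)$. A set $N\subseteq X$ is bi-dense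 if for every $x\in X$ there is a $\|\cdot\|$-bounded sequence in $N$ converging to $x$ w.r.t. $\tau$; $A$ is bi-densely (resp. $\gamma$-densely) defined if $D(A)$ is bi-dense (resp. $\gamma$-dense) in $X$. $A$ is bi-closed if for each sequence $(x_i)$ in $D(A)$ with $(x_i)$, $(Ax_i)$ $\|\cdot\|$-bounded and $x_i\to x$, $Ax_i\to y$ w.r.t. $\tau$ one has $x\in D(A)$, $Ax=y$; $A$ is $\gamma$-closed if its graph is closed in $(X,\gamma)\times(X,\gamma)$. $A$ is bi-closable (resp. $\gamma$-closable) if it has a bi-closed (resp. $\gamma$-closed) extension, and then $\overline A^{\mathrm{bi}}$ (resp. $\overline A^{\gamma}$) denotes the smallest such extension. $D$ is a bi-core for $A$ if for all $x\in D(A)$ there is a sequence $(x_i)$ in $D$ with $(x_i)$, $(Ax_i)$ $\|\cdot\|$-bounded and $x_i\to x$ w.r.t. the topology on $D(A)$ given by the seminorms $x\mapsto p(x)+p(Ax)$, $p\in\mathcal P_\tau$. $D$ is a $\gamma$-core for $A$ if $D$ is dense in $D(A)$ w.r.t. the topology given by the seminorms $x\mapsto p(x)+p(Ax)$, $p$ running through a system of seminorms generating $\gamma$. *)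

theory Defs
  imports "HOL-Analysis.Analysis"
begin

(* Scalars: by the Gelfand-Mazur theorem the types of class real_normed_field are, up to isometric
   isomorphism, exactly the real and the complex numbers.  A normed space over such a field is a real
   normed space with a compatible scalar multiplication sc (scaleR itself in the real case). *)

definition normed_scaling :: "('k::real_normed_field \<Rightarrow> 'a::real_normed_vector \<Rightarrow> 'a) \<Rightarrow> bool" where
  "normed_scaling sc \<longleftrightarrow> vector_space sc \<and> (\<forall>r x. sc (of_real r) x = r *\<^sub>R x) \<and>
     (\<forall>c x. norm (sc c x) = norm c * norm x)"


subsection \<open>Saks spaces\<close>

definition is_seminorm :: "('k::real_normed_field \<Rightarrow> 'a::real_normed_vector \<Rightarrow> 'a) \<Rightarrow> ('a \<Rightarrow> real) \<Rightarrow> bool" where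
  "is_seminorm sc p \<longleftrightarrow> (\<forall>x y. p (x + y) \<le> p x + p y) \<and> (\<forall>c x. p (sc c x) = norm c * p x)"

definition seminorm_topology :: "('a::real_normed_vector \<Rightarrow> real) set \<Rightarrow> 'a topology" where
  "seminorm_topology P =
     topology_generated_by (insert UNIV {{y. p (y - x) < r} | p x r. p \<in> P \<and> 0 < r})"

definition directed_system :: "('a \<Rightarrow> real) set \<Rightarrow> bool" where
  "directed_system P \<longleftrightarrow> P \<noteq> {} \<and> (\<forall>p\<in>P. \<forall>q\<in>P. \<exists>r\<in>P. \<forall>x. max (p x) (q x) \<le> r x)"

definition coarser :: "'a topology \<Rightarrow> 'a topology \<Rightarrow> bool" where
  "coarser T1 T2 \<longleftrightarrow> (\<forall>U. openin T1 U \<longrightarrow> openin T2 U)"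

(* euclidean is the norm topology of the type. *)

definition saks_space :: "('k::real_normed_field \<Rightarrow> 'a::real_normed_vector \<Rightarrow> 'a) \<Rightarrow> 'a topology \<Rightarrow> bool" where
  "saks_space sc \<tau> \<longleftrightarrow> normed_scaling sc \<and> coarser \<tau> euclidean \<and> Hausdorff_space \<tau> \<and>
     (\<exists>P. (\<forall>p\<in>P. is_seminorm sc p) \<and> directed_system P \<and> \<tau> = seminorm_topology P \<and>
          (\<forall>x. bdd_above ((\<lambda>p. p x) ` P) \<and> norm x = (SUP p\<in>P. p x)))"

definition linear_topology :: "('k::real_normed_field \<Rightarrow> 'a::real_normed_vector \<Rightarrow> 'a) \<Rightarrow> 'a topology \<Rightarrow> bool" where
  "linear_topology sc T \<longleftrightarrow> topspace T = UNIV \<and>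
     continuous_map (prod_topology T T) T (\<lambda>(x, y). x + y) \<and>
     continuous_map (prod_topology euclidean T) T (\<lambda>(c, x). sc c x)"

definition mixed_candidate :: "('k::real_normed_field \<Rightarrow> 'a::real_normed_vector \<Rightarrow> 'a) \<Rightarrow> 'a topology \<Rightarrow> 'a topology \<Rightarrow> bool" where
  "mixed_candidate sc \<tau> T \<longleftrightarrow> linear_topology sc T \<and>
     (\<forall>E. bounded E \<longrightarrow> subtopology T E = subtopology \<tau> E) \<and>
     coarser \<tau> T \<and> coarser T euclidean"

definition is_mixed_topology :: "('k::real_normed_field \<Rightarrow> 'a::real_normed_vector \<Rightarrow> 'a) \<Rightarrow> 'a topology \<Rightarrow> 'a topology \<Rightarrow> bool" where
  "is_mixed_topology sc \<tau> \<gamma> \<longleftrightarrow> mixed_candidate sc \<tau> \<gamma> \<and>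
     (\<forall>T. mixed_candidate sc \<tau> T \<longrightarrow> coarser T \<gamma>)"

definition seq_complete :: "'a::real_normed_vector topology \<Rightarrow> bool" where
  "seq_complete T \<longleftrightarrow>
     (\<forall>s :: nat \<Rightarrow> 'a. (\<forall>U. openin T U \<and> 0 \<in> U \<longrightarrow> (\<exists>N. \<forall>m\<ge>N. \<forall>n\<ge>N. s m - s n \<in> U)) \<longrightarrow>
        (\<exists>x. limitin T s x sequentially))"

definition seq_open :: "'a topology \<Rightarrow> 'a set \<Rightarrow> bool" where
  "seq_open T U \<longleftrightarrow>
     (\<forall>s x. x \<in> U \<and> limitin T s x sequentially \<longrightarrow> (\<forall>\<^sub>F n in sequentially. s n \<in> U))"

definition C_sequential :: "'a::real_normed_vector topology \<Rightarrow> bool" where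
  "C_sequential T \<longleftrightarrow> (\<forall>U. convex U \<and> seq_open T U \<longrightarrow> openin T U)"


subsection \<open>Cosine families\<close>

definition bi_equicontinuous :: "'a::real_normed_vector topology \<Rightarrow> 'j set \<Rightarrow> ('j \<Rightarrow> 'a \<Rightarrow> 'a) \<Rightarrow> bool" where
  "bi_equicontinuous \<tau> J T \<longleftrightarrow>
     (\<forall>s x. bounded (range s) \<and> limitin \<tau> s x sequentially \<longrightarrow>
        (\<forall>U. openin \<tau> U \<and> 0 \<in> U \<longrightarrow> (\<forall>\<^sub>F n in sequentially. \<forall>j\<in>J. T j (s n - x) \<in> U)))"

definition uniformly_locally_bi_equicontinuous ::
    "'a::real_normed_vector topology \<Rightarrow> (nat \<Rightarrow> real \<Rightarrow> 'a \<Rightarrow> 'a) \<Rightarrow> bool" where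
  "uniformly_locally_bi_equicontinuous \<tau> S \<longleftrightarrow>
     (\<forall>N. compact N \<and> N \<subseteq> {0..} \<longrightarrow> bi_equicontinuous \<tau> (UNIV \<times> N) (\<lambda>(n, t). S n t))"

definition bounded_operator :: "('k::real_normed_field \<Rightarrow> 'a::real_normed_vector \<Rightarrow> 'a) \<Rightarrow> ('a \<Rightarrow> 'a) \<Rightarrow> bool" where
  "bounded_operator sc T \<longleftrightarrow> Vector_Spaces.linear sc sc T \<and> bounded_linear T"

definition continuous_operator :: "('k::real_normed_field \<Rightarrow> 'a::real_normed_vector \<Rightarrow> 'a) \<Rightarrow> 'a topology \<Rightarrow> ('a \<Rightarrow> 'a) \<Rightarrow> bool" where
  "continuous_operator sc \<gamma> T \<longleftrightarrow> Vector_Spaces.linear sc sc T \<and> continuous_map \<gamma> \<gamma> T"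

(* Families indexed by [0,\<infinity>) are functions of a real parameter whose values at negative
   parameters are never used. *)

definition cosine_family :: "('k::real_normed_field \<Rightarrow> 'a::real_normed_vector \<Rightarrow> 'a) \<Rightarrow> (real \<Rightarrow> 'a \<Rightarrow> 'a) \<Rightarrow> bool" where
  "cosine_family sc S \<longleftrightarrow> (\<forall>t\<ge>0. Vector_Spaces.linear sc sc (S t)) \<and> S 0 = id \<and>
     (\<forall>t s x. 0 \<le> s \<and> s \<le> t \<longrightarrow> 2 *\<^sub>R S t (S s x) = S (t + s) x + S (t - s) x)"

definition locally_bicontinuous_cosine ::
    "('k::real_normed_field \<Rightarrow> 'a::real_normed_vector \<Rightarrow> 'a) \<Rightarrow> 'a topology \<Rightarrow> (real \<Rightarrow> 'a \<Rightarrow> 'a) \<Rightarrow> bool" where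
  "locally_bicontinuous_cosine sc \<tau> S \<longleftrightarrow> cosine_family sc S \<and>
     (\<forall>t\<ge>0. bounded_operator sc (S t)) \<and>
     (\<forall>x. continuous_map (top_of_set {0..}) \<tau> (\<lambda>t. S t x)) \<and>
     (\<forall>N. compact N \<and> N \<subseteq> {0..} \<longrightarrow>
        bdd_above ((\<lambda>t. onorm (S t)) ` N) \<and> bi_equicontinuous \<tau> N S)"


subsection \<open>Unbounded operators\<close>

(* An operator (A, D(A)) is a partial function A with dom A = D(A) and value the (A x) at x in dom A;
   extension of operators is map_le, and equality includes equality of domains. *)

definition bi_generator :: "'a::real_normed_vector topology \<Rightarrow> (real \<Rightarrow> 'a \<Rightarrow> 'a) \<Rightarrow> ('a \<rightharpoonup> 'a)" where
  "bi_generator \<tau> S = (\<lambda>x.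
     if (\<exists>y. limitin \<tau> (\<lambda>t. (2 / t\<^sup>2) *\<^sub>R (S t x - x)) y (at_right 0)) \<and>
        bdd_above ((\<lambda>t. 2 / t\<^sup>2 * norm (S t x - x)) ` {0<..1})
     then Some (THE y. limitin \<tau> (\<lambda>t. (2 / t\<^sup>2) *\<^sub>R (S t x - x)) y (at_right 0))
     else None)"

definition linear_op :: "('k::real_normed_field \<Rightarrow> 'a::real_normed_vector \<Rightarrow> 'a) \<Rightarrow> ('a \<rightharpoonup> 'a) \<Rightarrow> bool" where
  "linear_op sc A \<longleftrightarrow> module.subspace sc (dom A) \<and>
     (\<forall>x\<in>dom A. \<forall>y\<in>dom A. the (A (x + y)) = the (A x) + the (A y)) \<and>
     (\<forall>c. \<forall>x\<in>dom A. the (A (sc c x)) = sc c (the (A x)))"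

definition scalar_minus :: "('k::real_normed_field \<Rightarrow> 'a::real_normed_vector \<Rightarrow> 'a) \<Rightarrow> 'k \<Rightarrow> ('a \<rightharpoonup> 'a) \<Rightarrow> 'a \<Rightarrow> 'a" where
  "scalar_minus sc \<mu> A = (\<lambda>x. sc \<mu> x - the (A x))"

definition resolvent_exists :: "('k::real_normed_field \<Rightarrow> 'a::real_normed_vector \<Rightarrow> 'a) \<Rightarrow> 'k \<Rightarrow> ('a \<rightharpoonup> 'a) \<Rightarrow> bool" where
  "resolvent_exists sc \<mu> A \<longleftrightarrow> bij_betw (scalar_minus sc \<mu> A) (dom A) UNIV"

(* Meaningful only under resolvent_exists. *)

definition resolvent :: "('k::real_normed_field \<Rightarrow> 'a::real_normed_vector \<Rightarrow> 'a) \<Rightarrow> 'k \<Rightarrow> ('a \<rightharpoonup> 'a) \<Rightarrow> 'a \<Rightarrow> 'a" where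
  "resolvent sc \<mu> A = the_inv_into (dom A) (scalar_minus sc \<mu> A)"

definition bi_dense :: "'a::real_normed_vector topology \<Rightarrow> 'a set \<Rightarrow> bool" where
  "bi_dense \<tau> N \<longleftrightarrow>
     (\<forall>x. \<exists>s :: nat \<Rightarrow> 'a. range s \<subseteq> N \<and> bounded (range s) \<and> limitin \<tau> s x sequentially)"

definition dense_in :: "'a topology \<Rightarrow> 'a set \<Rightarrow> bool" where
  "dense_in T N \<longleftrightarrow> T closure_of N = UNIV"

definition bi_closed :: "'a::real_normed_vector topology \<Rightarrow> ('a \<rightharpoonup> 'a) \<Rightarrow> bool" where
  "bi_closed \<tau> A \<longleftrightarrow>
     (\<forall>(s :: nat \<Rightarrow> 'a) x y. range s \<subseteq> dom A \<and> bounded (range s) \<and> bounded (range (\<lambda>i. the (A (s i)))) \<and>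
        limitin \<tau> s x sequentially \<and> limitin \<tau> (\<lambda>i. the (A (s i))) y sequentially \<longrightarrow>
        A x = Some y)"

definition graph_closed :: "'a topology \<Rightarrow> ('a \<rightharpoonup> 'a) \<Rightarrow> bool" where
  "graph_closed \<gamma> A \<longleftrightarrow> closedin (prod_topology \<gamma> \<gamma>) {(x, y). A x = Some y}"

definition closed_extension ::
    "('k::real_normed_field \<Rightarrow> 'a::real_normed_vector \<Rightarrow> 'a) \<Rightarrow> (('a \<rightharpoonup> 'a) \<Rightarrow> bool) \<Rightarrow> ('a \<rightharpoonup> 'a) \<Rightarrow> ('a \<rightharpoonup> 'a) \<Rightarrow> bool" where
  "closed_extension sc clsd A C \<longleftrightarrow> linear_op sc C \<and> A \<subseteq>\<^sub>m C \<and> clsd C"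

definition bi_closable :: "('k::real_normed_field \<Rightarrow> 'a::real_normed_vector \<Rightarrow> 'a) \<Rightarrow> 'a topology \<Rightarrow> ('a \<rightharpoonup> 'a) \<Rightarrow> bool" where
  "bi_closable sc \<tau> A \<longleftrightarrow> (\<exists>C. closed_extension sc (bi_closed \<tau>) A C)"

definition graph_closable :: "('k::real_normed_field \<Rightarrow> 'a::real_normed_vector \<Rightarrow> 'a) \<Rightarrow> 'a topology \<Rightarrow> ('a \<rightharpoonup> 'a) \<Rightarrow> bool" where
  "graph_closable sc \<gamma> A \<longleftrightarrow> (\<exists>C. closed_extension sc (graph_closed \<gamma>) A C)"

definition is_bi_closure ::
    "('k::real_normed_field \<Rightarrow> 'a::real_normed_vector \<Rightarrow> 'a) \<Rightarrow> 'a topology \<Rightarrow> ('a \<rightharpoonup> 'a) \<Rightarrow> ('a \<rightharpoonup> 'a) \<Rightarrow> bool" where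
  "is_bi_closure sc \<tau> A C \<longleftrightarrow> closed_extension sc (bi_closed \<tau>) A C \<and>
     (\<forall>C'. closed_extension sc (bi_closed \<tau>) A C' \<longrightarrow> C \<subseteq>\<^sub>m C')"

definition is_graph_closure ::
    "('k::real_normed_field \<Rightarrow> 'a::real_normed_vector \<Rightarrow> 'a) \<Rightarrow> 'a topology \<Rightarrow> ('a \<rightharpoonup> 'a) \<Rightarrow> ('a \<rightharpoonup> 'a) \<Rightarrow> bool" where
  "is_graph_closure sc \<gamma> A C \<longleftrightarrow> closed_extension sc (graph_closed \<gamma>) A C \<and>
     (\<forall>C'. closed_extension sc (graph_closed \<gamma>) A C' \<longrightarrow> C \<subseteq>\<^sub>m C')"

(* All continuous seminorms: a system generating the topology whenever it is locally convex.  The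
   operator-domain topology below does not depend on which generating system is used. *)

definition continuous_seminorms ::
    "('k::real_normed_field \<Rightarrow> 'a::real_normed_vector \<Rightarrow> 'a) \<Rightarrow> 'a topology \<Rightarrow> ('a \<Rightarrow> real) set" where
  "continuous_seminorms sc T = {p. is_seminorm sc p \<and> continuous_map T euclideanreal p}"

definition domain_topology :: "('k::real_normed_field \<Rightarrow> 'a::real_normed_vector \<Rightarrow> 'a) \<Rightarrow> 'a topology \<Rightarrow> ('a \<rightharpoonup> 'a) \<Rightarrow> 'a topology" where
  "domain_topology sc T A = topology_generated_by (insert (dom A)
     {{y \<in> dom A. p (y - x) + p (the (A (y - x))) < r} | p x r.
        p \<in> continuous_seminorms sc T \<and> x \<in> dom A \<and> 0 < r})"

definition bi_core ::
    "('k::real_normed_field \<Rightarrow> 'a::real_normed_vector \<Rightarrow> 'a) \<Rightarrow> 'a topology \<Rightarrow> ('a \<rightharpoonup> 'a) \<Rightarrow> 'a set \<Rightarrow> bool" where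
  "bi_core sc \<tau> A D \<longleftrightarrow> module.subspace sc D \<and> D \<subseteq> dom A \<and>
     (\<forall>x\<in>dom A. \<exists>s :: nat \<Rightarrow> 'a. range s \<subseteq> D \<and> bounded (range s) \<and>
        bounded (range (\<lambda>i. the (A (s i)))) \<and> limitin (domain_topology sc \<tau> A) s x sequentially)"

definition topological_core ::
    "('k::real_normed_field \<Rightarrow> 'a::real_normed_vector \<Rightarrow> 'a) \<Rightarrow> 'a topology \<Rightarrow> ('a \<rightharpoonup> 'a) \<Rightarrow> 'a set \<Rightarrow> bool" where
  "topological_core sc \<gamma> A D \<longleftrightarrow> module.subspace sc D \<and> D \<subseteq> dom A \<and>
     domain_topology sc \<gamma> A closure_of D = dom A"


subsection \<open>The assertions of the approximation theorem\<close>

(* For x in D the value An n x is defined only for all sufficiently large n; boundedness of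
   the sequence refers to the indices for which it is defined. *)

definition assertion_a ::
    "('k::real_normed_field \<Rightarrow> 'a::real_normed_vector \<Rightarrow> 'a) \<Rightarrow> 'a topology \<Rightarrow> (nat \<Rightarrow> 'a \<rightharpoonup> 'a) \<Rightarrow> real \<Rightarrow>
     ('a \<rightharpoonup> 'a) \<Rightarrow> 'a set \<Rightarrow> bool" where
  "assertion_a sc \<tau> An l A D \<longleftrightarrow> linear_op sc A \<and> bi_dense \<tau> (dom A) \<and> bi_core sc \<tau> A D \<and>
     D \<subseteq> (\<Union>k. \<Inter>n\<in>{k..}. dom (An n)) \<and>
     (\<forall>x\<in>D. bounded {the (An n x) | n. x \<in> dom (An n)} \<and>
             limitin \<tau> (\<lambda>n. the (An n x)) (the (A x)) sequentially) \<and>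
     bi_dense \<tau> (scalar_minus sc (of_real (l\<^sup>2)) A ` dom A)"

definition assertion_b ::
    "('k::real_normed_field \<Rightarrow> 'a::real_normed_vector \<Rightarrow> 'a) \<Rightarrow> 'a topology \<Rightarrow> (nat \<Rightarrow> 'a \<rightharpoonup> 'a) \<Rightarrow> real \<Rightarrow>
     ('a \<rightharpoonup> 'a) \<Rightarrow> 'a set \<Rightarrow> bool" where
  "assertion_b sc \<gamma> An l A D \<longleftrightarrow> linear_op sc A \<and> dense_in \<gamma> (dom A) \<and> topological_core sc \<gamma> A D \<and>
     D \<subseteq> (\<Union>k. \<Inter>n\<in>{k..}. dom (An n)) \<and>
     (\<forall>x\<in>D. limitin \<gamma> (\<lambda>n. the (An n x)) (the (A x)) sequentially) \<and>
     dense_in \<gamma> (scalar_minus sc (of_real (l\<^sup>2)) A ` dom A)"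

definition assertion_c ::
    "('k::real_normed_field \<Rightarrow> 'a::real_normed_vector \<Rightarrow> 'a) \<Rightarrow> 'a topology \<Rightarrow> (nat \<Rightarrow> 'a \<rightharpoonup> 'a) \<Rightarrow> real \<Rightarrow>
     ('a \<Rightarrow> 'a) \<Rightarrow> bool" where
  "assertion_c sc \<tau> An l R \<longleftrightarrow> bounded_operator sc R \<and>
     (\<forall>x. limitin \<tau> (\<lambda>n. resolvent sc (of_real (l\<^sup>2)) (An n) x) (R x) sequentially) \<and>
     inj R \<and> bi_dense \<tau> (range R)"

definition assertion_d ::
    "('k::real_normed_field \<Rightarrow> 'a::real_normed_vector \<Rightarrow> 'a) \<Rightarrow> 'a topology \<Rightarrow> (nat \<Rightarrow> 'a \<rightharpoonup> 'a) \<Rightarrow> real \<Rightarrow>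
     ('a \<Rightarrow> 'a) \<Rightarrow> bool" where
  "assertion_d sc \<gamma> An l R \<longleftrightarrow> continuous_operator sc \<gamma> R \<and>
     (\<forall>x. limitin \<gamma> (\<lambda>n. resolvent sc (of_real (l\<^sup>2)) (An n) x) (R x) sequentially) \<and>
     inj R \<and> dense_in \<gamma> (range R)"

definition assertion_e ::
    "('k::real_normed_field \<Rightarrow> 'a::real_normed_vector \<Rightarrow> 'a) \<Rightarrow> 'a topology \<Rightarrow> (nat \<Rightarrow> real \<Rightarrow> 'a \<Rightarrow> 'a) \<Rightarrow>
     real \<Rightarrow> real \<Rightarrow> (real \<Rightarrow> 'a \<Rightarrow> 'a) \<Rightarrow> bool" where
  "assertion_e sc \<tau> Sn M \<omega> S \<longleftrightarrow> locally_bicontinuous_cosine sc \<tau> S \<and>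
     (\<forall>t\<ge>0. onorm (S t) \<le> M * exp (\<omega> * t)) \<and>
     (\<forall>x N. compact N \<and> N \<subseteq> {0..} \<longrightarrow>
        (\<forall>U. openin \<tau> U \<and> 0 \<in> U \<longrightarrow>
           (\<forall>\<^sub>F n in sequentially. \<forall>t\<in>N. Sn n t x - S t x \<in> U)))"

end

theory Submission
  imports Defs
begin

text \<open>
  For an even weight \<open>e\<close> decaying faster than \<open>exp (- \<omega> \<bar>t\<bar>)\<close> put
  \<open>\<Phi>(e) x = \<integral> e(t) S(\<bar>t\<bar>) x dt\<close>.  The cosine equation gives \<open>2 S(s) \<Phi>(e) = \<Phi>(e(\<cdot> - s) + e(\<cdot> + s))\<close>,
  so the generator acts on \<open>\<Phi>(e)\<close> by differentiating \<open>e\<close> twice, and \<open>R(l\<^sup>2, A) = \<Phi>(exp (- l \<bar>t\<bar>)) / (2 l)\<close>.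

  Suppose that \<open>R(l\<^sup>2, A\<^sub>n)\<close> converges strongly at a single \<open>l\<close>.  The weights \<open>\<bar>t\<bar>\<^sup>k exp (- l \<bar>t\<bar>)\<close> satisfy a
  recursion in \<open>k\<close> through \<open>R(l\<^sup>2, A\<^sub>n)\<close>, so \<open>\<Phi>\<^sub>n(e)\<close> converges for all of them, and by Taylor expansion of
  the exponential and the Weierstrass theorem for every \<open>e(t) = exp (- l \<bar>t\<bar>) h(exp (- c \<bar>t\<bar>))\<close> with \<open>h\<close>
  continuous on the unit interval.  The weight of \<open>S\<^sub>n(s) R(l\<^sup>2, A\<^sub>n)\<close> has this form and depends on \<open>s\<close> in a
  Lipschitz way; hence \<open>S\<^sub>n(s)\<close> converges locally uniformly in \<open>s\<close> as soon as the limit of the resolvents has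
  dense range.  The limit family then identifies the limit of the resolvents as the resolvent of its
  generator, from which the statements on closures follow.

  Since the space is C-sequential, the bi-equicontinuity assumptions amount to estimates
  \<open>p(S\<^sub>n(t) x) \<le> exp (b t) q(x)\<close> between \<open>\<gamma>\<close>-continuous seminorms.
\<close>

section \<open>A Hahn-Banach theorem\<close>

text \<open>No seminorm is preserved by the families: \<open>p (Sn n t x)\<close> is only bounded
  through another seminorm \<open>q\<close>, so an estimate cannot be iterated through powers of the
  resolvents. A kernel operator pays for this change of seminorm once:
  \<open>p (Phi e x) \<le> K * q x\<close>, where \<open>q\<close> depends on \<open>p\<close> and
  the decay rate alone and \<open>K\<close> is the weighted supremum of \<open>e\<close>.
  Approximation therefore takes place among scalar weights, and its errors are uniform in
  \<open>n\<close>.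

  Integration over the whole line turns the cosine equation into a pure translation of weights. The
  price is the kink of an even weight at 0; its Dirac mass becomes the identity in the resolvent
  equation.

  The topology \<gamma> is given only as a finest linear topology. Its local convexity and the
  boundedness of its convergent sequences are derived beforehand; the latter identifies
  \<gamma>-convergence of sequences with bounded \<tau>-convergence and so translates the
  bi-notions. The Hahn-Banach theorem is there for the integrals, which are defined weakly.\<close>

definition sublinear :: "('a::real_vector \<Rightarrow> real) \<Rightarrow> bool" where
  "sublinear p \<longleftrightarrow> (\<forall>x y. p (x + y) \<le> p x + p y) \<and> (\<forall>c x. 0 \<le> c \<longrightarrow> p (c *\<^sub>R x) = c * p x)"

text \<open>The inequality for positive \<open>c\<close> already gives equality, since it may be
  applied once more with \<open>inverse c\<close>.\<close>

lemma sublinearI: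
  assumes add: "\<And>x y. p (x + y) \<le> p x + p y"
    and hom: "\<And>c x. 0 < c \<Longrightarrow> p (c *\<^sub>R x) \<le> c * p x"
    and zero: "p 0 = 0"
  shows "sublinear p"
  unfolding sublinear_def
proof (intro conjI allI impI)
  fix c :: real and x assume "0 \<le> c"
  show "p (c *\<^sub>R x) = c * p x"
  proof (cases "c = 0")
    case False
    then have c: "c > 0" using \<open>0 \<le> c\<close> by simp
    have "p x = p (inverse c *\<^sub>R (c *\<^sub>R x))" using c by simp
    also have "\<dots> \<le> inverse c * p (c *\<^sub>R x)" using c by (intro hom) simp
    finally have "c * p x \<le> p (c *\<^sub>R x)" using c by (simp add: field_simps)
    with hom[OF c, of x] show ?thesis by simp
  qed (simp add: zero)
qed (rule add)

lemma sublinearD: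
  assumes "sublinear p"
  shows "p (x + y) \<le> p x + p y" and "0 \<le> c \<Longrightarrow> p (c *\<^sub>R x) = c * p x"
    and "p 0 = 0" and "- p (- x) \<le> p x"
proof -
  show add: "p (x + y) \<le> p x + p y" for x y using assms by (auto simp: sublinear_def)
  show "0 \<le> c \<Longrightarrow> p (c *\<^sub>R x) = c * p x" using assms by (auto simp: sublinear_def)
  have "p (0 *\<^sub>R 0) = 0 * p 0" using assms unfolding sublinear_def by blast
  then show z: "p 0 = 0" by simp
  show "- p (- x) \<le> p x" using add[of x "-x"] z by simp
qed

text \<open>A minimal sublinear functional coincides with all its tilts, hence is linear; tilting \<open>p\<close> along
  \<open>x0\<close> first makes the minimal functional attain \<open>p x0\<close>.\<close>

definition tilt :: "('a::real_vector \<Rightarrow> real) \<Rightarrow> 'a \<Rightarrow> 'a \<Rightarrow> real" where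
  "tilt p x y = (INF t\<in>{0..}. p (y + t *\<^sub>R x) - t * p x)"

lemma tilt_bdd_below:
  assumes "sublinear p"
  shows "bdd_below ((\<lambda>t. p (y + t *\<^sub>R x) - t * p x) ` {0..})"
proof (rule bdd_belowI2)
  fix t :: real assume "t \<in> {0..}"
  then have "t * p x = p ((y + t *\<^sub>R x) + (- y))" using sublinearD(2)[OF assms] by simp
  also have "\<dots> \<le> p (y + t *\<^sub>R x) + p (- y)" by (rule sublinearD[OF assms])
  finally show "- p (- y) \<le> p (y + t *\<^sub>R x) - t * p x" by simp
qed

lemma tilt_le:
  assumes "sublinear p" "0 \<le> t"
  shows "tilt p x y \<le> p (y + t *\<^sub>R x) - t * p x"
  unfolding tilt_def using assms by (intro cINF_lower tilt_bdd_below) auto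

lemma tilt_greatest:
  assumes "\<And>t. 0 \<le> t \<Longrightarrow> c \<le> p (y + t *\<^sub>R x) - t * p x"
  shows "c \<le> tilt p x y"
  unfolding tilt_def using assms by (intro cINF_greatest) auto

lemma sublinear_tilt:
  assumes p: "sublinear p"
  shows "sublinear (tilt p x)"
proof (rule sublinearI)
  fix y z
  have *: "tilt p x (y + z) \<le> (p (y + s *\<^sub>R x) - s * p x) + (p (z + t *\<^sub>R x) - t * p x)"
    if "0 \<le> s" "0 \<le> t" for s t
  proof -
    have "tilt p x (y + z) \<le> p ((y + z) + (s + t) *\<^sub>R x) - (s + t) * p x"
      using that by (intro tilt_le[OF p]) simp
    also have "(y + z) + (s + t) *\<^sub>R x = (y + s *\<^sub>R x) + (z + t *\<^sub>R x)"
      by (simp add: algebra_simps)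
    finally show ?thesis using sublinearD(1)[OF p, of "y + s *\<^sub>R x" "z + t *\<^sub>R x"]
      by (simp add: algebra_simps)
  qed
  have "tilt p x (y + z) - (p (y + s *\<^sub>R x) - s * p x) \<le> tilt p x z" if "0 \<le> s" for s
    using *[OF that] by (intro tilt_greatest) (simp add: algebra_simps)
  then have "tilt p x (y + z) - tilt p x z \<le> tilt p x y"
    by (intro tilt_greatest) (simp add: algebra_simps)
  then show "tilt p x (y + z) \<le> tilt p x y + tilt p x z" by simp
next
  fix c :: real and y assume c: "0 < c"
  have "inverse c * tilt p x (c *\<^sub>R y) \<le> tilt p x y"
  proof (rule tilt_greatest)
    fix t :: real assume t: "0 \<le> t"
    have "tilt p x (c *\<^sub>R y) \<le> p (c *\<^sub>R y + (c * t) *\<^sub>R x) - (c * t) * p x"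
      using c t by (intro tilt_le[OF p]) simp
    also have "c *\<^sub>R y + (c * t) *\<^sub>R x = c *\<^sub>R (y + t *\<^sub>R x)" by (simp add: algebra_simps)
    also have "p \<dots> = c * p (y + t *\<^sub>R x)" using c by (intro sublinearD[OF p]) simp
    finally show "inverse c * tilt p x (c *\<^sub>R y) \<le> p (y + t *\<^sub>R x) - t * p x"
      using c by (simp add: field_simps)
  qed
  then show "tilt p x (c *\<^sub>R y) \<le> c * tilt p x y" using c by (simp add: field_simps)
next
  have "tilt p x 0 \<le> 0" using tilt_le[OF p, of 0 x 0] by (simp add: sublinearD[OF p])
  moreover have "0 \<le> tilt p x 0" by (rule tilt_greatest) (simp add: sublinearD[OF p])
  ultimately show "tilt p x 0 = 0" by simp
qed

text \<open>Zorn's lemma applies because the pointwise infimum of a chain is again sublinear; it is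
  finite as every sublinear \<open>q \<le> p\<close> satisfies
  \<open>- p (- y) \<le> q y\<close>.\<close>

lemma minimal_sublinear_exists:
  assumes p: "sublinear p"
  obtains m where "sublinear m" "m \<le> p" "\<And>q. sublinear q \<Longrightarrow> q \<le> m \<Longrightarrow> q = m"
proof -
  define A where "A = {q. sublinear q \<and> q \<le> p}"
  \<comment> \<open>Reversed pointwise order, since Zorn's lemma delivers maximal elements.\<close>
  define R where "R = (\<lambda>a b :: 'a \<Rightarrow> real. b \<le> a)"
  have po: "partial_order_on A (relation_of R A)"
    unfolding R_def by (rule partial_order_on_relation_ofI) auto
  have "\<exists>m\<in>A. \<forall>a\<in>A. R m a \<longrightarrow> a = m"
  proof (rule predicate_Zorn[OF po])
    fix C assume C: "C \<in> Chains (relation_of R A)"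
    have CA: "q \<in> A" if "q \<in> C" for q using C that by (auto simp: Chains_def relation_of_def)
    have total: "a \<le> b \<or> b \<le> a" if "a \<in> C" "b \<in> C" for a b
      using C that by (auto simp: Chains_def relation_of_def R_def)
    show "\<exists>u\<in>A. \<forall>a\<in>C. R a u"
    proof (cases "C = {}")
      case True
      then show ?thesis using p by (auto simp: A_def)
    next
      case False
      define u where "u = (\<lambda>y. INF q\<in>C. q y)"
      have bdd: "bdd_below ((\<lambda>q. q y) ` C)" for y
      proof (rule bdd_belowI2)
        fix q assume "q \<in> C"
        then have q: "sublinear q" "q \<le> p" using CA by (auto simp: A_def)
        have "- p (- y) \<le> - q (- y)" using q(2) by (simp add: le_fun_def)
        also have "\<dots> \<le> q y" by (rule sublinearD[OF q(1)])
        finally show "- p (- y) \<le> q y" .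
      qed
      have ule: "u y \<le> q y" if "q \<in> C" for q y
        unfolding u_def using that by (intro cINF_lower bdd)
      have ugr: "c \<le> u y" if "\<And>q. q \<in> C \<Longrightarrow> c \<le> q y" for c y
        unfolding u_def using that False by (intro cINF_greatest)
      have "sublinear u"
      proof (rule sublinearI)
        fix y z
        have *: "u (y + z) \<le> a y + b z" if ab: "a \<in> C" "b \<in> C" for a b
        proof -
          \<comment> \<open>Of two members of a chain the smaller one serves both summands, so
            subadditivity survives the infimum.\<close>
          obtain q where q: "q \<in> C" "q \<le> a" "q \<le> b" using total[OF ab] ab by blast
          have "u (y + z) \<le> q (y + z)" by (rule ule[OF q(1)])
          also have "\<dots> \<le> q y + q z" using CA[OF q(1)] sublinearD(1) by (auto simp: A_def)
          also have "\<dots> \<le> a y + b z" using q(2,3) by (intro add_mono) (auto simp: le_fun_def)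
          finally show ?thesis .
        qed
        have "u (y + z) - a y \<le> u z" if "a \<in> C" for a
          using *[OF that] by (intro ugr) (simp add: algebra_simps)
        then have "u (y + z) - u z \<le> u y" by (intro ugr) (simp add: algebra_simps)
        then show "u (y + z) \<le> u y + u z" by simp
      next
        fix c :: real and y assume c: "0 < c"
        have "inverse c * u (c *\<^sub>R y) \<le> u y"
        proof (rule ugr)
          fix q assume q: "q \<in> C"
          then have "u (c *\<^sub>R y) \<le> c * q y"
            using ule[OF q, of "c *\<^sub>R y"] CA[OF q] c sublinearD(2)[of q c y] by (auto simp: A_def)
          then show "inverse c * u (c *\<^sub>R y) \<le> q y" using c by (simp add: field_simps)
        qed
        then show "u (c *\<^sub>R y) \<le> c * u y" using c by (simp add: field_simps)
      next
        have "q 0 = 0" if "q \<in> C" for q using CA[OF that] sublinearD(3) by (auto simp: A_def)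
        then have "(\<lambda>q. q 0) ` C = {0}" using False by force
        then show "u 0 = 0" by (simp add: u_def)
      qed
      moreover have "u \<le> p"
      proof -
        obtain q where q: "q \<in> C" using False by blast
        have "u y \<le> p y" for y using ule[OF q, of y] CA[OF q] by (auto simp: A_def le_fun_def intro: order_trans)
        then show ?thesis by (simp add: le_fun_def)
      qed
      ultimately show ?thesis using ule by (auto simp: A_def R_def le_fun_def)
    qed
  qed
  then obtain m where m: "m \<in> A" "\<And>a. a \<in> A \<Longrightarrow> a \<le> m \<Longrightarrow> a = m" by (auto simp: R_def)
  show ?thesis
  proof (rule that)
    show "sublinear m" "m \<le> p" using m(1) by (auto simp: A_def)
    show "q = m" if "sublinear q" "q \<le> m" for q
      using m that by (intro m(2)) (auto simp: A_def)
  qed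
qed

lemma hahn_banach_dominated:
  assumes p: "sublinear p"
  obtains f where "linear f" "\<And>x. f x \<le> p x" "f x0 = p x0"
proof -
  obtain m where m: "sublinear m" "m \<le> tilt p x0"
    and min: "\<And>q. sublinear q \<Longrightarrow> q \<le> m \<Longrightarrow> q = m"
    using minimal_sublinear_exists[OF sublinear_tilt[OF p]] by blast
  have sup: "m x + m y \<le> m (x + y)" for x y
  proof -
    have "tilt m x \<le> m" using tilt_le[OF m(1), of 0 x] by (simp add: le_fun_def)
    then have "tilt m x = m" by (intro min sublinear_tilt m)
    \<comment> \<open>Parameter 1 of the tilt: \<open>tilt m x = m\<close> becomes
      superadditivity.\<close>
    then have "m y \<le> m (y + 1 *\<^sub>R x) - 1 * m x" using tilt_le[OF m(1), of 1 x y] by simp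
    then show ?thesis by (simp add: add.commute)
  qed
  have add: "m (x + y) = m x + m y" for x y
    using sup[of x y] sublinearD(1)[OF m(1), of x y] by simp
  have neg: "m (- x) = - m x" for x
    using add[of x "- x"] sublinearD(3)[OF m(1)] by simp
  have "linear m"
  proof (rule linearI)
    fix r :: real and x
    show "m (r *\<^sub>R x) = r *\<^sub>R m x"
    proof (cases "0 \<le> r")
      case True then show ?thesis using sublinearD(2)[OF m(1)] by simp
    next
      case False
      then have "m ((- r) *\<^sub>R x) = (- r) * m x" by (intro sublinearD(2)[OF m(1)]) simp
      then show ?thesis using neg[of "r *\<^sub>R x"] by simp
    qed
  qed (rule add)
  moreover have le: "m x \<le> p x" for x
  proof -
    have "m x \<le> tilt p x0 x" using m(2) by (simp add: le_fun_def)
    also have "\<dots> \<le> p x" using tilt_le[OF p, of 0 x0 x] by simp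
    finally show ?thesis .
  qed
  moreover have "m x0 = p x0"
  proof -
    \<comment> \<open>The tilt along \<open>x0\<close> gives
      \<open>m (- x0) \<le> p 0 - p x0\<close>, and oddness of \<open>m\<close> makes this the
      missing lower bound at \<open>x0\<close>.\<close>
    have "m (- x0) \<le> tilt p x0 (- x0)" using m(2) by (simp add: le_fun_def)
    also have "\<dots> \<le> - p x0" using tilt_le[OF p, of 1 x0 "- x0"] by (simp add: sublinearD(3)[OF p])
    finally show ?thesis using le[of x0] neg[of x0] by simp
  qed
  ultimately show ?thesis by (rule that)
qed


section \<open>Topologies generated by seminorms\<close>

lemma normed_scalingD:
  assumes "normed_scaling sc"
  shows "vector_space sc" "sc (of_real r) x = r *\<^sub>R x" "norm (sc c x) = norm c * norm x"
  using assms by (auto simp: normed_scaling_def)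

text \<open>Lets the estimates be carried out with real multiples, whatever the scalar field
  is.\<close>

lemma is_seminorm_scaleR:
  fixes sc :: "'k::real_normed_field \<Rightarrow> 'a::real_normed_vector \<Rightarrow> 'a"
  assumes "normed_scaling sc" "is_seminorm sc p"
  shows "is_seminorm (*\<^sub>R) p"
  unfolding is_seminorm_def
proof (intro conjI allI)
  show "p (x + y) \<le> p x + p y" for x y using assms by (simp add: is_seminorm_def)
  show "p (r *\<^sub>R x) = norm r * p x" for r x
  proof -
    have "p (sc (of_real r) x) = norm (of_real r :: 'k) * p x"
      using assms(2) unfolding is_seminorm_def by blast
    then show ?thesis by (simp add: normed_scalingD(2)[OF assms(1)])
  qed
qed

lemma
  assumes "is_seminorm (*\<^sub>R) p"
  shows seminorm_triangle: "p (x + y) \<le> p x + p y"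
    and seminorm_scale: "p (r *\<^sub>R x) = \<bar>r\<bar> * p x"
    and seminorm_zero: "p 0 = 0"
    and seminorm_minus: "p (- x) = p x"
    and seminorm_nonneg: "0 \<le> p x"
    and seminorm_minus_commute: "p (x - y) = p (y - x)"
    and seminorm_diff_le: "p (x - y) \<le> p x + p y"
    and seminorm_diff_triangle: "p (x - z) \<le> p (x - y) + p (y - z)"
    and seminorm_reverse_triangle: "\<bar>p x - p y\<bar> \<le> p (x - y)"
proof -
  show tri: "p (x + y) \<le> p x + p y" for x y using assms by (simp add: is_seminorm_def)
  show sc: "p (r *\<^sub>R x) = \<bar>r\<bar> * p x" for r x using assms by (simp add: is_seminorm_def)
  show z: "p 0 = 0" using sc[of 0 0] by simp
  show m: "p (- x) = p x" for x using sc[of "-1" x] by simp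
  show "0 \<le> p x" using tri[of x "- x"] m[of x] z by simp
  show mc: "p (x - y) = p (y - x)" for x y using m[of "x - y"] by simp
  show "p (x - y) \<le> p x + p y" using tri[of x "- y"] m by simp
  show "p (x - z) \<le> p (x - y) + p (y - z)" using tri[of "x - y" "y - z"] by simp
  show "\<bar>p x - p y\<bar> \<le> p (x - y)" using tri[of "x - y" y] tri[of "y - x" x] mc[of x y] by simp
qed

lemma sublinear_seminorm:
  assumes "is_seminorm (*\<^sub>R) p"
  shows "sublinear p"
  unfolding sublinear_def by (simp add: seminorm_triangle[OF assms] seminorm_scale[OF assms])

text \<open>The generating balls may be centred anywhere; the triangle inequality recentres them, so
  finite intersections of balls around \<open>x\<close> form a base at \<open>x\<close>. An empty
  \<open>F\<close> accounts for the whole space.\<close>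

lemma openin_seminorm_topology:
  assumes sn: "\<And>p. p \<in> Q \<Longrightarrow> is_seminorm (*\<^sub>R) p"
  shows "openin (seminorm_topology Q) U \<longleftrightarrow>
    (\<forall>x\<in>U. \<exists>F r. finite F \<and> F \<subseteq> Q \<and> 0 < r \<and> {y. \<forall>p\<in>F. p (y - x) < r} \<subseteq> U)" (is "?L \<longleftrightarrow> ?R U")
proof
  assume ?L
  then have "generate_topology_on (insert UNIV {{y. p (y - x) < r} | p x r. p \<in> Q \<and> 0 < r}) U"
    by (simp add: seminorm_topology_def openin_topology_generated_by_iff)
  then show "?R U"
  proof induction
    case (Int a b)
    show ?case
    proof
      fix x assume x: "x \<in> a \<inter> b"
      obtain F r where 1: "finite F" "F \<subseteq> Q" "0 < r" "{y. \<forall>p\<in>F. p (y - x) < r} \<subseteq> a"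
        using bspec[OF Int.IH(1) IntD1[OF x]] by (elim exE conjE) (rule that)
      obtain F' r' where 2: "finite F'" "F' \<subseteq> Q" "0 < r'" "{y. \<forall>p\<in>F'. p (y - x) < r'} \<subseteq> b"
        using bspec[OF Int.IH(2) IntD2[OF x]] by (elim exE conjE) (rule that)
      show "\<exists>F r. finite F \<and> F \<subseteq> Q \<and> 0 < r \<and> {y. \<forall>p\<in>F. p (y - x) < r} \<subseteq> a \<inter> b"
        using 1 2 by (intro exI[of _ "F \<union> F'"] exI[of _ "min r r'"]) auto
    qed
  next
    case (UN K)
    show ?case
    proof
      fix x assume "x \<in> \<Union>K"
      then obtain k where k: "k \<in> K" "x \<in> k" by blast
      obtain F r where "finite F" "F \<subseteq> Q" "0 < r" "{y. \<forall>p\<in>F. p (y - x) < r} \<subseteq> k"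
        using bspec[OF UN.IH[OF k(1)] k(2)] by (elim exE conjE) (rule that)
      moreover have "k \<subseteq> \<Union>K" using k by blast
      ultimately show "\<exists>F r. finite F \<and> F \<subseteq> Q \<and> 0 < r \<and> {y. \<forall>p\<in>F. p (y - x) < r} \<subseteq> \<Union>K"
        by (intro exI[of _ F] exI[of _ r] conjI) (assumption | rule order_trans)+
    qed
  next
    case (Basis s)
    then consider "s = UNIV" | p z r where "p \<in> Q" "0 < r" "s = {y. p (y - z) < r}" by auto
    then show ?case
    proof cases
      case 1 then show ?thesis by (auto intro!: exI[of _ "{}"] exI[of _ 1])
    next
      case 2
      show ?thesis
      proof
        fix x assume "x \<in> s"
        then have "0 < r - p (x - z)" using 2 by simp
        moreover have "{y. \<forall>q\<in>{p}. q (y - x) < r - p (x - z)} \<subseteq> s"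
        proof
          fix y assume "y \<in> {y. \<forall>q\<in>{p}. q (y - x) < r - p (x - z)}"
          then show "y \<in> s"
            using 2 seminorm_diff_triangle[OF sn[OF 2(1)], of y z x] by simp
        qed
        ultimately show "\<exists>F r. finite F \<and> F \<subseteq> Q \<and> 0 < r \<and> {y. \<forall>p\<in>F. p (y - x) < r} \<subseteq> s"
          using 2(1) by (intro exI[of _ "{p}"] exI[of _ "r - p (x - z)"] conjI) simp_all
      qed
    qed
  qed auto
next
  assume R: "?R U"
  show ?L
  proof (subst openin_subopen, intro ballI)
    fix x assume "x \<in> U"
    then obtain F r where F: "finite F" "F \<subseteq> Q" "0 < r" "{y. \<forall>p\<in>F. p (y - x) < r} \<subseteq> U"
      using bspec[OF R \<open>x \<in> U\<close>] by (elim exE conjE) (rule that)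
    have UN: "openin (seminorm_topology Q) UNIV"
      unfolding seminorm_topology_def by (rule topology_generated_by_Basis) simp
    have "openin (seminorm_topology Q) (UNIV \<inter> (\<Inter>p\<in>F. {y. p (y - x) < r}))"
    proof (cases "F = {}")
      case False
      have "openin (seminorm_topology Q) {y. p (y - x) < r}" if "p \<in> F" for p
        unfolding seminorm_topology_def using F that by (intro topology_generated_by_Basis) blast
      then have "openin (seminorm_topology Q) (\<Inter>p\<in>F. {y. p (y - x) < r})"
        using F False by (intro openin_INT2) auto
      then show ?thesis by simp
    qed (use UN in simp)
    also have "UNIV \<inter> (\<Inter>p\<in>F. {y. p (y - x) < r}) = {y. \<forall>p\<in>F. p (y - x) < r}" by auto
    finally have "openin (seminorm_topology Q) {y. \<forall>p\<in>F. p (y - x) < r}" .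
    moreover have "x \<in> {y. \<forall>p\<in>F. p (y - x) < r}"
      using F sn by (auto simp: seminorm_zero)
    ultimately show "\<exists>T. openin (seminorm_topology Q) T \<and> x \<in> T \<and> T \<subseteq> U"
      using F(4) by (intro exI[of _ "{y. \<forall>p\<in>F. p (y - x) < r}"] conjI)
  qed
qed

lemma topspace_seminorm_topology: "topspace (seminorm_topology Q) = UNIV"
  unfolding seminorm_topology_def topology_generated_by_topspace by auto

text \<open>Needed to recognise a topology generated by seminorms as a competitor of the mixed
  topology.\<close>

lemma linear_topology_seminorm_topology:
  assumes sc: "normed_scaling sc" and sn: "\<And>p. p \<in> Q \<Longrightarrow> is_seminorm sc p"
  shows "linear_topology sc (seminorm_topology Q)"
proof -
  let ?T = "seminorm_topology Q"
  have sn': "\<And>p. p \<in> Q \<Longrightarrow> is_seminorm (*\<^sub>R) p" using is_seminorm_scaleR[OF sc sn] .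
  have op: "openin ?T U \<longleftrightarrow>
      (\<forall>x\<in>U. \<exists>F r. finite F \<and> F \<subseteq> Q \<and> 0 < r \<and> {y. \<forall>p\<in>F. p (y - x) < r} \<subseteq> U)" for U
    by (rule openin_seminorm_topology) (rule sn')
  have ball: "openin ?T {y. \<forall>p\<in>F. p (y - x) < r}" if F: "finite F" "F \<subseteq> Q" "0 < r" for F x r
    unfolding op
  proof (rule ballI)
    fix z assume z: "z \<in> {y. \<forall>p\<in>F. p (y - x) < r}"
    \<comment> \<open>The inserted 1 keeps the minimum meaningful for empty
      \<open>F\<close>.\<close>
    define \<delta> where "\<delta> = Min (insert 1 ((\<lambda>p. r - p (z - x)) ` F))"
    have "\<delta> > 0" unfolding \<delta>_def using z F by (subst Min_gr_iff) auto
    moreover have "{y. \<forall>p\<in>F. p (y - z) < \<delta>} \<subseteq> {y. \<forall>p\<in>F. p (y - x) < r}"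
    proof (intro subsetI CollectI ballI)
      fix y p assume y: "y \<in> {y. \<forall>p\<in>F. p (y - z) < \<delta>}" and p: "p \<in> F"
      have "\<delta> \<le> r - p (z - x)" unfolding \<delta>_def using p F by (intro Min_le) auto
      moreover have "p (y - x) \<le> p (y - z) + p (z - x)"
        using p F by (intro seminorm_diff_triangle sn') auto
      ultimately show "p (y - x) < r" using y p by force
    qed
    ultimately show "\<exists>F' r'. finite F' \<and> F' \<subseteq> Q \<and> 0 < r' \<and> {y. \<forall>p\<in>F'. p (y - z) < r'} \<subseteq> {y. \<forall>p\<in>F. p (y - x) < r}"
      using F by blast
  qed
  have "continuous_map (prod_topology ?T ?T) ?T (\<lambda>(x, y). x + y)"
    unfolding continuous_map_def
  proof (intro conjI allI impI)
    fix U assume U: "openin ?T U"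
    show "openin (prod_topology ?T ?T) {z \<in> topspace (prod_topology ?T ?T). (case z of (x, y) \<Rightarrow> x + y) \<in> U}"
    proof (subst openin_subopen, intro ballI)
      fix z assume "z \<in> {z \<in> topspace (prod_topology ?T ?T). (case z of (x, y) \<Rightarrow> x + y) \<in> U}"
      then obtain a b where z: "z = (a, b)" "a + b \<in> U" by auto
      obtain F r where F: "finite F" "F \<subseteq> Q" "0 < r" "{y. \<forall>p\<in>F. p (y - (a + b)) < r} \<subseteq> U"
        using bspec[OF U[unfolded op] z(2)] by (elim exE conjE) (rule that)
      let ?B = "\<lambda>x. {y. \<forall>p\<in>F. p (y - x) < r / 2}"
      have sub: "u + v \<in> U" if uv: "u \<in> ?B a" "v \<in> ?B b" for u v
      proof -
        have "p (u + v - (a + b)) < r" if "p \<in> F" for p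
        proof -
          have "p ((u - a) + (v - b)) \<le> p (u - a) + p (v - b)"
            using that F by (intro seminorm_triangle sn') auto
          also have "\<dots> < r / 2 + r / 2" using uv that by (intro add_strict_mono) auto
          finally show ?thesis by (simp add: algebra_simps)
        qed
        then show "u + v \<in> U" using F(4) by blast
      qed
      have "openin (prod_topology ?T ?T) (?B a \<times> ?B b)"
        by (intro openin_prod_Times_iff[THEN iffD2] disjI2 conjI ball) (use F in auto)
      moreover have "z \<in> ?B a \<times> ?B b" using z F sn' by (auto simp: seminorm_zero)
      ultimately show "\<exists>T. openin (prod_topology ?T ?T) T \<and> z \<in> T \<and>
          T \<subseteq> {z \<in> topspace (prod_topology ?T ?T). (case z of (x, y) \<Rightarrow> x + y) \<in> U}"
        using sub by (intro exI[of _ "?B a \<times> ?B b"]) (auto simp: topspace_seminorm_topology)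
    qed
  qed (auto simp: topspace_seminorm_topology)
  moreover have "continuous_map (prod_topology euclidean ?T) ?T (\<lambda>(c, x). sc c x)"
    unfolding continuous_map_def
  proof (intro conjI allI impI)
    fix U assume U: "openin ?T U"
    show "openin (prod_topology euclidean ?T) {z \<in> topspace (prod_topology euclidean ?T). (case z of (c, x) \<Rightarrow> sc c x) \<in> U}"
    proof (subst openin_subopen, intro ballI)
      fix z assume "z \<in> {z \<in> topspace (prod_topology euclidean ?T). (case z of (c, x) \<Rightarrow> sc c x) \<in> U}"
      then obtain a b where z: "z = (a, b)" "sc a b \<in> U" by auto
      obtain F r where F: "finite F" "F \<subseteq> Q" "0 < r" "{y. \<forall>p\<in>F. p (y - sc a b) < r} \<subseteq> U"
        using bspec[OF U[unfolded op] z(2)] by (elim exE conjE) (rule that)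
      \<comment> \<open>Constants for the splitting
        \<open>sc c x - sc a b = sc c (x - b) + sc (c - a) b\<close>: since
        \<open>s \<le> 1\<close>, \<open>norm c\<close> is at most \<open>norm a + 1\<close>, so
        \<open>\<delta>\<close> and \<open>s\<close> leave \<open>r / 2\<close> for each term. The
        sum over \<open>F\<close> stands in for a maximum.\<close>
      define s where "s = min 1 (r / 2 / (1 + (\<Sum>p\<in>F. p b)))"
      define \<delta> where "\<delta> = r / 2 / (norm a + 1)"
      have Fn: "0 \<le> p x" if "p \<in> F" for p x using that F sn' by (auto intro: seminorm_nonneg)
      have den: "1 + (\<Sum>p\<in>F. p b) > 0" using sum_nonneg[of F "\<lambda>p. p b"] Fn by fastforce
      have s: "s > 0" "s \<le> 1" unfolding s_def using F den by auto
      have na: "norm a + 1 > 0" by (simp add: add_nonneg_pos)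
      have \<delta>: "\<delta> > 0" unfolding \<delta>_def using F na by simp
      have sub: "sc c x \<in> U" if c: "dist a c < s" and x: "\<forall>p\<in>F. p (x - b) < \<delta>" for c x
      proof -
        have "p (sc c x - sc a b) < r" if "p \<in> F" for p
        proof -
          interpret vector_space sc by (rule normed_scalingD[OF sc])
          have p: "is_seminorm sc p" "is_seminorm (*\<^sub>R) p" using that F sn sn' by auto
          have nc: "norm c \<le> norm a + 1" using norm_triangle_ineq2[of c a] c s
            by (simp add: dist_norm norm_minus_commute)
          have "sc c x - sc a b = sc c (x - b) + sc (c - a) b"
            by (simp add: scale_right_diff_distrib scale_left_diff_distrib)
          then have "p (sc c x - sc a b) \<le> p (sc c (x - b)) + p (sc (c - a) b)"
            by (simp add: seminorm_triangle[OF p(2)])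
          also have "\<dots> = norm c * p (x - b) + norm (c - a) * p b"
            using p(1) by (simp add: is_seminorm_def)
          also have "norm c * p (x - b) \<le> (norm a + 1) * p (x - b)"
            using nc Fn[OF that] by (intro mult_right_mono) auto
          also have "\<dots> < (norm a + 1) * \<delta>"
            using x that na by (intro mult_strict_left_mono) auto
          also have "(norm a + 1) * \<delta> = r / 2" using na unfolding \<delta>_def by (simp add: field_simps)
          also have "norm (c - a) * p b \<le> s * (1 + (\<Sum>p\<in>F. p b))"
          proof (rule mult_mono)
            show "norm (c - a) \<le> s" using c by (simp add: dist_norm norm_minus_commute)
            have "p b \<le> (\<Sum>p\<in>F. p b)" using that F Fn by (intro member_le_sum) auto
            then show "p b \<le> 1 + (\<Sum>p\<in>F. p b)" by simp
          qed (use s Fn that in auto)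
          also have "\<dots> \<le> r / 2 / (1 + (\<Sum>p\<in>F. p b)) * (1 + (\<Sum>p\<in>F. p b))"
            using den unfolding s_def by (intro mult_right_mono) auto
          also have "\<dots> = r / 2"
            by (intro nonzero_eq_divide_eq[THEN iffD1, OF _ refl]) (use den in simp)
          finally show ?thesis by simp
        qed
        then show "sc c x \<in> U" using F(4) by blast
      qed
      have "openin (prod_topology euclidean ?T) (ball a s \<times> {y. \<forall>p\<in>F. p (y - b) < \<delta>})"
        by (intro openin_prod_Times_iff[THEN iffD2] disjI2 conjI ball) (use F \<delta> in auto)
      moreover have "z \<in> ball a s \<times> {y. \<forall>p\<in>F. p (y - b) < \<delta>}" using z F sn' s \<delta> by (auto simp: seminorm_zero)
      ultimately show "\<exists>T. openin (prod_topology euclidean ?T) T \<and> z \<in> T \<and>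
          T \<subseteq> {z \<in> topspace (prod_topology euclidean ?T). (case z of (c, x) \<Rightarrow> sc c x) \<in> U}"
        using sub by (intro exI[of _ "ball a s \<times> {y. \<forall>p\<in>F. p (y - b) < \<delta>}"]) (auto simp: topspace_seminorm_topology)
    qed
  qed (auto simp: topspace_seminorm_topology)
  ultimately show ?thesis
    unfolding linear_topology_def by (simp add: topspace_seminorm_topology)
qed

section \<open>The mixed topology\<close>

text \<open>The norming system \<open>P\<close> becomes a parameter, so the existential in the
  notion of a Saks space is opened once and for all.\<close>

locale mixed_saks =
  fixes sc :: "'k::real_normed_field \<Rightarrow> 'a::real_normed_vector \<Rightarrow> 'a"
    and \<tau> \<gamma> :: "'a topology" and P :: "('a \<Rightarrow> real) set"
  assumes scaling: "normed_scaling sc"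
    and P_sc_seminorm: "p \<in> P \<Longrightarrow> is_seminorm sc p"
    and P_directed: "directed_system P"
    and tau_eq: "\<tau> = seminorm_topology P"
    and norm_P: "bdd_above ((\<lambda>p. p x) ` P)" "norm x = (SUP p\<in>P. p x)"
    and mixed: "is_mixed_topology sc \<tau> \<gamma>"
    and complete: "seq_complete \<gamma>"
    and C_seq: "C_sequential \<gamma>"
begin

abbreviation \<Gamma> :: "('a \<Rightarrow> real) set" where "\<Gamma> \<equiv> continuous_seminorms sc \<gamma>"

lemma P_seminorm: "p \<in> P \<Longrightarrow> is_seminorm (*\<^sub>R) p"
  using is_seminorm_scaleR[OF scaling P_sc_seminorm] .

lemma \<Gamma>_sc_seminorm: "p \<in> \<Gamma> \<Longrightarrow> is_seminorm sc p"
  by (simp add: continuous_seminorms_def)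

lemma \<Gamma>_seminorm: "p \<in> \<Gamma> \<Longrightarrow> is_seminorm (*\<^sub>R) p"
  using is_seminorm_scaleR[OF scaling \<Gamma>_sc_seminorm] .

lemma P_nonempty: "P \<noteq> {}" using P_directed by (simp add: directed_system_def)

lemma P_le_norm: "p \<in> P \<Longrightarrow> p x \<le> norm x"
  unfolding norm_P(2) by (rule cSUP_upper[OF _ norm_P(1)])

lemma norm_le_P: "(\<And>p. p \<in> P \<Longrightarrow> p x \<le> c) \<Longrightarrow> norm x \<le> c"
  unfolding norm_P(2) by (rule cSUP_least[OF P_nonempty])

lemma P_finite_bound:
  assumes "finite F" "F \<subseteq> P"
  obtains p where "p \<in> P" "\<And>q x. q \<in> F \<Longrightarrow> q x \<le> p x"
proof -
  have "\<exists>p\<in>P. \<forall>q\<in>F. \<forall>x. q x \<le> p x"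
    using assms
  proof (induction F)
    case empty then show ?case using P_nonempty by auto
  next
    case (insert q F)
    then obtain p where p: "p \<in> P" "\<forall>q\<in>F. \<forall>x. q x \<le> p x" by auto
    then obtain r where r: "r \<in> P" "\<And>x. max (p x) (q x) \<le> r x"
      using P_directed insert.prems unfolding directed_system_def by (metis insert_subset)
    have "q' x \<le> r x" if "q' \<in> insert q F" for q' x
    proof (cases "q' = q")
      case True then show ?thesis using r(2)[of x] by simp
    next
      case False
      then have "q' x \<le> p x" using p that by auto
      then show ?thesis using r(2)[of x] by simp
    qed
    then show ?case using r(1) by blast
  qed
  then show ?thesis using that by blast
qed

text \<open>Directedness replaces finitely many seminorms by a single one.\<close>

lemma openin_tau: "openin \<tau> U \<longleftrightarrow> (\<forall>x\<in>U. \<exists>p\<in>P. \<exists>r>0. {y. p (y - x) < r} \<subseteq> U)"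
proof -
  have "openin \<tau> U \<longleftrightarrow>
    (\<forall>x\<in>U. \<exists>F r. finite F \<and> F \<subseteq> P \<and> 0 < r \<and> {y. \<forall>p\<in>F. p (y - x) < r} \<subseteq> U)"
    unfolding tau_eq by (rule openin_seminorm_topology) (rule P_seminorm)
  also have "\<dots> \<longleftrightarrow> (\<forall>x\<in>U. \<exists>p\<in>P. \<exists>r>0. {y. p (y - x) < r} \<subseteq> U)"
  proof (intro ball_cong refl iffI)
    fix x assume "\<exists>F r. finite F \<and> F \<subseteq> P \<and> 0 < r \<and> {y. \<forall>p\<in>F. p (y - x) < r} \<subseteq> U"
    then obtain F r where F: "finite F" "F \<subseteq> P" "0 < r" "{y. \<forall>p\<in>F. p (y - x) < r} \<subseteq> U"
      by (elim exE conjE) (rule that)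
    obtain p where p: "p \<in> P" "\<And>q x. q \<in> F \<Longrightarrow> q x \<le> p x"
      using P_finite_bound[OF F(1,2)] by blast
    have "{y. p (y - x) < r} \<subseteq> {y. \<forall>p\<in>F. p (y - x) < r}"
      using p(2) by (auto intro: le_less_trans)
    then show "\<exists>p\<in>P. \<exists>r>0. {y. p (y - x) < r} \<subseteq> U"
      using p(1) F(3,4) by (intro bexI[of _ p] exI[of _ r] conjI) auto
  next
    fix x assume "\<exists>p\<in>P. \<exists>r>0. {y. p (y - x) < r} \<subseteq> U"
    then obtain p r where "p \<in> P" "0 < r" "{y. p (y - x) < r} \<subseteq> U" by (elim bexE exE conjE) (rule that)
    then show "\<exists>F r. finite F \<and> F \<subseteq> P \<and> 0 < r \<and> {y. \<forall>p\<in>F. p (y - x) < r} \<subseteq> U"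
      by (intro exI[of _ "{p}"] exI[of _ r]) simp
  qed
  finally show ?thesis .
qed

lemma tau_ball: "p \<in> P \<Longrightarrow> openin \<tau> {y. p (y - x) < r}"
  unfolding openin_tau
proof (intro ballI bexI exI conjI)
  fix z assume p: "p \<in> P" and z: "z \<in> {y. p (y - x) < r}"
  show "0 < r - p (z - x)" using z by simp
  show "{y. p (y - z) < r - p (z - x)} \<subseteq> {y. p (y - x) < r}"
  proof
    fix y assume "y \<in> {y. p (y - z) < r - p (z - x)}"
    then show "y \<in> {y. p (y - x) < r}"
      using seminorm_diff_triangle[OF P_seminorm[OF p], of y x z] by simp
  qed
qed

lemma topspace_tau [simp]: "topspace \<tau> = UNIV"
  by (simp add: tau_eq topspace_seminorm_topology)

lemma limitin_tau: "limitin \<tau> s x F \<longleftrightarrow> (\<forall>p\<in>P. ((\<lambda>i. p (s i - x)) \<longlongrightarrow> 0) F)"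
proof
  assume L: "limitin \<tau> s x F"
  show "\<forall>p\<in>P. ((\<lambda>i. p (s i - x)) \<longlongrightarrow> 0) F"
  proof (intro ballI tendstoI)
    fix p e assume p: "p \<in> P" and e: "(0::real) < e"
    have "\<forall>\<^sub>F i in F. s i \<in> {y. p (y - x) < e}"
      using L tau_ball[OF p, of x e] e seminorm_zero[OF P_seminorm[OF p]] by (auto simp: limitin_def)
    then show "\<forall>\<^sub>F i in F. dist (p (s i - x)) 0 < e"
      by (rule eventually_mono) (simp add: seminorm_nonneg[OF P_seminorm[OF p]])
  qed
next
  assume R: "\<forall>p\<in>P. ((\<lambda>i. p (s i - x)) \<longlongrightarrow> 0) F"
  show "limitin \<tau> s x F"
    unfolding limitin_def
  proof (intro conjI allI impI)
    fix U assume U: "openin \<tau> U \<and> x \<in> U"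
    then obtain p r where p: "p \<in> P" "0 < r" "{y. p (y - x) < r} \<subseteq> U"
      using bspec[of U _ x, OF U[THEN conjunct1, unfolded openin_tau] U[THEN conjunct2]]
      by (elim bexE exE conjE) (rule that)
    have "\<forall>\<^sub>F i in F. p (s i - x) < r" using R p by (intro order_tendstoD(2)) auto
    then show "\<forall>\<^sub>F i in F. s i \<in> U" by (rule eventually_mono) (use p(3) in blast)
  qed simp
qed

section \<open>Continuous seminorms of the mixed topology\<close>

lemma gamma_candidate: "mixed_candidate sc \<tau> \<gamma>"
  and gamma_finest: "mixed_candidate sc \<tau> T \<Longrightarrow> coarser T \<gamma>"
  using mixed by (auto simp: is_mixed_topology_def)

lemma gamma_linear: "linear_topology sc \<gamma>"
  and gamma_agree: "bounded E \<Longrightarrow> subtopology \<gamma> E = subtopology \<tau> E"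
  and gamma_le_norm: "openin \<gamma> U \<Longrightarrow> open U"
  using gamma_candidate by (auto simp: mixed_candidate_def coarser_def)

lemma topspace_gamma [simp]: "topspace \<gamma> = UNIV"
  using gamma_linear by (simp add: linear_topology_def)

lemma gamma_translate:
  assumes "openin \<gamma> U" shows "openin \<gamma> {y. y + a \<in> U}"
proof -
  have "continuous_map \<gamma> \<gamma> ((\<lambda>(x, y). x + y) \<circ> (\<lambda>y. (y, a)))"
    using gamma_linear unfolding linear_topology_def
    by (intro continuous_map_compose[where X' = "prod_topology \<gamma> \<gamma>"]) (auto intro!: continuous_map_pairedI)
  then have "openin \<gamma> {y \<in> topspace \<gamma>. ((\<lambda>(x, y). x + y) \<circ> (\<lambda>y. (y, a))) y \<in> U}"
    using assms by (rule openin_continuous_map_preimage)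
  then show ?thesis by simp
qed

text \<open>Equality of the two topologies on a ball, read off at its centre: on bounded sets a
  \<gamma>-neighbourhood is controlled by one seminorm of \<open>P\<close>.\<close>

lemma gamma_nbhd_small:
  assumes U: "openin \<gamma> U" "0 \<in> U"
  shows "\<exists>p\<in>P. \<exists>\<delta>>0. \<forall>x. norm x \<le> K \<longrightarrow> p x < \<delta> \<longrightarrow> x \<in> U"
proof -
  \<comment> \<open>\<open>K\<close> may be negative; the absolute value keeps 0 in the
    ball.\<close>
  define E where "E = cball (0::'a) \<bar>K\<bar>"
  have "openin (subtopology \<gamma> E) (U \<inter> E)" using U by (auto simp: openin_subtopology)
  then have "openin (subtopology \<tau> E) (U \<inter> E)" using gamma_agree[of E] by (simp add: E_def)
  then obtain V where V: "openin \<tau> V" "U \<inter> E = V \<inter> E" unfolding openin_subtopology by blast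
  have "0 \<in> U \<inter> E" using U by (simp add: E_def)
  then have "0 \<in> V" unfolding V(2) by blast
  then obtain p r where p: "p \<in> P" "0 < r" "{y. p (y - 0) < r} \<subseteq> V"
    using bspec[OF V(1)[unfolded openin_tau] \<open>0 \<in> V\<close>] by (elim bexE exE conjE) (rule that)
  have "x \<in> U" if "norm x \<le> K" "p x < r" for x
  proof -
    have "x \<in> V" using p(3) that by auto
    moreover have "x \<in> E" using that by (simp add: E_def)
    ultimately show ?thesis using V(2) by blast
  qed
  then show ?thesis using p by blast
qed

lemma \<Gamma>_ball_open: "p \<in> \<Gamma> \<Longrightarrow> openin \<gamma> {x. p x < r}"
  using openin_continuous_map_preimage[of \<gamma> euclideanreal p "{..<r}"]
  by (simp add: continuous_seminorms_def)

lemma \<Gamma>_small: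
  assumes "p \<in> \<Gamma>" "0 < \<epsilon>"
  shows "\<exists>q\<in>P. \<exists>\<delta>>0. \<forall>x. norm x \<le> K \<longrightarrow> q x < \<delta> \<longrightarrow> p x < \<epsilon>"
  using gamma_nbhd_small[OF \<Gamma>_ball_open[OF assms(1)], of \<epsilon> K] assms
  by (simp add: seminorm_zero[OF \<Gamma>_seminorm])

text \<open>Here the maximality of \<gamma> enters: adjoining \<open>q\<close> to \<open>P\<close>
  yields a linear topology that still agrees with \<tau> on bounded sets, hence is coarser than
  \<gamma>. The criterion is used below for suprema and infimal convolutions of seminorms.\<close>

lemma small_imp_\<Gamma>:
  assumes q: "is_seminorm sc q"
    and small: "\<And>K \<epsilon>. 0 < \<epsilon> \<Longrightarrow> \<exists>p\<in>P. \<exists>\<delta>>0. \<forall>x. norm x \<le> K \<longrightarrow> p x < \<delta> \<longrightarrow> q x < \<epsilon>"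
  shows "q \<in> \<Gamma>"
proof -
  define T where "T = seminorm_topology (insert q P)"
  have q': "is_seminorm (*\<^sub>R) q" using is_seminorm_scaleR[OF scaling q] .
  have sn: "p \<in> insert q P \<Longrightarrow> is_seminorm sc p" for p using q P_sc_seminorm by auto
  have sn': "p \<in> insert q P \<Longrightarrow> is_seminorm (*\<^sub>R) p" for p using q' P_seminorm by auto
  have opT: "openin T U \<longleftrightarrow>
      (\<forall>x\<in>U. \<exists>F r. finite F \<and> F \<subseteq> insert q P \<and> 0 < r \<and> {y. \<forall>p\<in>F. p (y - x) < r} \<subseteq> U)" for U
    unfolding T_def by (rule openin_seminorm_topology) (rule sn')
  have opTD: "\<exists>p\<in>P. \<exists>r>0. \<forall>y. p (y - x) < r \<longrightarrow> q (y - x) < r \<longrightarrow> y \<in> U" if Ux: "openin T U" "x \<in> U" for U x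
  proof -
    obtain F r where F: "finite F" "F \<subseteq> insert q P" "0 < r" "{y. \<forall>p\<in>F. p (y - x) < r} \<subseteq> U"
      using bspec[OF Ux(1)[unfolded opT] Ux(2)] by (elim exE conjE) (rule that)
    obtain p where p: "p \<in> P" "\<And>q' x. q' \<in> F - {q} \<Longrightarrow> q' x \<le> p x"
      using P_finite_bound[of "F - {q}"] F by blast
    have "y \<in> U" if "p (y - x) < r" "q (y - x) < r" for y
    proof -
      have "q' (y - x) < r" if "q' \<in> F" for q'
        using p(2)[of q' "y - x"] that \<open>p (y - x) < r\<close> \<open>q (y - x) < r\<close> by (cases "q' = q") auto
      then show ?thesis using F(4) by blast
    qed
    then show ?thesis using p F(3) by blast
  qed
  have tT: "openin T U" if U: "openin \<tau> U" for U
    unfolding opT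
  proof
    fix x assume x: "x \<in> U"
    obtain p r where "p \<in> P" "0 < r" "{y. p (y - x) < r} \<subseteq> U"
      using bspec[OF U[unfolded openin_tau] x] by (elim bexE exE conjE) (rule that)
    then show "\<exists>F r. finite F \<and> F \<subseteq> insert q P \<and> 0 < r \<and> {y. \<forall>p\<in>F. p (y - x) < r} \<subseteq> U"
      by (intro exI[of _ "{p}"] exI[of _ r]) simp
  qed
  have "mixed_candidate sc \<tau> T"
    unfolding mixed_candidate_def
  proof (intro conjI allI impI)
    show "linear_topology sc T"
      unfolding T_def by (rule linear_topology_seminorm_topology[OF scaling]) (rule sn)
    show "coarser \<tau> T" using tT by (simp add: coarser_def)
    show "coarser T euclidean"
      unfolding coarser_def
    proof (intro allI impI)
      fix U assume U: "openin T U"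
      have "\<exists>e>0. \<forall>y. dist y x < e \<longrightarrow> y \<in> U" if x: "x \<in> U" for x
      proof -
        obtain p r where p: "p \<in> P" "0 < r" "\<forall>y. p (y - x) < r \<longrightarrow> q (y - x) < r \<longrightarrow> y \<in> U"
          using opTD[OF U x] by blast
        \<comment> \<open>The bound 1 on the norm is secured by the 1 in the minimum that
          follows.\<close>
        obtain p' \<delta> where p': "p' \<in> P" "0 < \<delta>" "\<forall>x. norm x \<le> 1 \<longrightarrow> p' x < \<delta> \<longrightarrow> q x < r"
          using small[OF p(2), of 1] by blast
        have "y \<in> U" if "dist y x < min 1 (min r \<delta>)" for y
          using that P_le_norm[OF p(1), of "y - x"] P_le_norm[OF p'(1), of "y - x"] p(3) p'(3)
          by (simp add: dist_norm)
        then show ?thesis using p(2) p'(2) by (intro exI[of _ "min 1 (min r \<delta>)"]) auto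
      qed
      then show "openin euclidean U" by (simp add: open_dist)
    qed
    fix E :: "'a set" assume "bounded E"
    then obtain K where K: "\<And>x. x \<in> E \<Longrightarrow> norm x \<le> K" by (auto simp: bounded_iff)
    show "subtopology T E = subtopology \<tau> E"
      unfolding topology_eq
    proof (intro allI iffI)
      fix S assume "openin (subtopology \<tau> E) S"
      then show "openin (subtopology T E) S" using tT by (auto simp: openin_subtopology)
    next
      fix S assume "openin (subtopology T E) S"
      then obtain U where U: "openin T U" "S = U \<inter> E" by (auto simp: openin_subtopology)
      show "openin (subtopology \<tau> E) S"
      proof (subst openin_subopen, intro ballI)
        fix x assume x: "x \<in> S"
        then have xE: "x \<in> U" "x \<in> E" using U by auto
        obtain p r where p: "p \<in> P" "0 < r" "\<forall>y. p (y - x) < r \<longrightarrow> q (y - x) < r \<longrightarrow> y \<in> U"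
          using opTD[OF U(1) xE(1)] by blast
        \<comment> \<open>Radius \<open>2 * K\<close>, since the criterion is applied to differences
          of points of \<open>E\<close>.\<close>
        obtain p' \<delta> where p': "p' \<in> P" "0 < \<delta>" "\<forall>x. norm x \<le> 2 * K \<longrightarrow> p' x < \<delta> \<longrightarrow> q x < r"
          using small[OF p(2), of "2 * K"] by blast
        let ?V = "({y. p (y - x) < r} \<inter> {y. p' (y - x) < \<delta>}) \<inter> E"
        have "openin (subtopology \<tau> E) ?V"
          by (intro openin_subtopology_Int openin_Int tau_ball p p')
        moreover have "x \<in> ?V" using p p' xE by (simp add: seminorm_zero P_seminorm)
        moreover have "?V \<subseteq> S"
        proof
          fix y assume y: "y \<in> ?V"
          then have "norm (y - x) \<le> 2 * K"
            using K[of y] K[OF xE(2)] norm_triangle_ineq4[of y x] by simp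
          then show "y \<in> S" using y p(3) p'(3) U(2) by auto
        qed
        ultimately show "\<exists>V. openin (subtopology \<tau> E) V \<and> x \<in> V \<and> V \<subseteq> S" by blast
      qed
    qed
  qed
  then have Tg: "openin \<gamma> U" if "openin T U" for U
    using gamma_finest that by (auto simp: coarser_def)
  have "continuous_map \<gamma> euclideanreal q"
    unfolding continuous_map_def
  proof (intro conjI allI impI)
    fix V :: "real set" assume V: "openin euclideanreal V"
    have "openin T {x. q x \<in> V}"
      unfolding opT
    proof
      fix x assume "x \<in> {x. q x \<in> V}"
      then obtain e where e: "0 < e" "\<And>t. dist t (q x) < e \<Longrightarrow> t \<in> V"
        using V by (auto simp: open_dist)
      have "{y. \<forall>p\<in>{q}. p (y - x) < e} \<subseteq> {x. q x \<in> V}"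
      proof
        fix y assume "y \<in> {y. \<forall>p\<in>{q}. p (y - x) < e}"
        then have "dist (q y) (q x) < e"
          using seminorm_reverse_triangle[OF q', of y x] by (simp add: dist_real_def)
        then show "y \<in> {x. q x \<in> V}" using e(2) by simp
      qed
      then show "\<exists>F r. finite F \<and> F \<subseteq> insert q P \<and> 0 < r \<and> {y. \<forall>p\<in>F. p (y - x) < r} \<subseteq> {x. q x \<in> V}"
        using e(1) by (intro exI[of _ "{q}"] exI[of _ e] conjI) simp_all
    qed
    then show "openin \<gamma> {x \<in> topspace \<gamma>. q x \<in> V}" using Tg by simp
  qed simp
  then show ?thesis using q by (simp add: continuous_seminorms_def)
qed

lemma P_subset_\<Gamma>: "P \<subseteq> \<Gamma>"
proof
  fix p assume "p \<in> P"
  then show "p \<in> \<Gamma>" by (intro small_imp_\<Gamma> P_sc_seminorm) auto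
qed

lemma \<Gamma>_add: "p \<in> \<Gamma> \<Longrightarrow> q \<in> \<Gamma> \<Longrightarrow> (\<lambda>x. p x + q x) \<in> \<Gamma>"
  unfolding continuous_seminorms_def
proof clarify
  assume a: "is_seminorm sc p" "is_seminorm sc q" "continuous_map \<gamma> euclideanreal p" "continuous_map \<gamma> euclideanreal q"
  have "p (x + y) + q (x + y) \<le> (p x + q x) + (p y + q y)" for x y
  proof -
    have "p (x + y) \<le> p x + p y" "q (x + y) \<le> q x + q y" using a by (auto simp: is_seminorm_def)
    then show ?thesis by simp
  qed
  then have "is_seminorm sc (\<lambda>x. p x + q x)"
    using a by (simp add: is_seminorm_def algebra_simps)
  then show "is_seminorm sc (\<lambda>x. p x + q x) \<and> continuous_map \<gamma> euclideanreal (\<lambda>x. p x + q x)"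
    using a by (intro conjI continuous_map_add)
qed

lemma \<Gamma>_cmult: "p \<in> \<Gamma> \<Longrightarrow> 0 \<le> c \<Longrightarrow> (\<lambda>x. c * p x) \<in> \<Gamma>"
  unfolding continuous_seminorms_def
proof clarify
  assume c: "0 \<le> c" and a: "is_seminorm sc p" "continuous_map \<gamma> euclideanreal p"
  have "c * p (x + y) \<le> c * p x + c * p y" for x y
    using mult_left_mono[of "p (x + y)" "p x + p y" c] c a(1) by (simp add: is_seminorm_def algebra_simps)
  then have "is_seminorm sc (\<lambda>x. c * p x)"
    using a by (simp add: is_seminorm_def)
  then show "is_seminorm sc (\<lambda>x. c * p x) \<and> continuous_map \<gamma> euclideanreal (\<lambda>x. c * p x)"
    using a by (intro conjI continuous_map_real_mult_left)
qed

text \<open>As \<gamma> is coarser than the norm topology, some norm ball lies in the unit ball of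
  \<open>p\<close>.\<close>

lemma \<Gamma>_bound:
  assumes p: "p \<in> \<Gamma>"
  obtains C where "0 < C" "\<And>x. p x \<le> C * norm x"
proof -
  have "open {x. p x < 1}" by (rule gamma_le_norm[OF \<Gamma>_ball_open[OF p]])
  moreover have "0 \<in> {x. p x < 1}" by (simp add: seminorm_zero[OF \<Gamma>_seminorm[OF p]])
  ultimately obtain r where r: "0 < r" "ball 0 r \<subseteq> {x. p x < 1}" by (meson open_contains_ball)
  have "p x \<le> (2 / r) * norm x" for x
  proof (cases "x = 0")
    case False
    define c where "c = r / 2 / norm x"
    have c: "c > 0" using False r by (simp add: c_def)
    have "c *\<^sub>R x \<in> ball 0 r" using r False by (simp add: c_def)
    then have "p (c *\<^sub>R x) < 1" using r(2) by blast
    then have "c * p x < 1" using c by (simp add: seminorm_scale[OF \<Gamma>_seminorm[OF p]])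
    then show ?thesis using c False r by (simp add: c_def field_simps)
  qed (simp add: seminorm_zero[OF \<Gamma>_seminorm[OF p]])
  then show ?thesis using r by (intro that[of "2 / r"]) auto
qed


section \<open>Local convexity of the mixed topology\<close>

lemma gamma_half_nbhd:
  assumes "openin \<gamma> W" "0 \<in> W"
  obtains V where "openin \<gamma> V" "0 \<in> V" "\<And>x y. x \<in> V \<Longrightarrow> y \<in> V \<Longrightarrow> x + y \<in> W"
proof -
  have "continuous_map (prod_topology \<gamma> \<gamma>) \<gamma> (\<lambda>(x, y). x + y)"
    using gamma_linear by (simp add: linear_topology_def)
  then have op: "openin (prod_topology \<gamma> \<gamma>) {z \<in> topspace (prod_topology \<gamma> \<gamma>). (case z of (x, y) \<Rightarrow> x + y) \<in> W}"
    using assms(1) by (rule openin_continuous_map_preimage)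
  have "(0, 0) \<in> {z \<in> topspace (prod_topology \<gamma> \<gamma>). (case z of (x, y) \<Rightarrow> x + y) \<in> W}"
    using assms by simp
  from op[unfolded openin_prod_topology_alt, rule_format, OF this] obtain U V where UV: "openin \<gamma> U" "openin \<gamma> V" "(0::'a) \<in> U" "(0::'a) \<in> V"
      "U \<times> V \<subseteq> {z \<in> topspace (prod_topology \<gamma> \<gamma>). (case z of (x, y) \<Rightarrow> x + y) \<in> W}"
    by (elim exE conjE) (rule that)
  show ?thesis
  proof (rule that[of "U \<inter> V"])
    show "x + y \<in> W" if "x \<in> U \<inter> V" "y \<in> U \<inter> V" for x y
    proof -
      have "(x, y) \<in> U \<times> V" using that by simp
      from subsetD[OF UV(5) this] show ?thesis by simp
    qed
  qed (use UV(1-4) in \<open>simp_all add: openin_Int\<close>)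
qed

text \<open>The seminorm is the infimal convolution of the seminorms
  \<open>max (p\<^sub>k / \<delta>\<^sub>k) (norm / (k + 1))\<close>, where \<open>{p\<^sub>k < \<delta>\<^sub>k}\<close> meets the ball of radius \<open>k + 1\<close> inside the
  \<open>k\<close>-th member of a sequence of successively halved neighbourhoods.\<close>

lemma gamma_locally_convex:
  assumes U: "openin \<gamma> U" "0 \<in> U"
  obtains q where "q \<in> \<Gamma>" "{x. q x < 1} \<subseteq> U"
proof -
  have "\<exists>V. (V 0 = U) \<and> (\<forall>n. openin \<gamma> (V n) \<and> 0 \<in> V n \<and> (\<forall>x\<in>V (Suc n). \<forall>y\<in>V (Suc n). x + y \<in> V n))"
  proof -
    have "\<exists>V. \<forall>n. (openin \<gamma> (V n) \<and> 0 \<in> V n \<and> (n = 0 \<longrightarrow> V n = U)) \<and> (\<forall>x\<in>V (Suc n). \<forall>y\<in>V (Suc n). x + y \<in> V n)"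
    proof (rule dependent_nat_choice)
      show "\<exists>x. openin \<gamma> x \<and> 0 \<in> x \<and> (0 = 0 \<longrightarrow> x = U)" using U by blast
    next
      fix W and n :: nat assume "openin \<gamma> W \<and> 0 \<in> W \<and> (n = 0 \<longrightarrow> W = U)"
      then obtain V where "openin \<gamma> V" "0 \<in> V" "\<And>x y. x \<in> V \<Longrightarrow> y \<in> V \<Longrightarrow> x + y \<in> W"
        using gamma_half_nbhd by blast
      then show "\<exists>y. (openin \<gamma> y \<and> 0 \<in> y \<and> (Suc n = 0 \<longrightarrow> y = U)) \<and> (\<forall>x\<in>y. \<forall>ya\<in>y. x + ya \<in> W)"
        by (intro exI[of _ V]) auto
    qed
    then show ?thesis by (metis (no_types, lifting))
  qed
  then obtain V where V: "V 0 = U" "\<And>n. openin \<gamma> (V n)" "\<And>n. 0 \<in> V n"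
      "\<And>n x y. x \<in> V (Suc n) \<Longrightarrow> y \<in> V (Suc n) \<Longrightarrow> x + y \<in> V n"
    by auto
  have "\<forall>k. \<exists>p \<delta>. p \<in> P \<and> \<delta> > 0 \<and> (\<forall>x. norm x \<le> real k + 1 \<longrightarrow> p x < \<delta> \<longrightarrow> x \<in> V (Suc k))"
    using gamma_nbhd_small[OF V(2,3)] by meson
  then obtain pk dk where pk: "\<And>k. pk k \<in> P" "\<And>k. dk k > 0"
      "\<And>k x. norm x \<le> real k + 1 \<Longrightarrow> pk k x < dk k \<Longrightarrow> x \<in> V (Suc k)"
    by metis
  define a where "a k x = max (pk k x / dk k) (norm x / (real k + 1))" for k and x :: 'a
  have a0 [simp]: "a k 0 = 0" for k by (simp add: a_def seminorm_zero[OF P_seminorm[OF pk(1)]])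
  have a_nonneg: "0 \<le> a k x" for k x
    by (simp add: a_def le_max_iff_disj)
  have a_tri: "a k (x + y) \<le> a k x + a k y" for k x y
  proof -
    have "pk k (x + y) / dk k \<le> pk k x / dk k + pk k y / dk k"
      using seminorm_triangle[OF P_seminorm[OF pk(1)], of k x y] pk(2)[of k]
      by (simp add: divide_right_mono flip: add_divide_distrib)
    moreover have "norm (x + y) / (real k + 1) \<le> norm x / (real k + 1) + norm y / (real k + 1)"
      using norm_triangle_ineq[of x y] by (simp add: divide_right_mono flip: add_divide_distrib)
    ultimately show ?thesis unfolding a_def by linarith
  qed
  have a_sc: "a k (sc c x) = norm c * a k x" for k c x
    using P_sc_seminorm[OF pk(1)[of k]] normed_scalingD(3)[OF scaling, of c x]
    by (simp add: a_def is_seminorm_def max_mult_distrib_left)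
  \<comment> \<open>Decompositions of \<open>x\<close> into finitely many pieces; the vanishing tail
    lets two of them be padded to a common length.\<close>
  define rep where "rep n y x \<longleftrightarrow> x = (\<Sum>k<n. y k) \<and> (\<forall>k\<ge>n. y k = 0)" for n :: nat and y :: "nat \<Rightarrow> 'a" and x
  define S where "S x = {\<Sum>k<n. a k (y k) | n y. rep n y x}" for x
  define q where "q x = Inf (S x)" for x
  have SI: "(\<Sum>k<n. a k (y k)) \<in> S x" if "rep n y x" for n y x
    unfolding S_def using that by blast
  have S_nonneg: "0 \<le> s" if "s \<in> S x" for s x
    using that by (auto simp: S_def intro!: sum_nonneg a_nonneg)
  have bdd: "bdd_below (S x)" for x using S_nonneg by (intro bdd_belowI) auto
  have extend: "(\<Sum>k<n. a k (y k)) = (\<Sum>k<N. a k (y k))" "rep N y x" if "rep n y x" "n \<le> N" for n N y x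
  proof -
    have z: "\<forall>k\<in>{..<N} - {..<n}. y k = 0" using that by (auto simp: rep_def)
    then show "(\<Sum>k<n. a k (y k)) = (\<Sum>k<N. a k (y k))"
      using that by (intro sum.mono_neutral_left) auto
    have "(\<Sum>k<n. y k) = (\<Sum>k<N. y k)"
      using that z by (intro sum.mono_neutral_left) auto
    then show "rep N y x" using that by (auto simp: rep_def)
  qed
  have q_le_a: "q x \<le> a k x" for k x
  proof -
    have "rep (Suc k) (\<lambda>i. if i = k then x else 0) x" by (auto simp: rep_def)
    then have "(\<Sum>i<Suc k. a i (if i = k then x else 0)) \<in> S x" by (rule SI)
    moreover have "(\<Sum>i<Suc k. a i (if i = k then x else 0)) = a k x" by simp
    ultimately show ?thesis unfolding q_def using bdd by (metis cInf_lower)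
  qed
  have S_ne: "S x \<noteq> {}" for x
  proof -
    have "rep 1 (\<lambda>i. if i = 0 then x else 0) x" by (auto simp: rep_def)
    then show ?thesis using SI by blast
  qed
  have q_nonneg: "0 \<le> q x" for x
    unfolding q_def using S_ne S_nonneg by (intro cInf_greatest) auto
  have q_tri: "q (x + z) \<le> q x + q z" for x z
  proof -
    have *: "q (x + z) \<le> s + t" if st: "s \<in> S x" "t \<in> S z" for s t
    proof -
      obtain n y where y: "rep n y x" "s = (\<Sum>k<n. a k (y k))" using st(1) unfolding S_def by blast
      obtain m w where w: "rep m w z" "t = (\<Sum>k<m. a k (w k))" using st(2) unfolding S_def by blast
      define N where "N = max n m"
      have N: "n \<le> N" "m \<le> N" by (auto simp: N_def)
      have "rep N (\<lambda>k. y k + w k) (x + z)"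
        using extend(2)[OF y(1) N(1)] extend(2)[OF w(1) N(2)] by (auto simp: rep_def sum.distrib)
      then have "(\<Sum>k<N. a k (y k + w k)) \<in> S (x + z)" by (rule SI)
      then have "q (x + z) \<le> (\<Sum>k<N. a k (y k + w k))" unfolding q_def by (intro cInf_lower bdd)
      also have "\<dots> \<le> (\<Sum>k<N. a k (y k)) + (\<Sum>k<N. a k (w k))"
        by (subst sum.distrib[symmetric]) (intro sum_mono a_tri)
      also have "\<dots> = s + t"
        using extend(1)[OF y(1) N(1)] extend(1)[OF w(1) N(2)] y(2) w(2) by simp
      finally show ?thesis .
    qed
    have "q (x + z) - s \<le> q z" if "s \<in> S x" for s
      unfolding q_def[of z] using *[OF that] by (intro cInf_greatest S_ne) (simp add: algebra_simps)
    then have "q (x + z) - q z \<le> q x"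
      unfolding q_def[of x] by (intro cInf_greatest S_ne) (simp add: algebra_simps)
    then show ?thesis by simp
  qed
  interpret vector_space sc by (rule normed_scalingD[OF scaling])
  have q_sc_le: "q (sc c x) \<le> norm c * q x" if c: "c \<noteq> 0" for c x
  proof -
    have "q (sc c x) / norm c \<le> q x"
      unfolding q_def[of x]
    proof (rule cInf_greatest[OF S_ne])
      fix s assume "s \<in> S x"
      then obtain n y where y: "rep n y x" "s = (\<Sum>k<n. a k (y k))" unfolding S_def by blast
      have "rep n (\<lambda>k. sc c (y k)) (sc c x)" using y(1) by (auto simp: rep_def scale_sum_right)
      then have "(\<Sum>k<n. a k (sc c (y k))) \<in> S (sc c x)" by (rule SI)
      then have "q (sc c x) \<le> (\<Sum>k<n. a k (sc c (y k)))" unfolding q_def by (intro cInf_lower bdd)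
      also have "\<dots> = norm c * s" by (simp add: a_sc y(2) sum_distrib_left)
      finally show "q (sc c x) / norm c \<le> s" using c by (simp add: field_simps)
    qed
    then show ?thesis using c by (simp add: field_simps)
  qed
  have q0: "q 0 = 0" using q_le_a[of 0 0] q_nonneg[of 0] by simp
  have q_sc: "q (sc c x) = norm c * q x" for c x
  proof (cases "c = 0")
    case False
    have "q (sc (inverse c) (sc c x)) \<le> norm (inverse c) * q (sc c x)" using False by (intro q_sc_le) simp
    then have "q x \<le> inverse (norm c) * q (sc c x)" using False by (simp add: norm_inverse)
    then have "norm c * q x \<le> q (sc c x)" using False by (simp add: field_simps)
    then show ?thesis using q_sc_le[OF False, of x] by simp
  qed (simp add: q0)
  have "q \<in> \<Gamma>"
  proof (rule small_imp_\<Gamma>)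
    show "is_seminorm sc q" using q_tri q_sc by (simp add: is_seminorm_def)
    fix K \<epsilon> :: real assume e: "0 < \<epsilon>"
    \<comment> \<open>On the ball of radius \<open>K\<close> the norm term of \<open>a k\<close>
      falls below \<epsilon> by the choice of \<open>k\<close>, which leaves only the single
      seminorm \<open>pk k\<close> to be controlled.\<close>
    obtain k :: nat where k: "K / \<epsilon> < real k" using reals_Archimedean2 by blast
    have "q x < \<epsilon>" if "norm x \<le> K" "pk k x < dk k * \<epsilon>" for x
    proof -
      have "norm x < \<epsilon> * (real k + 1)"
        using k e that(1) by (simp add: field_simps)
      then have "norm x / (real k + 1) < \<epsilon>" by (simp add: pos_divide_less_eq)
      moreover have "pk k x / dk k < \<epsilon>" using that(2) pk(2)[of k] by (simp add: pos_divide_less_eq mult.commute)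
      ultimately have "a k x < \<epsilon>" by (simp add: a_def)
      then show ?thesis using q_le_a[of x k] by simp
    qed
    then show "\<exists>p\<in>P. \<exists>\<delta>>0. \<forall>x. norm x \<le> K \<longrightarrow> p x < \<delta> \<longrightarrow> q x < \<epsilon>"
      using pk(1,2)[of k] e by (intro bexI[of _ "pk k"] exI[of _ "dk k * \<epsilon>"]) auto
  qed
  moreover have "{x. q x < 1} \<subseteq> U"
  proof clarify
    fix x assume "q x < 1"
    then obtain s where s: "s \<in> S x" "s < 1"
      unfolding q_def using cInf_lessD[OF S_ne] by blast
    then obtain n y where y: "rep n y x" "s = (\<Sum>k<n. a k (y k))" unfolding S_def by blast
    have yk: "y k \<in> V (Suc k)" if "k < n" for k
    proof -
      have "a k (y k) \<le> s" unfolding y(2) using that by (intro member_le_sum a_nonneg) auto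
      then have "a k (y k) < 1" using s(2) by simp
      then have "norm (y k) < real k + 1" "pk k (y k) < dk k"
        using pk(2)[of k] by (auto simp: a_def pos_divide_less_eq)
      then show ?thesis by (intro pk(3)) auto
    qed
    \<comment> \<open>Tail sums from \<open>j\<close> on lie in \<open>V j\<close>: adding
      \<open>y j\<close>, which lies in \<open>V (Suc j)\<close>, costs exactly one halving.\<close>
    have "j \<le> n \<Longrightarrow> (\<Sum>k\<in>{j..<n}. y k) \<in> V j" for j
    proof (induction "n - j" arbitrary: j)
      case 0
      then show ?case using V(3) by simp
    next
      case (Suc d)
      then have "j < n" by simp
      then have "(\<Sum>k\<in>{j..<n}. y k) = y j + (\<Sum>k\<in>{Suc j..<n}. y k)" by (rule sum.atLeast_Suc_lessThan)
      moreover have "(\<Sum>k\<in>{Suc j..<n}. y k) \<in> V (Suc j)" using Suc \<open>j < n\<close> by simp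
      ultimately show ?case using V(4) yk[OF \<open>j < n\<close>] by simp
    qed
    from this[of 0] have "(\<Sum>k<n. y k) \<in> U" using V(1) by (simp add: lessThan_atLeast0)
    then show "x \<in> U" using y(1) by (simp add: rep_def)
  qed
  ultimately show ?thesis by (rule that)
qed

lemma openin_gamma: "openin \<gamma> U \<longleftrightarrow> (\<forall>x\<in>U. \<exists>p\<in>\<Gamma>. {y. p (y - x) < 1} \<subseteq> U)"
proof
  assume U: "openin \<gamma> U"
  show "\<forall>x\<in>U. \<exists>p\<in>\<Gamma>. {y. p (y - x) < 1} \<subseteq> U"
  proof
    fix x assume x: "x \<in> U"
    have "openin \<gamma> {y. y + x \<in> U}" by (rule gamma_translate[OF U])
    then obtain q where q: "q \<in> \<Gamma>" "{y. q y < 1} \<subseteq> {y. y + x \<in> U}"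
      using gamma_locally_convex[of "{y. y + x \<in> U}"] x by auto
    have "{y. q (y - x) < 1} \<subseteq> U"
    proof
      fix y assume "y \<in> {y. q (y - x) < 1}"
      then have "y - x \<in> {y. y + x \<in> U}" using q(2) by blast
      then show "y \<in> U" by simp
    qed
    then show "\<exists>p\<in>\<Gamma>. {y. p (y - x) < 1} \<subseteq> U" using q(1) by blast
  qed
next
  assume R: "\<forall>x\<in>U. \<exists>p\<in>\<Gamma>. {y. p (y - x) < 1} \<subseteq> U"
  show "openin \<gamma> U"
  proof (subst openin_subopen, intro ballI)
    fix x assume x: "x \<in> U"
    then obtain p where p: "p \<in> \<Gamma>" "{y. p (y - x) < 1} \<subseteq> U" using R by blast
    have "openin \<gamma> {y. y + (- x) \<in> {z. p z < 1}}" by (intro gamma_translate \<Gamma>_ball_open p)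
    moreover have "{y. y + (- x) \<in> {z. p z < 1}} = {y. p (y - x) < 1}" by simp
    moreover have "x \<in> {y. p (y - x) < 1}" by (simp add: seminorm_zero[OF \<Gamma>_seminorm[OF p(1)]])
    ultimately show "\<exists>T. openin \<gamma> T \<and> x \<in> T \<and> T \<subseteq> U" using p(2) by metis
  qed
qed

lemma \<Gamma>_translate_ball_open: "p \<in> \<Gamma> \<Longrightarrow> openin \<gamma> {y. p (y - x) < r}"
  using gamma_translate[OF \<Gamma>_ball_open[of p r], of "- x"] by simp

lemma limitin_gamma: "limitin \<gamma> s x F \<longleftrightarrow> (\<forall>p\<in>\<Gamma>. ((\<lambda>i. p (s i - x)) \<longlongrightarrow> 0) F)"
proof
  assume L: "limitin \<gamma> s x F"
  show "\<forall>p\<in>\<Gamma>. ((\<lambda>i. p (s i - x)) \<longlongrightarrow> 0) F"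
  proof (intro ballI tendstoI)
    fix p e assume p: "p \<in> \<Gamma>" and e: "(0::real) < e"
    have "\<forall>\<^sub>F i in F. s i \<in> {y. p (y - x) < e}"
      using L \<Gamma>_translate_ball_open[OF p, of x e] e seminorm_zero[OF \<Gamma>_seminorm[OF p]] by (auto simp: limitin_def)
    then show "\<forall>\<^sub>F i in F. dist (p (s i - x)) 0 < e"
      by (rule eventually_mono) (simp add: seminorm_nonneg[OF \<Gamma>_seminorm[OF p]])
  qed
next
  assume R: "\<forall>p\<in>\<Gamma>. ((\<lambda>i. p (s i - x)) \<longlongrightarrow> 0) F"
  show "limitin \<gamma> s x F"
    unfolding limitin_def
  proof (intro conjI allI impI)
    fix U assume U: "openin \<gamma> U \<and> x \<in> U"
    then obtain p where p: "p \<in> \<Gamma>" "{y. p (y - x) < 1} \<subseteq> U"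
      using bspec[of U _ x, OF U[THEN conjunct1, unfolded openin_gamma] U[THEN conjunct2]] by blast
    have "\<forall>\<^sub>F i in F. p (s i - x) < 1" using R p by (intro order_tendstoD(2)) auto
    then show "\<forall>\<^sub>F i in F. s i \<in> U" by (rule eventually_mono) (use p(2) in blast)
  qed simp
qed

section \<open>Convergence in the two topologies\<close>

lemma tau_limit_unique:
  assumes "limitin \<tau> s x F" "limitin \<tau> s y F" "F \<noteq> bot"
  shows "x = y"
proof -
  have "p (x - y) \<le> 0" if p: "p \<in> P" for p
  proof -
    have "((\<lambda>i. p (s i - x) + p (s i - y)) \<longlongrightarrow> 0 + 0) F"
      using assms p unfolding limitin_tau by (intro tendsto_add) auto
    moreover have "p (x - y) \<le> p (s i - x) + p (s i - y)" for i
      using seminorm_diff_triangle[OF P_seminorm[OF p], of x y "s i"]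
        seminorm_minus_commute[OF P_seminorm[OF p], of x "s i"] by simp
    ultimately show ?thesis
      using assms(3) by (intro tendsto_lowerbound[of _ _ F]) auto
  qed
  then have "norm (x - y) \<le> 0" by (rule norm_le_P)
  then show ?thesis by simp
qed

lemma limitin_gamma_imp_tau: "limitin \<gamma> s x F \<Longrightarrow> limitin \<tau> s x F"
  unfolding limitin_gamma limitin_tau using P_subset_\<Gamma> by blast

lemma gamma_limit_unique:
  "limitin \<gamma> s x F \<Longrightarrow> limitin \<gamma> s y F \<Longrightarrow> F \<noteq> bot \<Longrightarrow> x = y"
  by (rule tau_limit_unique[OF limitin_gamma_imp_tau limitin_gamma_imp_tau])

text \<open>On bounded sets \<open>\<Gamma>_small\<close> dominates \<gamma>-seminorms by
  \<tau>-seminorms. The arbitrary filter makes the lemma available for limits in time as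
  well.\<close>

lemma limitin_gammaI:
  assumes "limitin \<tau> s x F" "\<forall>\<^sub>F i in F. norm (s i) \<le> K"
  shows "limitin \<gamma> s x F"
  unfolding limitin_gamma
proof (intro ballI tendstoI)
  fix p and e :: real assume p: "p \<in> \<Gamma>" and e: "0 < e"
  obtain q \<delta> where q: "q \<in> P" "0 < \<delta>" "\<And>z. norm z \<le> K + norm x \<Longrightarrow> q z < \<delta> \<Longrightarrow> p z < e"
    using \<Gamma>_small[OF p e, of "K + norm x"] by blast
  have "\<forall>\<^sub>F i in F. q (s i - x) < \<delta>"
    using assms(1) q(1,2) unfolding limitin_tau by (intro order_tendstoD(2)) auto
  with assms(2) show "\<forall>\<^sub>F i in F. dist (p (s i - x)) 0 < e"
  proof eventually_elim
    case (elim i)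
    have "norm (s i - x) \<le> K + norm x" using norm_triangle_ineq4[of "s i" x] elim by simp
    then show ?case using q(3) elim by (simp add: seminorm_nonneg[OF \<Gamma>_seminorm[OF p]])
  qed
qed

text \<open>An unbounded \<gamma>-convergent sequence would have differences
  \<open>s (m k) - x\<close> on which some \<open>pk k\<close> in \<open>P\<close> exceeds
  \<open>k + 1\<close>. The supremum of the seminorms \<open>pk k / (k + 1)\<close> is
  \<gamma>-continuous, because on a bounded set all but finitely many of them are small, yet it
  exceeds 1 along these indices.\<close>

lemma gamma_convergent_bounded:
  assumes L: "limitin \<gamma> s x sequentially"
  shows "bounded (range s)"
proof (rule ccontr)
  assume nb: "\<not> bounded (range s)"
  \<comment> \<open>Large values occur beyond every index, so the bad indices \<open>m k\<close>
    tend to infinity.\<close>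
  have "\<exists>n\<ge>k. real k + 1 < norm (s n - x)" for k :: nat
  proof (rule ccontr)
    assume "\<not> (\<exists>n\<ge>k. real k + 1 < norm (s n - x))"
    then have tail: "norm (s n - x) \<le> real k + 1" if "n \<ge> k" for n using that by force
    have "bounded (s ` {..<k} \<union> s ` {k..})"
      unfolding bounded_Un
    proof
      show "bounded (s ` {..<k})" by (intro finite_imp_bounded) simp
      have "norm (s n) \<le> real k + 1 + norm x" if "n \<ge> k" for n
        using tail[OF that] norm_triangle_sub[of "s n" x] by simp
      then show "bounded (s ` {k..})" unfolding bounded_iff by blast
    qed
    moreover have "s ` {..<k} \<union> s ` {k..} = range s"
      by (simp flip: image_Un) (metis UNIV_I ivl_disj_un_one(8) lessThan_atLeast0 sup.commute Un_UNIV_left sup_top_left order.refl atLeast_0 zero_le)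
    ultimately show False using nb by simp
  qed
  then obtain m where m: "\<And>k. k \<le> m k" "\<And>k. real k + 1 < norm (s (m k) - x)" by metis
  have "\<exists>p\<in>P. real k + 1 < p (s (m k) - x)" for k
    using norm_le_P[of "s (m k) - x" "real k + 1"] m(2)[of k] by force
  then obtain pk where pk: "\<And>k. pk k \<in> P" "\<And>k. real k + 1 < pk k (s (m k) - x)" by metis
  define q where "q z = (SUP k. pk k z / (real k + 1))" for z
  have le: "pk k z / (real k + 1) \<le> norm z / (real k + 1)" for k z
    using P_le_norm[OF pk(1)] by (intro divide_right_mono) auto
  have le': "pk k z / (real k + 1) \<le> norm z" for k z
  proof -
    have "norm z / (real k + 1) \<le> norm z / 1" by (intro divide_left_mono) auto
    then show ?thesis using le[of k z] by simp
  qed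
  have bdd: "bdd_above (range (\<lambda>k. pk k z / (real k + 1)))" for z
    using le' by (intro bdd_aboveI2)
  have up: "pk k z / (real k + 1) \<le> q z" for k z
    unfolding q_def by (intro cSUP_upper bdd) simp
  have qle: "q z \<le> c" if "\<And>k. pk k z / (real k + 1) \<le> c" for z c
    unfolding q_def using that by (intro cSUP_least) auto
  have q_sc_le: "q (sc c z) \<le> norm c * q z" for c z
  proof (rule qle)
    fix k
    have "pk k (sc c z) = norm c * pk k z" using P_sc_seminorm[OF pk(1)] by (simp add: is_seminorm_def)
    then show "pk k (sc c z) / (real k + 1) \<le> norm c * q z"
      using mult_left_mono[OF up[of k z], of "norm c"] by simp
  qed
  interpret vector_space sc by (rule normed_scalingD[OF scaling])
  have qG: "q \<in> \<Gamma>"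
  proof (rule small_imp_\<Gamma>)
    show "is_seminorm sc q"
      unfolding is_seminorm_def
    proof (intro conjI allI)
      fix y z
      show "q (y + z) \<le> q y + q z"
      proof (rule qle)
        fix k
        have "pk k (y + z) / (real k + 1) \<le> pk k y / (real k + 1) + pk k z / (real k + 1)"
          using seminorm_triangle[OF P_seminorm[OF pk(1)], of k y z]
          by (simp add: divide_right_mono flip: add_divide_distrib)
        then show "pk k (y + z) / (real k + 1) \<le> q y + q z" using up[of k y] up[of k z] by simp
      qed
    next
      fix c z
      show "q (sc c z) = norm c * q z"
      proof (cases "c = 0")
        case True
        then show ?thesis by (simp add: q_def seminorm_zero[OF P_seminorm[OF pk(1)]])
      next
        case False
        have "q (sc (inverse c) (sc c z)) \<le> norm (inverse c) * q (sc c z)" by (rule q_sc_le)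
        then have "q z \<le> inverse (norm c) * q (sc c z)" using False by (simp add: norm_inverse)
        then have "norm c * q z \<le> q (sc c z)" using False by (simp add: field_simps)
        then show ?thesis using q_sc_le[of c z] by simp
      qed
    qed
    fix K \<epsilon> :: real assume e: "0 < \<epsilon>"
    \<comment> \<open>Beyond index \<open>j\<close> the scaled seminorms are at most
      \<open>\<epsilon> / 2\<close> by the norm bound; the first ones lie below a single member of
      \<open>P\<close>.\<close>
    obtain j :: nat where j: "2 * K / \<epsilon> < real j" using reals_Archimedean2 by blast
    obtain p where p: "p \<in> P" "\<And>q z. q \<in> pk ` {..j} \<Longrightarrow> q z \<le> p z"
      using P_finite_bound[of "pk ` {..j}"] pk(1) by blast
    have "q z < \<epsilon>" if z: "norm z \<le> K" "p z < \<epsilon> / 2" for z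
    proof -
      have "q z \<le> \<epsilon> / 2"
      proof (rule qle)
        fix k
        show "pk k z / (real k + 1) \<le> \<epsilon> / 2"
        proof (cases "k \<le> j")
          case True
          have "pk k z / (real k + 1) \<le> pk k z / 1"
            using seminorm_nonneg[OF P_seminorm[OF pk(1)]] by (intro divide_left_mono) auto
          also have "\<dots> \<le> p z" using p(2)[of "pk k" z] True by simp
          also have "\<dots> \<le> \<epsilon> / 2" using z(2) by simp
          finally show ?thesis .
        next
          case False
          have "norm z \<le> \<epsilon> / 2 * real j" using z(1) j e by (simp add: field_simps)
          also have "\<dots> \<le> \<epsilon> / 2 * (real k + 1)" using False e by (intro mult_left_mono) auto
          finally have "norm z / (real k + 1) \<le> \<epsilon> / 2" by (simp add: pos_divide_le_eq)
          with le[of k z] show ?thesis by (rule order_trans)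
        qed
      qed
      then show ?thesis using e by simp
    qed
    then show "\<exists>p\<in>P. \<exists>\<delta>>0. \<forall>x. norm x \<le> K \<longrightarrow> p x < \<delta> \<longrightarrow> q x < \<epsilon>"
      using p(1) e by (intro bexI[of _ p] exI[of _ "\<epsilon> / 2"]) auto
  qed
  have "(\<lambda>n. q (s n - x)) \<longlonglongrightarrow> 0" using L qG by (simp add: limitin_gamma)
  then have "\<forall>\<^sub>F n in sequentially. q (s n - x) < 1" by (rule order_tendstoD(2)) simp
  then obtain N where N: "\<And>n. n \<ge> N \<Longrightarrow> q (s n - x) < 1" by (auto simp: eventually_sequentially)
  have "1 < pk N (s (m N) - x) / (real N + 1)" using pk(2)[of N] by (simp add: pos_less_divide_eq)
  also have "\<dots> \<le> q (s (m N) - x)" by (rule up)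
  finally show False using N[OF m(1)[of N]] by simp
qed

text \<open>The dictionary between the bi-notions, which are phrased with bounded \<tau>-convergent
  sequences, and the mixed topology.\<close>

lemma limitin_gamma_iff:
  "limitin \<gamma> s x sequentially \<longleftrightarrow> bounded (range s) \<and> limitin \<tau> s x sequentially"
proof
  assume "bounded (range s) \<and> limitin \<tau> s x sequentially"
  then obtain K where "\<And>n. norm (s n) \<le> K" "limitin \<tau> s x sequentially" by (auto simp: bounded_iff)
  then show "limitin \<gamma> s x sequentially" by (intro limitin_gammaI[where K = K]) auto
qed (use gamma_convergent_bounded limitin_gamma_imp_tau in blast)

text \<open>C-sequentiality concerns convex sets, and the balls of a seminorm are convex: sequential
  continuity makes them sequentially open, hence open.\<close>

lemma seq_continuous_imp_\<Gamma>:
  assumes q: "is_seminorm sc q"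
    and seq: "\<And>s. limitin \<gamma> s 0 sequentially \<Longrightarrow> (\<lambda>n. q (s n)) \<longlonglongrightarrow> 0"
  shows "q \<in> \<Gamma>"
proof -
  have q': "is_seminorm (*\<^sub>R) q" using is_seminorm_scaleR[OF scaling q] .
  have open_ball: "openin \<gamma> {x. q x < r}" for r
  proof -
    have "convex {x. q x < r}"
      unfolding convex_alt
    proof (intro ballI allI impI)
      fix x y and u :: real
      assume "x \<in> {x. q x < r}" "y \<in> {x. q x < r}" "0 \<le> u \<and> u \<le> 1"
      then have xy: "q x < r" "q y < r" "0 \<le> u" "u \<le> 1" by auto
      have "q ((1 - u) *\<^sub>R x + u *\<^sub>R y) \<le> (1 - u) * q x + u * q y"
        using seminorm_triangle[OF q', of "(1 - u) *\<^sub>R x" "u *\<^sub>R y"] xy by (simp add: seminorm_scale[OF q'])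
      also have "\<dots> < r" using xy by (intro convex_bound_lt) auto
      finally show "(1 - u) *\<^sub>R x + u *\<^sub>R y \<in> {x. q x < r}" by simp
    qed
    moreover have "seq_open \<gamma> {x. q x < r}"
      unfolding seq_open_def
    proof (intro allI impI)
      fix s x assume "x \<in> {x. q x < r} \<and> limitin \<gamma> s x sequentially"
      then have x: "q x < r" and L: "limitin \<gamma> s x sequentially" by auto
      have "limitin \<gamma> (\<lambda>n. s n - x) 0 sequentially" using L by (simp add: limitin_gamma)
      then have "(\<lambda>n. q (s n - x)) \<longlonglongrightarrow> 0" by (rule seq)
      then have "\<forall>\<^sub>F n in sequentially. q (s n - x) < r - q x" by (rule order_tendstoD(2)) (use x in simp)
      then show "\<forall>\<^sub>F n in sequentially. s n \<in> {x. q x < r}"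
      proof eventually_elim
        case (elim n)
        then show ?case using seminorm_triangle[OF q', of "s n - x" x] by simp
      qed
    qed
    ultimately show ?thesis using C_seq by (simp add: C_sequential_def)
  qed
  show ?thesis
  proof (rule small_imp_\<Gamma>[OF q])
    fix K \<epsilon> :: real assume "0 < \<epsilon>"
    then show "\<exists>p\<in>P. \<exists>\<delta>>0. \<forall>x. norm x \<le> K \<longrightarrow> p x < \<delta> \<longrightarrow> q x < \<epsilon>"
      using gamma_nbhd_small[OF open_ball[of \<epsilon>], of K] by (simp add: seminorm_zero[OF q'])
  qed
qed

lemma gamma_Cauchy_convergent:
  assumes "\<And>p \<epsilon>. p \<in> \<Gamma> \<Longrightarrow> 0 < \<epsilon> \<Longrightarrow> \<exists>N. \<forall>m\<ge>N. \<forall>n\<ge>N. p (s m - s n) < \<epsilon>"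
  shows "\<exists>x. limitin \<gamma> s x sequentially"
proof -
  have "\<exists>N. \<forall>m\<ge>N. \<forall>n\<ge>N. s m - s n \<in> U" if U: "openin \<gamma> U" "0 \<in> U" for U
  proof -
    obtain q where q: "q \<in> \<Gamma>" "{x. q x < 1} \<subseteq> U" using gamma_locally_convex[OF U] by blast
    obtain N where "\<forall>m\<ge>N. \<forall>n\<ge>N. q (s m - s n) < 1" using assms[OF q(1), of 1] by auto
    then show ?thesis using q(2) by blast
  qed
  then show ?thesis using complete by (simp add: seq_complete_def)
qed

end

section \<open>Weak integrals\<close>

lemma has_bochner_integral_exp_abs:
  fixes d :: real assumes d: "0 < d"
  shows "has_bochner_integral lborel (\<lambda>t. exp (- d * \<bar>t\<bar>)) (2 / d)"
proof -
  have "(\<integral>\<^sup>+x. ennreal (exp (- d * x)) * indicator {0..} x \<partial>lborel) = ennreal (0 - (- (exp (- d * 0) / d)))"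
  proof (rule nn_integral_FTC_atLeast)
    show "((\<lambda>x. - (exp (- d * x) / d)) \<longlongrightarrow> 0) at_top"
    proof -
      have "((\<lambda>x. exp (- d * x)) \<longlongrightarrow> 0) at_top"
        by (rule filterlim_compose[OF exp_at_bot filterlim_tendsto_neg_mult_at_bot[OF tendsto_const _ filterlim_ident]])
           (use d in simp)
      then have "((\<lambda>x. - (exp (- d * x) / d)) \<longlongrightarrow> - (0 / d)) at_top"
        using d by (intro tendsto_intros) auto
      then show ?thesis by simp
    qed
    show "DERIV (\<lambda>x. - (exp (- d * x) / d)) x :> exp (- d * x)" for x
      using d by (auto intro!: derivative_eq_intros)
  qed auto
  moreover have "(\<integral>\<^sup>+x. ennreal (indicator {0..} x *\<^sub>R exp (- d * \<bar>x\<bar>)) \<partial>lborel)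
      = (\<integral>\<^sup>+x. ennreal (exp (- d * x)) * indicator {0..} x \<partial>lborel)"
    by (intro nn_integral_cong) (auto simp: indicator_def)
  ultimately have nn: "(\<integral>\<^sup>+x. ennreal (indicator {0..} x *\<^sub>R exp (- d * \<bar>x\<bar>)) \<partial>lborel) = ennreal (1 / d)"
    by simp
  have "has_bochner_integral lborel (\<lambda>x. indicator {0..} x *\<^sub>R exp (- d * \<bar>x\<bar>)) (1 / d)"
    by (rule has_bochner_integral_nn_integral[OF _ _ _ nn]) (use d in \<open>auto simp: indicator_def\<close>)
  then have "has_bochner_integral lborel (\<lambda>x. exp (- d * \<bar>x\<bar>)) (2 *\<^sub>R (1 / d))"
    by (rule has_bochner_integral_even_function) simp
  then show ?thesis by simp
qed

context mixed_saks
begin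

text \<open>Real-linear functionals, also over complex scalars: they suffice to recover
  \<open>p\<close>. A one-sided bound is enough because \<open>p\<close> is even.\<close>

definition dominated :: "('a \<Rightarrow> real) \<Rightarrow> ('a \<Rightarrow> real) set" where
  "dominated p = {\<psi>. linear \<psi> \<and> (\<forall>x. \<psi> x \<le> p x)}"

lemma dominatedD:
  assumes "\<psi> \<in> dominated p" "p \<in> \<Gamma>"
  shows "linear \<psi>" "\<psi> x \<le> p x" "\<bar>\<psi> x\<bar> \<le> p x"
    "\<bar>\<psi> x - \<psi> y\<bar> \<le> p (x - y)"
proof -
  show "linear \<psi>" and le: "\<psi> x \<le> p x" for x using assms by (auto simp: dominated_def)
  show abs: "\<bar>\<psi> x\<bar> \<le> p x" for x
    using le[of x] le[of "- x"] linear_neg[OF \<open>linear \<psi>\<close>, of x] seminorm_minus[OF \<Gamma>_seminorm[OF assms(2)], of x]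
    by simp
  show "\<bar>\<psi> x - \<psi> y\<bar> \<le> p (x - y)"
    using abs[of "x - y"] by (simp add: linear_diff[OF \<open>linear \<psi>\<close>])
qed

lemma dominated_attains:
  assumes "p \<in> \<Gamma>" obtains \<psi> where "\<psi> \<in> dominated p" "\<psi> x = p x"
  using hahn_banach_dominated[OF sublinear_seminorm[OF \<Gamma>_seminorm[OF assms]], of x]
  unfolding dominated_def by blast

lemma eq_0_if_\<Gamma>_0: "(\<And>p. p \<in> \<Gamma> \<Longrightarrow> p x \<le> 0) \<Longrightarrow> x = 0"
  using norm_le_P[of x 0] P_subset_\<Gamma> by auto

text \<open>The type of the space is not known to be complete in its norm and orbits of a cosine family are not
  norm continuous, so the integrals of the library do not apply.  By the Hahn-Banach theorem the
  functionals in \<open>dominated p\<close> recover \<open>p\<close>.\<close>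

definition wint :: "(real \<Rightarrow> 'a) \<Rightarrow> 'a \<Rightarrow> bool" where
  "wint f y \<longleftrightarrow> (\<forall>p\<in>\<Gamma>. \<forall>\<psi>\<in>dominated p. has_bochner_integral lborel (\<lambda>t. \<psi> (f t)) (\<psi> y))"

lemma wintD: "wint f y \<Longrightarrow> p \<in> \<Gamma> \<Longrightarrow> \<psi> \<in> dominated p \<Longrightarrow> has_bochner_integral lborel (\<lambda>t. \<psi> (f t)) (\<psi> y)"
  by (simp add: wint_def)

text \<open>A functional attaining \<open>p\<close> at \<open>y\<close> reduces the estimate to
  scalar integrals.\<close>

lemma wint_bound:
  assumes f: "wint f y" and p: "p \<in> \<Gamma>" and le: "\<And>t. p (f t) \<le> g t"
    and g: "has_bochner_integral lborel g K"
  shows "p y \<le> K"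
proof -
  obtain \<psi> where \<psi>: "\<psi> \<in> dominated p" "\<psi> y = p y" using dominated_attains[OF p] .
  have "\<psi> (f t) \<le> g t" for t using dominatedD(2)[OF \<psi>(1) p, of "f t"] le[of t] by simp
  then have "\<psi> y \<le> K"
    using integral_mono[of lborel "\<lambda>t. \<psi> (f t)" g] wintD[OF f p \<psi>(1)] g
    by (simp add: has_bochner_integral_iff)
  then show ?thesis using \<psi>(2) by simp
qed

lemma wint_add: "wint f y \<Longrightarrow> wint g z \<Longrightarrow> wint (\<lambda>t. f t + g t) (y + z)"
  unfolding wint_def by (auto simp: dominated_def linear_add intro!: has_bochner_integral_add)

lemma wint_scaleR: "wint f y \<Longrightarrow> wint (\<lambda>t. c *\<^sub>R f t) (c *\<^sub>R y)"
  unfolding wint_def by (auto simp: dominated_def linear_cmul intro!: has_bochner_integral_mult_right)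

lemma wint_diff: "wint f y \<Longrightarrow> wint g z \<Longrightarrow> wint (\<lambda>t. f t - g t) (y - z)"
  using wint_add[of f y "\<lambda>t. (- 1) *\<^sub>R g t" "(- 1) *\<^sub>R z"] wint_scaleR[of g z "- 1"] by simp

lemma wint_unique:
  assumes "wint f y" "wint f z" shows "y = z"
proof -
  have "p (y - z) \<le> 0" if "p \<in> \<Gamma>" for p
    using wint_diff[OF assms] that
    by (rule wint_bound[where g = "\<lambda>_. 0"]) (auto simp: seminorm_zero[OF \<Gamma>_seminorm[OF that]])
  then show ?thesis using eq_0_if_\<Gamma>_0[of "y - z"] by simp
qed

lemma wint_shift:
  assumes "wint f y" shows "wint (\<lambda>t. f (t + s)) y"
  unfolding wint_def
proof (intro ballI)
  fix p \<psi> assume "p \<in> \<Gamma>" "\<psi> \<in> dominated p"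
  then have "has_bochner_integral lborel (\<lambda>t. \<psi> (f t)) (\<psi> y)" by (rule wintD[OF assms])
  then show "has_bochner_integral lborel (\<lambda>t. \<psi> (f (t + s))) (\<psi> y)"
    using lborel_has_bochner_integral_real_affine_iff[of 1 "\<lambda>t. \<psi> (f t)" "\<psi> y" s] by (simp add: add.commute)
qed

lemma wint_const:
  assumes "has_bochner_integral lborel g c"
  shows "wint (\<lambda>t. g t *\<^sub>R x) (c *\<^sub>R x)"
  unfolding wint_def
proof (intro ballI)
  fix p \<psi> assume "p \<in> \<Gamma>" "\<psi> \<in> dominated p"
  then have "linear \<psi>" by (rule dominatedD(1)[rotated])
  then show "has_bochner_integral lborel (\<lambda>t. \<psi> (g t *\<^sub>R x)) (\<psi> (c *\<^sub>R x))"
    using has_bochner_integral_mult_left[OF assms, of "\<psi> x"] by (simp add: linear_cmul)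
qed

text \<open>If \<open>\<psi>\<close> is dominated by \<open>p\<close> and
  \<open>p (T x) \<le> q x\<close>, then \<open>\<psi>\<close> after \<open>T\<close> is dominated
  by \<open>q\<close>. Since weak integrals are tested against all of \<open>\<Gamma>\<close>, the
  operator passes through.\<close>

lemma wint_image:
  assumes f: "wint f y" and T: "linear T" and bd: "\<And>p. p \<in> \<Gamma> \<Longrightarrow> \<exists>q\<in>\<Gamma>. \<forall>x. p (T x) \<le> q x"
  shows "wint (\<lambda>t. T (f t)) (T y)"
  unfolding wint_def
proof (intro ballI)
  fix p \<psi> assume p: "p \<in> \<Gamma>" "\<psi> \<in> dominated p"
  obtain q where q: "q \<in> \<Gamma>" "\<And>x. p (T x) \<le> q x" using bd[OF p(1)] by blast
  have "(\<lambda>x. \<psi> (T x)) \<in> dominated q"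
    unfolding dominated_def
  proof (intro CollectI conjI allI)
    show "linear (\<lambda>x. \<psi> (T x))" using linear_compose[OF T dominatedD(1)[OF p(2,1)]] by (simp add: o_def)
    show "\<psi> (T x) \<le> q x" for x using dominatedD(2)[OF p(2,1), of "T x"] q(2)[of x] by simp
  qed
  from wintD[OF f q(1) this] show "has_bochner_integral lborel (\<lambda>t. \<psi> (T (f t))) (\<psi> (T y))" .
qed

text \<open>Riemann sums converge: tested with a functional dominated by \<open>p\<close>, their
  distance to the integral is at most the integral of \<open>p (fn n t - f t)\<close>, which tends
  to 0 by dominated convergence. This bound is uniform over these functionals, so the sums are
  \<gamma>-Cauchy and sequential completeness supplies the limit.\<close>

lemma wint_exists:
  assumes cont: "\<And>p t. p \<in> \<Gamma> \<Longrightarrow> ((\<lambda>s. p (f s - f t)) \<longlongrightarrow> 0) (at t)"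
    and bound: "\<And>t. norm (f t) \<le> C * exp (- d * \<bar>t\<bar>)" and d: "0 < d"
  shows "\<exists>y. wint f y"
proof -
  \<comment> \<open>Mesh \<open>1 / N\<close> on the interval from \<open>- N\<close> to
    \<open>N\<close>, hence \<open>N^2\<close> cells on either side of 0: mesh and range improve
    together.\<close>
  define N where "N n = real (Suc n)" for n
  define J where "J n = {- ((int (Suc n))^2) ..< (int (Suc n))^2}" for n
  define y where "y n = (1 / N n) *\<^sub>R (\<Sum>k\<in>J n. f (of_int k / N n))" for n
  define fn where "fn n t = (if \<lfloor>N n * t\<rfloor> \<in> J n then f (of_int \<lfloor>N n * t\<rfloor> / N n) else 0)" for n t
  have Npos: "N n > 0" "N n \<ge> 1" for n by (auto simp: N_def)
  have near: "\<bar>of_int \<lfloor>N n * t\<rfloor> / N n - t\<bar> \<le> 1 / N n" for n t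
  proof -
    have "\<bar>of_int \<lfloor>N n * t\<rfloor> - N n * t\<bar> \<le> 1" by linarith
    then have "\<bar>of_int \<lfloor>N n * t\<rfloor> - N n * t\<bar> / N n \<le> 1 / N n" using Npos[of n] by (intro divide_right_mono) auto
    moreover have "of_int \<lfloor>N n * t\<rfloor> / N n - t = (of_int \<lfloor>N n * t\<rfloor> - N n * t) / N n"
      using Npos[of n] by (simp add: field_simps)
    ultimately show ?thesis using Npos[of n] by simp
  qed
  have Ninv: "(\<lambda>n. 1 / N n) \<longlonglongrightarrow> 0"
    unfolding N_def using LIMSEQ_inverse_real_of_nat by (simp add: inverse_eq_divide)
  have near_lim: "(\<lambda>n. of_int \<lfloor>N n * t\<rfloor> / N n) \<longlonglongrightarrow> t" for t
  proof -
    have "(\<lambda>n. of_int \<lfloor>N n * t\<rfloor> / N n - t) \<longlonglongrightarrow> 0"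
      by (rule Lim_null_comparison[OF _ Ninv]) (use near in simp)
    then show ?thesis by (simp add: LIM_zero_iff)
  qed
  have in_J: "\<forall>\<^sub>F n in sequentially. \<lfloor>N n * t\<rfloor> \<in> J n" for t
  proof -
    obtain m :: nat where m: "\<bar>t\<bar> + 1 < real m" using reals_Archimedean2 by blast
    have "\<lfloor>N n * t\<rfloor> \<in> J n" if "n \<ge> m" for n
    proof -
      have t: "\<bar>t\<bar> < N n" using m that by (simp add: N_def)
      have "\<bar>N n * t\<bar> < N n * N n" using t Npos[of n] by (simp add: abs_mult)
      then have "- (N n * N n) \<le> N n * t" "N n * t < N n * N n" by auto
      moreover have "N n * N n = of_int (int (Suc n) ^ 2)" by (simp add: N_def power2_eq_square)
      ultimately show ?thesis by (simp add: J_def floor_less_iff le_floor_iff)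
    qed
    then show ?thesis by (auto simp: eventually_sequentially)
  qed
  \<comment> \<open>Joint continuity is what makes \<open>p (fn n t - f t)\<close> measurable in
    \<open>t\<close>; \<open>f\<close> itself is continuous only for \<gamma>.\<close>
  have cont': "continuous_on UNIV (\<lambda>t. p (f (fst t) - f (snd t)))" if p: "p \<in> \<Gamma>" for p
  proof -
    have "((\<lambda>z. p (f (fst z) - f (snd z))) \<longlongrightarrow> p (f a - f b)) (at (a, b))" for a b
    proof -
      have lim: "((\<lambda>s. p (f s - f t)) \<longlongrightarrow> 0) (nhds t)" for t
        using cont[OF p, of t] by (simp add: tendsto_nhds_iff seminorm_zero[OF \<Gamma>_seminorm[OF p]])
      have A: "((\<lambda>z::real \<times> real. p (f (fst z) - f a) + p (f (snd z) - f b)) \<longlongrightarrow> 0 + 0) (at (a, b))"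
        by (intro tendsto_add filterlim_compose[OF lim] tendsto_eq_intros) auto
      have B: "norm (p (f (fst z) - f (snd z)) - p (f a - f b)) \<le> p (f (fst z) - f a) + p (f (snd z) - f b)" for z :: "real \<times> real"
      proof -
        have "\<bar>p (f (fst z) - f (snd z)) - p (f a - f b)\<bar> \<le> p ((f (fst z) - f (snd z)) - (f a - f b))"
          by (rule seminorm_reverse_triangle[OF \<Gamma>_seminorm[OF p]])
        also have "(f (fst z) - f (snd z)) - (f a - f b) = (f (fst z) - f a) - (f (snd z) - f b)" by simp
        also have "p \<dots> \<le> p (f (fst z) - f a) + p (f (snd z) - f b)"
          by (rule seminorm_diff_le[OF \<Gamma>_seminorm[OF p]])
        finally show ?thesis by simp
      qed
      have "((\<lambda>z. p (f (fst z) - f (snd z)) - p (f a - f b)) \<longlongrightarrow> 0) (at (a, b))"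
        by (rule Lim_null_comparison[OF always_eventually[OF allI[OF B]]]) (use A in simp)
      then show ?thesis by (simp add: LIM_zero_iff)
    qed
    then show ?thesis by (auto simp: continuous_on_def)
  qed
  have Cpos: "0 \<le> C" using order_trans[OF norm_ge_zero bound[of 0]] by simp
  have int_\<psi>: "integrable lborel (\<lambda>t. \<psi> (f t))" if p: "p \<in> \<Gamma>" "\<psi> \<in> dominated p" for p \<psi>
  proof -
    obtain B where B: "0 < B" "\<And>x. p x \<le> B * norm x" using \<Gamma>_bound[OF p(1)] by blast
    have "continuous_on UNIV (\<lambda>t. \<psi> (f t))"
    proof -
      have "((\<lambda>s. \<psi> (f s) - \<psi> (f t)) \<longlongrightarrow> 0) (at t)" for t
        by (rule Lim_null_comparison[OF _ cont[OF p(1), of t]])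
           (use dominatedD(4)[OF p(2,1)] in simp)
      then have "((\<lambda>s. \<psi> (f s)) \<longlongrightarrow> \<psi> (f t)) (at t)" for t by (rule LIM_zero_cancel)
      then show ?thesis by (auto simp: continuous_on_def)
    qed
    then have m: "(\<lambda>t. \<psi> (f t)) \<in> borel_measurable lborel"
      using borel_measurable_continuous_onI by simp
    have "integrable lborel (\<lambda>t. (B * C) * exp (- d * \<bar>t\<bar>))"
      using has_bochner_integral_exp_abs[OF d] by (simp add: has_bochner_integral_iff)
    then show ?thesis
    proof (rule Bochner_Integration.integrable_bound[OF _ m], intro AE_I2)
      fix t
      have "\<bar>\<psi> (f t)\<bar> \<le> B * norm (f t)" using dominatedD(3)[OF p(2,1), of "f t"] B(2)[of "f t"] by simp
      also have "\<dots> \<le> B * (C * exp (- d * \<bar>t\<bar>))" using B bound by (intro mult_left_mono) auto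
      finally show "norm (\<psi> (f t)) \<le> norm ((B * C) * exp (- d * \<bar>t\<bar>))" using B(1) Cpos by (simp add: abs_mult)
    qed
  qed
  have int_step: "has_bochner_integral lborel (\<lambda>t. \<psi> (fn n t)) (\<psi> (y n))" if lin: "linear \<psi>" for \<psi> :: "'a \<Rightarrow> real" and n
  proof -
    have "has_bochner_integral lborel (\<lambda>t. \<Sum>k\<in>J n. indicator {of_int k / N n..<of_int (k + 1) / N n} t * \<psi> (f (of_int k / N n)))
        (\<Sum>k\<in>J n. measure lborel {of_int k / N n..<of_int (k + 1) / N n} * \<psi> (f (of_int k / N n)))"
      by (intro has_bochner_integral_sum has_bochner_integral_mult_left has_bochner_integral_real_indicator)
         (simp_all add: divide_right_mono less_imp_le[OF Npos(1)])
    also have "(\<lambda>t. \<Sum>k\<in>J n. indicator {of_int k / N n..<of_int (k + 1) / N n} t * \<psi> (f (of_int k / N n))) = (\<lambda>t. \<psi> (fn n t))"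
    proof
      fix t
      have ind: "indicator {of_int k / N n..<of_int (k + 1) / N n} t = (if k = \<lfloor>N n * t\<rfloor> then 1 else (0::real))" for k
      proof -
        have "t \<in> {of_int k / N n..<of_int (k + 1) / N n} \<longleftrightarrow> of_int k \<le> N n * t \<and> N n * t < of_int k + 1"
          using Npos(1)[of n] by (simp add: pos_divide_le_eq pos_less_divide_eq mult.commute)
        also have "\<dots> \<longleftrightarrow> k = \<lfloor>N n * t\<rfloor>" by linarith
        finally show ?thesis by (simp add: indicator_def)
      qed
      have fin: "finite (J n)" by (simp add: J_def)
      have "(\<Sum>k\<in>J n. indicator {of_int k / N n..<of_int (k + 1) / N n} t * \<psi> (f (of_int k / N n)))
          = (\<Sum>k\<in>J n. if k = \<lfloor>N n * t\<rfloor> then \<psi> (f (of_int k / N n)) else 0)"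
        unfolding ind by (intro sum.cong) auto
      also have "\<dots> = \<psi> (fn n t)"
        using fin linear_0[OF lin] by (simp add: fn_def)
      finally show "(\<Sum>k\<in>J n. indicator {of_int k / N n..<of_int (k + 1) / N n} t * \<psi> (f (of_int k / N n))) = \<psi> (fn n t)" .
    qed
    also have "(\<Sum>k\<in>J n. measure lborel {of_int k / N n..<of_int (k + 1) / N n} * \<psi> (f (of_int k / N n))) = \<psi> (y n)"
    proof -
      have "measure lborel {of_int k / N n..<of_int (k + 1) / N n} = 1 / N n" for k
        using Npos(1)[of n] by (simp add: divide_right_mono add_divide_distrib)
      then show ?thesis by (simp add: y_def linear_cmul[OF lin] linear_sum[OF lin] sum_distrib_left)
    qed
    finally show ?thesis .
  qed
  define \<delta> where "\<delta> p n = (LINT t|lborel. p (fn n t - f t))" for p :: "'a \<Rightarrow> real" and n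
  have \<delta>: "\<delta> p \<longlonglongrightarrow> 0" "integrable lborel (\<lambda>t. p (fn n t - f t))" if p: "p \<in> \<Gamma>" for p n
  proof -
    note sn = \<Gamma>_seminorm[OF p]
    obtain B where B: "0 < B" "\<And>x. p x \<le> B * norm x" using \<Gamma>_bound[OF p] by blast
    \<comment> \<open>The sampling point lies within distance 1 of \<open>t\<close>, which costs the
      factor \<open>exp d\<close>; the summand 1 is for \<open>f t\<close> itself.\<close>
    define w where "w t = (B * C * (exp d + 1)) * exp (- d * \<bar>t\<bar>)" for t
    have w: "integrable lborel w"
      unfolding w_def using has_bochner_integral_exp_abs[OF d] by (simp add: has_bochner_integral_iff)
    have meas: "(\<lambda>t. p (fn n t - f t)) \<in> borel_measurable lborel" for n
    proof -
      have "(\<lambda>t. (of_int \<lfloor>N n * t\<rfloor> / N n, t)) \<in> borel_measurable borel" by measurable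
      from measurable_compose[OF this borel_measurable_continuous_onI[OF cont'[OF p]]]
      have 1: "(\<lambda>t. p (f (of_int \<lfloor>N n * t\<rfloor> / N n) - f t)) \<in> borel_measurable borel" by simp
      have "continuous_on UNIV (\<lambda>t. p (f t - 0))"
      proof -
        have "((\<lambda>s. p (f s) - p (f t)) \<longlongrightarrow> 0) (at t)" for t
          by (rule Lim_null_comparison[OF _ cont[OF p, of t]]) (simp add: seminorm_reverse_triangle[OF sn])
        then have "((\<lambda>s. p (f s)) \<longlongrightarrow> p (f t)) (at t)" for t by (rule LIM_zero_cancel)
        then show ?thesis by (auto simp: continuous_on_def)
      qed
      then have 2: "(\<lambda>t. p (f t)) \<in> borel_measurable borel"
        using borel_measurable_continuous_onI by simp
      have "(\<lambda>t. if \<lfloor>N n * t\<rfloor> \<in> J n then p (f (of_int \<lfloor>N n * t\<rfloor> / N n) - f t) else p (f t)) \<in> borel_measurable borel"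
        using 1 2 by measurable
      moreover have "(\<lambda>t. if \<lfloor>N n * t\<rfloor> \<in> J n then p (f (of_int \<lfloor>N n * t\<rfloor> / N n) - f t) else p (f t)) = (\<lambda>t. p (fn n t - f t))"
        by (auto simp: fn_def seminorm_minus[OF sn])
      ultimately show ?thesis by simp
    qed
    have dom: "norm (p (fn n t - f t)) \<le> w t" for n t
    proof -
      have "norm (fn n t) \<le> C * (exp d * exp (- d * \<bar>t\<bar>))"
      proof (cases "\<lfloor>N n * t\<rfloor> \<in> J n")
        case True
        define r where "r = of_int \<lfloor>N n * t\<rfloor> / N n"
        have "\<bar>r - t\<bar> \<le> 1" using near[of n t] Npos[of n] unfolding r_def by (smt (verit) divide_le_eq_1)
        then have "\<bar>t\<bar> \<le> 1 + \<bar>r\<bar>" by linarith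
        then have "d * \<bar>t\<bar> \<le> d * (1 + \<bar>r\<bar>)" using d by (intro mult_left_mono) auto
        then have "- d * \<bar>r\<bar> \<le> d + - d * \<bar>t\<bar>" by (simp add: algebra_simps)
        then have "exp (- d * \<bar>r\<bar>) \<le> exp d * exp (- d * \<bar>t\<bar>)" by (simp flip: exp_add)
        then have "C * exp (- d * \<bar>r\<bar>) \<le> C * (exp d * exp (- d * \<bar>t\<bar>))" using Cpos by (intro mult_left_mono) auto
        then show ?thesis using True bound[of r] by (simp add: fn_def flip: r_def)
      qed (use Cpos in \<open>simp add: fn_def\<close>)
      then have "norm (fn n t - f t) \<le> C * (exp d + 1) * exp (- d * \<bar>t\<bar>)"
        using norm_triangle_ineq4[of "fn n t" "f t"] bound[of t] by (simp add: algebra_simps)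
      then have "B * norm (fn n t - f t) \<le> B * (C * (exp d + 1) * exp (- d * \<bar>t\<bar>))" using B by (intro mult_left_mono) auto
      then show ?thesis using B(2)[of "fn n t - f t"] seminorm_nonneg[OF sn] by (simp add: w_def mult.assoc)
    qed
    have lim: "(\<lambda>n. p (fn n t - f t)) \<longlonglongrightarrow> 0" for t
    proof -
      have nh: "((\<lambda>s. p (f s - f t)) \<longlongrightarrow> 0) (nhds t)"
        using cont[OF p, of t] by (simp add: tendsto_nhds_iff seminorm_zero[OF sn])
      have "(\<lambda>n. p (f (of_int \<lfloor>N n * t\<rfloor> / N n) - f t)) \<longlonglongrightarrow> 0"
        by (rule filterlim_compose[OF nh near_lim])
      moreover have "\<forall>\<^sub>F n in sequentially. p (f (of_int \<lfloor>N n * t\<rfloor> / N n) - f t) = p (fn n t - f t)"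
        using in_J[of t] by (rule eventually_mono) (simp add: fn_def)
      ultimately show ?thesis by (rule Lim_transform_eventually)
    qed
    show "integrable lborel (\<lambda>t. p (fn n t - f t))"
      by (rule Bochner_Integration.integrable_bound[OF w meas])
         (rule AE_I2, unfold real_norm_def[of "w _"], rule order_trans[OF dom abs_ge_self])
    have "(\<lambda>n. LINT t|lborel. p (fn n t - f t)) \<longlonglongrightarrow> (LINT t|(lborel::real measure). 0)"
      by (rule integral_dominated_convergence[where w = w]) (use meas w lim dom in auto)
    then show "\<delta> p \<longlonglongrightarrow> 0" by (simp add: \<delta>_def[abs_def])
  qed
  have diff: "\<bar>\<psi> (y n) - (LINT t|lborel. \<psi> (f t))\<bar> \<le> \<delta> p n" if p: "p \<in> \<Gamma>" "\<psi> \<in> dominated p" for p \<psi> n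
  proof -
    note lin = dominatedD(1)[OF p(2,1)]
    have 1: "integrable lborel (\<lambda>t. \<psi> (fn n t))" "(LINT t|lborel. \<psi> (fn n t)) = \<psi> (y n)"
      using int_step[OF lin] by (auto simp: has_bochner_integral_iff)
    have "\<psi> (y n) - (LINT t|lborel. \<psi> (f t)) = (LINT t|lborel. \<psi> (fn n t) - \<psi> (f t))"
      using 1 int_\<psi>[OF p] by simp
    also have "\<bar>\<dots>\<bar> \<le> (LINT t|lborel. \<bar>\<psi> (fn n t) - \<psi> (f t)\<bar>)" by (rule integral_abs_bound)
    also have "\<dots> \<le> \<delta> p n"
      unfolding \<delta>_def
    proof (rule integral_mono)
      show "integrable lborel (\<lambda>t. \<bar>\<psi> (fn n t) - \<psi> (f t)\<bar>)" using 1(1) int_\<psi>[OF p] by auto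
      show "integrable lborel (\<lambda>t. p (fn n t - f t))" by (rule \<delta>(2)[OF p(1)])
      show "\<bar>\<psi> (fn n t) - \<psi> (f t)\<bar> \<le> p (fn n t - f t)" for t
        by (rule dominatedD(4)[OF p(2,1)])
    qed
    finally show ?thesis .
  qed
  have "\<exists>z. limitin \<gamma> y z sequentially"
  proof (rule gamma_Cauchy_convergent)
    fix p and \<epsilon> :: real assume p: "p \<in> \<Gamma>" and e: "0 < \<epsilon>"
    have "\<forall>\<^sub>F n in sequentially. \<delta> p n < \<epsilon> / 2" by (rule order_tendstoD(2)[OF \<delta>(1)[OF p]]) (use e in simp)
    then obtain n0 where n0: "\<And>n. n \<ge> n0 \<Longrightarrow> \<delta> p n < \<epsilon> / 2" by (auto simp: eventually_sequentially)
    have "p (y m - y n) < \<epsilon>" if mn: "m \<ge> n0" "n \<ge> n0" for m n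
    proof -
      obtain \<psi> where \<psi>: "\<psi> \<in> dominated p" "\<psi> (y m - y n) = p (y m - y n)" using dominated_attains[OF p] .
      have "\<psi> (y m - y n) = \<psi> (y m) - \<psi> (y n)" by (rule linear_diff[OF dominatedD(1)[OF \<psi>(1) p]])
      then show ?thesis
        using \<psi>(2) diff[OF p \<psi>(1), of m] diff[OF p \<psi>(1), of n] n0[OF mn(1)] n0[OF mn(2)] by linarith
    qed
    then show "\<exists>n0. \<forall>m\<ge>n0. \<forall>n\<ge>n0. p (y m - y n) < \<epsilon>" by blast
  qed
  then obtain z where z: "limitin \<gamma> y z sequentially" by blast
  have "wint f z"
    unfolding wint_def
  proof (intro ballI)
    fix p \<psi> assume p: "p \<in> \<Gamma>" "\<psi> \<in> dominated p"
    note lin = dominatedD(1)[OF p(2,1)]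
    have "(\<lambda>n. \<psi> (y n) - (LINT t|lborel. \<psi> (f t))) \<longlonglongrightarrow> 0"
      by (rule Lim_null_comparison[OF _ \<delta>(1)[OF p(1)]]) (use diff[OF p] in simp)
    then have 1: "(\<lambda>n. \<psi> (y n)) \<longlonglongrightarrow> (LINT t|lborel. \<psi> (f t))" by (rule LIM_zero_cancel)
    have "(\<lambda>n. p (y n - z)) \<longlonglongrightarrow> 0" using z p(1) by (simp add: limitin_gamma)
    then have "(\<lambda>n. \<psi> (y n) - \<psi> z) \<longlonglongrightarrow> 0"
      by (rule Lim_null_comparison[rotated]) (use dominatedD(4)[OF p(2,1)] in simp)
    then have "(\<lambda>n. \<psi> (y n)) \<longlonglongrightarrow> \<psi> z" by (rule LIM_zero_cancel)
    then have "(LINT t|lborel. \<psi> (f t)) = \<psi> z" using 1 LIMSEQ_unique by blast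
    then show "has_bochner_integral lborel (\<lambda>t. \<psi> (f t)) (\<psi> z)"
      using int_\<psi>[OF p] by (simp add: has_bochner_integral_iff)
  qed
  then show ?thesis by blast
qed

end

section \<open>Cosine families and kernel operators\<close>

lemma tendsto_0_squeeze:
  fixes f g :: "'b \<Rightarrow> real"
  assumes "(g \<longlongrightarrow> 0) F" "\<And>i. 0 \<le> f i" "\<And>i. f i \<le> g i"
  shows "(f \<longlongrightarrow> 0) F"
  by (rule tendsto_sandwich[OF always_eventually always_eventually tendsto_const assms(1)])
     (use assms(2,3) in auto)

section \<open>Weighted kernels\<close>

definition kernel :: "real \<Rightarrow> (real \<Rightarrow> real) \<Rightarrow> bool" where
  "kernel a e \<longleftrightarrow> continuous_on UNIV e \<and> (\<exists>K. \<forall>t. \<bar>e t\<bar> \<le> K * exp (- a * \<bar>t\<bar>))"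

lemma kernelI: "continuous_on UNIV e \<Longrightarrow> (\<And>t. \<bar>e t\<bar> \<le> K * exp (- a * \<bar>t\<bar>)) \<Longrightarrow> kernel a e"
  by (auto simp: kernel_def)

lemma kernel_add:
  assumes "kernel a e" "kernel a e'" shows "kernel a (\<lambda>t. e t + e' t)"
proof -
  obtain K where K: "\<And>t. \<bar>e t\<bar> \<le> K * exp (- a * \<bar>t\<bar>)" using assms by (auto simp: kernel_def)
  obtain K' where K': "\<And>t. \<bar>e' t\<bar> \<le> K' * exp (- a * \<bar>t\<bar>)" using assms by (auto simp: kernel_def)
  have "\<bar>e t + e' t\<bar> \<le> (K + K') * exp (- a * \<bar>t\<bar>)" for t
    using abs_triangle_ineq[of "e t" "e' t"] K[of t] K'[of t] by (simp add: distrib_right)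
  then show ?thesis using assms by (intro kernelI[where K = "K + K'"]) (auto simp: kernel_def intro: continuous_on_add)
qed

lemma kernel_cmult:
  assumes "kernel a e" shows "kernel a (\<lambda>t. c * e t)"
proof -
  obtain K where K: "\<And>t. \<bar>e t\<bar> \<le> K * exp (- a * \<bar>t\<bar>)" using assms by (auto simp: kernel_def)
  have "\<bar>c * e t\<bar> \<le> (\<bar>c\<bar> * K) * exp (- a * \<bar>t\<bar>)" for t
    using mult_left_mono[OF K[of t], of "\<bar>c\<bar>"] by (simp add: abs_mult mult.assoc)
  then show ?thesis using assms by (intro kernelI[where K = "\<bar>c\<bar> * K"]) (auto simp: kernel_def intro!: continuous_intros)
qed

lemma kernel_diff: "kernel a e \<Longrightarrow> kernel a e' \<Longrightarrow> kernel a (\<lambda>t. e t - e' t)"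
  using kernel_add[of a e "\<lambda>t. (- 1) * e' t"] kernel_cmult[of a e' "- 1"] by simp

lemma kernel_shift:
  assumes "kernel a e" "0 \<le> a" shows "kernel a (\<lambda>t. e (t + s))"
proof -
  obtain K where K: "\<And>t. \<bar>e t\<bar> \<le> K * exp (- a * \<bar>t\<bar>)" using assms by (auto simp: kernel_def)
  have K0: "0 \<le> K" using order_trans[OF abs_ge_zero K[of 0]] by simp
  have "\<bar>e (t + s)\<bar> \<le> (K * exp (a * \<bar>s\<bar>)) * exp (- a * \<bar>t\<bar>)" for t
  proof -
    have "a * \<bar>t\<bar> \<le> a * (\<bar>s\<bar> + \<bar>t + s\<bar>)" using assms(2) by (intro mult_left_mono) auto
    then have "exp (- a * \<bar>t + s\<bar>) \<le> exp (a * \<bar>s\<bar>) * exp (- a * \<bar>t\<bar>)" by (simp add: algebra_simps flip: exp_add)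
    then have "K * exp (- a * \<bar>t + s\<bar>) \<le> K * (exp (a * \<bar>s\<bar>) * exp (- a * \<bar>t\<bar>))" using K0 by (rule mult_left_mono)
    then show ?thesis using K[of "t + s"] by simp
  qed
  moreover have "continuous_on UNIV (\<lambda>t. e (t + s))"
    by (rule continuous_on_compose2[of UNIV e UNIV "\<lambda>t. t + s"])
       (use assms(1) in \<open>auto simp: kernel_def intro!: continuous_intros\<close>)
  ultimately show ?thesis by (rule kernelI[rotated])
qed

text \<open>Half of the second difference quotient of \<open>\<bar>t\<bar>\<close> with step
  \<open>s\<close>: a probability density that concentrates at 0.\<close>

definition tent :: "real \<Rightarrow> real \<Rightarrow> real" where
  "tent s t = max 0 (s - \<bar>t\<bar>) / s\<^sup>2"

lemma tent_nonneg: "0 \<le> tent s t"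
  by (simp add: tent_def)

lemma kernel_tent:
  assumes "0 < s" "0 \<le> a" shows "kernel a (tent s)"
proof (rule kernelI)
  show "continuous_on UNIV (tent s)"
    unfolding tent_def using assms by (intro continuous_intros) auto
  show "\<bar>tent s t\<bar> \<le> (1 / s * exp (a * s)) * exp (- a * \<bar>t\<bar>)" for t
  proof (cases "\<bar>t\<bar> \<le> s")
    case True
    have "tent s t \<le> s / s\<^sup>2" unfolding tent_def using True by (intro divide_right_mono) auto
    also have "\<dots> = 1 / s * 1" using assms by (simp add: power2_eq_square)
    also have "\<dots> \<le> 1 / s * (exp (a * s) * exp (- a * \<bar>t\<bar>))"
    proof (intro mult_left_mono)
      have "a * \<bar>t\<bar> \<le> a * s" using True assms by (intro mult_left_mono) auto
      then show "1 \<le> exp (a * s) * exp (- a * \<bar>t\<bar>)" by (simp flip: exp_add)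
    qed (use assms in auto)
    finally show ?thesis using tent_nonneg[of s t] by simp
  qed (use assms in \<open>simp add: tent_def\<close>)
qed

lemma has_bochner_integral_tent:
  assumes s: "0 < s" shows "has_bochner_integral lborel (tent s) 1"
proof -
  let ?F = "\<lambda>t. (s * t - t\<^sup>2 / 2) / s\<^sup>2"
  have "has_bochner_integral lborel (\<lambda>t. (s - t) / s\<^sup>2 * indicator {0..s} t) (?F s - ?F 0)"
    by (rule has_bochner_integral_FTC_Icc_real)
       (use s in \<open>auto intro!: derivative_eq_intros continuous_intros simp: field_simps\<close>)
  moreover have "?F s - ?F 0 = 1 / 2" using s by (simp add: field_simps power2_eq_square)
  moreover have "(s - t) / s\<^sup>2 * indicator {0..s} t = indicator {0..} t *\<^sub>R tent s t" for t
    by (auto simp: indicator_def tent_def)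
  ultimately have "has_bochner_integral lborel (\<lambda>t. indicator {0..} t *\<^sub>R tent s t) (1 / 2)" by simp
  then have "has_bochner_integral lborel (tent s) (2 *\<^sub>R (1 / 2))"
    by (rule has_bochner_integral_even_function) (simp add: tent_def)
  then show ?thesis by simp
qed

section \<open>Orbits of a cosine family\<close>

lemma (in mixed_saks) sc_linear_imp_linear:
  assumes "Vector_Spaces.linear sc sc T" shows "linear T"
proof (rule linearI)
  show "T (x + y) = T x + T y" for x y using assms unfolding Vector_Spaces.linear_iff by blast
  show "T (r *\<^sub>R x) = r *\<^sub>R T x" for r x
  proof -
    have "T (sc (of_real r) x) = sc (of_real r) (T x)" using assms unfolding Vector_Spaces.linear_iff by blast
    then show ?thesis by (simp add: normed_scalingD(2)[OF scaling])
  qed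
qed

lemma (in mixed_saks) limitin_gamma_image:
  assumes "linear T" and bd: "\<And>p. p \<in> \<Gamma> \<Longrightarrow> \<exists>q\<in>\<Gamma>. \<forall>x. p (T x) \<le> q x"
    and L: "limitin \<gamma> s x F"
  shows "limitin \<gamma> (\<lambda>i. T (s i)) (T x) F"
  unfolding limitin_gamma
proof
  fix p assume p: "p \<in> \<Gamma>"
  obtain q where q: "q \<in> \<Gamma>" "\<And>x. p (T x) \<le> q x" using bd[OF p] by blast
  have "p (T y - T x) \<le> q (y - x)" for y
    using q(2)[of "y - x"] by (simp add: linear_diff[OF assms(1)])
  moreover have lim: "((\<lambda>i. q (s i - x)) \<longlongrightarrow> 0) F" using L q(1) by (simp add: limitin_gamma)
  ultimately show "((\<lambda>i. p (T (s i) - T x)) \<longlongrightarrow> 0) F"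
    by (intro tendsto_0_squeeze[OF lim] seminorm_nonneg[OF \<Gamma>_seminorm[OF p]])
qed

text \<open>The working form of a locally \<tau>-bi-continuous family, with continuity and
  equicontinuity in terms of \<gamma>-seminorms. The norm grows at rate \<open>\<omega>\<close>,
  while the bound of one seminorm by another is available at every rate \<open>b\<close> above
  \<open>\<omega>\<close>.\<close>

locale saks_cosine = mixed_saks sc \<tau> \<gamma> P
  for sc :: "'k::real_normed_field \<Rightarrow> 'a::real_normed_vector \<Rightarrow> 'a"
    and \<tau> \<gamma> :: "'a topology" and P :: "('a \<Rightarrow> real) set" +
  fixes S :: "real \<Rightarrow> 'a \<Rightarrow> 'a" and M \<omega> :: real
  assumes S_sc_linear: "0 \<le> t \<Longrightarrow> Vector_Spaces.linear sc sc (S t)"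
    and S_0: "S 0 = id"
    and S_cosine: "0 \<le> s \<Longrightarrow> s \<le> t \<Longrightarrow> 2 *\<^sub>R S t (S s x) = S (t + s) x + S (t - s) x"
    and S_norm: "0 \<le> t \<Longrightarrow> norm (S t x) \<le> M * exp (\<omega> * t) * norm x"
    and S_cont: "p \<in> \<Gamma> \<Longrightarrow> 0 \<le> t \<Longrightarrow> ((\<lambda>s. p (S s x - S t x)) \<longlongrightarrow> 0) (at t within {0..})"
    and S_equi: "p \<in> \<Gamma> \<Longrightarrow> \<omega> < b \<Longrightarrow> \<exists>q\<in>\<Gamma>. \<forall>t\<ge>0. \<forall>x. p (S t x) \<le> exp (b * t) * q x"
    and omega: "0 \<le> \<omega>" and M: "1 \<le> M"
begin

lemma S_linear: "0 \<le> t \<Longrightarrow> linear (S t)"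
  by (rule sc_linear_imp_linear[OF S_sc_linear])

lemma S_bounded_\<Gamma>:
  assumes "0 \<le> t" "p \<in> \<Gamma>" shows "\<exists>q\<in>\<Gamma>. \<forall>x. p (S t x) \<le> q x"
proof -
  obtain q where "q \<in> \<Gamma>" "\<And>t x. 0 \<le> t \<Longrightarrow> p (S t x) \<le> exp ((\<omega> + 1) * t) * q x"
    using S_equi[OF assms(2), of "\<omega> + 1"] by auto
  then show ?thesis
    using assms(1) by (intro bexI[of _ "\<lambda>x. exp ((\<omega> + 1) * t) * q x"] \<Gamma>_cmult) auto
qed

lemma S_cont_abs:
  assumes p: "p \<in> \<Gamma>" shows "((\<lambda>r. p (S \<bar>r\<bar> x - S \<bar>t\<bar> x)) \<longlongrightarrow> 0) (at t)"
proof (rule tendstoI)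
  fix e :: real assume e: "0 < e"
  have "\<forall>\<^sub>F s in at \<bar>t\<bar> within {0..}. dist (p (S s x - S \<bar>t\<bar> x)) 0 < e"
    by (rule tendstoD[OF S_cont[OF p] e]) simp
  then obtain d where d: "d > 0" "\<And>s. 0 \<le> s \<Longrightarrow> s \<noteq> \<bar>t\<bar> \<Longrightarrow> dist s \<bar>t\<bar> < d \<Longrightarrow> dist (p (S s x - S \<bar>t\<bar> x)) 0 < e"
    unfolding eventually_at by force
  have "dist (p (S \<bar>r\<bar> x - S \<bar>t\<bar> x)) 0 < e" if "dist r t < d" for r
  proof (cases "\<bar>r\<bar> = \<bar>t\<bar>")
    case True
    then show ?thesis using e seminorm_zero[OF \<Gamma>_seminorm[OF p]] by simp
  next
    case False
    have "dist \<bar>r\<bar> \<bar>t\<bar> < d" using that by (simp add: dist_real_def)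
    then show ?thesis using d(2)[of "\<bar>r\<bar>"] False by simp
  qed
  then show "\<forall>\<^sub>F r in at t. dist (p (S \<bar>r\<bar> x - S \<bar>t\<bar> x)) 0 < e"
    unfolding eventually_at using d(1) by blast
qed

text \<open>The operator \<open>U\<close> is kept general because the lemma is used twice, first for
  \<open>S h\<close> and then for a multiple \<open>S (m h)\<close>.\<close>

lemma commute_multiple:
  assumes U: "linear U" and s: "0 \<le> s" and comm: "\<And>x. U (S s x) = S s (U x)"
  shows "U (S (real n * s) x) = S (real n * s) (U x)"
proof (induction n arbitrary: x rule: less_induct)
  case (less n)
  consider "n = 0" | "n = 1" | m where "n = Suc (Suc m)" by (metis One_nat_def not0_implies_Suc)
  then show ?case
  proof cases
    case 3
    \<comment> \<open>The Chebyshev recursion for cosine families.\<close>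
    have rec: "S (real n * s) x = 2 *\<^sub>R S (real (Suc m) * s) (S s x) - S (real m * s) x" for x
    proof -
      have "s \<le> real (Suc m) * s" using s by (simp add: algebra_simps)
      from S_cosine[OF s this, of x] show ?thesis by (simp add: 3 algebra_simps)
    qed
    have lt: "Suc m < n" "m < n" using 3 by auto
    have "U (S (real n * s) x) = 2 *\<^sub>R U (S (real (Suc m) * s) (S s x)) - U (S (real m * s) x)"
      by (simp only: rec linear_diff[OF U] linear_cmul[OF U])
    also have "\<dots> = 2 *\<^sub>R S (real (Suc m) * s) (S s (U x)) - S (real m * s) (U x)"
      by (simp only: less.IH[OF lt(1)] less.IH[OF lt(2)] comm)
    also have "\<dots> = S (real n * s) (U x)" by (simp only: rec[of "U x"])
    finally show ?thesis .
  qed (use S_0 comm in auto)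
qed

text \<open>The cosine equation is only assumed for \<open>s \<le> t\<close>.  It makes \<open>S (n h)\<close> a polynomial in \<open>S h\<close>, so
  operators at commensurable times commute, and continuity gives the rest.\<close>

lemma S_commute:
  assumes "0 \<le> s" "0 \<le> t"
  shows "S s (S t x) = S t (S s x)"
proof (cases "s = 0")
  case False
  then have s: "s > 0" using assms by simp
  have mult: "S (real m * h) (S (real n * h) x) = S (real n * h) (S (real m * h) x)" if h: "0 \<le> h" for m n h x
  proof (rule commute_multiple[OF S_linear h])
    show "S (real m * h) (S h y) = S h (S (real m * h) y)" for y
      using commute_multiple[OF S_linear[OF h] h, of m y] by simp
  qed (use h in auto)
  \<comment> \<open>\<open>r k\<close> and \<open>s\<close> are both multiples of the step
    \<open>s / (k + 1)\<close>, and rounding \<open>t\<close> down to this grid errs by at most one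
    step.\<close>
  define r where "r k = real (nat \<lfloor>t * real (Suc k) / s\<rfloor>) * (s / real (Suc k))" for k
  have eq: "S s (S (r k) x) = S (r k) (S s x)" for k
    using mult[of "s / real (Suc k)" "Suc k" "nat \<lfloor>t * real (Suc k) / s\<rfloor>" x] s by (simp add: r_def)
  have r: "r \<longlonglongrightarrow> t"
  proof -
    have "\<bar>r k - t\<bar> \<le> s * (1 / real (Suc k))" for k
    proof -
      let ?z = "t * real (Suc k) / s"
      have z: "0 \<le> ?z" using s assms by simp
      have "real (nat \<lfloor>?z\<rfloor>) = of_int \<lfloor>?z\<rfloor>" using z by simp
      moreover have "t = ?z * (s / real (Suc k))" using s by simp
      ultimately have "r k - t = (of_int \<lfloor>?z\<rfloor> - ?z) * (s / real (Suc k))"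
        unfolding r_def by (metis left_diff_distrib)
      then have "\<bar>r k - t\<bar> = \<bar>of_int \<lfloor>?z\<rfloor> - ?z\<bar> * (s / real (Suc k))"
        using s by (simp add: abs_mult)
      also have "\<dots> \<le> 1 * (s / real (Suc k))"
        using s by (intro mult_right_mono) (linarith, simp)
      finally show ?thesis by simp
    qed
    moreover have lim: "(\<lambda>k. s * (1 / real (Suc k))) \<longlonglongrightarrow> 0"
      using tendsto_mult_left[OF LIMSEQ_inverse_real_of_nat, of s] by (simp add: inverse_eq_divide)
    ultimately have "(\<lambda>k. \<bar>r k - t\<bar>) \<longlonglongrightarrow> 0"
      by (intro tendsto_0_squeeze[OF lim]) auto
    then show ?thesis by (simp add: tendsto_rabs_zero_iff LIM_zero_iff)
  qed
  have r0: "0 \<le> r k" for k using s by (simp add: r_def)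
  have lim: "limitin \<gamma> (\<lambda>k. S (r k) y) (S t y) sequentially" for y
    unfolding limitin_gamma
  proof
    fix p assume p: "p \<in> \<Gamma>"
    have "((\<lambda>u. p (S \<bar>u\<bar> y - S \<bar>t\<bar> y)) \<longlongrightarrow> 0) (nhds t)"
      using S_cont_abs[OF p, of y t] by (simp add: tendsto_nhds_iff seminorm_zero[OF \<Gamma>_seminorm[OF p]])
    from filterlim_compose[OF this r] show "(\<lambda>k. p (S (r k) y - S t y)) \<longlonglongrightarrow> 0"
      using r0 assms(2) by simp
  qed
  have "limitin \<gamma> (\<lambda>k. S s (S (r k) x)) (S s (S t x)) sequentially"
    using S_linear[OF assms(1)] S_bounded_\<Gamma>[OF assms(1)] lim by (rule limitin_gamma_image)
  then have "limitin \<gamma> (\<lambda>k. S (r k) (S s x)) (S s (S t x)) sequentially" by (simp only: eq)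
  then show ?thesis using lim[of "S s x"] by (rule gamma_limit_unique) simp
qed (simp add: S_0)

text \<open>The cosine equation has the smaller time inside. For \<open>\<bar>t\<bar> < s\<close>
  this is the product wanted; for \<open>s \<le> \<bar>t\<bar>\<close> the factors have to be
  interchanged. Negative \<open>t\<close> follows by symmetry.\<close>

lemma S_product:
  assumes s: "0 \<le> s"
  shows "2 *\<^sub>R S s (S \<bar>t\<bar> x) = S \<bar>t + s\<bar> x + S \<bar>t - s\<bar> x"
proof -
  have pos: "2 *\<^sub>R S s (S u x) = S (u + s) x + S \<bar>u - s\<bar> x" if u: "0 \<le> u" for u
  proof (cases "s \<le> u")
    case True
    then show ?thesis using S_cosine[OF s True, of x] S_commute[OF s u, of x] by simp
  next
    case False
    then show ?thesis using S_cosine[OF u, of s x] by (simp add: add.commute)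
  qed
  show ?thesis
  proof (cases "0 \<le> t")
    case True then show ?thesis using pos[of t] s by simp
  next
    case False
    then have "\<bar>t + s\<bar> = \<bar>- t - s\<bar>" "\<bar>t - s\<bar> = - t + s" "\<bar>t\<bar> = - t" using s by auto
    then show ?thesis using pos[of "- t"] False by (simp add: add.commute)
  qed
qed

section \<open>Kernel operators\<close>

definition Phi :: "(real \<Rightarrow> real) \<Rightarrow> 'a \<Rightarrow> 'a" where
  "Phi e x = (THE y. wint (\<lambda>t. e t *\<^sub>R S \<bar>t\<bar> x) y)"

lemma PhiI: "wint (\<lambda>t. e t *\<^sub>R S \<bar>t\<bar> x) y \<Longrightarrow> Phi e x = y"
  unfolding Phi_def by (rule the_equality) (auto intro: wint_unique)

text \<open>The integrand decays in norm at rate \<open>a - \<omega>\<close>, but its continuity is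
  available in \<gamma>-seminorms only; \<open>wint_exists\<close> is tailored to this
  combination.\<close>

lemma Phi_wint:
  assumes e: "kernel a e" and a: "\<omega> < a"
  shows "wint (\<lambda>t. e t *\<^sub>R S \<bar>t\<bar> x) (Phi e x)"
proof -
  obtain K where K: "\<And>t. \<bar>e t\<bar> \<le> K * exp (- a * \<bar>t\<bar>)" using e by (auto simp: kernel_def)
  have "\<exists>y. wint (\<lambda>t. e t *\<^sub>R S \<bar>t\<bar> x) y"
  proof (rule wint_exists)
    fix p t assume p: "p \<in> \<Gamma>"
    note sn = \<Gamma>_seminorm[OF p]
    have ec: "(e \<longlongrightarrow> e t) (at t)" using e by (auto simp: kernel_def continuous_on_def)
    have "((\<lambda>s. \<bar>e s\<bar> * p (S \<bar>s\<bar> x - S \<bar>t\<bar> x) + \<bar>e s - e t\<bar> * p (S \<bar>t\<bar> x)) \<longlongrightarrow> \<bar>e t\<bar> * 0 + \<bar>e t - e t\<bar> * p (S \<bar>t\<bar> x)) (at t)"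
      by (intro tendsto_intros ec S_cont_abs[OF p])
    then have lim: "((\<lambda>s. \<bar>e s\<bar> * p (S \<bar>s\<bar> x - S \<bar>t\<bar> x) + \<bar>e s - e t\<bar> * p (S \<bar>t\<bar> x)) \<longlongrightarrow> 0) (at t)" by simp
    have "norm (p (e s *\<^sub>R S \<bar>s\<bar> x - e t *\<^sub>R S \<bar>t\<bar> x)) \<le> \<bar>e s\<bar> * p (S \<bar>s\<bar> x - S \<bar>t\<bar> x) + \<bar>e s - e t\<bar> * p (S \<bar>t\<bar> x)" for s
    proof -
      have "e s *\<^sub>R S \<bar>s\<bar> x - e t *\<^sub>R S \<bar>t\<bar> x = e s *\<^sub>R (S \<bar>s\<bar> x - S \<bar>t\<bar> x) + (e s - e t) *\<^sub>R S \<bar>t\<bar> x"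
        by (simp add: algebra_simps)
      then show ?thesis
        using seminorm_triangle[OF sn, of "e s *\<^sub>R (S \<bar>s\<bar> x - S \<bar>t\<bar> x)" "(e s - e t) *\<^sub>R S \<bar>t\<bar> x"]
        by (simp add: seminorm_scale[OF sn] seminorm_nonneg[OF sn])
    qed
    from Lim_null_comparison[OF always_eventually[OF allI[OF this]] lim]
    show "((\<lambda>s. p (e s *\<^sub>R S \<bar>s\<bar> x - e t *\<^sub>R S \<bar>t\<bar> x)) \<longlongrightarrow> 0) (at t)" .
  next
    fix t
    have "norm (e t *\<^sub>R S \<bar>t\<bar> x) \<le> (K * exp (- a * \<bar>t\<bar>)) * (M * exp (\<omega> * \<bar>t\<bar>) * norm x)"
      unfolding norm_scaleR by (intro mult_mono K S_norm) (use order_trans[OF abs_ge_zero K[of t]] in auto)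
    also have "\<dots> = (K * M * norm x) * exp (- (a - \<omega>) * \<bar>t\<bar>)"
      by (simp add: algebra_simps flip: exp_add)
    finally show "norm (e t *\<^sub>R S \<bar>t\<bar> x) \<le> (K * M * norm x) * exp (- (a - \<omega>) * \<bar>t\<bar>)" .
  qed (use a in simp)
  then show ?thesis using PhiI by metis
qed

text \<open>The rates are decoupled: \<open>a\<close> only ensures that \<open>Phi e x\<close>
  exists, while \<open>c\<close> and \<open>b\<close> enter the estimate. \<open>Q\<close> is a
  number, so the lemma serves seminorms of \<open>\<Gamma>\<close> with \<open>b\<close> above
  \<open>\<omega>\<close> as well as members of \<open>P\<close> with
  \<open>b = \<omega>\<close>.\<close>

lemma Phi_bound:
  assumes e: "kernel a e" and a: "\<omega> < a" and p: "p \<in> \<Gamma>"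
    and K: "\<And>t. \<bar>e t\<bar> \<le> K * exp (- c * \<bar>t\<bar>)" and bc: "b < c"
    and Q: "\<And>t. 0 \<le> t \<Longrightarrow> p (S t x) \<le> exp (b * t) * Q"
  shows "p (Phi e x) \<le> K * Q * (2 / (c - b))"
proof (rule wint_bound[OF Phi_wint[OF e a] p])
  note sn = \<Gamma>_seminorm[OF p]
  show "has_bochner_integral lborel (\<lambda>t. K * Q * exp (- (c - b) * \<bar>t\<bar>)) (K * Q * (2 / (c - b)))"
    using has_bochner_integral_exp_abs[of "c - b"] bc by (intro has_bochner_integral_mult_right) auto
  fix t
  have "p (e t *\<^sub>R S \<bar>t\<bar> x) = \<bar>e t\<bar> * p (S \<bar>t\<bar> x)" by (rule seminorm_scale[OF sn])
  also have "\<dots> \<le> (K * exp (- c * \<bar>t\<bar>)) * (exp (b * \<bar>t\<bar>) * Q)"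
    using order_trans[OF abs_ge_zero K[of t]] by (intro mult_mono K Q) (auto simp: seminorm_nonneg[OF sn])
  also have "\<dots> = K * Q * exp (- (c - b) * \<bar>t\<bar>)" by (simp add: algebra_simps flip: exp_add)
  finally show "p (e t *\<^sub>R S \<bar>t\<bar> x) \<le> K * Q * exp (- (c - b) * \<bar>t\<bar>)" .
qed

lemma Phi_add:
  assumes "kernel a e" "kernel a e'" "\<omega> < a"
  shows "Phi (\<lambda>t. e t + e' t) x = Phi e x + Phi e' x"
  using wint_add[OF Phi_wint[OF assms(1,3), of x] Phi_wint[OF assms(2,3), of x]]
  by (intro PhiI) (simp add: scaleR_add_left)

lemma Phi_cmult:
  assumes "kernel a e" "\<omega> < a"
  shows "Phi (\<lambda>t. c * e t) x = c *\<^sub>R Phi e x"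
  using wint_scaleR[OF Phi_wint[OF assms, of x], of c] by (intro PhiI) simp

lemma Phi_diff:
  assumes "kernel a e" "kernel a e'" "\<omega> < a"
  shows "Phi (\<lambda>t. e t - e' t) x = Phi e x - Phi e' x"
  using wint_diff[OF Phi_wint[OF assms(1,3), of x] Phi_wint[OF assms(2,3), of x]]
  by (intro PhiI) (simp add: scaleR_diff_left)

lemma Phi_sc_linear:
  assumes "kernel a e" "\<omega> < a"
  shows "Vector_Spaces.linear sc sc (Phi e)"
  unfolding Vector_Spaces.linear_iff
proof (intro conjI allI normed_scalingD(1)[OF scaling])
  fix x y
  show "Phi e (x + y) = Phi e x + Phi e y"
    using wint_add[OF Phi_wint[OF assms, of x] Phi_wint[OF assms, of y]]
    by (intro PhiI) (simp add: linear_add[OF S_linear] scaleR_add_right)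
next
  fix c x
  interpret vector_space sc by (rule normed_scalingD[OF scaling])
  have sR: "sc c (r *\<^sub>R x) = r *\<^sub>R sc c x" for r x
    by (simp flip: normed_scalingD(2)[OF scaling])
  have "wint (\<lambda>t. sc c (e t *\<^sub>R S \<bar>t\<bar> x)) (sc c (Phi e x))"
  proof (rule wint_image[OF Phi_wint[OF assms]])
    show "linear (sc c)" by (rule linearI) (simp_all add: scale_right_distrib sR)
    fix p assume p: "p \<in> \<Gamma>"
    then show "\<exists>q\<in>\<Gamma>. \<forall>x. p (sc c x) \<le> q x"
      using \<Gamma>_sc_seminorm[OF p] by (intro bexI[OF _ \<Gamma>_cmult[OF p, of "norm c"]]) (auto simp: is_seminorm_def)
  qed
  moreover have "sc c (S \<bar>t\<bar> x) = S \<bar>t\<bar> (sc c x)" for t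
    using S_sc_linear[of "\<bar>t\<bar>"] unfolding Vector_Spaces.linear_iff by simp
  ultimately show "Phi e (sc c x) = sc c (Phi e x)"
    by (intro PhiI) (simp add: sR)
qed

lemma Phi_linear:
  assumes "kernel a e" "\<omega> < a" shows "linear (Phi e)"
  by (rule sc_linear_imp_linear[OF Phi_sc_linear[OF assms]])

lemma Phi_equi:
  assumes e: "kernel a e" and a: "\<omega> < a" and p: "p \<in> \<Gamma>"
  shows "\<exists>q\<in>\<Gamma>. \<forall>x. p (Phi e x) \<le> q x"
proof -
  obtain K where K: "\<And>t. \<bar>e t\<bar> \<le> K * exp (- a * \<bar>t\<bar>)" using e by (auto simp: kernel_def)
  have K0: "0 \<le> K" using order_trans[OF abs_ge_zero K[of 0]] by simp
  \<comment> \<open>Midpoint: \<open>b\<close> has to exceed \<open>\<omega>\<close> for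
    equicontinuity and to stay below \<open>a\<close> for integrability.\<close>
  define b where "b = (a + \<omega>) / 2"
  have b: "\<omega> < b" "b < a" using a by (auto simp: b_def)
  obtain q where q: "q \<in> \<Gamma>" "\<And>t x. 0 \<le> t \<Longrightarrow> p (S t x) \<le> exp (b * t) * q x"
    using S_equi[OF p b(1)] by blast
  have "p (Phi e x) \<le> K * (2 / (a - b)) * q x" for x
    using Phi_bound[OF e a p K b(2) q(2), of x] by (simp add: algebra_simps)
  then show ?thesis
    using b K0 q(1) by (intro bexI[OF _ \<Gamma>_cmult[OF q(1), of "K * (2 / (a - b))"]]) auto
qed

text \<open>The cosine equation splits the integrand into two translates of the orbit; substitution
  in the integral over the line moves the translations to the kernel.\<close>

lemma Phi_shift:
  assumes e: "kernel a e" and a: "\<omega> < a" and s: "0 \<le> s"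
  shows "2 *\<^sub>R S s (Phi e x) = Phi (\<lambda>t. e (t - s) + e (t + s)) x"
proof -
  have a0: "0 \<le> a" using a omega by simp
  have k: "kernel a (\<lambda>t. e (t - s))" "kernel a (\<lambda>t. e (t + s))"
    using kernel_shift[OF e a0, of "- s"] kernel_shift[OF e a0, of s] by auto
  let ?T = "\<lambda>x. 2 *\<^sub>R S s x"
  have "wint (\<lambda>t. ?T (e t *\<^sub>R S \<bar>t\<bar> x)) (?T (Phi e x))"
  proof (rule wint_image[OF Phi_wint[OF e a]])
    show "linear ?T" by (rule linear_compose_scale_right[OF S_linear[OF s]])
    fix p assume p: "p \<in> \<Gamma>"
    obtain q where "q \<in> \<Gamma>" "\<And>x. p (S s x) \<le> q x" using S_bounded_\<Gamma>[OF s p] by blast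
    then show "\<exists>q\<in>\<Gamma>. \<forall>x. p (?T x) \<le> q x"
      by (intro bexI[OF _ \<Gamma>_cmult[of q 2]]) (auto simp: seminorm_scale[OF \<Gamma>_seminorm[OF p]])
  qed
  moreover have "?T (e t *\<^sub>R S \<bar>t\<bar> x) = e t *\<^sub>R S \<bar>t + s\<bar> x + e t *\<^sub>R S \<bar>t - s\<bar> x" for t
  proof -
    have "?T (e t *\<^sub>R S \<bar>t\<bar> x) = e t *\<^sub>R (2 *\<^sub>R S s (S \<bar>t\<bar> x))" by (simp add: linear_cmul[OF S_linear[OF s]])
    then show ?thesis by (simp only: S_product[OF s] scaleR_add_right)
  qed
  moreover have "wint (\<lambda>t. e t *\<^sub>R S \<bar>t + s\<bar> x + e t *\<^sub>R S \<bar>t - s\<bar> x)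
      (Phi (\<lambda>t. e (t - s)) x + Phi (\<lambda>t. e (t + s)) x)"
    using wint_add[OF wint_shift[OF Phi_wint[OF k(1) a, of x], of s] wint_shift[OF Phi_wint[OF k(2) a, of x], of "- s"]]
    by simp
  ultimately have "?T (Phi e x) = Phi (\<lambda>t. e (t - s)) x + Phi (\<lambda>t. e (t + s)) x"
    using wint_unique by simp
  then show ?thesis by (simp add: Phi_add[OF k a])
qed

text \<open>Averaging against a probability density supported in the interval from
  \<open>- s\<close> to \<open>s\<close> does not increase the bound.\<close>

lemma Phi_tent_bound:
  assumes p: "p \<in> \<Gamma>" and s: "0 < s" and K: "\<And>t. 0 \<le> t \<Longrightarrow> t \<le> s \<Longrightarrow> p (S t x - x) \<le> K"
  shows "p (Phi (tent s) x - x) \<le> K"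
proof -
  have k: "kernel (\<omega> + 1) (tent s)" using s omega by (intro kernel_tent) auto
  have "wint (\<lambda>t. tent s t *\<^sub>R S \<bar>t\<bar> x - tent s t *\<^sub>R x) (Phi (tent s) x - 1 *\<^sub>R x)"
    by (intro wint_diff Phi_wint[OF k] wint_const has_bochner_integral_tent s) simp
  moreover have "has_bochner_integral lborel (\<lambda>t. K * tent s t) (K * 1)"
    by (intro has_bochner_integral_mult_right has_bochner_integral_tent s)
  moreover have "p (tent s t *\<^sub>R S \<bar>t\<bar> x - tent s t *\<^sub>R x) \<le> K * tent s t" for t
  proof (cases "\<bar>t\<bar> \<le> s")
    case True
    have "p (tent s t *\<^sub>R (S \<bar>t\<bar> x - x)) = tent s t * p (S \<bar>t\<bar> x - x)"
      by (simp add: seminorm_scale[OF \<Gamma>_seminorm[OF p]] tent_nonneg)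
    also have "\<dots> \<le> tent s t * K" using True by (intro mult_left_mono K tent_nonneg) auto
    finally show ?thesis by (simp add: scaleR_diff_right mult.commute)
  qed (simp add: tent_def seminorm_zero[OF \<Gamma>_seminorm[OF p]])
  ultimately show ?thesis using wint_bound[OF _ p] by fastforce
qed

end

section \<open>The generator and its resolvent\<close>

lemma Taylor_order3_bound:
  fixes \<phi> \<phi>1 \<phi>2 \<phi>3 :: "real \<Rightarrow> real"
  assumes d: "\<And>t. (\<phi> has_real_derivative \<phi>1 t) (at t)" "\<And>t. (\<phi>1 has_real_derivative \<phi>2 t) (at t)"
      "\<And>t. (\<phi>2 has_real_derivative \<phi>3 t) (at t)"
    and bd: "\<And>w. min u v \<le> w \<Longrightarrow> w \<le> max u v \<Longrightarrow> \<bar>\<phi>3 w\<bar> \<le> B"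
  shows "\<bar>\<phi> v - (\<phi> u + \<phi>1 u * (v - u) + \<phi>2 u / 2 * (v - u)\<^sup>2)\<bar> \<le> B / 6 * \<bar>v - u\<bar> ^ 3"
proof (cases "v = u")
  case False
  define diff where "diff m = (if m = 0 then \<phi> else if m = 1 then \<phi>1 else if m = 2 then \<phi>2 else \<phi>3)" for m :: nat
  have "\<exists>t. (if v < u then v < t \<and> t < u else u < t \<and> t < v) \<and>
      \<phi> v = (\<Sum>m<3. (diff m u / fact m) * (v - u) ^ m) + (diff 3 t / fact 3) * (v - u) ^ 3"
    by (rule Taylor[where a = "min u v" and b = "max u v"])
       (use d False in \<open>auto simp: diff_def less_Suc_eq numeral_3_eq_3\<close>)
  then obtain t where t: "if v < u then v < t \<and> t < u else u < t \<and> t < v"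
      and eq: "\<phi> v = (\<Sum>m<3. (diff m u / fact m) * (v - u) ^ m) + (diff 3 t / fact 3) * (v - u) ^ 3"
    by blast
  have rem: "\<phi> v - (\<phi> u + \<phi>1 u * (v - u) + \<phi>2 u / 2 * (v - u)\<^sup>2) = \<phi>3 t / 6 * (v - u) ^ 3"
    unfolding eq by (simp add: diff_def eval_nat_numeral)
  have "\<bar>\<phi>3 t\<bar> \<le> B" using t by (intro bd) (auto split: if_splits)
  then have "\<bar>\<phi>3 t\<bar> / 6 * \<bar>v - u\<bar> ^ 3 \<le> B / 6 * \<bar>v - u\<bar> ^ 3" by (intro mult_right_mono) auto
  then show ?thesis unfolding rem by (simp add: abs_mult power_abs)
qed simp

text \<open>The distributional second derivative of \<open>t \<mapsto> \<phi> \<bar>t\<bar>\<close> is \<open>\<phi>2 \<bar>t\<bar>\<close> plus \<open>2 \<phi>1(0)\<close> times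
  the Dirac mass at \<open>0\<close>, which the second difference quotient smears out to a tent.\<close>

lemma second_difference_bound:
  fixes \<phi> \<phi>1 \<phi>2 \<phi>3 :: "real \<Rightarrow> real"
  assumes d: "\<And>t. (\<phi> has_real_derivative \<phi>1 t) (at t)" "\<And>t. (\<phi>1 has_real_derivative \<phi>2 t) (at t)"
      "\<And>t. (\<phi>2 has_real_derivative \<phi>3 t) (at t)"
    and bd: "\<And>w. 0 \<le> w \<Longrightarrow> \<bar>\<phi>3 w\<bar> \<le> C * exp (- a * w)"
    and a: "0 \<le> a" and s: "0 < s" "s \<le> 1"
  shows "\<bar>(\<phi> \<bar>t + s\<bar> + \<phi> \<bar>t - s\<bar> - 2 * \<phi> \<bar>t\<bar>) / s\<^sup>2 - \<phi>2 \<bar>t\<bar> - 2 * \<phi>1 0 * tent s t\<bar>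
    \<le> (3 * C * exp a * s) * exp (- a * \<bar>t\<bar>)"
proof -
  have C: "0 \<le> C" using order_trans[OF abs_ge_zero bd[of 0]] by simp
  have ad: "\<bar>X / s\<^sup>2\<bar> \<le> Y / s\<^sup>2" if "\<bar>X\<bar> \<le> Y" for X Y :: real
    using divide_right_mono[OF that, of "s\<^sup>2"] by simp
  have pos: "\<bar>(\<phi> \<bar>t + s\<bar> + \<phi> \<bar>t - s\<bar> - 2 * \<phi> t) / s\<^sup>2 - \<phi>2 t - 2 * \<phi>1 0 * tent s t\<bar>
    \<le> (3 * C * exp a * s) * exp (- a * t)" if t: "0 \<le> t" for t
  proof (cases "s \<le> t")
    case True
    \<comment> \<open>Away from the kink the shifted points stay nonnegative and the tent vanishes;
      over a distance \<open>s \<le> 1\<close> the weight grows by at most the factor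
      \<open>exp a\<close>.\<close>
    define B where "B = C * exp a * exp (- a * t)"
    have B0: "0 \<le> B" using C by (simp add: B_def)
    have B: "\<bar>\<phi>3 w\<bar> \<le> B" if "t - s \<le> w" for w
    proof -
      have "a * t \<le> a * (1 + w)" using that s a by (intro mult_left_mono) auto
      then have "exp (- a * w) \<le> exp a * exp (- a * t)" by (simp add: algebra_simps flip: exp_add)
      then have "C * exp (- a * w) \<le> B" unfolding B_def mult.assoc using C by (rule mult_left_mono)
      then show ?thesis using bd[of w] that True by simp
    qed
    have 1: "\<bar>\<phi> (t + s) - (\<phi> t + \<phi>1 t * (t + s - t) + \<phi>2 t / 2 * (t + s - t)\<^sup>2)\<bar> \<le> B / 6 * \<bar>t + s - t\<bar> ^ 3"
      by (rule Taylor_order3_bound[OF d B]) (use s in auto)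
    have 2: "\<bar>\<phi> (t - s) - (\<phi> t + \<phi>1 t * (t - s - t) + \<phi>2 t / 2 * (t - s - t)\<^sup>2)\<bar> \<le> B / 6 * \<bar>t - s - t\<bar> ^ 3"
      by (rule Taylor_order3_bound[OF d B]) (use s in auto)
    have "\<bar>\<phi> (t + s) + \<phi> (t - s) - 2 * \<phi> t - \<phi>2 t * s\<^sup>2\<bar> \<le> B / 3 * s ^ 3"
      using 1 2 s by (simp add: abs_le_iff) argo
    then have "\<bar>(\<phi> (t + s) + \<phi> (t - s) - 2 * \<phi> t - \<phi>2 t * s\<^sup>2) / s\<^sup>2\<bar> \<le> B / 3 * s ^ 3 / s\<^sup>2"
      by (rule ad)
    also have "(\<phi> (t + s) + \<phi> (t - s) - 2 * \<phi> t - \<phi>2 t * s\<^sup>2) / s\<^sup>2 = (\<phi> (t + s) + \<phi> (t - s) - 2 * \<phi> t) / s\<^sup>2 - \<phi>2 t"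
      using s by (simp add: diff_divide_distrib)
    also have "B / 3 * s ^ 3 / s\<^sup>2 = B / 3 * s" using s by (simp add: eval_nat_numeral)
    also have "\<dots> \<le> 3 * B * s" using B0 s by simp
    finally show ?thesis using True s t by (simp add: tent_def B_def mult_ac)
  next
    case False
    have B: "\<bar>\<phi>3 w\<bar> \<le> C" if "0 \<le> w" for w
    proof -
      have "C * exp (- a * w) \<le> C * 1" using C a that by (intro mult_left_mono) auto
      then show ?thesis using bd[OF that] by simp
    qed
    \<comment> \<open>Near the kink all arguments are at most \<open>2 * s\<close>, so everything is
      expanded at 0. The first-order terms leave \<open>2 * \<phi>1 0 * (s - t)\<close>, which is
      the tent, and the second-order terms leave \<open>\<phi>2 0 * s^2\<close>.\<close>
    have T: "\<bar>\<phi> v - (\<phi> 0 + \<phi>1 0 * v + \<phi>2 0 / 2 * v\<^sup>2)\<bar> \<le> C / 6 * v ^ 3" if "0 \<le> v" for v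
      using Taylor_order3_bound[OF d B, of 0 v] that by simp
    have c1: "C / 6 * (t + s) ^ 3 \<le> C / 6 * (8 * s ^ 3)"
    proof (intro mult_left_mono)
      have "(t + s) ^ 3 \<le> (2 * s) ^ 3" using False t s by (intro power_mono) auto
      then show "(t + s) ^ 3 \<le> 8 * s ^ 3" by (simp add: power_mult_distrib)
    qed (use C in auto)
    have c2: "C / 6 * (s - t) ^ 3 \<le> C / 6 * s ^ 3"
      using False t s C by (intro mult_left_mono power_mono) auto
    have c3: "C / 6 * t ^ 3 \<le> C / 6 * s ^ 3"
      using False t s C by (intro mult_left_mono power_mono) auto
    define N where "N = \<phi> (t + s) + \<phi> (s - t) - 2 * \<phi> t"
    define X where "X v = \<phi> v - (\<phi> 0 + \<phi>1 0 * v + \<phi>2 0 / 2 * v\<^sup>2)" for v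
    have "N - 2 * \<phi>1 0 * (s - t) - \<phi>2 0 * s\<^sup>2 = X (t + s) + X (s - t) - 2 * X t"
      by (simp add: N_def X_def power2_eq_square field_simps)
    moreover have "\<bar>X (t + s)\<bar> \<le> C / 6 * (8 * s ^ 3)" "\<bar>X (s - t)\<bar> \<le> C / 6 * s ^ 3" "\<bar>X t\<bar> \<le> C / 6 * s ^ 3"
      unfolding X_def using order_trans[OF T c1] order_trans[OF T c2] order_trans[OF T c3] False t s by auto
    moreover have "0 \<le> C / 6 * s ^ 3" using C s by simp
    \<comment> \<open>The remainders add up to 8 + 1 + 2 = 11 units \<open>C / 6 * s ^ 3\<close>,
      rounded up to 12.\<close>
    moreover have "C / 6 * (8 * s ^ 3) = 8 * (C / 6 * s ^ 3)" "2 * C * s ^ 3 = 12 * (C / 6 * s ^ 3)" by auto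
    ultimately have N: "\<bar>N - 2 * \<phi>1 0 * (s - t) - \<phi>2 0 * s\<^sup>2\<bar> \<le> 2 * C * s ^ 3" by linarith
    have "\<bar>\<phi>2 t - \<phi>2 0\<bar> \<le> C * s"
    proof (cases "t = 0")
      case False
      then obtain z where "0 < z" "z < t" "\<phi>2 t - \<phi>2 0 = (t - 0) * \<phi>3 z"
        using MVT2[of 0 t \<phi>2 \<phi>3] d(3) t by auto
      then have "\<bar>\<phi>2 t - \<phi>2 0\<bar> \<le> t * C" using t B[of z] by (simp add: abs_mult mult_left_mono)
      also have "\<dots> \<le> s * C" using \<open>\<not> s \<le> t\<close> C by (intro mult_right_mono) auto
      finally show ?thesis by (simp add: mult.commute)
    qed (use C s in simp)
    moreover have "\<bar>N / s\<^sup>2 - 2 * \<phi>1 0 * tent s t - \<phi>2 0\<bar> \<le> 2 * C * s"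
    proof -
      have "N / s\<^sup>2 - 2 * \<phi>1 0 * tent s t - \<phi>2 0 = (N - 2 * \<phi>1 0 * (s - t) - \<phi>2 0 * s\<^sup>2) / s\<^sup>2"
      proof -
        have tent: "tent s t = (s - t) / s\<^sup>2" using t False by (simp add: tent_def)
        show ?thesis unfolding tent using s by (simp add: field_simps)
      qed
      also have "\<bar>\<dots>\<bar> \<le> 2 * C * s ^ 3 / s\<^sup>2"
        using N by (rule ad)
      also have "\<dots> = 2 * C * s" using s by (simp add: eval_nat_numeral)
      finally show ?thesis .
    qed
    ultimately have "\<bar>N / s\<^sup>2 - \<phi>2 t - 2 * \<phi>1 0 * tent s t\<bar> \<le> 3 * C * s" by linarith
    also have "\<dots> \<le> (3 * C * s) * (exp a * exp (- a * t))"
    proof -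
      have "a * t \<le> a * 1" using False s a by (intro mult_left_mono) auto
      then have "1 \<le> exp a * exp (- a * t)" by (simp flip: exp_add)
      then have "(3 * C * s) * 1 \<le> (3 * C * s) * (exp a * exp (- a * t))" using C s by (intro mult_left_mono) auto
      then show ?thesis by simp
    qed
    finally show ?thesis using False s t by (simp add: N_def mult_ac abs_minus_commute)
  qed
  show ?thesis
  proof (cases "0 \<le> t")
    case True then show ?thesis using pos[of t] by simp
  next
    case False
    have "\<bar>t + s\<bar> = \<bar>- t - s\<bar>" "\<bar>t - s\<bar> = \<bar>- t + s\<bar>" "\<bar>t\<bar> = - t" "tent s t = tent s (- t)"
      using False by (auto simp: tent_def)
    then show ?thesis using pos[of "- t"] False by (simp add: add.commute)
  qed
qed

section \<open>The generator on kernel operators\<close>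

context saks_cosine
begin

lemma bi_generator_eq_Some:
  "bi_generator \<tau> S x = Some y \<longleftrightarrow> limitin \<tau> (\<lambda>t. (2 / t\<^sup>2) *\<^sub>R (S t x - x)) y (at_right 0) \<and>
    bdd_above ((\<lambda>t. 2 / t\<^sup>2 * norm (S t x - x)) ` {0<..1})" (is "_ \<longleftrightarrow> ?L y \<and> ?B")
proof -
  have THE: "(THE y. ?L y) = y" if "?L y" for y
    using that by (rule the_equality) (rule tau_limit_unique[OF _ that], auto)
  show ?thesis
  proof
    assume "bi_generator \<tau> S x = Some y"
    then have ex: "(\<exists>y. ?L y) \<and> ?B" and y: "y = (THE y. ?L y)"
      unfolding bi_generator_def by (auto split: if_splits)
    then obtain z where z: "?L z" by blast
    then have "y = z" using THE y by simp
    then show "?L y \<and> ?B" using z ex by simp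
  next
    assume R: "?L y \<and> ?B"
    have "\<exists>y. ?L y" using conjunct1[OF R] by (rule exI)
    then have "(\<exists>y. ?L y) \<and> ?B" using conjunct2[OF R] by (rule conjI)
    moreover have "(THE y. ?L y) = y" by (rule THE[OF conjunct1[OF R]])
    ultimately show "bi_generator \<tau> S x = Some y" unfolding bi_generator_def by simp
  qed
qed

context
  fixes \<phi> \<phi>1 \<phi>2 \<phi>3 :: "real \<Rightarrow> real" and C a :: real and x :: 'a
  assumes d: "\<And>t. (\<phi> has_real_derivative \<phi>1 t) (at t)" "\<And>t. (\<phi>1 has_real_derivative \<phi>2 t) (at t)"
      "\<And>t. (\<phi>2 has_real_derivative \<phi>3 t) (at t)"
    and bd: "\<And>w. 0 \<le> w \<Longrightarrow> \<bar>\<phi>3 w\<bar> \<le> C * exp (- a * w)"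
    and k: "kernel a (\<lambda>t. \<phi> \<bar>t\<bar>)" "kernel a (\<lambda>t. \<phi>2 \<bar>t\<bar>)"
    and a: "\<omega> < a"
begin

text \<open>Growth \<open>Q\<close> and oscillation \<open>T\<close> are plain numbers, so that one
  estimate yields both the limit, where \<open>T\<close> is small for small \<open>s\<close>, and
  the norm bound, where \<open>p\<close> ranges over \<open>P\<close> and
  \<open>b = \<omega>\<close>.\<close>

lemma difference_quotient_bound:
  assumes p: "p \<in> \<Gamma>" and s: "0 < s" "s \<le> 1" and b: "b < a"
    and Q: "\<And>t. 0 \<le> t \<Longrightarrow> p (S t x) \<le> exp (b * t) * Q"
    and T: "\<And>t. 0 \<le> t \<Longrightarrow> t \<le> s \<Longrightarrow> p (S t x - x) \<le> T"
  shows "p ((2 / s\<^sup>2) *\<^sub>R (S s (Phi (\<lambda>t. \<phi> \<bar>t\<bar>) x) - Phi (\<lambda>t. \<phi> \<bar>t\<bar>) x)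
      - (Phi (\<lambda>t. \<phi>2 \<bar>t\<bar>) x + (2 * \<phi>1 0) *\<^sub>R x))
    \<le> (3 * C * exp a * s) * Q * (2 / (a - b)) + \<bar>2 * \<phi>1 0\<bar> * T"
proof -
  have a0: "0 \<le> a" using a omega by simp
  define e where "e = (\<lambda>t. \<phi> \<bar>t\<bar>)"
  define e2 where "e2 = (\<lambda>t. \<phi>2 \<bar>t\<bar>)"
  \<comment> \<open>\<open>w\<close> is the kernel of the difference quotient; \<open>r\<close> is
    what remains of it after the second derivative and the smeared Dirac mass are removed.\<close>
  define w where "w = (\<lambda>t. 1 / s\<^sup>2 * ((e (t - s) + e (t + s)) - 2 * e t))"
  define r where "r = (\<lambda>t. (w t - e2 t) - (2 * \<phi>1 0) * tent s t)"
  have ke: "kernel a e" "kernel a e2" using k by (auto simp: e_def e2_def)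
  have ks: "kernel a (\<lambda>t. e (t - s) + e (t + s))"
    using kernel_add[OF kernel_shift[OF ke(1) a0, of "- s"] kernel_shift[OF ke(1) a0, of s]] by simp
  note k2 = kernel_cmult[OF ke(1), of 2]
  have kw: "kernel a w" unfolding w_def by (rule kernel_cmult[OF kernel_diff[OF ks k2]])
  have kt: "kernel a (tent s)" using kernel_tent[OF s(1) a0] .
  note kt' = kernel_cmult[OF kt, of "2 * \<phi>1 0"]
  have kr: "kernel a r" unfolding r_def by (rule kernel_diff[OF kernel_diff[OF kw ke(2)] kt'])
  have "Phi w x = (1 / s\<^sup>2) *\<^sub>R (2 *\<^sub>R S s (Phi e x) - 2 *\<^sub>R Phi e x)"
    unfolding w_def
    by (simp only: Phi_cmult[OF kernel_diff[OF ks k2] a] Phi_diff[OF ks k2 a] Phi_cmult[OF ke(1) a] Phi_shift[OF ke(1) a less_imp_le[OF s(1)]])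
  then have w: "Phi w x = (2 / s\<^sup>2) *\<^sub>R (S s (Phi e x) - Phi e x)"
    by (simp add: algebra_simps)
  have "Phi r x = Phi w x - Phi e2 x - (2 * \<phi>1 0) *\<^sub>R Phi (tent s) x"
    unfolding r_def
    by (simp only: Phi_diff[OF kernel_diff[OF kw ke(2)] kt' a] Phi_diff[OF kw ke(2) a] Phi_cmult[OF kt a])
  then have "(2 / s\<^sup>2) *\<^sub>R (S s (Phi e x) - Phi e x) - (Phi e2 x + (2 * \<phi>1 0) *\<^sub>R x)
      = Phi r x + (2 * \<phi>1 0) *\<^sub>R (Phi (tent s) x - x)"
    unfolding w by (simp add: algebra_simps)
  also have "p \<dots> \<le> p (Phi r x) + p ((2 * \<phi>1 0) *\<^sub>R (Phi (tent s) x - x))"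
    by (rule seminorm_triangle[OF \<Gamma>_seminorm[OF p]])
  also have "p ((2 * \<phi>1 0) *\<^sub>R (Phi (tent s) x - x)) \<le> \<bar>2 * \<phi>1 0\<bar> * T"
    unfolding seminorm_scale[OF \<Gamma>_seminorm[OF p]] by (rule mult_left_mono[OF Phi_tent_bound[OF p s(1) T]]) auto
  also have "p (Phi r x) \<le> (3 * C * exp a * s) * Q * (2 / (a - b))"
  proof (rule Phi_bound[OF kr a p _ b Q])
    fix t
    have "r t = (\<phi> \<bar>t + s\<bar> + \<phi> \<bar>t - s\<bar> - 2 * \<phi> \<bar>t\<bar>) / s\<^sup>2 - \<phi>2 \<bar>t\<bar> - 2 * \<phi>1 0 * tent s t"
      by (simp add: r_def w_def e_def e2_def add.commute)
    then show "\<bar>r t\<bar> \<le> 3 * C * exp a * s * exp (- a * \<bar>t\<bar>)"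
      using second_difference_bound[OF d bd a0 s, of t] by simp
  qed
  finally show ?thesis by (simp add: e_def e2_def)
qed

text \<open>The generator asks for a limit of the quotients and for a bound in norm. Both come from
  \<open>difference_quotient_bound\<close>, the second because its right-hand side can be chosen
  independently of \<open>p\<close> in \<open>P\<close>.\<close>

lemma generator_Phi:
  "bi_generator \<tau> S (Phi (\<lambda>t. \<phi> \<bar>t\<bar>) x) = Some (Phi (\<lambda>t. \<phi>2 \<bar>t\<bar>) x + (2 * \<phi>1 0) *\<^sub>R x)"
proof -
  define y where "y = Phi (\<lambda>t. \<phi> \<bar>t\<bar>) x"
  define z where "z = Phi (\<lambda>t. \<phi>2 \<bar>t\<bar>) x + (2 * \<phi>1 0) *\<^sub>R x"
  define D where "D s = (2 / s\<^sup>2) *\<^sub>R (S s y - y)" for s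
  have C: "0 \<le> C" using order_trans[OF abs_ge_zero bd[of 0]] by simp
  have "limitin \<gamma> D z (at_right 0)"
    unfolding limitin_gamma
  proof (intro ballI tendstoI)
    fix p and \<epsilon> :: real assume p: "p \<in> \<Gamma>" and \<epsilon>: "0 < \<epsilon>"
    note sn = \<Gamma>_seminorm[OF p]
    define b where "b = (a + \<omega>) / 2"
    have b: "\<omega> < b" "b < a" using a by (auto simp: b_def)
    obtain q where q: "q \<in> \<Gamma>" "\<And>t x. 0 \<le> t \<Longrightarrow> p (S t x) \<le> exp (b * t) * q x"
      using S_equi[OF p b(1)] by blast
    \<comment> \<open>Leaves \<open>\<epsilon> / 2\<close> for the Dirac term; the added 1 avoids a
      vanishing denominator.\<close>
    define \<eta> where "\<eta> = \<epsilon> / (2 * (\<bar>2 * \<phi>1 0\<bar> + 1))"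
    have \<eta>: "0 < \<eta>" using \<epsilon> by (simp add: \<eta>_def)
    have "\<forall>\<^sub>F s in at 0 within {0..}. dist (p (S s x - S 0 x)) 0 < \<eta>"
      by (rule tendstoD[OF S_cont[OF p] \<eta>]) simp
    then obtain \<delta> where \<delta>: "\<delta> > 0" "\<And>s. 0 \<le> s \<Longrightarrow> s \<noteq> 0 \<Longrightarrow> dist s 0 < \<delta> \<Longrightarrow> dist (p (S s x - S 0 x)) 0 < \<eta>"
      unfolding eventually_at by force
    have T: "p (S t x - x) \<le> \<eta>" if "0 \<le> t" "t < \<delta>" for t
      using \<delta>(2)[of t] that \<eta> S_0 by (cases "t = 0") (auto simp: seminorm_zero[OF sn])
    define K where "K = 3 * C * exp a * q x * (2 / (a - b))"
    have K: "0 \<le> K" using C b seminorm_nonneg[OF \<Gamma>_seminorm[OF q(1)]] by (simp add: K_def)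
    \<comment> \<open>Three demands: \<open>s \<le> 1\<close>, oscillation of the orbit at most
      \<open>\<eta>\<close>, and \<open>K * s\<close> below \<open>\<epsilon> / 2\<close>.\<close>
    define s0 where "s0 = min (min 1 \<delta>) (\<epsilon> / (2 * (K + 1)))"
    have s0: "0 < s0" using \<delta> \<epsilon> K by (simp add: s0_def)
    have "dist (p (D s - z)) 0 < \<epsilon>" if s: "0 < s" "s < s0" for s
    proof -
      have "p (D s - z) \<le> (3 * C * exp a * s) * q x * (2 / (a - b)) + \<bar>2 * \<phi>1 0\<bar> * \<eta>"
        unfolding D_def y_def z_def
        by (rule difference_quotient_bound[OF p _ _ b(2) q(2) T]) (use s in \<open>auto simp: s0_def\<close>)
      also have "(3 * C * exp a * s) * q x * (2 / (a - b)) = K * s" by (simp add: K_def)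
      also have "K * s \<le> (K + 1) * s" using s by simp
      also have "\<dots> < (K + 1) * (\<epsilon> / (2 * (K + 1)))" using s K by (intro mult_strict_left_mono) (auto simp: s0_def)
      also have "\<dots> = \<epsilon> / 2" using K by (simp add: field_simps)
      also have "\<bar>2 * \<phi>1 0\<bar> * \<eta> \<le> (\<bar>2 * \<phi>1 0\<bar> + 1) * \<eta>" using \<eta> by simp
      also have "\<dots> = \<epsilon> / 2"
      proof -
        have "\<bar>2 * \<phi>1 0\<bar> + 1 \<noteq> 0" by linarith
        then show ?thesis unfolding \<eta>_def by (simp add: divide_simps)
      qed
      finally show ?thesis by (simp add: seminorm_nonneg[OF sn])
    qed
    then show "\<forall>\<^sub>F s in at_right 0. dist (p (D s - z)) 0 < \<epsilon>"
      using s0 unfolding eventually_at_right_field by blast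
  qed
  then have lim: "limitin \<tau> D z (at_right 0)" by (rule limitin_gamma_imp_tau)
  define T where "T = (M * exp \<omega> + 1) * norm x"
  define B where "B = (3 * C * exp a) * (M * norm x) * (2 / (a - \<omega>)) + \<bar>2 * \<phi>1 0\<bar> * T"
  have "2 / s\<^sup>2 * norm (S s y - y) \<le> B + norm z" if s: "s \<in> {0<..1}" for s
  proof -
    have s': "0 < s" "s \<le> 1" using s by auto
    have "norm (D s - z) \<le> B"
    proof (rule norm_le_P)
      fix p assume pP: "p \<in> P"
      then have p: "p \<in> \<Gamma>" using P_subset_\<Gamma> by blast
      have Q: "p (S t x) \<le> exp (\<omega> * t) * (M * norm x)" if "0 \<le> t" for t
        using order_trans[OF P_le_norm[OF pP] S_norm[OF that, of x]] by (simp add: mult_ac)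
      have T: "p (S t x - x) \<le> T" if t: "0 \<le> t" "t \<le> s" for t
      proof -
        have "p (S t x - x) \<le> norm (S t x) + norm x"
          using order_trans[OF P_le_norm[OF pP] norm_triangle_ineq4] .
        also have "norm (S t x) \<le> M * exp (\<omega> * t) * norm x" by (rule S_norm[OF t(1)])
        also have "\<dots> \<le> M * exp \<omega> * norm x"
        proof (intro mult_right_mono mult_left_mono)
          have "\<omega> * t \<le> \<omega> * 1" using t s' omega by (intro mult_left_mono) auto
          then show "exp (\<omega> * t) \<le> exp \<omega>" by simp
        qed (use M in auto)
        finally show ?thesis by (simp add: T_def algebra_simps)
      qed
      have "p (D s - z) \<le> (3 * C * exp a * s) * (M * norm x) * (2 / (a - \<omega>)) + \<bar>2 * \<phi>1 0\<bar> * T"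
        unfolding D_def y_def z_def
        by (rule difference_quotient_bound[OF p s' a Q T])
      also have "(3 * C * exp a * s) * (M * norm x) * (2 / (a - \<omega>)) = (3 * C * exp a) * (M * norm x) * (2 / (a - \<omega>)) * s"
        by simp
      also have "\<dots> \<le> (3 * C * exp a) * (M * norm x) * (2 / (a - \<omega>)) * 1"
        using C M a s' by (intro mult_left_mono) auto
      finally show "p (D s - z) \<le> B" by (simp add: B_def)
    qed
    then have "norm (D s) \<le> B + norm z" using norm_triangle_sub[of "D s" z] by simp
    then show ?thesis by (simp add: D_def)
  qed
  then have "bdd_above ((\<lambda>s. 2 / s\<^sup>2 * norm (S s y - y)) ` {0<..1})" by (rule bdd_aboveI2)
  then have "bi_generator \<tau> S y = Some z" using lim unfolding bi_generator_eq_Some D_def by blast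
  then show ?thesis by (simp add: y_def z_def)
qed

end

end

section \<open>Exponential weights and the resolvent\<close>

lemma power_le_fact_exp:
  fixes y :: real assumes "0 \<le> y" shows "y ^ n \<le> fact n * exp y"
proof -
  obtain t where t: "exp y = (\<Sum>m<Suc n. y ^ m / fact m) + exp t / fact (Suc n) * y ^ Suc n"
    using Maclaurin_exp_le[of y "Suc n"] by blast
  have "y ^ n / fact n \<le> (\<Sum>m<Suc n. y ^ m / fact m)"
    using assms by (intro member_le_sum) auto
  also have "\<dots> \<le> exp y" unfolding t using assms by simp
  finally show ?thesis by (simp add: field_simps)
qed

definition laguerre :: "real \<Rightarrow> nat \<Rightarrow> real \<Rightarrow> real" where
  "laguerre l k t = t ^ k * exp (- l * t)"

lemma laguerre_deriv:
  "(laguerre l k has_real_derivative real k * laguerre l (k - 1) t - l * laguerre l k t) (at t)"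
  unfolding laguerre_def[abs_def] by (auto intro!: derivative_eq_intros simp: algebra_simps)

lemma laguerre_bound:
  assumes a: "a < l" and t: "0 \<le> t"
  shows "\<bar>laguerre l k t\<bar> \<le> fact k / (l - a) ^ k * exp (- a * t)"
proof -
  have "((l - a) * t) ^ k \<le> fact k * exp ((l - a) * t)"
    using a t by (intro power_le_fact_exp) auto
  then have "t ^ k * (l - a) ^ k \<le> fact k * exp ((l - a) * t)"
    by (simp only: power_mult_distrib mult.commute)
  then have "t ^ k \<le> fact k * exp ((l - a) * t) / (l - a) ^ k"
    using a by (subst pos_le_divide_eq) auto
  then have "t ^ k \<le> fact k / (l - a) ^ k * exp ((l - a) * t)" by simp
  then have "t ^ k * exp (- l * t) \<le> fact k / (l - a) ^ k * exp ((l - a) * t) * exp (- l * t)"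
    by (rule mult_right_mono) simp
  also have "\<dots> = fact k / (l - a) ^ k * exp (- a * t)"
    by (simp add: algebra_simps flip: exp_add)
  finally show ?thesis using t by (simp add: laguerre_def)
qed

lemma kernel_laguerre: "a < l \<Longrightarrow> kernel a (\<lambda>t. laguerre l k \<bar>t\<bar>)"
  by (rule kernelI[OF _ laguerre_bound]) (auto simp: laguerre_def intro!: continuous_intros)

lemma kernel_exp: "a \<le> l \<Longrightarrow> kernel a (\<lambda>t. exp (- l * \<bar>t\<bar>))"
  by (rule kernelI[where K = 1]) (auto intro!: continuous_intros mult_right_mono)

lemma kernel_exp_div: "a \<le> l \<Longrightarrow> kernel a (\<lambda>t. exp (- l * \<bar>t\<bar>) / c)"
  using kernel_cmult[OF kernel_exp, of a l "inverse c"] by (simp add: divide_inverse mult.commute)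

context saks_cosine
begin

text \<open>Members of \<open>P\<close> lie below the norm, so no change of seminorm is involved and
  the rate \<open>\<omega>\<close> itself is admissible.\<close>

lemma Phi_norm_bound:
  assumes e: "kernel a e" and a: "\<omega> < a" and K: "\<And>t. \<bar>e t\<bar> \<le> K * exp (- a * \<bar>t\<bar>)"
  shows "norm (Phi e x) \<le> K * (M * norm x) * (2 / (a - \<omega>))"
proof (rule norm_le_P)
  fix p assume p: "p \<in> P"
  show "p (Phi e x) \<le> K * (M * norm x) * (2 / (a - \<omega>))"
  proof (rule Phi_bound[OF e a _ K a])
    show "p \<in> \<Gamma>" using p P_subset_\<Gamma> by blast
    show "p (S t x) \<le> exp (\<omega> * t) * (M * norm x)" if "0 \<le> t" for t
      using order_trans[OF P_le_norm[OF p] S_norm[OF that, of x]] by (simp add: mult_ac)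
  qed
qed

lemma Phi_bounded_operator:
  assumes e: "kernel a e" and a: "\<omega> < a" shows "bounded_operator sc (Phi e)"
  unfolding bounded_operator_def
proof
  show "Vector_Spaces.linear sc sc (Phi e)" by (rule Phi_sc_linear[OF assms])
  obtain K where K: "\<And>t. \<bar>e t\<bar> \<le> K * exp (- a * \<bar>t\<bar>)" using e by (auto simp: kernel_def)
  have lin: "linear (Phi e)" by (rule Phi_linear[OF assms])
  show "bounded_linear (Phi e)"
    by (rule bounded_linear_intro[where K = "K * M * (2 / (a - \<omega>))"])
       (use linear_add[OF lin] linear_cmul[OF lin] Phi_norm_bound[OF e a K] in \<open>auto simp: mult_ac\<close>)
qed

lemma Phi_S_commute:
  assumes e: "kernel a e" and a: "\<omega> < a" and s: "0 \<le> s"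
  shows "Phi e (S s x) = S s (Phi e x)"
proof (rule PhiI)
  have "wint (\<lambda>t. S s (e t *\<^sub>R S \<bar>t\<bar> x)) (S s (Phi e x))"
    using Phi_wint[OF e a] S_linear[OF s] S_bounded_\<Gamma>[OF s] by (rule wint_image)
  then show "wint (\<lambda>t. e t *\<^sub>R S \<bar>t\<bar> (S s x)) (S s (Phi e x))"
    by (simp add: linear_cmul[OF S_linear[OF s]] S_commute[OF s])
qed

definition Res :: "real \<Rightarrow> 'a \<Rightarrow> 'a" where
  "Res l = Phi (\<lambda>t. exp (- l * \<bar>t\<bar>) / (2 * l))"

context
  fixes l :: real assumes l: "\<omega> < l"
begin

lemma l_pos: "0 < l" using l omega by simp

lemma kernel_Res: "kernel l (\<lambda>t. exp (- l * \<bar>t\<bar>) / (2 * l))"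
  by (rule kernel_exp_div) simp

lemma Res_linear: "linear (Res l)"
  and Res_sc_linear: "Vector_Spaces.linear sc sc (Res l)"
  and Res_bounded_operator: "bounded_operator sc (Res l)"
  unfolding Res_def
  by (rule Phi_linear Phi_sc_linear Phi_bounded_operator, rule kernel_Res, rule l)+

lemma Res_equi: "p \<in> \<Gamma> \<Longrightarrow> \<exists>q\<in>\<Gamma>. \<forall>x. p (Res l x) \<le> q x"
  unfolding Res_def by (rule Phi_equi[OF kernel_Res l])

text \<open>For \<open>\<phi> t = exp (- l * t) / (2 * l)\<close> the second derivative is
  \<open>l^2\<close> times \<open>\<phi>\<close> and the slope at 0 is \<open>- 1 / 2\<close>; the
  factor \<open>1 / (2 * l)\<close> is chosen to give the Dirac mass the weight -1.\<close>

lemma generator_Res: "bi_generator \<tau> S (Res l x) = Some (l\<^sup>2 *\<^sub>R Res l x - x)"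
proof -
  let ?\<phi> = "\<lambda>t. exp (- l * t) / (2 * l)"
  have d: "((\<lambda>t. c * exp (- l * t)) has_real_derivative (- l * c) * exp (- l * t)) (at t)" for c t
    by (auto intro!: derivative_eq_intros)
  have d1: "(?\<phi> has_real_derivative (- 1 / 2) * exp (- l * t)) (at t)" for t
    using d[of "1 / (2 * l)" t] l_pos by simp
  have d2: "((\<lambda>t. (- 1 / 2) * exp (- l * t)) has_real_derivative (l / 2) * exp (- l * t)) (at t)" for t
    using d[of "- 1 / 2" t] by simp
  have d3: "((\<lambda>t. (l / 2) * exp (- l * t)) has_real_derivative (- l\<^sup>2 / 2) * exp (- l * t)) (at t)" for t
    using d[of "l / 2" t] by (simp add: power2_eq_square)
  have "bi_generator \<tau> S (Phi (\<lambda>t. ?\<phi> \<bar>t\<bar>) x)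
      = Some (Phi (\<lambda>t. (l / 2) * exp (- l * \<bar>t\<bar>)) x + (2 * ((- 1 / 2) * exp (- l * 0))) *\<^sub>R x)"
    by (rule generator_Phi[OF d1 d2 d3 _ kernel_Res kernel_cmult[OF kernel_exp] l, of "l\<^sup>2 / 2"]) (simp_all add: abs_mult)
  moreover have "Phi (\<lambda>t. (l / 2) * exp (- l * \<bar>t\<bar>)) x = l\<^sup>2 *\<^sub>R Res l x"
  proof -
    have "(\<lambda>t. (l / 2) * exp (- l * \<bar>t\<bar>)) = (\<lambda>t. l\<^sup>2 * (exp (- l * \<bar>t\<bar>) / (2 * l)))"
      using l_pos by (auto simp: power2_eq_square)
    then show ?thesis by (simp only: Res_def Phi_cmult[OF kernel_Res l])
  qed
  ultimately show ?thesis by (simp add: Res_def)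
qed

text \<open>\<open>Res l\<close> commutes with the family, so it maps the difference quotients of
  \<open>x\<close> to those of \<open>Res l x\<close>, whose limit is known. The boundedness clause
  of the generator turns the \<tau>-limit into a \<gamma>-limit, through which \<open>Res l\<close>
  may be taken.\<close>

lemma Res_of_generator:
  assumes "bi_generator \<tau> S x = Some y"
  shows "Res l (l\<^sup>2 *\<^sub>R x - y) = x"
proof -
  define D where "D t = (2 / t\<^sup>2) *\<^sub>R (S t x - x)" for t
  have "bdd_above ((\<lambda>t. 2 / t\<^sup>2 * norm (S t x - x)) ` {0<..1})"
    using assms unfolding bi_generator_eq_Some by (rule conjunct2)
  then obtain K where K0: "\<And>v. v \<in> (\<lambda>t. 2 / t\<^sup>2 * norm (S t x - x)) ` {0<..1} \<Longrightarrow> v \<le> K"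
    by (rule bdd_above.E) (rule that)
  have K: "2 / t\<^sup>2 * norm (S t x - x) \<le> K" if "0 < t" "t \<le> 1" for t
    by (rule K0[OF imageI]) (use that in simp)
  have "\<forall>\<^sub>F t in at_right 0. norm (D t) \<le> K"
    unfolding eventually_at_right_field using K by (intro exI[of _ 1]) (simp add: D_def)
  moreover have "limitin \<tau> D y (at_right 0)"
    using assms unfolding bi_generator_eq_Some D_def by blast
  ultimately have "limitin \<gamma> D y (at_right 0)" by (rule limitin_gammaI[rotated])
  then have "limitin \<gamma> (\<lambda>t. Res l (D t)) (Res l y) (at_right 0)"
    using Res_linear Res_equi by (rule limitin_gamma_image[rotated 2])
  moreover have "\<forall>\<^sub>F t in at_right 0. Res l (D t) = (2 / t\<^sup>2) *\<^sub>R (S t (Res l x) - Res l x)"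
  proof -
    have "Res l (D t) = (2 / t\<^sup>2) *\<^sub>R (S t (Res l x) - Res l x)" if "0 < t" for t
      using Phi_S_commute[OF kernel_Res l, of t x, folded Res_def] that
      by (simp add: D_def linear_cmul[OF Res_linear] linear_diff[OF Res_linear])
    then show ?thesis unfolding eventually_at_right_field by (intro exI[of _ 1]) simp
  qed
  ultimately have "limitin \<gamma> (\<lambda>t. (2 / t\<^sup>2) *\<^sub>R (S t (Res l x) - Res l x)) (Res l y) (at_right 0)"
    by (rule limitin_transform_eventually[rotated])
  then have "limitin \<tau> (\<lambda>t. (2 / t\<^sup>2) *\<^sub>R (S t (Res l x) - Res l x)) (Res l y) (at_right 0)"
    by (rule limitin_gamma_imp_tau)
  moreover have "limitin \<tau> (\<lambda>t. (2 / t\<^sup>2) *\<^sub>R (S t (Res l x) - Res l x)) (l\<^sup>2 *\<^sub>R Res l x - x) (at_right 0)"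
    using generator_Res[of x] unfolding bi_generator_eq_Some by blast
  ultimately have "Res l y = l\<^sup>2 *\<^sub>R Res l x - x" by (rule tau_limit_unique) simp
  then show ?thesis by (simp add: linear_diff[OF Res_linear] linear_cmul[OF Res_linear])
qed

text \<open>The graph of the generator becomes the solution set of one equation between
  \<gamma>-continuous linear maps; the closedness and closure arguments rest on this.\<close>

lemma generator_iff: "bi_generator \<tau> S x = Some y \<longleftrightarrow> Res l (l\<^sup>2 *\<^sub>R x - y) = x"
  using Res_of_generator[of x y] generator_Res[of "l\<^sup>2 *\<^sub>R x - y"] by fastforce

lemma inj_Res: "inj (Res l)"
proof (rule injI)
  fix x y assume h: "Res l x = Res l y"
  have "bi_generator \<tau> S (Res l y) = Some (l\<^sup>2 *\<^sub>R Res l y - x)"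
    using generator_Res[of x] unfolding h .
  then show "x = y" using generator_Res[of y] by simp
qed

lemma dom_generator: "dom (bi_generator \<tau> S) = range (Res l)"
proof
  show "dom (bi_generator \<tau> S) \<subseteq> range (Res l)"
  proof
    fix x assume "x \<in> dom (bi_generator \<tau> S)"
    then obtain y where "bi_generator \<tau> S x = Some y" unfolding dom_def by fast
    from Res_of_generator[OF this] show "x \<in> range (Res l)" by (metis rangeI)
  qed
  show "range (Res l) \<subseteq> dom (bi_generator \<tau> S)"
    using domI[of "bi_generator \<tau> S", OF generator_Res] by (rule image_subsetI)
qed

lemma scalar_minus_generator:
  "scalar_minus sc (of_real (l\<^sup>2)) (bi_generator \<tau> S) (Res l x) = x"
  unfolding scalar_minus_def generator_Res normed_scalingD(2)[OF scaling] by simp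

lemma resolvent_exists_generator: "resolvent_exists sc (of_real (l\<^sup>2)) (bi_generator \<tau> S)"
  unfolding resolvent_exists_def dom_generator
  by (rule bij_betw_byWitness[where f' = "Res l"]) (auto simp only: scalar_minus_generator image_iff)

lemma resolvent_generator: "resolvent sc (of_real (l\<^sup>2)) (bi_generator \<tau> S) = Res l"
proof
  fix x
  have "inj_on (scalar_minus sc (of_real (l\<^sup>2)) (bi_generator \<tau> S)) (dom (bi_generator \<tau> S))"
    using resolvent_exists_generator by (simp add: resolvent_exists_def bij_betw_def)
  then show "resolvent sc (of_real (l\<^sup>2)) (bi_generator \<tau> S) x = Res l x"
    unfolding resolvent_def by (rule the_inv_into_f_eq) (simp_all only: scalar_minus_generator dom_generator rangeI)
qed

text \<open>Differentiating \<open>t^k * exp (- l * t)\<close> twice reproduces it with the factor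
  \<open>l^2\<close> up to terms of lower degree, so \<open>Res l\<close> recovers it from these.
  The multiple of \<open>x\<close> stems from the kink and vanishes for \<open>k \<ge> 2\<close>.
  Truncation in \<open>k - 1\<close> and \<open>k - 2\<close> is harmless because the coefficients
  vanish there.\<close>

lemma laguerre_recursion:
  "Phi (\<lambda>t. laguerre l k \<bar>t\<bar>) x = Res l
    ((2 * l * real k) *\<^sub>R Phi (\<lambda>t. laguerre l (k - 1) \<bar>t\<bar>) x
      - (real k * real (k - 1)) *\<^sub>R Phi (\<lambda>t. laguerre l (k - 2) \<bar>t\<bar>) x
      - (2 * (real k * laguerre l (k - 1) 0 - l * laguerre l k 0)) *\<^sub>R x)"
proof -
  \<comment> \<open>The polynomial factor spoils the decay rate \<open>l\<close>, so a rate strictly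
    between \<open>\<omega>\<close> and \<open>l\<close> is used.\<close>
  define a where "a = (l + \<omega>) / 2"
  have a: "\<omega> < a" "a < l" using l by (auto simp: a_def)
  let ?L = "\<lambda>k t. laguerre l k t"
  define \<phi>1 where "\<phi>1 t = real k * ?L (k - 1) t - l * ?L k t" for t
  define \<phi>2 where "\<phi>2 t = ((real k * real (k - 1)) * ?L (k - 2) t - (2 * l * real k) * ?L (k - 1) t) + l\<^sup>2 * ?L k t" for t
  define \<phi>3 where "\<phi>3 t = ((real k * real (k - 1)) * (real (k - 2) * ?L (k - 2 - 1) t - l * ?L (k - 2) t)
      - (2 * l * real k) * (real (k - 1) * ?L (k - 1 - 1) t - l * ?L (k - 1) t)) + l\<^sup>2 * (real k * ?L (k - 1) t - l * ?L k t)" for t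
  note kl = kernel_laguerre[OF a(2)]
  have d1: "(?L k has_real_derivative \<phi>1 t) (at t)" for t
    unfolding \<phi>1_def by (rule laguerre_deriv)
  have d2: "(\<phi>1 has_real_derivative \<phi>2 t) (at t)" for t
    unfolding \<phi>1_def[abs_def] \<phi>2_def
    by (rule derivative_eq_intros laguerre_deriv refl)+ (simp add: algebra_simps power2_eq_square numeral_2_eq_2)
  have d3: "(\<phi>2 has_real_derivative \<phi>3 t) (at t)" for t
    unfolding \<phi>2_def[abs_def] \<phi>3_def
    by (rule derivative_eq_intros laguerre_deriv refl)+ (simp add: algebra_simps)
  have k2: "kernel a (\<lambda>t. \<phi>2 \<bar>t\<bar>)"
    unfolding \<phi>2_def by (intro kernel_add kernel_diff kernel_cmult kl)
  have "kernel a (\<lambda>t. \<phi>3 \<bar>t\<bar>)"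
    unfolding \<phi>3_def by (intro kernel_add kernel_diff kernel_cmult kl)
  then obtain C where "\<And>t. \<bar>\<phi>3 \<bar>t\<bar>\<bar> \<le> C * exp (- a * \<bar>t\<bar>)" by (auto simp: kernel_def)
  then have bd: "\<bar>\<phi>3 t\<bar> \<le> C * exp (- a * t)" if "0 \<le> t" for t using that by (metis abs_of_nonneg)
  have "bi_generator \<tau> S (Phi (\<lambda>t. ?L k \<bar>t\<bar>) x) = Some (Phi (\<lambda>t. \<phi>2 \<bar>t\<bar>) x + (2 * \<phi>1 0) *\<^sub>R x)"
    by (rule generator_Phi[OF d1 d2 d3 bd kl k2 a(1)])
  from Res_of_generator[OF this]
  have "Phi (\<lambda>t. ?L k \<bar>t\<bar>) x = Res l (l\<^sup>2 *\<^sub>R Phi (\<lambda>t. ?L k \<bar>t\<bar>) x - (Phi (\<lambda>t. \<phi>2 \<bar>t\<bar>) x + (2 * \<phi>1 0) *\<^sub>R x))"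
    by simp
  moreover have "Phi (\<lambda>t. \<phi>2 \<bar>t\<bar>) x = ((real k * real (k - 1)) *\<^sub>R Phi (\<lambda>t. ?L (k - 2) \<bar>t\<bar>) x
      - (2 * l * real k) *\<^sub>R Phi (\<lambda>t. ?L (k - 1) \<bar>t\<bar>) x) + l\<^sup>2 *\<^sub>R Phi (\<lambda>t. ?L k \<bar>t\<bar>) x"
    unfolding \<phi>2_def
    by (subst Phi_add[OF _ _ a(1)], intro kernel_diff kernel_cmult kl, intro kernel_cmult kl,
        subst Phi_diff[OF _ _ a(1)], intro kernel_cmult kl, intro kernel_cmult kl) (simp only: Phi_cmult[OF kl a(1)])
  ultimately show ?thesis by (simp add: \<phi>1_def algebra_simps)
qed

end

text \<open>\<open>m^2\<close> times \<open>Res m x\<close> averages the orbit against the density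
  \<open>m / 2 * exp (- m * |t|)\<close> of total mass 1, which concentrates at 0 as
  \<open>m\<close> grows.\<close>

lemma Res_approx:
  assumes p: "p \<in> \<Gamma>"
  shows "((\<lambda>m. p (m\<^sup>2 *\<^sub>R Res m x - x)) \<longlongrightarrow> 0) at_top"
proof (rule tendstoI)
  fix \<epsilon> :: real assume \<epsilon>: "0 < \<epsilon>"
  note sn = \<Gamma>_seminorm[OF p]
  define b where "b = \<omega> + 1"
  have b: "\<omega> < b" "0 < b" using omega by (auto simp: b_def)
  obtain q where q: "q \<in> \<Gamma>" "\<And>t x. 0 \<le> t \<Longrightarrow> p (S t x) \<le> exp (b * t) * q x"
    using S_equi[OF p b(1)] by blast
  define Q where "Q = q x + p x"
  have Q0: "0 \<le> Q" using seminorm_nonneg[OF sn] seminorm_nonneg[OF \<Gamma>_seminorm[OF q(1)]] by (simp add: Q_def)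
  have Q: "p (S t x - x) \<le> exp (b * t) * Q" if "0 \<le> t" for t
  proof -
    have "p (S t x - x) \<le> p (S t x) + p x" by (rule seminorm_diff_le[OF sn])
    also have "\<dots> \<le> exp (b * t) * q x + exp (b * t) * p x"
    proof (intro add_mono q(2)[OF that])
      have "1 * p x \<le> exp (b * t) * p x" using b that seminorm_nonneg[OF sn] by (intro mult_right_mono) auto
      then show "p x \<le> exp (b * t) * p x" by simp
    qed
    finally show ?thesis by (simp add: Q_def algebra_simps)
  qed
  have "\<forall>\<^sub>F s in at 0 within {0..}. dist (p (S s x - S 0 x)) 0 < \<epsilon> / 2"
    by (rule tendstoD[OF S_cont[OF p]]) (use \<epsilon> in auto)
  then obtain \<delta> where \<delta>: "\<delta> > 0" "\<And>s. 0 \<le> s \<Longrightarrow> s \<noteq> 0 \<Longrightarrow> dist s 0 < \<delta> \<Longrightarrow> dist (p (S s x - S 0 x)) 0 < \<epsilon> / 2"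
    unfolding eventually_at by force
  have T: "p (S t x - x) \<le> \<epsilon> / 2" if "0 \<le> t" "t < \<delta>" for t
    using \<delta>(2)[of t] that \<epsilon> S_0 by (cases "t = 0") (auto simp: seminorm_zero[OF sn])
  \<comment> \<open>\<open>4 * b \<le> m\<close> gives \<open>m \<le> 4 * (m / 2 - b)\<close>, the
    origin of the factor 4 in the tail.\<close>
  have est: "p (m\<^sup>2 *\<^sub>R Res m x - x) \<le> \<epsilon> / 2 + 4 * Q * exp (- (m / 2 * \<delta>))" if m: "4 * b \<le> m" for m
  proof -
    have m\<omega>: "\<omega> < m" "0 < m" using m b by auto
    have "wint (\<lambda>t. m\<^sup>2 *\<^sub>R ((exp (- m * \<bar>t\<bar>) / (2 * m)) *\<^sub>R S \<bar>t\<bar> x)) (m\<^sup>2 *\<^sub>R Res m x)"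
      unfolding Res_def by (intro wint_scaleR Phi_wint[OF kernel_Res[OF m\<omega>(1)] m\<omega>(1)])
    moreover have "wint (\<lambda>t. (m / 2 * exp (- m * \<bar>t\<bar>)) *\<^sub>R x) ((m / 2 * (2 / m)) *\<^sub>R x)"
      by (intro wint_const has_bochner_integral_mult_right has_bochner_integral_exp_abs m\<omega>)
    ultimately have w: "wint (\<lambda>t. m\<^sup>2 *\<^sub>R ((exp (- m * \<bar>t\<bar>) / (2 * m)) *\<^sub>R S \<bar>t\<bar> x) - (m / 2 * exp (- m * \<bar>t\<bar>)) *\<^sub>R x) (m\<^sup>2 *\<^sub>R Res m x - x)"
      using m\<omega> wint_diff by fastforce
    \<comment> \<open>The first term serves times below \<open>\<delta>\<close>. In the tail, half
      of the rate \<open>m\<close> is spent on the factor \<open>exp (- (m / 2 * \<delta>))\<close>,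
      and the other half dominates the growth \<open>b\<close>.\<close>
    define g where "g t = \<epsilon> / 2 * (m / 2) * exp (- m * \<bar>t\<bar>) + Q * (m / 2) * exp (- (m / 2 * \<delta>)) * exp (- (m / 2 - b) * \<bar>t\<bar>)" for t
    have pos: "0 < m / 2 - b" "m \<le> 4 * (m / 2 - b)" using m b by auto
    have "has_bochner_integral lborel g (\<epsilon> / 2 * (m / 2) * (2 / m) + Q * (m / 2) * exp (- (m / 2 * \<delta>)) * (2 / (m / 2 - b)))"
      unfolding g_def[abs_def]
      by (intro has_bochner_integral_add has_bochner_integral_mult_right has_bochner_integral_exp_abs m\<omega> pos)
    moreover have "p (m\<^sup>2 *\<^sub>R ((exp (- m * \<bar>t\<bar>) / (2 * m)) *\<^sub>R S \<bar>t\<bar> x) - (m / 2 * exp (- m * \<bar>t\<bar>)) *\<^sub>R x) \<le> g t" for t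
    proof -
      have "m\<^sup>2 * (exp (- m * \<bar>t\<bar>) / (2 * m)) = m / 2 * exp (- m * \<bar>t\<bar>)"
        using m\<omega> by (simp add: power2_eq_square)
      then have "p (m\<^sup>2 *\<^sub>R ((exp (- m * \<bar>t\<bar>) / (2 * m)) *\<^sub>R S \<bar>t\<bar> x) - (m / 2 * exp (- m * \<bar>t\<bar>)) *\<^sub>R x)
          = p ((m / 2 * exp (- m * \<bar>t\<bar>)) *\<^sub>R (S \<bar>t\<bar> x - x))"
        by (simp only: scaleR_scaleR scaleR_diff_right)
      also have "\<dots> = m / 2 * exp (- m * \<bar>t\<bar>) * p (S \<bar>t\<bar> x - x)"
        using m\<omega> by (simp add: seminorm_scale[OF sn])
      also have "\<dots> \<le> g t"
      proof (cases "\<bar>t\<bar> < \<delta>")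
        case True
        have "m / 2 * exp (- m * \<bar>t\<bar>) * p (S \<bar>t\<bar> x - x) \<le> m / 2 * exp (- m * \<bar>t\<bar>) * (\<epsilon> / 2)"
          using True m\<omega> by (intro mult_left_mono T) auto
        moreover have "0 \<le> Q * (m / 2) * exp (- (m / 2 * \<delta>)) * exp (- (m / 2 - b) * \<bar>t\<bar>)" using Q0 m\<omega> by simp
        ultimately show ?thesis by (simp add: g_def mult_ac)
      next
        case False
        have "m / 2 * exp (- m * \<bar>t\<bar>) * p (S \<bar>t\<bar> x - x) \<le> m / 2 * exp (- m * \<bar>t\<bar>) * (exp (b * \<bar>t\<bar>) * Q)"
          using m\<omega> by (intro mult_left_mono Q) auto
        also have "\<dots> = Q * (m / 2) * (exp (- m * \<bar>t\<bar>) * exp (b * \<bar>t\<bar>))" by simp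
        also have "\<dots> \<le> Q * (m / 2) * (exp (- (m / 2 * \<delta>)) * exp (- (m / 2 - b) * \<bar>t\<bar>))"
        proof (rule mult_left_mono)
          have "m / 2 * \<delta> \<le> m / 2 * \<bar>t\<bar>" using False m\<omega> by (intro mult_left_mono) auto
          then show "exp (- m * \<bar>t\<bar>) * exp (b * \<bar>t\<bar>) \<le> exp (- (m / 2 * \<delta>)) * exp (- (m / 2 - b) * \<bar>t\<bar>)"
            by (simp add: algebra_simps flip: exp_add)
        qed (use Q0 m\<omega> in auto)
        also have "\<dots> \<le> g t" using \<epsilon> m\<omega> by (simp add: g_def mult.assoc)
        finally show ?thesis .
      qed
      finally show ?thesis .
    qed
    ultimately have "p (m\<^sup>2 *\<^sub>R Res m x - x) \<le> \<epsilon> / 2 * (m / 2) * (2 / m) + Q * (m / 2) * exp (- (m / 2 * \<delta>)) * (2 / (m / 2 - b))"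
      using wint_bound[OF w p] by blast
    also have "\<epsilon> / 2 * (m / 2) * (2 / m) = \<epsilon> / 2" using m\<omega> by simp
    also have "Q * (m / 2) * exp (- (m / 2 * \<delta>)) * (2 / (m / 2 - b)) = Q * exp (- (m / 2 * \<delta>)) * (m / (m / 2 - b))" by simp
    also have "\<dots> \<le> Q * exp (- (m / 2 * \<delta>)) * 4"
      using Q0 pos by (intro mult_left_mono) (simp_all add: pos_divide_le_eq)
    finally show ?thesis by (simp add: mult_ac)
  qed
  have "((\<lambda>m. 4 * Q * exp (- (m / 2 * \<delta>))) \<longlongrightarrow> 4 * Q * 0) at_top"
  proof (intro tendsto_mult tendsto_const filterlim_compose[OF exp_at_bot])
    show "LIM m at_top. - (m / 2 * \<delta>) :> at_bot"
      using filterlim_tendsto_neg_mult_at_bot[OF tendsto_const[of "- (\<delta> / 2)"] _ filterlim_ident] \<delta>(1)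
      by (simp add: mult.commute)
  qed
  then have "\<forall>\<^sub>F m in at_top. 4 * Q * exp (- (m / 2 * \<delta>)) < \<epsilon> / 2"
    by (rule order_tendstoD(2)) (use \<epsilon> in simp)
  moreover have "\<forall>\<^sub>F m in at_top. 4 * b \<le> m" by (rule eventually_ge_at_top)
  ultimately show "\<forall>\<^sub>F m in at_top. dist (p (m\<^sup>2 *\<^sub>R Res m x - x)) 0 < \<epsilon>"
  proof eventually_elim
    case (elim m)
    have "p (m\<^sup>2 *\<^sub>R Res m x - x) < \<epsilon>" using est[OF elim(2)] elim(1) by simp
    then show ?case by (simp add: seminorm_nonneg[OF sn])
  qed
qed

text \<open>All resolvents have the domain of the generator as their range, so \<open>m^2\<close>
  times \<open>Res m x\<close> approximates \<open>x\<close> from within the range of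
  \<open>Res l\<close>.\<close>

lemma bi_dense_range_Res:
  assumes l: "\<omega> < l" shows "bi_dense \<tau> (range (Res l))"
  unfolding bi_dense_def
proof
  fix x
  define m where "m n = real n + (\<omega> + 1)" for n :: nat
  define s where "s n = (m n)\<^sup>2 *\<^sub>R Res (m n) x" for n
  have m: "\<omega> < m n" for n by (simp add: m_def)
  have lim: "limitin \<gamma> s x sequentially"
    unfolding limitin_gamma
  proof
    fix p assume p: "p \<in> \<Gamma>"
    have "filterlim m at_top sequentially"
      by (rule filterlim_at_top_mono[OF filterlim_real_sequentially]) (use omega in \<open>simp add: m_def\<close>)
    from filterlim_compose[OF Res_approx[OF p] this] show "(\<lambda>n. p (s n - x)) \<longlonglongrightarrow> 0" by (simp add: s_def)
  qed
  moreover have "range s \<subseteq> range (Res l)"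
  proof clarify
    fix n
    have "Res (m n) x = Res l (l\<^sup>2 *\<^sub>R Res (m n) x - ((m n)\<^sup>2 *\<^sub>R Res (m n) x - x))" (is "_ = Res l ?y")
      using Res_of_generator[OF l generator_Res[OF m, of n x]] by simp
    then have "s n = Res l ((m n)\<^sup>2 *\<^sub>R ?y)" by (simp add: s_def linear_cmul[OF Res_linear[OF l]])
    then show "s n \<in> range (Res l)" by blast
  qed
  ultimately show "\<exists>s. range s \<subseteq> range (Res l) \<and> bounded (range s) \<and> limitin \<tau> s x sequentially"
    using limitin_gamma_iff by blast
qed

text \<open>The complement is open: where the equation of \<open>generator_iff\<close> fails, some
  seminorm detects the defect and keeps detecting it nearby.\<close>

lemma graph_closed_generator:
  assumes l: "\<omega> < l" shows "graph_closed \<gamma> (bi_generator \<tau> S)"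
  unfolding graph_closed_def closedin_def
proof
  show "openin (prod_topology \<gamma> \<gamma>) (topspace (prod_topology \<gamma> \<gamma>) - {(x, y). bi_generator \<tau> S x = Some y})"
    unfolding openin_prod_topology_alt
  proof (intro allI impI)
    fix x y assume "(x, y) \<in> topspace (prod_topology \<gamma> \<gamma>) - {(x, y). bi_generator \<tau> S x = Some y}"
    then have ne: "Res l (l\<^sup>2 *\<^sub>R x - y) - x \<noteq> 0" by (simp add: generator_iff[OF l])
    define T where "T x y = Res l (l\<^sup>2 *\<^sub>R x - y) - x" for x y
    obtain p where p: "p \<in> \<Gamma>" "0 < p (T x y)"
      using eq_0_if_\<Gamma>_0[of "T x y"] ne by (force simp: T_def)
    note sn = \<Gamma>_seminorm[OF p(1)]
    obtain q where q: "q \<in> \<Gamma>" "\<And>x. p (Res l x) \<le> q x" using Res_equi[OF l p(1)] by blast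
    define \<eta> where "\<eta> = p (T x y)"
    \<comment> \<open>Positive and at least \<open>l^2\<close>; the three terms of the difference
      receive a third of \<open>\<eta>\<close> each.\<close>
    define c where "c = l\<^sup>2 + 1"
    have l0: "0 < c" "l\<^sup>2 \<le> c" by (auto simp: c_def add_nonneg_pos)
    let ?U = "{u. q (u - x) < \<eta> / (3 * c)} \<inter> {u. p (u - x) < \<eta> / 3}"
    let ?V = "{v. q (v - y) < \<eta> / 3}"
    have "openin \<gamma> ?U" by (intro openin_Int \<Gamma>_translate_ball_open p q)
    moreover have "openin \<gamma> ?V" by (intro \<Gamma>_translate_ball_open q)
    moreover have "x \<in> ?U" "y \<in> ?V"
      using p q(1) l0 by (simp_all add: \<eta>_def seminorm_zero \<Gamma>_seminorm)
    moreover have "bi_generator \<tau> S u \<noteq> Some v" if u: "u \<in> ?U" and v: "v \<in> ?V" for u v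
    proof
      assume "bi_generator \<tau> S u = Some v"
      then have "T u v = 0" by (simp add: T_def generator_iff[OF l])
      have "T x y = Res l (l\<^sup>2 *\<^sub>R (x - u)) - Res l (y - v) - (x - u)"
        using \<open>T u v = 0\<close> by (simp add: T_def linear_diff[OF Res_linear[OF l]] linear_cmul[OF Res_linear[OF l]] algebra_simps)
      then have "\<eta> \<le> p (Res l (l\<^sup>2 *\<^sub>R (x - u))) + p (Res l (y - v)) + p (x - u)"
        using seminorm_diff_le[OF sn, of "Res l (l\<^sup>2 *\<^sub>R (x - u)) - Res l (y - v)" "x - u"]
          seminorm_diff_le[OF sn, of "Res l (l\<^sup>2 *\<^sub>R (x - u))" "Res l (y - v)"] by (simp add: \<eta>_def)
      also have "p (Res l (l\<^sup>2 *\<^sub>R (x - u))) \<le> l\<^sup>2 * q (x - u)"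
        using q(2)[of "l\<^sup>2 *\<^sub>R (x - u)"] by (simp add: seminorm_scale[OF \<Gamma>_seminorm[OF q(1)]])
      also have "\<dots> \<le> c * q (x - u)"
        using seminorm_nonneg[OF \<Gamma>_seminorm[OF q(1)], of "x - u"] l0 by (intro mult_right_mono)
      also have "\<dots> < c * (\<eta> / (3 * c))"
        using u l0 by (intro mult_strict_left_mono) (auto simp: seminorm_minus_commute[OF \<Gamma>_seminorm[OF q(1)], of x])
      also have "\<dots> = \<eta> / 3" using l0 by simp
      also have "p (Res l (y - v)) \<le> \<eta> / 3"
        using q(2)[of "y - v"] v by (simp add: seminorm_minus_commute[OF \<Gamma>_seminorm[OF q(1)], of y])
      also have "p (x - u) \<le> \<eta> / 3" using u by (simp add: seminorm_minus_commute[OF sn, of x])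
      finally show False by simp
    qed
    ultimately show "\<exists>U V. openin \<gamma> U \<and> openin \<gamma> V \<and> x \<in> U \<and> y \<in> V \<and>
        U \<times> V \<subseteq> topspace (prod_topology \<gamma> \<gamma>) - {(x, y). bi_generator \<tau> S x = Some y}"
      by (intro exI[of _ ?U] exI[of _ ?V] conjI) (assumption | auto)+
  qed
qed simp

lemma linear_op_generator: "linear_op sc (bi_generator \<tau> S)"
proof -
  \<comment> \<open>Any point above \<open>\<omega>\<close> serves, as the statement does not
    involve \<open>l\<close>.\<close>
  define l where "l = \<omega> + 1"
  have l: "\<omega> < l" by (simp add: l_def)
  interpret vector_space sc by (rule normed_scalingD[OF scaling])
  note R = Res_sc_linear[OF l, unfolded Vector_Spaces.linear_iff]
  have add: "Res l (x + y) = Res l x + Res l y" for x y using R by blast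
  have sca: "Res l (sc c x) = sc c (Res l x)" for c x using R by blast
  have val: "the (bi_generator \<tau> S (Res l x)) = l\<^sup>2 *\<^sub>R Res l x - x" for x
    by (simp add: generator_Res[OF l])
  have sR: "sc c (r *\<^sub>R x) = r *\<^sub>R sc c x" for c r x
    by (simp flip: normed_scalingD(2)[OF scaling])
  show ?thesis
    unfolding linear_op_def dom_generator[OF l]
  proof (intro conjI ballI allI)
    show "subspace (range (Res l))"
      unfolding subspace_def
    proof (intro conjI ballI allI)
      show "0 \<in> range (Res l)" using linear_0[OF Res_linear[OF l]] by (metis rangeI)
      show "x + y \<in> range (Res l)" if "x \<in> range (Res l)" "y \<in> range (Res l)" for x y
        using that by (auto simp flip: add)
      show "sc c x \<in> range (Res l)" if "x \<in> range (Res l)" for c x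
        using that by (auto simp flip: sca)
    qed
    show "the (bi_generator \<tau> S (x + y)) = the (bi_generator \<tau> S x) + the (bi_generator \<tau> S y)"
      if xy: "x \<in> range (Res l)" "y \<in> range (Res l)" for x y
    proof -
      obtain u v where uv: "x = Res l u" "y = Res l v" using xy by blast
      show ?thesis unfolding uv add[symmetric] val by (simp add: add algebra_simps)
    qed
    show "the (bi_generator \<tau> S (sc c x)) = sc c (the (bi_generator \<tau> S x))" if x: "x \<in> range (Res l)" for c x
    proof -
      obtain u where u: "x = Res l u" using x by blast
      show ?thesis unfolding u sca[symmetric] val by (simp add: sca sR scale_right_diff_distrib)
    qed
  qed
qed

end

section \<open>Sequences of cosine families\<close>

text \<open>Mean value estimate: the larger of the two exponentials bounds the derivative in
  between.\<close>

lemma exp_neg_diff_le: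
  fixes A B :: real shows "\<bar>exp (- A) - exp (- B)\<bar> \<le> \<bar>A - B\<bar> * exp (- min A B)"
proof -
  have *: "\<bar>exp (- A) - exp (- B)\<bar> \<le> \<bar>A - B\<bar> * exp (- min A B)" if "A \<le> B" for A B :: real
  proof -
    have "exp (- A) - exp (- B) = exp (- A) * (1 - exp (- (B - A)))" by (simp add: algebra_simps flip: exp_add)
    also have "\<dots> \<le> exp (- A) * (B - A)"
    proof (rule mult_left_mono)
      have "1 + - (B - A) \<le> exp (- (B - A))" by (rule exp_ge_add_one_self)
      then show "1 - exp (- (B - A)) \<le> B - A" by linarith
    qed simp
    finally show ?thesis using that by (simp add: mult.commute)
  qed
  show ?thesis using *[of A B] *[of B A] by (cases "A \<le> B") (auto simp: abs_minus_commute min.commute)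
qed

context mixed_saks
begin

lemma limitin_gammaI_squeeze:
  assumes "\<And>p. p \<in> \<Gamma> \<Longrightarrow> \<exists>g. (g \<longlongrightarrow> 0) F \<and> (\<forall>i. p (s i - x) \<le> g i)"
  shows "limitin \<gamma> s x F"
  unfolding limitin_gamma
proof
  fix p assume p: "p \<in> \<Gamma>"
  obtain g where g: "(g \<longlongrightarrow> 0) F" "\<And>i. p (s i - x) \<le> g i" using assms[OF p] by blast
  show "((\<lambda>i. p (s i - x)) \<longlongrightarrow> 0) F"
    by (rule tendsto_0_squeeze[OF g(1)]) (use g(2) seminorm_nonneg[OF \<Gamma>_seminorm[OF p]] in auto)
qed

lemma limitin_gammaD: "limitin \<gamma> s x F \<Longrightarrow> p \<in> \<Gamma> \<Longrightarrow> ((\<lambda>i. p (s i - x)) \<longlongrightarrow> 0) F"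
  by (simp add: limitin_gamma)

lemma limitin_gamma_const: "limitin \<gamma> (\<lambda>_. x) x F"
  by (simp add: limitin_gamma seminorm_zero[OF \<Gamma>_seminorm])

lemma ex_limitin_gamma_0: "\<exists>y. limitin \<gamma> (\<lambda>_. 0) y F"
  by (rule exI) (rule limitin_gamma_const)

lemma limitin_gamma_scaleR:
  assumes "limitin \<gamma> s x F" shows "limitin \<gamma> (\<lambda>i. c *\<^sub>R s i) (c *\<^sub>R x) F"
proof (rule limitin_gammaI_squeeze)
  fix p assume p: "p \<in> \<Gamma>"
  have "((\<lambda>i. \<bar>c\<bar> * p (s i - x)) \<longlongrightarrow> 0) F"
    using tendsto_mult_left[OF limitin_gammaD[OF assms p], of "\<bar>c\<bar>"] by simp
  then show "\<exists>g. (g \<longlongrightarrow> 0) F \<and> (\<forall>i. p (c *\<^sub>R s i - c *\<^sub>R x) \<le> g i)"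
    by (intro exI[of _ "\<lambda>i. \<bar>c\<bar> * p (s i - x)"])
       (simp add: seminorm_scale[OF \<Gamma>_seminorm[OF p]] flip: scaleR_diff_right)
qed

lemma limitin_gamma_add:
  assumes "limitin \<gamma> s x F" "limitin \<gamma> r y F" shows "limitin \<gamma> (\<lambda>i. s i + r i) (x + y) F"
proof (rule limitin_gammaI_squeeze)
  fix p assume p: "p \<in> \<Gamma>"
  have "((\<lambda>i. p (s i - x) + p (r i - y)) \<longlongrightarrow> 0) F"
    using tendsto_add[OF limitin_gammaD[OF assms(1) p] limitin_gammaD[OF assms(2) p]] by simp
  moreover have "p (s i + r i - (x + y)) \<le> p (s i - x) + p (r i - y)" for i
    using seminorm_triangle[OF \<Gamma>_seminorm[OF p], of "s i - x" "r i - y"] by (simp add: algebra_simps)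
  ultimately show "\<exists>g. (g \<longlongrightarrow> 0) F \<and> (\<forall>i. p (s i + r i - (x + y)) \<le> g i)" by blast
qed

lemma limitin_gamma_diff:
  assumes "limitin \<gamma> s x F" "limitin \<gamma> r y F" shows "limitin \<gamma> (\<lambda>i. s i - r i) (x - y) F"
  using limitin_gamma_add[OF assms(1) limitin_gamma_scaleR[OF assms(2), of "- 1"]] by simp

lemma limitin_gamma_seminorm:
  assumes "limitin \<gamma> s x F" "p \<in> \<Gamma>" shows "((\<lambda>i. p (s i)) \<longlongrightarrow> p x) F"
proof -
  have "((\<lambda>i. \<bar>p (s i) - p x\<bar>) \<longlongrightarrow> 0) F"
    by (rule tendsto_0_squeeze[OF limitin_gammaD[OF assms]])
       (simp_all add: seminorm_reverse_triangle[OF \<Gamma>_seminorm[OF assms(2)]])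
  then show ?thesis by (simp add: tendsto_rabs_zero_iff LIM_zero_iff)
qed

end

locale saks_cosine_sequence = mixed_saks sc \<tau> \<gamma> P
  for sc :: "'k::real_normed_field \<Rightarrow> 'a::real_normed_vector \<Rightarrow> 'a"
    and \<tau> \<gamma> :: "'a topology" and P :: "('a \<Rightarrow> real) set" +
  fixes Sn :: "nat \<Rightarrow> real \<Rightarrow> 'a \<Rightarrow> 'a" and M \<omega> :: real
  assumes Sn_cosine: "saks_cosine sc \<tau> \<gamma> P (Sn n) M \<omega>"
    and Sn_equi: "p \<in> \<Gamma> \<Longrightarrow> \<omega> < b \<Longrightarrow> \<exists>q\<in>\<Gamma>. \<forall>n. \<forall>t\<ge>0. \<forall>x. p (Sn n t x) \<le> exp (b * t) * q x"
begin

sublocale F: saks_cosine sc \<tau> \<gamma> P "Sn n" M \<omega> for n by (rule Sn_cosine)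

lemma omega_nonneg: "0 \<le> \<omega>" by (rule F.omega)

text \<open>Only the existence of limits is recorded: approximation arguments produce them through
  completeness, without naming a limit operator.\<close>

definition kconv :: "(real \<Rightarrow> real) \<Rightarrow> bool" where
  "kconv e \<longleftrightarrow> (\<forall>x. \<exists>y. limitin \<gamma> (\<lambda>n. F.Phi n e x) y sequentially)"

text \<open>The order of choices matters: \<open>q\<close> is fixed before \<open>n\<close>,
  \<open>e\<close> and \<open>K\<close>, so kernels that are close in the weighted norm give
  operators that are close uniformly in \<open>n\<close>.\<close>

lemma Phi_equi_uniform:
  assumes a: "\<omega> < a" and p: "p \<in> \<Gamma>"
  obtains q where "q \<in> \<Gamma>" "\<And>n e K x. kernel a e \<Longrightarrow> (\<And>t. \<bar>e t\<bar> \<le> K * exp (- a * \<bar>t\<bar>)) \<Longrightarrow> p (F.Phi n e x) \<le> K * q x"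
proof -
  define b where "b = (a + \<omega>) / 2"
  have b: "\<omega> < b" "b < a" using a by (auto simp: b_def)
  obtain q where q: "q \<in> \<Gamma>" "\<And>n t x. 0 \<le> t \<Longrightarrow> p (Sn n t x) \<le> exp (b * t) * q x"
    using Sn_equi[OF p b(1)] by blast
  show ?thesis
  proof (rule that)
    show "(\<lambda>x. 2 / (a - b) * q x) \<in> \<Gamma>" using b by (intro \<Gamma>_cmult q) auto
    show "p (F.Phi n e x) \<le> K * (2 / (a - b) * q x)"
      if "kernel a e" "\<And>t. \<bar>e t\<bar> \<le> K * exp (- a * \<bar>t\<bar>)" for n e K x
      using F.Phi_bound[OF that(1) a p that(2) b(2) q(2), of n x] by (simp add: mult_ac)
  qed
qed

lemma kconv_add:
  assumes "kernel a e" "kernel a e'" "\<omega> < a" "kconv e" "kconv e'"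
  shows "kconv (\<lambda>t. e t + e' t)"
  unfolding kconv_def
proof
  fix x
  obtain y where "limitin \<gamma> (\<lambda>n. F.Phi n e x) y sequentially" using assms(4) by (auto simp: kconv_def)
  moreover obtain z where "limitin \<gamma> (\<lambda>n. F.Phi n e' x) z sequentially" using assms(5) by (auto simp: kconv_def)
  ultimately show "\<exists>y. limitin \<gamma> (\<lambda>n. F.Phi n (\<lambda>t. e t + e' t) x) y sequentially"
    unfolding F.Phi_add[OF assms(1-3)] by (intro exI) (rule limitin_gamma_add)
qed

lemma kconv_cmult:
  assumes "kernel a e" "\<omega> < a" "kconv e"
  shows "kconv (\<lambda>t. c * e t)"
  unfolding kconv_def
proof
  fix x
  obtain y where "limitin \<gamma> (\<lambda>n. F.Phi n e x) y sequentially" using assms(3) by (auto simp: kconv_def)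
  then show "\<exists>y. limitin \<gamma> (\<lambda>n. F.Phi n (\<lambda>t. c * e t) x) y sequentially"
    unfolding F.Phi_cmult[OF assms(1,2)] by (intro exI) (rule limitin_gamma_scaleR)
qed

lemma kernel_kconv_sum:
  assumes a: "\<omega> < a" and I: "finite I" and e: "\<And>i. i \<in> I \<Longrightarrow> kernel a (e i) \<and> kconv (e i)"
  shows "kernel a (\<lambda>t. \<Sum>i\<in>I. c i * e i t) \<and> kconv (\<lambda>t. \<Sum>i\<in>I. c i * e i t)"
  using I e
proof (induction I)
  case empty
  have k0: "kernel a (\<lambda>_. 0)" by (rule kernelI[where K = 0]) auto
  have "F.Phi n (\<lambda>_. 0) x = 0" for n x using F.Phi_cmult[OF k0 a, of n 0 x] by simp
  then show ?case using k0 by (simp add: kconv_def ex_limitin_gamma_0)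
next
  case (insert i I)
  then have i: "kernel a (e i)" "kconv (e i)"
    and IH: "kernel a (\<lambda>t. \<Sum>i\<in>I. c i * e i t)" "kconv (\<lambda>t. \<Sum>i\<in>I. c i * e i t)" by auto
  have "kernel a (\<lambda>t. c i * e i t + (\<Sum>i\<in>I. c i * e i t))"
    by (rule kernel_add[OF kernel_cmult[OF i(1)] IH(1)])
  moreover have "kconv (\<lambda>t. c i * e i t + (\<Sum>i\<in>I. c i * e i t))"
    by (rule kconv_add[OF kernel_cmult[OF i(1)] IH(1) a kconv_cmult[OF i(1) a i(2)] IH(2)])
  ultimately show ?case using insert.hyps by simp
qed

text \<open>Closedness in the weighted supremum norm: passing to an approximating kernel moves all
  operators by less than a quarter of \<epsilon>, so the Cauchy property carries over.\<close>

lemma kconv_limit: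
  assumes a: "\<omega> < a" and e: "kernel a e"
    and approx: "\<And>\<epsilon>. 0 < \<epsilon> \<Longrightarrow> \<exists>e'. kernel a e' \<and> kconv e' \<and> (\<forall>t. \<bar>e t - e' t\<bar> \<le> \<epsilon> * exp (- a * \<bar>t\<bar>))"
  shows "kconv e"
  unfolding kconv_def
proof
  fix x
  show "\<exists>y. limitin \<gamma> (\<lambda>n. F.Phi n e x) y sequentially"
  proof (rule gamma_Cauchy_convergent)
    fix p and \<epsilon> :: real assume p: "p \<in> \<Gamma>" and \<epsilon>: "0 < \<epsilon>"
    note sn = \<Gamma>_seminorm[OF p]
    obtain q where q: "q \<in> \<Gamma>" "\<And>n e K x. kernel a e \<Longrightarrow> (\<And>t. \<bar>e t\<bar> \<le> K * exp (- a * \<bar>t\<bar>)) \<Longrightarrow> p (F.Phi n e x) \<le> K * q x"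
      using Phi_equi_uniform[OF a p] by metis
    have q0: "0 \<le> q x" by (rule seminorm_nonneg[OF \<Gamma>_seminorm[OF q(1)]])
    define \<eta> where "\<eta> = \<epsilon> / (4 * (q x + 1))"
    have \<eta>: "0 < \<eta>" "\<eta> * q x < \<epsilon> / 4"
    proof -
      show "0 < \<eta>" using \<epsilon> q0 by (simp add: \<eta>_def)
      then have "\<eta> * q x < \<eta> * (q x + 1)" by simp
      also have "\<dots> = \<epsilon> / 4" using q0 by (simp add: \<eta>_def field_simps)
      finally show "\<eta> * q x < \<epsilon> / 4" .
    qed
    obtain e' where e': "kernel a e'" "kconv e'" "\<And>t. \<bar>e t - e' t\<bar> \<le> \<eta> * exp (- a * \<bar>t\<bar>)"
      using approx[OF \<eta>(1)] by blast
    obtain y where y: "limitin \<gamma> (\<lambda>n. F.Phi n e' x) y sequentially" using e'(2) by (auto simp: kconv_def)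
    have "\<forall>\<^sub>F n in sequentially. p (F.Phi n e' x - y) < \<epsilon> / 4"
      by (rule order_tendstoD(2)[OF limitin_gammaD[OF y p]]) (use \<epsilon> in simp)
    then obtain N where N: "\<And>n. n \<ge> N \<Longrightarrow> p (F.Phi n e' x - y) < \<epsilon> / 4" by (auto simp: eventually_sequentially)
    have near: "p (F.Phi n e x - F.Phi n e' x) < \<epsilon> / 4" for n
      using q(2)[OF kernel_diff[OF e e'(1)] e'(3), of n x] \<eta>(2) by (simp add: F.Phi_diff[OF e e'(1) a])
    have close: "p (F.Phi n e x - y) < \<epsilon> / 2" if "n \<ge> N" for n
      using seminorm_diff_triangle[OF sn, of "F.Phi n e x" y "F.Phi n e' x"] near[of n] N[OF that] by simp
    have "p (F.Phi m e x - F.Phi n e x) < \<epsilon>" if "m \<ge> N" "n \<ge> N" for m n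
      using seminorm_diff_triangle[OF sn, of "F.Phi m e x" "F.Phi n e x" y] close[OF that(1)] close[OF that(2)]
        seminorm_minus_commute[OF sn, of y "F.Phi n e x"] by simp
    then show "\<exists>N. \<forall>m\<ge>N. \<forall>n\<ge>N. p (F.Phi m e x - F.Phi n e x) < \<epsilon>" by blast
  qed
qed

section \<open>Convergence of kernel operators from convergence of the resolvents at one
  point\<close>

context
  fixes l :: real assumes l: "\<omega> < l"
begin

lemma Res_equi_uniform:
  assumes p: "p \<in> \<Gamma>"
  shows "\<exists>q\<in>\<Gamma>. \<forall>n x. p (F.Res n l x) \<le> q x"
proof -
  obtain q where q: "q \<in> \<Gamma>" "\<And>n e K x. kernel l e \<Longrightarrow> (\<And>t. \<bar>e t\<bar> \<le> K * exp (- l * \<bar>t\<bar>)) \<Longrightarrow> p (F.Phi n e x) \<le> K * q x"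
    using Phi_equi_uniform[OF l p] by metis
  have l0: "0 < l" using l omega_nonneg by simp
  have "p (F.Res n l x) \<le> 1 / (2 * l) * q x" for n x
    unfolding F.Res_def by (rule q(2)[OF F.kernel_Res[OF l]]) (use l0 in simp)
  then show ?thesis using \<Gamma>_cmult[OF q(1), of "1 / (2 * l)"] l0 by (intro bexI[of _ "\<lambda>x. 1 / (2 * l) * q x"]) auto
qed

text \<open>The kernel of \<open>S s (Res l)\<close>: half the sum of the two translates of \<open>exp (- l \<bar>t\<bar>) / (2 l)\<close>.\<close>

definition shift_kernel :: "real \<Rightarrow> real \<Rightarrow> real" where
  "shift_kernel s t = 1 / 2 * (exp (- l * \<bar>t - s\<bar>) / (2 * l) + exp (- l * \<bar>t + s\<bar>) / (2 * l))"

lemma kernel_shift_kernel: "kernel l (shift_kernel s)"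
proof -
  have l0: "0 \<le> l" using l omega_nonneg by simp
  have "kernel l (\<lambda>t. exp (- l * \<bar>t - s\<bar>) / (2 * l))"
    using kernel_shift[OF F.kernel_Res[OF l] l0, of "- s"] by simp
  then show ?thesis
    unfolding shift_kernel_def[abs_def]
    by (intro kernel_cmult kernel_add kernel_shift[OF F.kernel_Res[OF l] l0])
qed

lemma Sn_Res: "0 \<le> s \<Longrightarrow> Sn n s (F.Res n l x) = F.Phi n (shift_kernel s) x"
proof -
  assume s: "0 \<le> s"
  have eq: "2 * shift_kernel s t = exp (- l * \<bar>t - s\<bar>) / (2 * l) + exp (- l * \<bar>t + s\<bar>) / (2 * l)" for t
  proof -
    have "2 * (1 / 2 * X) = X" for X :: real by simp
    then show ?thesis unfolding shift_kernel_def .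
  qed
  have "2 *\<^sub>R Sn n s (F.Res n l x) = F.Phi n (\<lambda>t. 2 * shift_kernel s t) x"
    unfolding F.Res_def eq by (rule F.Phi_shift[OF F.kernel_Res[OF l] l s])
  then show ?thesis by (simp add: F.Phi_cmult[OF kernel_shift_kernel l])
qed

text \<open>The mean value estimate contributes a factor \<open>l\<close>, which the normalisation
  by \<open>2 * l\<close> cancels; \<open>exp (l * T)\<close> is the cost of moving the weight by at
  most \<open>T\<close>.\<close>

lemma shift_kernel_Lipschitz:
  assumes "0 \<le> s" "s \<le> T" "0 \<le> s'" "s' \<le> T"
  shows "\<bar>shift_kernel s t - shift_kernel s' t\<bar> \<le> (\<bar>s - s'\<bar> * exp (l * T)) * exp (- l * \<bar>t\<bar>)"
proof -
  have l0: "0 < l" using l omega_nonneg by simp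
  have *: "\<bar>exp (- l * \<bar>u\<bar>) - exp (- l * \<bar>v\<bar>)\<bar> \<le> l * (\<bar>s - s'\<bar> * exp (l * T) * exp (- l * \<bar>t\<bar>))"
    if uv: "\<bar>u - v\<bar> \<le> \<bar>s - s'\<bar>" "\<bar>t\<bar> - T \<le> \<bar>u\<bar>" "\<bar>t\<bar> - T \<le> \<bar>v\<bar>" for u v
  proof -
    have "\<bar>exp (- l * \<bar>u\<bar>) - exp (- l * \<bar>v\<bar>)\<bar> \<le> \<bar>l * \<bar>u\<bar> - l * \<bar>v\<bar>\<bar> * exp (- min (l * \<bar>u\<bar>) (l * \<bar>v\<bar>))"
      using exp_neg_diff_le[of "l * \<bar>u\<bar>" "l * \<bar>v\<bar>"] by simp
    also have "\<dots> \<le> (l * \<bar>s - s'\<bar>) * exp (- (l * (\<bar>t\<bar> - T)))"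
    proof (intro mult_mono)
      have "\<bar>l * \<bar>u\<bar> - l * \<bar>v\<bar>\<bar> = l * \<bar>\<bar>u\<bar> - \<bar>v\<bar>\<bar>" using l0 by (simp add: abs_mult flip: right_diff_distrib)
      also have "\<dots> \<le> l * \<bar>s - s'\<bar>" using uv(1) l0 by (intro mult_left_mono) auto
      finally show "\<bar>l * \<bar>u\<bar> - l * \<bar>v\<bar>\<bar> \<le> l * \<bar>s - s'\<bar>" .
      have "l * (\<bar>t\<bar> - T) \<le> l * \<bar>u\<bar>" "l * (\<bar>t\<bar> - T) \<le> l * \<bar>v\<bar>"
        using uv(2,3) l0 by (auto intro!: mult_left_mono)
      then show "exp (- min (l * \<bar>u\<bar>) (l * \<bar>v\<bar>)) \<le> exp (- (l * (\<bar>t\<bar> - T)))" by simp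
    qed (use l0 in auto)
    also have "\<dots> = l * (\<bar>s - s'\<bar> * exp (l * T) * exp (- l * \<bar>t\<bar>))" by (simp add: algebra_simps flip: exp_add)
    finally show ?thesis .
  qed
  define D where "D = \<bar>s - s'\<bar> * exp (l * T) * exp (- l * \<bar>t\<bar>)"
  define X where "X = exp (- l * \<bar>t - s\<bar>) - exp (- l * \<bar>t - s'\<bar>)"
  define Y where "Y = exp (- l * \<bar>t + s\<bar>) - exp (- l * \<bar>t + s'\<bar>)"
  have "\<bar>X\<bar> \<le> l * D" "\<bar>Y\<bar> \<le> l * D"
    unfolding X_def Y_def D_def using assms by (intro *; auto)+
  then have "\<bar>X + Y\<bar> \<le> 2 * (l * D)" by linarith
  moreover have "shift_kernel s t - shift_kernel s' t = (X + Y) / (4 * l)"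
    by (simp add: shift_kernel_def X_def Y_def add_divide_distrib diff_divide_distrib)
  moreover have "\<bar>(X + Y) / (4 * l)\<bar> = \<bar>X + Y\<bar> / (4 * l)" using l0 by simp
  ultimately have "\<bar>shift_kernel s t - shift_kernel s' t\<bar> \<le> 2 * (l * D) / (4 * l)"
    using divide_right_mono[of "\<bar>X + Y\<bar>" "2 * (l * D)" "4 * l"] l0 by simp
  also have "\<dots> = D / 2" using l0 by simp
  also have "\<dots> \<le> D" by (simp add: D_def)
  finally show ?thesis by (simp add: D_def)
qed

context
  fixes R :: "'a \<Rightarrow> 'a"
  assumes R_lim: "\<And>x. limitin \<gamma> (\<lambda>n. F.Res n l x) (R x) sequentially"
begin

text \<open>Uniform equicontinuity of the resolvents allows arguments that vary with
  \<open>n\<close>, as the recursion for the weights requires.\<close>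

lemma Res_lim_moving:
  assumes u: "limitin \<gamma> u x sequentially"
  shows "limitin \<gamma> (\<lambda>n. F.Res n l (u n)) (R x) sequentially"
proof (rule limitin_gammaI_squeeze)
  fix p assume p: "p \<in> \<Gamma>"
  obtain q where q: "q \<in> \<Gamma>" "\<And>n x. p (F.Res n l x) \<le> q x" using Res_equi_uniform[OF p] by blast
  have "(\<lambda>n. q (u n - x) + p (F.Res n l x - R x)) \<longlonglongrightarrow> 0"
    using tendsto_add[OF limitin_gammaD[OF u q(1)] limitin_gammaD[OF R_lim p]] by simp
  moreover have "p (F.Res n l (u n) - R x) \<le> q (u n - x) + p (F.Res n l x - R x)" for n
    using seminorm_diff_triangle[OF \<Gamma>_seminorm[OF p], of "F.Res n l (u n)" "R x" "F.Res n l x"]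
      q(2)[of n "u n - x"] by (simp add: linear_diff[OF F.Res_linear[OF l]])
  ultimately show "\<exists>g. g \<longlonglongrightarrow> 0 \<and> (\<forall>n. p (F.Res n l (u n) - R x) \<le> g n)" by blast
qed

lemma kconv_laguerre: "kconv (\<lambda>t. laguerre l k \<bar>t\<bar>)"
proof (induction k rule: less_induct)
  case (less k)
  \<comment> \<open>At \<open>k = 0\<close> the truncated indices are not smaller than
    \<open>k\<close>; their coefficients vanish, so the induction hypothesis is demanded for nonzero
    coefficients only.\<close>
  have cond: "\<exists>y. limitin \<gamma> (\<lambda>n. c *\<^sub>R F.Phi n (\<lambda>t. laguerre l j \<bar>t\<bar>) x) y sequentially"
    if "c \<noteq> 0 \<Longrightarrow> j < k" for c j and x :: 'a
  proof (cases "c = 0")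
    case True
    then show ?thesis by (simp add: ex_limitin_gamma_0)
  next
    case False
    then show ?thesis using less.IH[OF that[OF False]] limitin_gamma_scaleR unfolding kconv_def by blast
  qed
  show ?case
    unfolding kconv_def
  proof
    fix x :: 'a
    define z where "z = (2 * (real k * laguerre l (k - 1) 0 - l * laguerre l k 0)) *\<^sub>R x"
    obtain y1 where y1: "limitin \<gamma> (\<lambda>n. (2 * l * real k) *\<^sub>R F.Phi n (\<lambda>t. laguerre l (k - 1) \<bar>t\<bar>) x) y1 sequentially"
      using cond[of "2 * l * real k" "k - 1"] by auto
    obtain y2 where y2: "limitin \<gamma> (\<lambda>n. (real k * real (k - 1)) *\<^sub>R F.Phi n (\<lambda>t. laguerre l (k - 2) \<bar>t\<bar>) x) y2 sequentially"
      using cond[of "real k * real (k - 1)" "k - 2"] by auto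
    have "limitin \<gamma> (\<lambda>n. F.Res n l ((2 * l * real k) *\<^sub>R F.Phi n (\<lambda>t. laguerre l (k - 1) \<bar>t\<bar>) x
        - (real k * real (k - 1)) *\<^sub>R F.Phi n (\<lambda>t. laguerre l (k - 2) \<bar>t\<bar>) x - z)) (R (y1 - y2 - z)) sequentially"
      by (intro Res_lim_moving limitin_gamma_diff y1 y2 limitin_gamma_const)
    then have "limitin \<gamma> (\<lambda>n. F.Phi n (\<lambda>t. laguerre l k \<bar>t\<bar>) x) (R (y1 - y2 - z)) sequentially"
      unfolding z_def by (simp only: F.laguerre_recursion[OF l, symmetric])
    then show "\<exists>y. limitin \<gamma> (\<lambda>n. F.Phi n (\<lambda>t. laguerre l k \<bar>t\<bar>) x) y sequentially" by blast
  qed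
qed

text \<open>The Taylor polynomials of \<open>exp (- c t)\<close> converge in the weighted norm as long as \<open>c\<close> is small
  compared with \<open>l - \<omega>\<close>; iterating with a fixed \<open>c\<close> reaches all exponents \<open>l + j c\<close>.\<close>

lemma kconv_laguerre_exp:
  assumes a: "\<omega> < a" and c: "0 < c" "a + 4 * c = l"
  shows "kernel a (\<lambda>t. laguerre l k \<bar>t\<bar> * exp (- real j * c * \<bar>t\<bar>)) \<and> kconv (\<lambda>t. laguerre l k \<bar>t\<bar> * exp (- real j * c * \<bar>t\<bar>))"
proof (induction j arbitrary: k)
  case 0
  then show ?case using kernel_laguerre[of a l k] kconv_laguerre[of k] c by simp
next
  case (Suc j)
  define E where "E i k t = laguerre l k \<bar>t\<bar> * exp (- real i * c * \<bar>t\<bar>)" for i k t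
  have kE: "kernel a (E i k)" for i k
  proof -
    obtain K where K: "\<And>t. \<bar>laguerre l k \<bar>t\<bar>\<bar> \<le> K * exp (- a * \<bar>t\<bar>)"
      using kernel_laguerre[of a l k] c by (auto simp: kernel_def)
    have "\<bar>E i k t\<bar> \<le> K * exp (- a * \<bar>t\<bar>)" for t
    proof -
      have "\<bar>E i k t\<bar> \<le> \<bar>laguerre l k \<bar>t\<bar>\<bar> * 1"
        unfolding E_def abs_mult using c by (intro mult_left_mono) auto
      then show ?thesis using K[of t] by simp
    qed
    then show ?thesis by (intro kernelI[where K = K]) (auto simp: E_def laguerre_def intro!: continuous_intros)
  qed
  have IH: "kernel a (E j k) \<and> kconv (E j k)" for k using Suc.IH[of k] unfolding E_def[abs_def] .
  \<comment> \<open>Bounding the Taylor remainder costs the growth \<open>exp (3 * c * |t|)\<close>.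
    Since \<open>a + 4 * c = l\<close>, the rate \<open>a + c\<close> remains, and its spare
    \<open>c\<close> absorbs \<open>|t|^k\<close>, which gives this constant.\<close>
  define B where "B = fact k / c ^ k"
  have B: "0 < B" using c by (simp add: B_def)
  have "kconv (E (Suc j) k)"
  proof (rule kconv_limit[OF a kE])
    fix \<epsilon> :: real assume \<epsilon>: "0 < \<epsilon>"
    \<comment> \<open>The power of 1/2 stems from
      \<open>y^N / N! \<le> 2^(- N) * exp (2 * y)\<close>: the factorial is traded for a faster
      exponential.\<close>
    obtain N :: nat where N: "(1 / 2) ^ N < \<epsilon> / B"
      using real_arch_pow_inv[of "\<epsilon> / B" "1 / 2"] \<epsilon> B by auto
    define e' where "e' t = (\<Sum>i\<in>{..<N}. ((- c) ^ i / fact i) * E j (k + i) t)" for t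
    have e': "kernel a e' \<and> kconv e'"
      unfolding e'_def[abs_def] by (rule kernel_kconv_sum[OF a _ IH]) simp
    have "\<bar>E (Suc j) k t - e' t\<bar> \<le> \<epsilon> * exp (- a * \<bar>t\<bar>)" for t
    proof -
      define y where "y = c * \<bar>t\<bar>"
      have y: "0 \<le> y" using c by (simp add: y_def)
      have e'y: "e' t = E j k t * (\<Sum>i<N. (- y) ^ i / fact i)"
        unfolding e'_def sum_distrib_left
      proof (rule sum.cong)
        fix i
        have "(- y) ^ i = (- c) ^ i * \<bar>t\<bar> ^ i" unfolding y_def by (metis minus_mult_left power_mult_distrib)
        then show "(- c) ^ i / fact i * E j (k + i) t = E j k t * ((- y) ^ i / fact i)"
          by (simp add: E_def laguerre_def power_add)
      qed simp
      obtain s where s: "\<bar>s\<bar> \<le> \<bar>- y\<bar>" "exp (- y) = (\<Sum>m<N. (- y) ^ m / fact m) + exp s / fact N * (- y) ^ N"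
        using Maclaurin_exp_le[of "- y" N] by blast
      have Ey: "E (Suc j) k t = E j k t * exp (- y)"
        by (simp add: E_def y_def algebra_simps flip: exp_add)
      have "E (Suc j) k t - e' t = E j k t * (exp s / fact N * (- y) ^ N)"
        unfolding Ey e'y s(2) by (simp add: algebra_simps)
      then have "\<bar>E (Suc j) k t - e' t\<bar> = \<bar>E j k t\<bar> * (exp s * (y ^ N / fact N))"
        using y by (simp add: abs_mult power_abs)
      also have "\<dots> \<le> \<bar>laguerre l k \<bar>t\<bar>\<bar> * (exp y * ((1 / 2) ^ N * exp (2 * y)))"
      proof (intro mult_mono)
        have "\<bar>E j k t\<bar> \<le> \<bar>laguerre l k \<bar>t\<bar>\<bar> * 1"
          unfolding E_def abs_mult using c by (intro mult_left_mono) auto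
        then show "\<bar>E j k t\<bar> \<le> \<bar>laguerre l k \<bar>t\<bar>\<bar>" by simp
        show "exp s \<le> exp y" using s(1) y by simp
        have "(2 * y) ^ N \<le> fact N * exp (2 * y)" using y by (intro power_le_fact_exp) auto
        then show "y ^ N / fact N \<le> (1 / 2) ^ N * exp (2 * y)"
          by (simp add: power_mult_distrib power_divide field_simps)
      qed (use y in auto)
      also have "\<dots> = (1 / 2) ^ N * \<bar>laguerre (l - 3 * c) k \<bar>t\<bar>\<bar>"
        by (simp add: laguerre_def y_def abs_mult algebra_simps flip: exp_add)
      also have "\<dots> \<le> (1 / 2) ^ N * (B * exp (- a * \<bar>t\<bar>))"
      proof (rule mult_left_mono)
        have eq: "l - 3 * c - a = c" using c by simp
        show "\<bar>laguerre (l - 3 * c) k \<bar>t\<bar>\<bar> \<le> B * exp (- a * \<bar>t\<bar>)"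
          using laguerre_bound[of a "l - 3 * c" "\<bar>t\<bar>" k, unfolded eq] c by (simp add: B_def)
      qed simp
      also have "\<dots> \<le> \<epsilon> / B * (B * exp (- a * \<bar>t\<bar>))" using N B by (intro mult_right_mono) auto
      also have "\<dots> = \<epsilon> * exp (- a * \<bar>t\<bar>)" using B by simp
      finally show ?thesis .
    qed
    then show "\<exists>e'. kernel a e' \<and> kconv e' \<and> (\<forall>t. \<bar>E (Suc j) k t - e' t\<bar> \<le> \<epsilon> * exp (- a * \<bar>t\<bar>))"
      using e' by blast
  qed
  then show ?case using kE[of "Suc j" k] by (simp only: E_def[abs_def])
qed

text \<open>With \<open>u = exp (- c * |t|)\<close> the exponents \<open>l + j * c\<close> become
  monomials in \<open>u\<close> on the unit interval. The weight \<open>exp (- l * |t|)\<close>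
  stays in front, so a uniform error in \<open>h\<close> is an error in the weighted norm.\<close>

lemma kconv_continuous:
  assumes a: "\<omega> < a" and c: "0 < c" "a + 4 * c = l" and h: "continuous_on {0..1} h"
  shows "kconv (\<lambda>t. exp (- l * \<bar>t\<bar>) * h (exp (- c * \<bar>t\<bar>)))"
proof -
  let ?e = "\<lambda>t. exp (- l * \<bar>t\<bar>) * h (exp (- c * \<bar>t\<bar>))"
  have u: "exp (- c * \<bar>t\<bar>) \<in> {0..1}" for t using c by simp
  have l_le: "exp (- l * \<bar>t\<bar>) \<le> exp (- a * \<bar>t\<bar>)" for t using c by (simp add: mult_right_mono)
  obtain H where "\<forall>v\<in>h ` {0..1}. norm v \<le> H"
    using compact_imp_bounded[OF compact_continuous_image[OF h compact_Icc]] unfolding bounded_iff by blast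
  then have H: "\<bar>h u\<bar> \<le> H" if "u \<in> {0..1}" for u using that by simp
  have H0: "0 \<le> H" using order_trans[OF abs_ge_zero H[of 0]] by simp
  have "kernel a ?e"
  proof (rule kernelI)
    show "continuous_on UNIV ?e"
      by (intro continuous_on_mult continuous_on_compose2[OF h] continuous_intros) (use c in auto)
    show "\<bar>?e t\<bar> \<le> H * exp (- a * \<bar>t\<bar>)" for t
    proof -
      have "\<bar>?e t\<bar> = exp (- l * \<bar>t\<bar>) * \<bar>h (exp (- c * \<bar>t\<bar>))\<bar>" by (simp add: abs_mult)
      also have "\<dots> \<le> exp (- a * \<bar>t\<bar>) * H" using l_le H[OF u] by (intro mult_mono) auto
      finally show ?thesis by (simp add: mult.commute)
    qed
  qed
  then show ?thesis
  proof (rule kconv_limit[OF a])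
    fix \<epsilon> :: real assume \<epsilon>: "0 < \<epsilon>"
    obtain g where g: "real_polynomial_function g" "\<And>u. u \<in> {0..1} \<Longrightarrow> \<bar>h u - g u\<bar> < \<epsilon>"
      using Stone_Weierstrass_real_polynomial_function[OF compact_Icc h \<epsilon>] by blast
    obtain A :: "nat \<Rightarrow> real" and n where A: "g = (\<lambda>u. \<Sum>i\<le>n. A i * u ^ i)"
      using g(1) by (auto simp: real_polynomial_function_iff_sum)
    define e' where "e' t = (\<Sum>i\<in>{..n}. A i * (laguerre l 0 \<bar>t\<bar> * exp (- real i * c * \<bar>t\<bar>)))" for t
    have "kernel a e' \<and> kconv e'"
      unfolding e'_def[abs_def] by (rule kernel_kconv_sum[OF a _ kconv_laguerre_exp[OF a c]]) simp
    moreover have "\<bar>?e t - e' t\<bar> \<le> \<epsilon> * exp (- a * \<bar>t\<bar>)" for t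
    proof -
      have "e' t = exp (- l * \<bar>t\<bar>) * g (exp (- c * \<bar>t\<bar>))"
        unfolding e'_def A sum_distrib_left
        by (rule sum.cong) (simp_all add: laguerre_def mult_ac flip: exp_of_nat_mult)
      then have "\<bar>?e t - e' t\<bar> = exp (- l * \<bar>t\<bar>) * \<bar>h (exp (- c * \<bar>t\<bar>)) - g (exp (- c * \<bar>t\<bar>))\<bar>"
        by (simp add: abs_mult flip: right_diff_distrib)
      also have "\<dots> \<le> exp (- a * \<bar>t\<bar>) * \<epsilon>"
        using l_le less_imp_le[OF g(2)[OF u]] by (intro mult_mono) auto
      finally show ?thesis by (simp add: mult.commute)
    qed
    ultimately show "\<exists>e'. kernel a e' \<and> kconv e' \<and> (\<forall>t. \<bar>?e t - e' t\<bar> \<le> \<epsilon> * exp (- a * \<bar>t\<bar>))" by blast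
  qed
qed

text \<open>It remains to give \<open>shift_kernel s\<close> the form treated by
  \<open>kconv_continuous\<close>: one of its two exponentials is
  \<open>exp (- l * (|t| + s))\<close>, and the other differs from it by the factor
  \<open>exp (2 * l * min |t| s)\<close>.\<close>

lemma Sn_Res_convergent:
  assumes s: "0 \<le> s" shows "\<exists>y. limitin \<gamma> (\<lambda>n. Sn n s (F.Res n l x)) y sequentially"
proof -
  have l0: "0 < l" using l omega_nonneg by simp
  define a where "a = (l + \<omega>) / 2"
  define c where "c = (l - a) / 4"
  have ac: "\<omega> < a" "0 < c" "a + 4 * c = l" using l by (auto simp: a_def c_def field_simps)
  \<comment> \<open>\<open>min |t| s\<close> corresponds to the maximum of \<open>u\<close> and
    \<open>exp (- c * s)\<close>. This keeps the base of the power away from 0, so \<open>h\<close>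
    is continuous up to \<open>u = 0\<close>, which stands for infinite time.\<close>
  define h where "h u = exp (- l * s) * (1 + max u (exp (- c * s)) powr (- (2 * l / c))) / (4 * l)" for u
  have "continuous_on {0..1} h"
    unfolding h_def[abs_def] by (intro continuous_intros) (use l0 in \<open>auto simp: max_def\<close>)
  then have "kconv (\<lambda>t. exp (- l * \<bar>t\<bar>) * h (exp (- c * \<bar>t\<bar>)))" by (rule kconv_continuous[OF ac])
  moreover have "exp (- l * \<bar>t\<bar>) * h (exp (- c * \<bar>t\<bar>)) = shift_kernel s t" for t
  proof -
    have "max (exp (- c * \<bar>t\<bar>)) (exp (- c * s)) = exp (- c * min \<bar>t\<bar> s)"
      using ac(2) by (auto simp: max_def min_def)
    then have "max (exp (- c * \<bar>t\<bar>)) (exp (- c * s)) powr (- (2 * l / c)) = exp (2 * l * min \<bar>t\<bar> s)"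
      using ac(2) by (simp add: powr_def)
    then have h: "exp (- l * \<bar>t\<bar>) * h (exp (- c * \<bar>t\<bar>))
        = (exp (- l * (\<bar>t\<bar> + s)) + exp (- l * (\<bar>t\<bar> + s) + 2 * l * min \<bar>t\<bar> s)) / (4 * l)"
      by (simp add: h_def algebra_simps flip: exp_add)
    have "- l * (\<bar>t\<bar> + s) + 2 * l * min \<bar>t\<bar> s = - l * \<bar>\<bar>t\<bar> - s\<bar>" by (auto simp: min_def algebra_simps)
    then have "exp (- l * \<bar>t\<bar>) * h (exp (- c * \<bar>t\<bar>)) = (exp (- l * (\<bar>t\<bar> + s)) + exp (- l * \<bar>\<bar>t\<bar> - s\<bar>)) / (4 * l)"
      using h by simp
    moreover have "(exp (- l * (\<bar>t\<bar> + s)) + exp (- l * \<bar>\<bar>t\<bar> - s\<bar>)) = exp (- l * \<bar>t - s\<bar>) + exp (- l * \<bar>t + s\<bar>)"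
    proof (cases "0 \<le> t")
      case True then show ?thesis using s by simp
    next
      case False
      then have "\<bar>t - s\<bar> = \<bar>t\<bar> + s" "\<bar>t + s\<bar> = \<bar>\<bar>t\<bar> - s\<bar>" using s by auto
      then show ?thesis by simp
    qed
    moreover have "shift_kernel s t = (exp (- l * \<bar>t - s\<bar>) + exp (- l * \<bar>t + s\<bar>)) / (4 * l)"
      using l0 by (simp add: shift_kernel_def field_simps)
    ultimately show ?thesis by simp
  qed
  ultimately show ?thesis unfolding kconv_def by (simp add: Sn_Res[OF s])
qed

end

end


section \<open>The limit family\<close>

lemma Sn_lim_moving:
  assumes t: "0 \<le> t" and u: "limitin \<gamma> u x sequentially" and L: "limitin \<gamma> (\<lambda>n. Sn n t x) y sequentially"
  shows "limitin \<gamma> (\<lambda>n. Sn n t (u n)) y sequentially"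
proof (rule limitin_gammaI_squeeze)
  fix p assume p: "p \<in> \<Gamma>"
  obtain q where q: "q \<in> \<Gamma>" "\<And>n t x. 0 \<le> t \<Longrightarrow> p (Sn n t x) \<le> exp ((\<omega> + 1) * t) * q x"
    using Sn_equi[OF p, of "\<omega> + 1"] by auto
  have "(\<lambda>n. exp ((\<omega> + 1) * t) * q (u n - x) + p (Sn n t x - y)) \<longlonglongrightarrow> 0"
    using tendsto_add[OF tendsto_mult_left[OF limitin_gammaD[OF u q(1)], of "exp ((\<omega> + 1) * t)"] limitin_gammaD[OF L p]]
    by simp
  moreover have "p (Sn n t (u n) - y) \<le> exp ((\<omega> + 1) * t) * q (u n - x) + p (Sn n t x - y)" for n
    using seminorm_diff_triangle[OF \<Gamma>_seminorm[OF p], of "Sn n t (u n)" y "Sn n t x"]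
      q(2)[OF t, of n "u n - x"] by (simp add: linear_diff[OF F.S_linear[OF t]])
  ultimately show "\<exists>g. g \<longlonglongrightarrow> 0 \<and> (\<forall>n. p (Sn n t (u n) - y) \<le> g n)" by blast
qed

definition uniform_limit_on_compacts :: "(real \<Rightarrow> 'a \<Rightarrow> 'a) \<Rightarrow> bool" where
  "uniform_limit_on_compacts S \<longleftrightarrow> (\<forall>p\<in>\<Gamma>. \<forall>x T \<epsilon>. 0 < \<epsilon> \<longrightarrow>
     (\<exists>N. \<forall>n\<ge>N. \<forall>t. 0 \<le> t \<and> t \<le> T \<longrightarrow> p (Sn n t x - S t x) < \<epsilon>))"

text \<open>An Arzela-Ascoli argument. On the vectors \<open>Res n l y\<close> the orbits are
  Lipschitz in time and converge. As \<open>Res n l y\<close> tends to \<open>R y\<close> and the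
  range of \<open>R\<close> is dense, estimates uniform in \<open>n\<close> carry equicontinuity in
  time and pointwise convergence over to all vectors; a finite grid of times then makes the
  convergence locally uniform.\<close>

lemma limit_family_exists:
  assumes l: "\<omega> < l"
    and R_lim: "\<And>x. limitin \<gamma> (\<lambda>n. F.Res n l x) (R x) sequentially"
    and dense: "\<And>p x \<epsilon>. p \<in> \<Gamma> \<Longrightarrow> 0 < \<epsilon> \<Longrightarrow> \<exists>y. p (x - R y) < \<epsilon>"
  obtains S where "saks_cosine sc \<tau> \<gamma> P S M \<omega>" "uniform_limit_on_compacts S"
proof -
  have equi: "\<exists>\<delta>>0. \<exists>N. \<forall>n\<ge>N. \<forall>s s'. 0 \<le> s \<and> s \<le> T \<and> 0 \<le> s' \<and> s' \<le> T \<and> \<bar>s - s'\<bar> < \<delta> \<longrightarrow> p (Sn n s z - Sn n s' z) < \<epsilon>"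
    if p: "p \<in> \<Gamma>" and \<epsilon>: "0 < \<epsilon>" for p z T \<epsilon>
  proof -
    note sn = \<Gamma>_seminorm[OF p]
    define b where "b = \<omega> + 1"
    have b: "\<omega> < b" "0 \<le> b" using omega_nonneg by (auto simp: b_def)
    obtain q where q: "q \<in> \<Gamma>" "\<And>n t x. 0 \<le> t \<Longrightarrow> p (Sn n t x) \<le> exp (b * t) * q x"
      using Sn_equi[OF p b(1)] by blast
    note snq = \<Gamma>_seminorm[OF q(1)]
    obtain q' where q': "q' \<in> \<Gamma>" "\<And>n e K x. kernel l e \<Longrightarrow> (\<And>t. \<bar>e t\<bar> \<le> K * exp (- l * \<bar>t\<bar>)) \<Longrightarrow> p (F.Phi n e x) \<le> K * q' x"
      using Phi_equi_uniform[OF l p] by metis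
    define E where "E = exp (b * T)"
    have E: "0 < E" by (simp add: E_def)
    \<comment> \<open>\<open>z\<close> is replaced by \<open>R y\<close> and then by
      \<open>Res n l y\<close>, each at the cost of \<open>\<eta>\<close> in \<open>q\<close>. Doing
      so at both times \<open>s\<close> and \<open>s'\<close> uses up half of
      \<open>\<epsilon>\<close>.\<close>
    define \<eta> where "\<eta> = \<epsilon> / (8 * E)"
    have \<eta>: "0 < \<eta>" "E * \<eta> = \<epsilon> / 8" using \<epsilon> E by (auto simp: \<eta>_def)
    obtain y where y: "q (z - R y) < \<eta>" using dense[OF q(1) \<eta>(1)] by blast
    have "\<forall>\<^sub>F n in sequentially. q (F.Res n l y - R y) < \<eta>"
      by (rule order_tendstoD(2)[OF limitin_gammaD[OF R_lim q(1)] \<eta>(1)])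
    then obtain N where N: "\<And>n. n \<ge> N \<Longrightarrow> q (F.Res n l y - R y) < \<eta>" by (auto simp: eventually_sequentially)
    define L where "L = exp (l * T) * q' y"
    have L: "0 \<le> L" using seminorm_nonneg[OF \<Gamma>_seminorm[OF q'(1)]] by (simp add: L_def)
    define \<delta> where "\<delta> = \<epsilon> / (4 * (L + 1))"
    have \<delta>: "0 < \<delta>" using \<epsilon> L by (simp add: \<delta>_def)
    have "p (Sn n s z - Sn n s' z) < \<epsilon>"
      if n: "n \<ge> N" and s: "0 \<le> s" "s \<le> T" "0 \<le> s'" "s' \<le> T" "\<bar>s - s'\<bar> < \<delta>" for n s s'
    proof -
      let ?w = "F.Res n l y"
      have qw: "q (z - ?w) < 2 * \<eta>"
        using seminorm_diff_triangle[OF snq, of z ?w "R y"] y N[OF n] seminorm_minus_commute[OF snq, of "R y" ?w] by simp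
      have A: "p (Sn n r z - Sn n r ?w) < \<epsilon> / 4" if r: "0 \<le> r" "r \<le> T" for r
      proof -
        have "p (Sn n r (z - ?w)) \<le> exp (b * r) * q (z - ?w)" by (rule q(2)[OF r(1)])
        also have "\<dots> \<le> E * q (z - ?w)"
          unfolding E_def using r b seminorm_nonneg[OF snq] by (intro mult_right_mono) (auto intro: mult_left_mono)
        also have "\<dots> < E * (2 * \<eta>)" using qw E by (intro mult_strict_left_mono)
        finally show ?thesis using \<eta>(2) by (simp add: linear_diff[OF F.S_linear[OF r(1)]])
      qed
      have "p (Sn n s ?w - Sn n s' ?w) = p (F.Phi n (\<lambda>t. shift_kernel l s t - shift_kernel l s' t) y)"
        by (simp add: Sn_Res[OF l s(1)] Sn_Res[OF l s(3)] F.Phi_diff[OF kernel_shift_kernel[OF l] kernel_shift_kernel[OF l] l])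
      also have "\<dots> \<le> (\<bar>s - s'\<bar> * exp (l * T)) * q' y"
        by (intro q'(2) kernel_diff kernel_shift_kernel[OF l] shift_kernel_Lipschitz[OF l] s)
      also have "\<dots> = \<bar>s - s'\<bar> * L" by (simp add: L_def)
      also have "\<dots> \<le> \<delta> * (L + 1)" using s(5) L \<delta> by (intro mult_mono) auto
      also have "\<dots> = \<epsilon> / 4" using L by (simp add: \<delta>_def field_simps)
      finally have B: "p (Sn n s ?w - Sn n s' ?w) \<le> \<epsilon> / 4" .
      have "p (Sn n s z - Sn n s' z) \<le> p (Sn n s z - Sn n s ?w) + (p (Sn n s ?w - Sn n s' ?w) + p (Sn n s' ?w - Sn n s' z))"
        using seminorm_diff_triangle[OF sn, of "Sn n s z" "Sn n s' z" "Sn n s ?w"]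
          seminorm_diff_triangle[OF sn, of "Sn n s ?w" "Sn n s' z" "Sn n s' ?w"] by simp
      then show ?thesis
        using A[OF s(1,2)] A[OF s(3,4)] B seminorm_minus_commute[OF sn, of "Sn n s' z" "Sn n s' ?w"] \<epsilon> by simp
    qed
    then show ?thesis using \<delta> by blast
  qed
  have conv: "\<exists>y. limitin \<gamma> (\<lambda>n. Sn n t z) y sequentially" if t: "0 \<le> t" for t z
  proof (rule gamma_Cauchy_convergent)
    fix p and \<epsilon> :: real assume p: "p \<in> \<Gamma>" and \<epsilon>: "0 < \<epsilon>"
    note sn = \<Gamma>_seminorm[OF p]
    obtain q where q: "q \<in> \<Gamma>" "\<And>n t x. 0 \<le> t \<Longrightarrow> p (Sn n t x) \<le> exp ((\<omega> + 1) * t) * q x"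
      using Sn_equi[OF p, of "\<omega> + 1"] by auto
    note snq = \<Gamma>_seminorm[OF q(1)]
    define E where "E = exp ((\<omega> + 1) * t)"
    have E: "0 < E" by (simp add: E_def)
    define \<eta> where "\<eta> = \<epsilon> / (8 * E)"
    have \<eta>: "0 < \<eta>" "E * \<eta> = \<epsilon> / 8" using \<epsilon> E by (auto simp: \<eta>_def)
    obtain x where x: "q (z - R x) < \<eta>" using dense[OF q(1) \<eta>(1)] by blast
    obtain y where y: "limitin \<gamma> (\<lambda>n. Sn n t (F.Res n l x)) y sequentially"
      using Sn_Res_convergent[OF l R_lim t] by blast
    have "\<forall>\<^sub>F n in sequentially. q (F.Res n l x - R x) < \<eta>"
      by (rule order_tendstoD(2)[OF limitin_gammaD[OF R_lim q(1)] \<eta>(1)])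
    moreover have "\<forall>\<^sub>F n in sequentially. p (Sn n t (F.Res n l x) - y) < \<epsilon> / 4"
      by (rule order_tendstoD(2)[OF limitin_gammaD[OF y p]]) (use \<epsilon> in simp)
    ultimately have "\<forall>\<^sub>F n in sequentially. p (Sn n t z - y) < \<epsilon> / 2"
    proof eventually_elim
      case (elim n)
      have "q (z - F.Res n l x) < 2 * \<eta>"
        using seminorm_diff_triangle[OF snq, of z "F.Res n l x" "R x"] x elim(1)
          seminorm_minus_commute[OF snq, of "R x" "F.Res n l x"] by simp
      then have "E * q (z - F.Res n l x) < E * (2 * \<eta>)" using E by (intro mult_strict_left_mono)
      also have "\<dots> = \<epsilon> / 4" using \<eta>(2) by simp
      finally have "p (Sn n t (z - F.Res n l x)) < \<epsilon> / 4"
        using q(2)[OF t, of n "z - F.Res n l x"] unfolding E_def by linarith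
      then show ?case
        using seminorm_diff_triangle[OF sn, of "Sn n t z" y "Sn n t (F.Res n l x)"] elim(2)
        by (simp add: linear_diff[OF F.S_linear[OF t]])
    qed
    then obtain N where N: "\<And>n. n \<ge> N \<Longrightarrow> p (Sn n t z - y) < \<epsilon> / 2" by (auto simp: eventually_sequentially)
    have "p (Sn m t z - Sn n t z) < \<epsilon>" if "m \<ge> N" "n \<ge> N" for m n
      using seminorm_diff_triangle[OF sn, of "Sn m t z" "Sn n t z" y] N[OF that(1)] N[OF that(2)]
        seminorm_minus_commute[OF sn, of y "Sn n t z"] by simp
    then show "\<exists>N. \<forall>m\<ge>N. \<forall>n\<ge>N. p (Sn m t z - Sn n t z) < \<epsilon>" by blast
  qed
  \<comment> \<open>Meaningful for nonnegative times only.\<close>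
  define S where "S t z = (SOME y. limitin \<gamma> (\<lambda>n. Sn n t z) y sequentially)" for t z
  have S: "limitin \<gamma> (\<lambda>n. Sn n t z) (S t z) sequentially" if "0 \<le> t" for t z
    unfolding S_def using conv[OF that] by (rule someI_ex)
  have S_eqI: "S t z = y" if "0 \<le> t" "limitin \<gamma> (\<lambda>n. Sn n t z) y sequentially" for t z y
    using gamma_limit_unique[OF S[OF that(1)] that(2)] by simp
  have S_le: "p (S t z) \<le> B" if t: "0 \<le> t" and p: "p \<in> \<Gamma>" and B: "\<And>n. p (Sn n t z) \<le> B" for t z p B
    by (rule tendsto_upperbound[OF limitin_gamma_seminorm[OF S[OF t] p] always_eventually]) (use B in auto)
  have S_diff_le: "p (S s z - S s' z) \<le> B"
    if s: "0 \<le> s" "0 \<le> s'" and p: "p \<in> \<Gamma>" and B: "\<And>n. n \<ge> N \<Longrightarrow> p (Sn n s z - Sn n s' z) \<le> B" for s s' z p B and N :: nat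
    by (rule tendsto_upperbound[OF limitin_gamma_seminorm[OF limitin_gamma_diff[OF S[OF s(1)] S[OF s(2)]] p]
          eventually_sequentiallyI[of N]]) (use B in auto)
  have "uniform_limit_on_compacts S"
    unfolding uniform_limit_on_compacts_def
  proof (intro ballI allI impI)
    fix p z T and \<epsilon> :: real assume p: "p \<in> \<Gamma>" and \<epsilon>: "0 < \<epsilon>"
    note sn = \<Gamma>_seminorm[OF p]
    have \<epsilon>4: "0 < \<epsilon> / 4" using \<epsilon> by simp
    obtain \<delta> N where \<delta>: "0 < \<delta>" and N: "\<And>n s s'. n \<ge> N \<Longrightarrow> 0 \<le> s \<Longrightarrow> s \<le> T \<Longrightarrow> 0 \<le> s' \<Longrightarrow> s' \<le> T \<Longrightarrow> \<bar>s - s'\<bar> < \<delta> \<Longrightarrow> p (Sn n s z - Sn n s' z) < \<epsilon> / 4"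
      using equi[OF p \<epsilon>4, of T z] by blast
    \<comment> \<open>A grid of step \<open>\<delta> / 2\<close>, so that each time in question lies
      strictly within \<open>\<delta>\<close> of the grid point below it.\<close>
    define G where "G = (\<lambda>k. real k * (\<delta> / 2)) ` {k. real k * (\<delta> / 2) \<le> T}"
    have finG: "finite G"
    proof -
      obtain m :: nat where m: "T / (\<delta> / 2) < real m" using reals_Archimedean2 by blast
      have "k \<le> m" if "real k * (\<delta> / 2) \<le> T" for k
      proof -
        have "real k \<le> T / (\<delta> / 2)" using that \<delta> by (subst pos_le_divide_eq) auto
        then show ?thesis using m by simp
      qed
      then have "{k. real k * (\<delta> / 2) \<le> T} \<subseteq> {..m}" by auto
      then have "finite {k. real k * (\<delta> / 2) \<le> T}" by (rule finite_subset) simp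
      then show ?thesis unfolding G_def by (rule finite_imageI)
    qed
    have G0: "0 \<le> g" "g \<le> T" if "g \<in> G" for g using that \<delta> by (auto simp: G_def)
    have "\<forall>\<^sub>F n in sequentially. p (Sn n g z - S g z) < \<epsilon> / 4" if "g \<in> G" for g
      by (rule order_tendstoD(2)[OF limitin_gammaD[OF S[OF G0(1)[OF that]] p] \<epsilon>4])
    then have "\<forall>\<^sub>F n in sequentially. \<forall>g\<in>G. p (Sn n g z - S g z) < \<epsilon> / 4"
      using finG by (simp add: eventually_ball_finite)
    then obtain N' where N': "\<And>n g. n \<ge> N' \<Longrightarrow> g \<in> G \<Longrightarrow> p (Sn n g z - S g z) < \<epsilon> / 4"
      unfolding eventually_sequentially by blast
    have "p (Sn n t z - S t z) < \<epsilon>" if n: "n \<ge> max N N'" and t: "0 \<le> t" "t \<le> T" for n t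
    proof -
      define k where "k = nat \<lfloor>t / (\<delta> / 2)\<rfloor>"
      define g where "g = real k * (\<delta> / 2)"
      have q0: "0 \<le> t / (\<delta> / 2)" using t \<delta> by simp
      then have k: "real k \<le> t / (\<delta> / 2)" "t / (\<delta> / 2) < real k + 1" unfolding k_def by linarith+
      have g: "g \<le> t" "t < g + \<delta> / 2" using k \<delta> by (auto simp: g_def field_simps)
      have gG: "g \<in> G" unfolding G_def using g t by (intro image_eqI[of _ _ k]) (auto simp: g_def)
      have tg: "\<bar>t - g\<bar> < \<delta>" using g \<delta> by simp
      have 1: "p (Sn n t z - Sn n g z) < \<epsilon> / 4" using n t tg G0[OF gG] by (intro N) auto
      have 2: "p (Sn n g z - S g z) < \<epsilon> / 4" using n gG by (intro N') auto
      \<comment> \<open>Equicontinuity in time passes to the limit family.\<close>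
      have "p (Sn m g z - Sn m t z) \<le> \<epsilon> / 4" if "m \<ge> N" for m
        using N[OF that t G0[OF gG] tg] seminorm_minus_commute[OF sn, of "Sn m t z"] by simp
      then have 3: "p (S g z - S t z) \<le> \<epsilon> / 4" by (rule S_diff_le[OF G0(1)[OF gG] t(1) p])
      show ?thesis
        using seminorm_diff_triangle[OF sn, of "Sn n t z" "S t z" "Sn n g z"]
          seminorm_diff_triangle[OF sn, of "Sn n g z" "S t z" "S g z"] 1 2 3 \<epsilon> by simp
    qed
    then show "\<exists>N. \<forall>n\<ge>N. \<forall>t. 0 \<le> t \<and> t \<le> T \<longrightarrow> p (Sn n t z - S t z) < \<epsilon>" by blast
  qed
  moreover have "saks_cosine sc \<tau> \<gamma> P S M \<omega>"
  proof (intro saks_cosine.intro saks_cosine_axioms.intro mixed_saks_axioms)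
    fix t :: real assume t: "0 \<le> t"
    interpret vector_space sc by (rule normed_scalingD[OF scaling])
    have lin: "Vector_Spaces.linear sc sc (Sn n t)" for n by (rule F.S_sc_linear[OF t])
    show "Vector_Spaces.linear sc sc (S t)"
      unfolding Vector_Spaces.linear_iff
    proof (intro conjI allI normed_scalingD(1)[OF scaling])
      fix x y
      have "Sn n t (x + y) = Sn n t x + Sn n t y" for n using lin unfolding Vector_Spaces.linear_iff by blast
      then show "S t (x + y) = S t x + S t y"
        using limitin_gamma_add[OF S[OF t, of x] S[OF t, of y]] by (intro S_eqI[OF t]) simp
    next
      fix c x
      have eq: "Sn n t (sc c x) = sc c (Sn n t x)" for n using lin unfolding Vector_Spaces.linear_iff by blast
      show "S t (sc c x) = sc c (S t x)"
      proof (rule S_eqI[OF t], unfold eq, rule limitin_gammaI_squeeze)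
        fix p assume p: "p \<in> \<Gamma>"
        have "(\<lambda>n. norm c * p (Sn n t x - S t x)) \<longlonglongrightarrow> 0"
          using tendsto_mult_left[OF limitin_gammaD[OF S[OF t] p], of "norm c"] by simp
        moreover have "p (sc c (Sn n t x) - sc c (S t x)) \<le> norm c * p (Sn n t x - S t x)" for n
          using \<Gamma>_sc_seminorm[OF p] by (simp add: is_seminorm_def flip: scale_right_diff_distrib)
        ultimately show "\<exists>g. g \<longlonglongrightarrow> 0 \<and> (\<forall>n. p (sc c (Sn n t x) - sc c (S t x)) \<le> g n)" by blast
      qed
    qed
  next
    show "S 0 = id"
    proof
      fix x show "S 0 x = id x"
        by (rule S_eqI) (simp_all add: F.S_0 limitin_gamma_const)
    qed
  next
    fix s t :: real and x assume st: "0 \<le> s" "s \<le> t"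
    then have t: "0 \<le> t" "0 \<le> t + s" "0 \<le> t - s" by auto
    \<comment> \<open>The inner vectors \<open>Sn n s x\<close> vary with \<open>n\<close>, which is
      why the limit with moving arguments is needed.\<close>
    have "limitin \<gamma> (\<lambda>n. 2 *\<^sub>R Sn n t (Sn n s x)) (2 *\<^sub>R S t (S s x)) sequentially"
      by (intro limitin_gamma_scaleR Sn_lim_moving[OF t(1) S[OF st(1)] S[OF t(1)]])
    moreover have "limitin \<gamma> (\<lambda>n. 2 *\<^sub>R Sn n t (Sn n s x)) (S (t + s) x + S (t - s) x) sequentially"
      unfolding F.S_cosine[OF st] by (intro limitin_gamma_add S t)
    ultimately show "2 *\<^sub>R S t (S s x) = S (t + s) x + S (t - s) x" by (rule gamma_limit_unique) simp
  next
    fix t :: real and x assume t: "0 \<le> t"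
    show "norm (S t x) \<le> M * exp (\<omega> * t) * norm x"
    proof (rule norm_le_P)
      fix p assume p: "p \<in> P"
      have pG: "p \<in> \<Gamma>" using p P_subset_\<Gamma> by blast
      show "p (S t x) \<le> M * exp (\<omega> * t) * norm x"
        by (rule S_le[OF t pG order_trans[OF P_le_norm[OF p] F.S_norm[OF t]]])
    qed
  next
    fix p t x assume p: "p \<in> \<Gamma>" and t: "(0::real) \<le> t"
    note sn = \<Gamma>_seminorm[OF p]
    show "((\<lambda>s. p (S s x - S t x)) \<longlongrightarrow> 0) (at t within {0..})"
    proof (rule tendstoI)
      fix \<epsilon> :: real assume \<epsilon>: "0 < \<epsilon>"
      then have \<epsilon>2: "0 < \<epsilon> / 2" by simp
      obtain \<delta> N where \<delta>: "0 < \<delta>" and N: "\<And>n s s'. n \<ge> N \<Longrightarrow> 0 \<le> s \<Longrightarrow> s \<le> t + 1 \<Longrightarrow> 0 \<le> s' \<Longrightarrow> s' \<le> t + 1 \<Longrightarrow> \<bar>s - s'\<bar> < \<delta> \<Longrightarrow> p (Sn n s x - Sn n s' x) < \<epsilon> / 2"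
        using equi[OF p \<epsilon>2, of "t + 1" x] by blast
      have "dist (p (S s x - S t x)) 0 < \<epsilon>" if s: "0 \<le> s" "dist s t < min \<delta> 1" for s
      proof -
        have s': "\<bar>s - t\<bar> < \<delta>" "s \<le> t + 1" using s by (auto simp: dist_real_def)
        have "p (S s x - S t x) \<le> \<epsilon> / 2"
        proof (rule S_diff_le[OF s(1) t p])
          show "p (Sn n s x - Sn n t x) \<le> \<epsilon> / 2" if "n \<ge> N" for n
            using N[OF that s(1) s'(2) t _ s'(1)] by simp
        qed
        then show ?thesis using \<epsilon> seminorm_nonneg[OF sn] by simp
      qed
      then show "\<forall>\<^sub>F s in at t within {0..}. dist (p (S s x - S t x)) 0 < \<epsilon>"
        unfolding eventually_at using \<delta> by (intro exI[of _ "min \<delta> 1"]) auto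
    qed
  next
    fix p b assume p: "p \<in> \<Gamma>" and b: "\<omega> < b"
    obtain q where q: "q \<in> \<Gamma>" "\<And>n t x. 0 \<le> t \<Longrightarrow> p (Sn n t x) \<le> exp (b * t) * q x"
      using Sn_equi[OF p b] by blast
    have "p (S t x) \<le> exp (b * t) * q x" if "0 \<le> t" for t x by (rule S_le[OF that p q(2)[OF that]])
    then show "\<exists>q\<in>\<Gamma>. \<forall>t\<ge>0. \<forall>x. p (S t x) \<le> exp (b * t) * q x" using q(1) by blast
  next
    show "0 \<le> \<omega>" by (rule F.omega)
    show "1 \<le> M" by (rule F.M)
  qed
  ultimately show ?thesis using that by blast
qed

text \<open>The integral is split at a time \<open>T\<close>: up to \<open>T\<close> the orbits
  converge uniformly, and beyond it exponential bounds uniform in \<open>n\<close> make the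
  contribution small.\<close>

lemma Res_limit:
  assumes S: "saks_cosine sc \<tau> \<gamma> P S M \<omega>" and lim: "uniform_limit_on_compacts S" and l: "\<omega> < l"
  shows "limitin \<gamma> (\<lambda>n. F.Res n l x) (saks_cosine.Res sc \<gamma> S l x) sequentially"
proof -
  interpret G: saks_cosine sc \<tau> \<gamma> P S M \<omega> by (rule S)
  have l0: "0 < l" using l omega_nonneg by simp
  show ?thesis
    unfolding limitin_gamma
  proof (intro ballI tendstoI)
    fix p and \<epsilon> :: real assume p: "p \<in> \<Gamma>" and \<epsilon>: "0 < \<epsilon>"
    note sn = \<Gamma>_seminorm[OF p]
    define b where "b = (l + \<omega>) / 2"
    have b: "\<omega> < b" "b < l" using l by (auto simp: b_def)
    \<comment> \<open>The gap \<open>l - b\<close> is halved: one part yields the small factor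
      \<open>exp (- (d * T))\<close>, the other keeps the tail integrable.\<close>
    define d where "d = (l - b) / 2"
    have d: "0 < d" "l - b = 2 * d" using b by (auto simp: d_def)
    obtain q where q: "q \<in> \<Gamma>" "\<And>n t x. 0 \<le> t \<Longrightarrow> p (Sn n t x) \<le> exp (b * t) * q x" using Sn_equi[OF p b(1)] by blast
    obtain q' where q': "q' \<in> \<Gamma>" "\<And>t x. 0 \<le> t \<Longrightarrow> p (S t x) \<le> exp (b * t) * q' x" using G.S_equi[OF p b(1)] by blast
    define Q where "Q = q x + q' x"
    have Q0: "0 \<le> Q" using seminorm_nonneg[OF \<Gamma>_seminorm[OF q(1)]] seminorm_nonneg[OF \<Gamma>_seminorm[OF q'(1)]] by (simp add: Q_def)
    have Q: "p (Sn n t x - S t x) \<le> exp (b * t) * Q" if "0 \<le> t" for n t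
      using seminorm_diff_le[OF sn, of "Sn n t x" "S t x"] q(2)[OF that, of n x] q'(2)[OF that, of x]
      by (simp add: Q_def distrib_left)
    define c where "c = Q / (l * d)"
    have c0: "0 \<le> c" using Q0 l0 d by (simp add: c_def)
    have "((\<lambda>T. c * exp (- (d * T))) \<longlongrightarrow> c * 0) at_top"
    proof (intro tendsto_mult tendsto_const filterlim_compose[OF exp_at_bot])
      show "LIM T at_top. - (d * T) :> at_bot"
        using filterlim_tendsto_neg_mult_at_bot[OF tendsto_const[of "- d"] _ filterlim_ident] d(1) by simp
    qed
    then have "\<forall>\<^sub>F T in at_top. c * exp (- (d * T)) < \<epsilon> / 2"
      by (rule order_tendstoD(2)) (use \<epsilon> in simp)
    then obtain T where T: "c * exp (- (d * T)) < \<epsilon> / 2" unfolding eventually_at_top_linorder by blast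
    \<comment> \<open>The kernel of the resolvent has integral \<open>1 / l^2\<close>, so this
      choice contributes \<open>\<epsilon> / 2\<close>.\<close>
    define \<eta> where "\<eta> = \<epsilon> / 2 * l\<^sup>2"
    have \<eta>: "0 < \<eta>" using \<epsilon> l0 by (simp add: \<eta>_def)
    obtain N where N: "\<And>n t. n \<ge> N \<Longrightarrow> 0 \<le> t \<Longrightarrow> t \<le> T \<Longrightarrow> p (Sn n t x - S t x) < \<eta>"
      using lim p \<eta> unfolding uniform_limit_on_compacts_def by blast
    have "p (F.Res n l x - G.Res l x) < \<epsilon>" if n: "n \<ge> N" for n
    proof -
      let ?e = "\<lambda>t. exp (- l * \<bar>t\<bar>) / (2 * l)"
      have w: "wint (\<lambda>t. ?e t *\<^sub>R Sn n \<bar>t\<bar> x - ?e t *\<^sub>R S \<bar>t\<bar> x) (F.Res n l x - G.Res l x)"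
        unfolding F.Res_def G.Res_def
        by (rule wint_diff[OF F.Phi_wint[OF F.kernel_Res[OF l] l] G.Phi_wint[OF G.kernel_Res[OF l] l]])
      define g where "g t = \<eta> / (2 * l) * exp (- l * \<bar>t\<bar>) + Q / (2 * l) * exp (- (d * T)) * exp (- d * \<bar>t\<bar>)" for t
      have "has_bochner_integral lborel g (\<eta> / (2 * l) * (2 / l) + Q / (2 * l) * exp (- (d * T)) * (2 / d))"
        unfolding g_def[abs_def]
        by (intro has_bochner_integral_add has_bochner_integral_mult_right has_bochner_integral_exp_abs l0 d)
      moreover have "p (?e t *\<^sub>R Sn n \<bar>t\<bar> x - ?e t *\<^sub>R S \<bar>t\<bar> x) \<le> g t" for t
      proof -
        have "p (?e t *\<^sub>R Sn n \<bar>t\<bar> x - ?e t *\<^sub>R S \<bar>t\<bar> x) = ?e t * p (Sn n \<bar>t\<bar> x - S \<bar>t\<bar> x)"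
          using l0 by (simp add: seminorm_scale[OF sn] flip: scaleR_diff_right)
        also have "\<dots> \<le> g t"
        proof (cases "\<bar>t\<bar> \<le> T")
          case True
          have "?e t * p (Sn n \<bar>t\<bar> x - S \<bar>t\<bar> x) \<le> ?e t * \<eta>"
            using N[OF n _ True] l0 by (intro mult_left_mono) auto
          moreover have "0 \<le> Q / (2 * l) * exp (- (d * T)) * exp (- d * \<bar>t\<bar>)" using Q0 l0 by simp
          ultimately show ?thesis by (simp add: g_def mult_ac)
        next
          case False
          have "?e t * p (Sn n \<bar>t\<bar> x - S \<bar>t\<bar> x) \<le> ?e t * (exp (b * \<bar>t\<bar>) * Q)"
            using l0 by (intro mult_left_mono Q) auto
          also have "\<dots> = Q / (2 * l) * (exp (- l * \<bar>t\<bar>) * exp (b * \<bar>t\<bar>))" by simp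
          also have "exp (- l * \<bar>t\<bar>) * exp (b * \<bar>t\<bar>) = exp (- (l - b) * \<bar>t\<bar>)"
            by (simp add: algebra_simps flip: exp_add)
          also have "\<dots> = exp (- (d * \<bar>t\<bar>)) * exp (- d * \<bar>t\<bar>)"
            unfolding d(2) by (simp flip: exp_add)
          also have "Q / (2 * l) * (exp (- (d * \<bar>t\<bar>)) * exp (- d * \<bar>t\<bar>)) \<le> Q / (2 * l) * (exp (- (d * T)) * exp (- d * \<bar>t\<bar>))"
            using False d Q0 l0 by (intro mult_left_mono mult_right_mono) auto
          also have "\<dots> \<le> g t" using \<eta> l0 by (simp add: g_def mult.assoc)
          finally show ?thesis .
        qed
        finally show ?thesis .
      qed
      ultimately have "p (F.Res n l x - G.Res l x) \<le> \<eta> / (2 * l) * (2 / l) + Q / (2 * l) * exp (- (d * T)) * (2 / d)"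
        using wint_bound[OF w p] by blast
      also have "\<eta> / (2 * l) * (2 / l) = \<epsilon> / 2" using l0 by (simp add: \<eta>_def power2_eq_square)
      also have "Q / (2 * l) * exp (- (d * T)) * (2 / d) = c * exp (- (d * T))" by (simp add: c_def)
      finally show ?thesis using T by simp
    qed
    then show "\<forall>\<^sub>F n in sequentially. dist (p (F.Res n l x - G.Res l x)) 0 < \<epsilon>"
      using seminorm_nonneg[OF sn] unfolding eventually_sequentially by auto
  qed
qed

end

section \<open>The approximation theorem\<close>

context mixed_saks
begin

text \<open>The supremum of \<open>exp (- b * t) * p (Sn n t x)\<close> over all \<open>n\<close>
  and \<open>t\<close> is the required seminorm. It is \<gamma>-continuous by C-sequentiality: along
  a null sequence bi-equicontinuity handles the times up to some \<open>T\<close>, and the surplus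
  \<open>b - \<omega>\<close> over the norm growth handles the later ones.\<close>

lemma exponentially_equicontinuous:
  fixes Sn :: "nat \<Rightarrow> real \<Rightarrow> 'a \<Rightarrow> 'a"
  assumes lin: "\<And>n t. 0 \<le> t \<Longrightarrow> Vector_Spaces.linear sc sc (Sn n t)"
    and nb: "\<And>n t x. 0 \<le> t \<Longrightarrow> norm (Sn n t x) \<le> M * exp (\<omega> * t) * norm x"
    and equi: "uniformly_locally_bi_equicontinuous \<tau> Sn"
    and \<omega>: "0 \<le> \<omega>" and M: "1 \<le> M"
    and p: "p \<in> \<Gamma>" and b: "\<omega> < b"
  shows "\<exists>q\<in>\<Gamma>. \<forall>n. \<forall>t\<ge>0. \<forall>x. p (Sn n t x) \<le> exp (b * t) * q x"
proof -
  note sn = \<Gamma>_seminorm[OF p]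
  interpret vector_space sc by (rule normed_scalingD[OF scaling])
  obtain B where B: "0 < B" "\<And>x. p x \<le> B * norm x" using \<Gamma>_bound[OF p] by blast
  define I where "I = (UNIV :: nat set) \<times> {0::real..}"
  have I: "I \<noteq> {}" by (auto simp: I_def)
  define f where "f i x = exp (- b * snd i) * p (Sn (fst i) (snd i) x)" for i x
  define q where "q x = (SUP i\<in>I. f i x)" for x
  have f_tail: "f i x \<le> B * M * norm x * exp (- (b - \<omega>) * snd i)" if "i \<in> I" for i x
  proof -
    have t: "0 \<le> snd i" using that by (auto simp: I_def)
    have "p (Sn (fst i) (snd i) x) \<le> B * (M * exp (\<omega> * snd i) * norm x)"
      using B(2)[of "Sn (fst i) (snd i) x"] mult_left_mono[OF nb[OF t, of "fst i" x], of B] B(1) by linarith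
    then have "f i x \<le> exp (- b * snd i) * (B * (M * exp (\<omega> * snd i) * norm x))"
      unfolding f_def by (intro mult_left_mono) auto
    also have "\<dots> = B * M * norm x * exp (- (b - \<omega>) * snd i)" by (simp add: algebra_simps flip: exp_add)
    finally show ?thesis .
  qed
  have f_le: "f i x \<le> B * M * norm x" if "i \<in> I" for i x
  proof -
    have "exp (- (b - \<omega>) * snd i) \<le> 1" using that b by (auto simp: I_def mult_nonpos_nonneg)
    then have "B * M * norm x * exp (- (b - \<omega>) * snd i) \<le> B * M * norm x * 1" using B M by (intro mult_left_mono) auto
    then show ?thesis using f_tail[OF that, of x] by simp
  qed
  have bdd: "bdd_above ((\<lambda>i. f i x) ` I)" for x using f_le by (intro bdd_aboveI2)
  have up: "f i x \<le> q x" if "i \<in> I" for i x unfolding q_def using that by (intro cSUP_upper bdd)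
  have qle: "q x \<le> c" if "\<And>i. i \<in> I \<Longrightarrow> f i x \<le> c" for x c unfolding q_def using that I by (intro cSUP_least)
  have f_nonneg: "0 \<le> f i x" for i x by (simp add: f_def seminorm_nonneg[OF sn])
  have q_nonneg: "0 \<le> q x" for x
  proof -
    have "(0, 0) \<in> I" by (simp add: I_def)
    then show ?thesis using up[of "(0, 0)" x] f_nonneg[of "(0, 0)" x] by linarith
  qed
  have f_sc: "f i (sc c x) = norm c * f i x" if "i \<in> I" for i c x
  proof -
    have "Sn (fst i) (snd i) (sc c x) = sc c (Sn (fst i) (snd i) x)"
      using lin[of "snd i" "fst i"] that unfolding Vector_Spaces.linear_iff I_def by auto
    then show ?thesis using \<Gamma>_sc_seminorm[OF p] by (simp add: f_def is_seminorm_def)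
  qed
  have q_sc_le: "q (sc c x) \<le> norm c * q x" for c x
    by (rule qle) (simp add: f_sc up mult_left_mono)
  have q_sc: "is_seminorm sc q"
    unfolding is_seminorm_def
  proof (intro conjI allI)
    fix x y
    show "q (x + y) \<le> q x + q y"
    proof (rule qle)
      fix i assume i: "i \<in> I"
      have "Sn (fst i) (snd i) (x + y) = Sn (fst i) (snd i) x + Sn (fst i) (snd i) y"
        using lin[of "snd i" "fst i"] i unfolding Vector_Spaces.linear_iff I_def by auto
      then have "f i (x + y) \<le> exp (- b * snd i) * (p (Sn (fst i) (snd i) x) + p (Sn (fst i) (snd i) y))"
        unfolding f_def by (intro mult_left_mono) (auto simp: seminorm_triangle[OF sn])
      also have "\<dots> = f i x + f i y" by (simp add: f_def distrib_left)
      also have "\<dots> \<le> q x + q y" by (intro add_mono up i)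
      finally show "f i (x + y) \<le> q x + q y" .
    qed
  next
    fix c x
    show "q (sc c x) = norm c * q x"
    proof (cases "c = 0")
      case True
      have "f i 0 = 0" if "i \<in> I" for i using f_sc[OF that, of 0 0] by simp
      then have "q 0 \<le> 0" by (intro qle) simp
      then show ?thesis using True q_nonneg[of 0] by simp
    next
      case False
      have "q (sc (inverse c) (sc c x)) \<le> norm (inverse c) * q (sc c x)" by (rule q_sc_le)
      then have "q x \<le> inverse (norm c) * q (sc c x)" using False by (simp add: norm_inverse)
      then have "norm c * q x \<le> q (sc c x)" using False by (simp add: field_simps)
      then show ?thesis using q_sc_le[of c x] by simp
    qed
  qed
  have qG: "q \<in> \<Gamma>"
  proof (rule seq_continuous_imp_\<Gamma>[OF q_sc])
    fix s assume L: "limitin \<gamma> s 0 sequentially"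
    then have bs: "bounded (range s)" and Lt: "limitin \<tau> s 0 sequentially" by (auto simp: limitin_gamma_iff)
    obtain K where "0 < K" "\<forall>x\<in>range s. norm x \<le> K" using bs unfolding bounded_pos by blast
    then have K: "0 < K" "\<And>i. norm (s i) \<le> K" by auto
    show "(\<lambda>n. q (s n)) \<longlonglongrightarrow> 0"
    proof (rule tendstoI)
      fix \<epsilon> :: real assume \<epsilon>: "0 < \<epsilon>"
      have "((\<lambda>T. B * M * K * exp (- ((b - \<omega>) * T))) \<longlongrightarrow> B * M * K * 0) at_top"
      proof (intro tendsto_mult tendsto_const filterlim_compose[OF exp_at_bot])
        show "LIM T at_top. - ((b - \<omega>) * T) :> at_bot"
          using filterlim_tendsto_neg_mult_at_bot[OF tendsto_const[of "- (b - \<omega>)"] _ filterlim_ident] b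
          by (simp add: algebra_simps)
      qed
      then have "\<forall>\<^sub>F T in at_top. B * M * K * exp (- ((b - \<omega>) * T)) < \<epsilon> / 2"
        by (rule order_tendstoD(2)) (use \<epsilon> in simp)
      then obtain T where T: "B * M * K * exp (- ((b - \<omega>) * T)) < \<epsilon> / 2" unfolding eventually_at_top_linorder by blast
      \<comment> \<open>The radius bounds all \<open>Sn n t (s i)\<close> with
        \<open>t \<le> T\<close>, so on these vectors \<open>p\<close> is controlled by one seminorm
        of \<tau>.\<close>
      obtain r \<delta> where r: "r \<in> P" "0 < \<delta>" "\<And>z. norm z \<le> M * exp (\<omega> * T) * K \<Longrightarrow> r z < \<delta> \<Longrightarrow> p z < \<epsilon> / 2"
        using \<Gamma>_small[OF p, of "\<epsilon> / 2" "M * exp (\<omega> * T) * K"] \<epsilon> by auto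
      have "bi_equicontinuous \<tau> (UNIV \<times> {0..T}) (\<lambda>(n, t). Sn n t)"
        using equi unfolding uniformly_locally_bi_equicontinuous_def by auto
      moreover have "openin \<tau> {y. r y < \<delta>} \<and> 0 \<in> {y. r y < \<delta>}"
        using tau_ball[OF r(1), of 0 \<delta>] r(2) by (simp add: seminorm_zero[OF P_seminorm[OF r(1)]])
      ultimately have "\<forall>\<^sub>F i in sequentially. \<forall>j\<in>UNIV \<times> {0..T}. (\<lambda>(n, t). Sn n t) j (s i - 0) \<in> {y. r y < \<delta>}"
        using bs Lt unfolding bi_equicontinuous_def by blast
      then show "\<forall>\<^sub>F i in sequentially. dist (q (s i)) 0 < \<epsilon>"
      proof eventually_elim
        case (elim i)
        have "f j (s i) \<le> \<epsilon> / 2" if j: "j \<in> I" for j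
        proof (cases "snd j \<le> T")
          case True
          have t: "0 \<le> snd j" using j by (auto simp: I_def)
          have "j \<in> UNIV \<times> {0..T}" using True t by (simp add: mem_Times_iff)
          from bspec[OF elim this] have "r (Sn (fst j) (snd j) (s i)) < \<delta>" by (simp add: case_prod_unfold)
          moreover have "norm (Sn (fst j) (snd j) (s i)) \<le> M * exp (\<omega> * T) * K"
          proof -
            have "M * exp (\<omega> * snd j) * norm (s i) \<le> M * exp (\<omega> * T) * K"
              using True \<omega> M K by (intro mult_mono) (auto intro: mult_left_mono)
            then show ?thesis using nb[OF t, of "fst j" "s i"] by simp
          qed
          ultimately have "p (Sn (fst j) (snd j) (s i)) < \<epsilon> / 2" by (intro r(3))
          moreover have "f j (s i) \<le> 1 * p (Sn (fst j) (snd j) (s i))"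
            unfolding f_def using t b \<omega> by (intro mult_right_mono seminorm_nonneg[OF sn]) auto
          ultimately show ?thesis by simp
        next
          case False
          have "f j (s i) \<le> B * M * norm (s i) * exp (- (b - \<omega>) * snd j)" by (rule f_tail[OF j])
          also have "\<dots> \<le> B * M * K * exp (- ((b - \<omega>) * T))"
          proof (intro mult_mono)
            have "(b - \<omega>) * T \<le> (b - \<omega>) * snd j" using False b by (intro mult_left_mono) auto
            then show "exp (- (b - \<omega>) * snd j) \<le> exp (- ((b - \<omega>) * T))" by (simp add: algebra_simps)
          qed (use B M K in auto)
          finally show ?thesis using T by simp
        qed
        then have "q (s i) \<le> \<epsilon> / 2" by (rule qle)
        then show ?case using q_nonneg[of "s i"] \<epsilon> by simp
      qed
    qed
  qed
  have "p (Sn n t x) \<le> exp (b * t) * q x" if t: "0 \<le> t" for n t x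
  proof -
    have "f (n, t) x \<le> q x" using t by (intro up) (simp add: I_def)
    then have "exp (b * t) * (exp (- b * t) * p (Sn n t x)) \<le> exp (b * t) * q x" by (simp add: f_def)
    then show ?thesis by (simp add: mult.assoc[symmetric] flip: exp_add)
  qed
  then show ?thesis using qG by blast
qed

lemma saks_cosineI:
  assumes S: "locally_bicontinuous_cosine sc \<tau> S"
    and nb: "\<And>t. 0 \<le> t \<Longrightarrow> onorm (S t) \<le> M * exp (\<omega> * t)"
    and \<omega>: "0 \<le> \<omega>" and M: "1 \<le> M"
  shows "saks_cosine sc \<tau> \<gamma> P S M \<omega>"
proof -
  have cf: "cosine_family sc S" and bo: "\<And>t. 0 \<le> t \<Longrightarrow> bounded_operator sc (S t)"
    and co: "\<And>x. continuous_map (top_of_set {0..}) \<tau> (\<lambda>t. S t x)"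
    and eq: "\<And>N. compact N \<Longrightarrow> N \<subseteq> {0..} \<Longrightarrow> bi_equicontinuous \<tau> N S"
    using S by (auto simp: locally_bicontinuous_cosine_def)
  have lin: "Vector_Spaces.linear sc sc (S t)" if "0 \<le> t" for t
    using bo[OF that] by (simp add: bounded_operator_def)
  have nb': "norm (S t x) \<le> M * exp (\<omega> * t) * norm x" if "0 \<le> t" for t x
  proof -
    have "norm (S t x) \<le> onorm (S t) * norm x" using bo[OF that] by (intro onorm) (simp add: bounded_operator_def)
    also have "\<dots> \<le> M * exp (\<omega> * t) * norm x" using nb[OF that] by (rule mult_right_mono) simp
    finally show ?thesis .
  qed
  \<comment> \<open>A single family is treated as a constant sequence.\<close>
  have unif: "uniformly_locally_bi_equicontinuous \<tau> (\<lambda>n::nat. S)"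
    unfolding uniformly_locally_bi_equicontinuous_def
  proof (intro allI impI)
    fix N :: "real set" assume "compact N \<and> N \<subseteq> {0..}"
    then have "bi_equicontinuous \<tau> N S" using eq by blast
    then show "bi_equicontinuous \<tau> (UNIV \<times> N) (\<lambda>(n::nat, t). S t)" unfolding bi_equicontinuous_def by auto
  qed
  have equi: "\<exists>q\<in>\<Gamma>. \<forall>n::nat. \<forall>t\<ge>0. \<forall>x. p (S t x) \<le> exp (b * t) * q x" if "p \<in> \<Gamma>" "\<omega> < b" for p b
    using lin nb' unif \<omega> M that by (rule exponentially_equicontinuous)
  show ?thesis
  proof (intro saks_cosine.intro saks_cosine_axioms.intro mixed_saks_axioms lin nb' \<omega> M)
    show "S 0 = id" using cf by (simp add: cosine_family_def)
    show "2 *\<^sub>R S t (S s x) = S (t + s) x + S (t - s) x" if "0 \<le> s" "s \<le> t" for s t x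
      using cf that unfolding cosine_family_def by blast
    show "\<exists>q\<in>\<Gamma>. \<forall>t\<ge>0. \<forall>x. p (S t x) \<le> exp (b * t) * q x" if "p \<in> \<Gamma>" "\<omega> < b" for p b
      using equi[OF that] by blast
    fix p t x assume p: "p \<in> \<Gamma>" and t: "(0::real) \<le> t"
    have "limitin \<tau> (\<lambda>s. S s x) (S t x) (at t within {0..})"
      unfolding limitin_def
    proof (intro conjI allI impI)
      fix U assume U: "openin \<tau> U \<and> S t x \<in> U"
      then have "openin (top_of_set {0..}) {s \<in> topspace (top_of_set {0..}). S s x \<in> U}"
        using co[of x] by (intro openin_continuous_map_preimage) auto
      then have "openin (top_of_set {0..}) {s \<in> {0..}. S s x \<in> U}" by simp
      moreover have "t \<in> {s \<in> {0..}. S s x \<in> U}" using U t by simp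
      ultimately obtain e where "0 < e" "\<forall>s\<in>{0..}. dist s t < e \<longrightarrow> s \<in> {s \<in> {0..}. S s x \<in> U}"
        unfolding openin_euclidean_subtopology_iff by blast
      then show "\<forall>\<^sub>F s in at t within {0..}. S s x \<in> U"
        unfolding eventually_at by (intro exI[of _ e]) auto
    qed simp
    \<comment> \<open>Near \<open>t\<close> the orbit is bounded in norm, which lifts its
      \<tau>-continuity to \<gamma>.\<close>
    moreover have "\<forall>\<^sub>F s in at t within {0..}. norm (S s x) \<le> M * exp (\<omega> * (t + 1)) * norm x"
      unfolding eventually_at
    proof (intro exI[of _ 1] conjI ballI impI)
      fix s assume s: "s \<in> {0..}" "s \<noteq> t \<and> dist s t < 1"
      have "\<omega> * s \<le> \<omega> * (t + 1)" using s \<omega> by (intro mult_left_mono) (auto simp: dist_real_def)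
      then have "M * exp (\<omega> * s) * norm x \<le> M * exp (\<omega> * (t + 1)) * norm x"
        using M by (intro mult_right_mono mult_left_mono) auto
      then show "norm (S s x) \<le> M * exp (\<omega> * (t + 1)) * norm x" using nb'[of s x] s by simp
    qed simp
    ultimately have "limitin \<gamma> (\<lambda>s. S s x) (S t x) (at t within {0..})" by (rule limitin_gammaI)
    then show "((\<lambda>s. p (S s x - S t x)) \<longlongrightarrow> 0) (at t within {0..})" using p by (simp add: limitin_gamma)
  qed
qed

section \<open>Bi-notions and topological notions\<close>

lemma bi_dense_imp_dense_in:
  assumes "bi_dense \<tau> N" shows "dense_in \<gamma> N"
  unfolding dense_in_def
proof (intro equalityI subset_UNIV subsetI)
  fix x
  obtain s :: "nat \<Rightarrow> 'a" where s: "range s \<subseteq> N" "bounded (range s)" "limitin \<tau> s x sequentially"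
    using assms unfolding bi_dense_def by blast
  then have L: "limitin \<gamma> s x sequentially" by (simp add: limitin_gamma_iff)
  show "x \<in> \<gamma> closure_of N"
    unfolding in_closure_of
  proof (intro conjI allI impI)
    fix T assume "x \<in> T \<and> openin \<gamma> T"
    then have "\<forall>\<^sub>F i in sequentially. s i \<in> T" using L by (simp add: limitin_def)
    then obtain i where "s i \<in> T" by (auto simp: eventually_sequentially)
    then show "\<exists>y. y \<in> N \<and> y \<in> T" using s(1) by blast
  qed simp
qed

lemma dense_inD:
  assumes "dense_in \<gamma> N" "p \<in> \<Gamma>" "0 < \<epsilon>"
  obtains y where "y \<in> N" "p (y - x) < \<epsilon>"
proof -
  have cl: "x \<in> \<gamma> closure_of N" using assms(1) by (simp add: dense_in_def)
  have nbhd: "x \<in> {y. p (y - x) < \<epsilon>} \<and> openin \<gamma> {y. p (y - x) < \<epsilon>}"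
    using assms by (simp add: \<Gamma>_translate_ball_open seminorm_zero[OF \<Gamma>_seminorm])
  from cl[unfolded in_closure_of, THEN conjunct2, rule_format, OF nbhd] show ?thesis using that by blast
qed

lemma continuous_mapI_\<Gamma>:
  assumes T: "linear T" and bd: "\<And>p. p \<in> \<Gamma> \<Longrightarrow> \<exists>q\<in>\<Gamma>. \<forall>x. p (T x) \<le> q x"
  shows "continuous_map \<gamma> \<gamma> T"
  unfolding continuous_map_def
proof (intro conjI allI impI)
  fix U assume U: "openin \<gamma> U"
  have "openin \<gamma> {x. T x \<in> U}"
    unfolding openin_gamma
  proof
    fix x assume "x \<in> {x. T x \<in> U}"
    then obtain p where p: "p \<in> \<Gamma>" "{y. p (y - T x) < 1} \<subseteq> U"
      using bspec[OF U[unfolded openin_gamma], of "T x"] by auto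
    obtain q where q: "q \<in> \<Gamma>" "\<And>x. p (T x) \<le> q x" using bd[OF p(1)] by blast
    have "{y. q (y - x) < 1} \<subseteq> {x. T x \<in> U}"
    proof
      fix y assume y: "y \<in> {y. q (y - x) < 1}"
      then have "p (T y - T x) < 1" using q(2)[of "y - x"] by (simp add: linear_diff[OF T])
      then show "y \<in> {x. T x \<in> U}" using p(2) by blast
    qed
    then show "\<exists>p\<in>\<Gamma>. {y. p (y - x) < 1} \<subseteq> {x. T x \<in> U}" using q(1) by blast
  qed
  then show "openin \<gamma> {x \<in> topspace \<gamma>. T x \<in> U}" by simp
qed simp

lemma linear_opD:
  assumes "linear_op sc A"
  shows "x \<in> dom A \<Longrightarrow> y \<in> dom A \<Longrightarrow> x - y \<in> dom A"
    and "x \<in> dom A \<Longrightarrow> y \<in> dom A \<Longrightarrow> the (A (x - y)) = the (A x) - the (A y)"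
    and "x \<in> dom A \<Longrightarrow> the (A 0) = 0"
proof -
  interpret vector_space sc by (rule normed_scalingD[OF scaling])
  have sub: "subspace (dom A)" and add: "\<And>x y. x \<in> dom A \<Longrightarrow> y \<in> dom A \<Longrightarrow> the (A (x + y)) = the (A x) + the (A y)"
    and sca: "\<And>c x. x \<in> dom A \<Longrightarrow> the (A (sc c x)) = sc c (the (A x))"
    using assms by (auto simp: linear_op_def)
  show d: "x - y \<in> dom A" if "x \<in> dom A" "y \<in> dom A" for x y using subspace_diff[OF sub that] .
  show "the (A (x - y)) = the (A x) - the (A y)" if "x \<in> dom A" "y \<in> dom A"
    using add[OF d[OF that] that(2)] by simp
  show "the (A 0) = 0" if "x \<in> dom A" using sca[OF that, of 0] by simp
qed

text \<open>The analogue of \<open>openin_seminorm_topology\<close> for graph seminorms: recentring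
  uses additivity of \<open>A\<close>, and rescaling \<open>p\<close> brings the radius to
  1.\<close>

lemma domain_nbhd:
  assumes A: "linear_op sc A" and U: "openin (domain_topology sc \<gamma> A) U" and x: "x \<in> U"
  shows "\<exists>p\<in>\<Gamma>. {y \<in> dom A. p (y - x) + p (the (A (y - x))) < 1} \<subseteq> U"
proof -
  have "generate_topology_on (insert (dom A)
     {{y \<in> dom A. p (y - x) + p (the (A (y - x))) < r} | p x r. p \<in> \<Gamma> \<and> x \<in> dom A \<and> 0 < r}) U"
    using U by (simp add: domain_topology_def openin_topology_generated_by_iff)
  then have "\<forall>x\<in>U. x \<in> dom A \<and> (\<exists>p\<in>\<Gamma>. {y \<in> dom A. p (y - x) + p (the (A (y - x))) < 1} \<subseteq> U)"
  proof induction
    case (Int a b)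
    show ?case
    proof
      fix x assume x: "x \<in> a \<inter> b"
      obtain p where p: "p \<in> \<Gamma>" "{y \<in> dom A. p (y - x) + p (the (A (y - x))) < 1} \<subseteq> a" "x \<in> dom A"
        using bspec[OF Int.IH(1) IntD1[OF x]] by (elim conjE bexE) (rule that)
      obtain q where q: "q \<in> \<Gamma>" "{y \<in> dom A. q (y - x) + q (the (A (y - x))) < 1} \<subseteq> b"
        using bspec[OF Int.IH(2) IntD2[OF x]] by (elim conjE bexE) (rule that)
      have "{y \<in> dom A. (p (y - x) + q (y - x)) + (p (the (A (y - x))) + q (the (A (y - x)))) < 1} \<subseteq> a \<inter> b"
      proof
        fix y assume y: "y \<in> {y \<in> dom A. (p (y - x) + q (y - x)) + (p (the (A (y - x))) + q (the (A (y - x)))) < 1}"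
        have "0 \<le> p (y - x) + p (the (A (y - x)))" "0 \<le> q (y - x) + q (the (A (y - x)))"
          by (intro add_nonneg_nonneg seminorm_nonneg[OF \<Gamma>_seminorm] p q)+
        then have "y \<in> {y \<in> dom A. p (y - x) + p (the (A (y - x))) < 1}" "y \<in> {y \<in> dom A. q (y - x) + q (the (A (y - x))) < 1}"
          using y by auto
        then show "y \<in> a \<inter> b" using p(2) q(2) by blast
      qed
      then show "x \<in> dom A \<and> (\<exists>p\<in>\<Gamma>. {y \<in> dom A. p (y - x) + p (the (A (y - x))) < 1} \<subseteq> a \<inter> b)"
        by (intro conjI p(3) bexI[of _ "\<lambda>z. p z + q z"] \<Gamma>_add[OF p(1) q(1)])
    qed
  next
    case (UN K)
    show ?case
    proof
      fix x assume "x \<in> \<Union>K"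
      then obtain k where k: "k \<in> K" "x \<in> k" by blast
      obtain p where "x \<in> dom A" "p \<in> \<Gamma>" "{y \<in> dom A. p (y - x) + p (the (A (y - x))) < 1} \<subseteq> k"
        using bspec[OF UN.IH[OF k(1)] k(2)] by (elim conjE bexE) (rule that)
      then show "x \<in> dom A \<and> (\<exists>p\<in>\<Gamma>. {y \<in> dom A. p (y - x) + p (the (A (y - x))) < 1} \<subseteq> \<Union>K)"
        using k(1) by (intro conjI bexI[of _ p]) (assumption | rule order_trans[OF _ Union_upper])+
    qed
  next
    case (Basis s)
    then consider "s = dom A" | p z r where "p \<in> \<Gamma>" "z \<in> dom A" "0 < r" "s = {y \<in> dom A. p (y - z) + p (the (A (y - z))) < r}" by auto
    then show ?case
    proof cases
      case 1
      obtain p where "p \<in> P" using P_nonempty by blast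
      then show ?thesis using 1 P_subset_\<Gamma> by blast
    next
      case 2
      note sn = \<Gamma>_seminorm[OF 2(1)]
      show ?thesis
      proof
        fix x assume x: "x \<in> s"
        define \<delta> where "\<delta> = r - (p (x - z) + p (the (A (x - z))))"
        have \<delta>: "0 < \<delta>" and xA: "x \<in> dom A" using x 2(4) by (auto simp: \<delta>_def)
        have inv_\<delta>: "0 \<le> 1 / \<delta>" using \<delta> by simp
        have "{y \<in> dom A. (1 / \<delta>) * p (y - x) + (1 / \<delta>) * p (the (A (y - x))) < 1} \<subseteq> s"
        proof
          fix y assume "y \<in> {y \<in> dom A. (1 / \<delta>) * p (y - x) + (1 / \<delta>) * p (the (A (y - x))) < 1}"
          then have y: "y \<in> dom A" "(p (y - x) + p (the (A (y - x)))) / \<delta> < 1" by (auto simp: add_divide_distrib)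
          then have lt: "p (y - x) + p (the (A (y - x))) < \<delta>" using \<delta> by (simp add: pos_divide_less_eq)
          have "the (A (y - z)) = the (A (y - x)) + the (A (x - z))"
            by (simp add: linear_opD(2)[OF A] y(1) xA 2(2))
          then have "p (the (A (y - z))) \<le> p (the (A (y - x))) + p (the (A (x - z)))"
            by (simp add: seminorm_triangle[OF sn])
          then have "p (y - z) + p (the (A (y - z))) < r"
            using seminorm_diff_triangle[OF sn, of y z x] lt by (simp add: \<delta>_def)
          then show "y \<in> s" using 2(4) y(1) by simp
        qed
        then show "x \<in> dom A \<and> (\<exists>p\<in>\<Gamma>. {y \<in> dom A. p (y - x) + p (the (A (y - x))) < 1} \<subseteq> s)"
          by (intro conjI xA bexI[of _ "\<lambda>z. (1 / \<delta>) * p z"] \<Gamma>_cmult[OF 2(1) inv_\<delta>])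
      qed
    qed
  qed auto
  then show ?thesis using x by blast
qed

lemma topological_coreD:
  assumes A: "linear_op sc A" and core: "topological_core sc \<gamma> A D" and x: "x \<in> dom A" and p: "p \<in> \<Gamma>" and \<epsilon>: "0 < \<epsilon>"
  obtains y where "y \<in> D" "p (y - x) + p (the (A (y - x))) < \<epsilon>"
proof -
  let ?U = "{y \<in> dom A. p (y - x) + p (the (A (y - x))) < \<epsilon>}"
  have op: "openin (domain_topology sc \<gamma> A) ?U"
    unfolding domain_topology_def using p x \<epsilon> by (intro topology_generated_by_Basis) blast
  have xU: "x \<in> ?U" using x \<epsilon> by (simp add: linear_opD(3)[OF A x] seminorm_zero[OF \<Gamma>_seminorm[OF p]])
  have cl: "x \<in> domain_topology sc \<gamma> A closure_of D" using core x by (simp add: topological_core_def)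
  from cl[unfolded in_closure_of, THEN conjunct2, rule_format, OF conjI[OF xU op]] show ?thesis using that by blast
qed

text \<open>A sequence from a bi-core and its images under \<open>A\<close> are bounded and
  \<tau>-convergent, hence \<gamma>-convergent, so the sequence converges in the graph topology of
  \<gamma>.\<close>

lemma bi_core_imp_topological_core:
  assumes A: "linear_op sc A" and core: "bi_core sc \<tau> A D"
  shows "topological_core sc \<gamma> A D"
  unfolding topological_core_def
proof (intro conjI)
  show "module.subspace sc D" and D: "D \<subseteq> dom A" using core by (auto simp: bi_core_def)
  have top: "topspace (domain_topology sc \<gamma> A) = dom A"
    unfolding domain_topology_def topology_generated_by_topspace by auto
  show "domain_topology sc \<gamma> A closure_of D = dom A"
  proof
    show "domain_topology sc \<gamma> A closure_of D \<subseteq> dom A" using closure_of_subset_topspace[of "domain_topology sc \<gamma> A" D] top by simp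
    show "dom A \<subseteq> domain_topology sc \<gamma> A closure_of D"
    proof
      fix x assume x: "x \<in> dom A"
      obtain s :: "nat \<Rightarrow> 'a" where s: "range s \<subseteq> D" "bounded (range s)" "bounded (range (\<lambda>i. the (A (s i))))"
          "limitin (domain_topology sc \<tau> A) s x sequentially"
        using core x unfolding bi_core_def by blast
      have sA: "s i \<in> dom A" for i using s(1) D by auto
      have L: "(\<lambda>i. p (s i - x) + p (the (A (s i - x)))) \<longlonglongrightarrow> 0" if p: "p \<in> P" for p
      proof (rule tendstoI)
        note sn = P_seminorm[OF p]
        fix \<epsilon> :: real assume \<epsilon>: "0 < \<epsilon>"
        let ?U = "{y \<in> dom A. p (y - x) + p (the (A (y - x))) < \<epsilon>}"
        \<comment> \<open>The domain topology is built from all \<tau>-continuous seminorms; the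
          members of \<open>P\<close> have to be recognised among them.\<close>
        have "continuous_map \<tau> euclideanreal p"
          unfolding continuous_map_def
        proof (intro conjI allI impI)
          fix V :: "real set" assume V: "openin euclideanreal V"
          have "openin \<tau> {z. p z \<in> V}"
            unfolding openin_tau
          proof
            fix z assume "z \<in> {z. p z \<in> V}"
            then obtain e where e: "0 < e" "\<And>t. dist t (p z) < e \<Longrightarrow> t \<in> V" using V by (auto simp: open_dist)
            have "{y. p (y - z) < e} \<subseteq> {z. p z \<in> V}"
            proof
              fix y assume "y \<in> {y. p (y - z) < e}"
              then have "dist (p y) (p z) < e" using seminorm_reverse_triangle[OF sn, of y z] by (simp add: dist_real_def)
              then show "y \<in> {z. p z \<in> V}" using e(2) by simp
            qed
            then show "\<exists>p'\<in>P. \<exists>r>0. {y. p' (y - z) < r} \<subseteq> {z. p z \<in> V}" using p e(1) by blast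
          qed
          then show "openin \<tau> {x \<in> topspace \<tau>. p x \<in> V}" by simp
        qed simp
        then have "p \<in> continuous_seminorms sc \<tau>" using P_sc_seminorm[OF p] by (simp add: continuous_seminorms_def)
        then have "openin (domain_topology sc \<tau> A) ?U"
          unfolding domain_topology_def using x \<epsilon> by (intro topology_generated_by_Basis) blast
        moreover have "x \<in> ?U" using x \<epsilon> by (simp add: linear_opD(3)[OF A x] seminorm_zero[OF sn])
        ultimately have "\<forall>\<^sub>F i in sequentially. s i \<in> ?U" using s(4) unfolding limitin_def by blast
        then show "\<forall>\<^sub>F i in sequentially. dist (p (s i - x) + p (the (A (s i - x)))) 0 < \<epsilon>"
          by (rule eventually_mono) (auto simp: add_nonneg_nonneg seminorm_nonneg[OF sn])
      qed
      have "limitin \<tau> s x sequentially"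
        unfolding limitin_tau
        by (intro ballI tendsto_0_squeeze[OF L]) (auto simp: seminorm_nonneg[OF P_seminorm])
      then have 1: "limitin \<gamma> s x sequentially" using s(2) by (simp add: limitin_gamma_iff)
      have "limitin \<tau> (\<lambda>i. the (A (s i))) (the (A x)) sequentially"
        unfolding limitin_tau
        by (intro ballI tendsto_0_squeeze[OF L]) (auto simp: linear_opD(2)[OF A] sA x seminorm_nonneg[OF P_seminorm])
      then have 2: "limitin \<gamma> (\<lambda>i. the (A (s i))) (the (A x)) sequentially" using s(3) by (simp add: limitin_gamma_iff)
      show "x \<in> domain_topology sc \<gamma> A closure_of D"
        unfolding in_closure_of
      proof (intro conjI allI impI)
        show "x \<in> topspace (domain_topology sc \<gamma> A)" using x top by simp
        fix T assume T: "x \<in> T \<and> openin (domain_topology sc \<gamma> A) T"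
        then obtain p where p: "p \<in> \<Gamma>" "{y \<in> dom A. p (y - x) + p (the (A (y - x))) < 1} \<subseteq> T"
          using domain_nbhd[OF A] by blast
        have "(\<lambda>i. p (s i - x) + p (the (A (s i)) - the (A x))) \<longlonglongrightarrow> 0"
          using tendsto_add[OF limitin_gammaD[OF 1 p(1)] limitin_gammaD[OF 2 p(1)]] by simp
        then have "\<forall>\<^sub>F i in sequentially. p (s i - x) + p (the (A (s i)) - the (A x)) < 1"
          by (rule order_tendstoD(2)) simp
        then obtain i where "p (s i - x) + p (the (A (s i)) - the (A x)) < 1" by (auto simp: eventually_sequentially)
        then have "s i \<in> {y \<in> dom A. p (y - x) + p (the (A (y - x))) < 1}"
          unfolding linear_opD(2)[OF A sA x, symmetric] using sA by simp
        then have "s i \<in> T" using p(2) by blast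
        then show "\<exists>y. y \<in> D \<and> y \<in> T" using s(1) by blast
      qed
    qed
  qed
qed

end

context saks_cosine
begin

lemma onorm_S_le: "0 \<le> t \<Longrightarrow> onorm (S t) \<le> M * exp (\<omega> * t)"
  by (rule onorm_bound) (use S_norm M in auto)

lemma S_bounded_operator: "0 \<le> t \<Longrightarrow> bounded_operator sc (S t)"
  unfolding bounded_operator_def
proof
  assume t: "0 \<le> t"
  show "Vector_Spaces.linear sc sc (S t)" by (rule S_sc_linear[OF t])
  show "bounded_linear (S t)"
    by (rule bounded_linear_intro[where K = "M * exp (\<omega> * t)"])
       (use S_norm[OF t] linear_add[OF S_linear[OF t]] linear_cmul[OF S_linear[OF t]] in \<open>auto simp: mult.commute\<close>)
qed

text \<open>The way back from \<open>saks_cosineI\<close>: bounded \<tau>-convergent sequences are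
  \<gamma>-convergent, so estimates between \<gamma>-seminorms give bi-equicontinuity.\<close>

lemma locally_bicontinuous: "locally_bicontinuous_cosine sc \<tau> S"
  unfolding locally_bicontinuous_cosine_def
proof (intro conjI allI impI)
  show "cosine_family sc S"
    unfolding cosine_family_def using S_sc_linear S_0 S_cosine by auto
  show "bounded_operator sc (S t)" if "0 \<le> t" for t by (rule S_bounded_operator[OF that])
  fix x
  show "continuous_map (top_of_set {0..}) \<tau> (\<lambda>t. S t x)"
    unfolding continuous_map_def
  proof (intro conjI allI impI)
    fix U assume U: "openin \<tau> U"
    have "openin (top_of_set {0..}) {t \<in> {0..}. S t x \<in> U}"
      unfolding openin_euclidean_subtopology_iff
    proof (intro conjI ballI)
      fix t assume "t \<in> {t \<in> {0..}. S t x \<in> U}"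
      then have t: "0 \<le> t" "S t x \<in> U" by auto
      obtain p r where p: "p \<in> P" "0 < r" "{y. p (y - S t x) < r} \<subseteq> U"
        using bspec[OF U[unfolded openin_tau] t(2)] by (elim bexE exE conjE) (rule that)
      have pG: "p \<in> \<Gamma>" using p(1) P_subset_\<Gamma> by blast
      have "\<forall>\<^sub>F s in at t within {0..}. p (S s x - S t x) < r"
        by (rule order_tendstoD(2)[OF S_cont[OF pG t(1)] p(2)])
      then obtain e where e: "0 < e" "\<And>s. s \<in> {0..} \<Longrightarrow> s \<noteq> t \<Longrightarrow> dist s t < e \<Longrightarrow> p (S s x - S t x) < r"
        unfolding eventually_at by blast
      have "s \<in> {t \<in> {0..}. S t x \<in> U}" if s: "s \<in> {0..}" "dist s t < e" for s
      proof (cases "s = t")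
        case True then show ?thesis using t by simp
      next
        case False
        then have "S s x \<in> {y. p (y - S t x) < r}" using e(2)[OF s(1) False s(2)] by simp
        then show ?thesis using p(3) s(1) by blast
      qed
      then show "\<exists>e>0. \<forall>s\<in>{0..}. dist s t < e \<longrightarrow> s \<in> {t \<in> {0..}. S t x \<in> U}" using e(1) by blast
    qed auto
    then show "openin (top_of_set {0..}) {t \<in> topspace (top_of_set {0..}). S t x \<in> U}" by simp
  qed simp
next
  fix N :: "real set" assume "compact N \<and> N \<subseteq> {0..}"
  then have N: "bounded N" "N \<subseteq> {0..}" by (auto intro: compact_imp_bounded)
  then obtain T where "\<forall>t\<in>N. norm t \<le> T" unfolding bounded_iff by blast
  then have T: "0 \<le> t" "t \<le> T" if "t \<in> N" for t using that N by auto
  have expT: "exp (b * t) \<le> exp (b * T)" if "t \<in> N" "0 \<le> b" for t b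
    using T[OF that(1)] that(2) by (simp add: mult_left_mono)
  show "bdd_above ((\<lambda>t. onorm (S t)) ` N)"
  proof (rule bdd_aboveI2)
    fix t assume t: "t \<in> N"
    have "M * exp (\<omega> * t) \<le> M * exp (\<omega> * T)" using expT[OF t omega] M by (intro mult_left_mono) auto
    then show "onorm (S t) \<le> M * exp (\<omega> * T)" using onorm_S_le[OF T(1)[OF t]] by simp
  qed
  show "bi_equicontinuous \<tau> N S"
    unfolding bi_equicontinuous_def
  proof (intro allI impI)
    fix s x U assume "bounded (range s) \<and> limitin \<tau> s x sequentially" and U: "openin \<tau> U \<and> 0 \<in> U"
    then have L: "limitin \<gamma> s x sequentially" by (simp add: limitin_gamma_iff)
    obtain p r where p: "p \<in> P" "0 < r" "{y. p (y - 0) < r} \<subseteq> U"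
      using bspec[of U _ 0, OF U[THEN conjunct1, unfolded openin_tau] U[THEN conjunct2]]
      by (elim bexE exE conjE) (rule that)
    have pG: "p \<in> \<Gamma>" using p(1) P_subset_\<Gamma> by blast
    obtain q where q: "q \<in> \<Gamma>" "\<And>t x. 0 \<le> t \<Longrightarrow> p (S t x) \<le> exp ((\<omega> + 1) * t) * q x"
      using S_equi[OF pG, of "\<omega> + 1"] by auto
    have "(\<lambda>n. exp ((\<omega> + 1) * T) * q (s n - x)) \<longlonglongrightarrow> 0"
      using tendsto_mult_left[OF limitin_gammaD[OF L q(1)], of "exp ((\<omega> + 1) * T)"] by simp
    then have "\<forall>\<^sub>F n in sequentially. exp ((\<omega> + 1) * T) * q (s n - x) < r"
      by (rule order_tendstoD(2)[OF _ p(2)])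
    then show "\<forall>\<^sub>F n in sequentially. \<forall>t\<in>N. S t (s n - x) \<in> U"
    proof (rule eventually_mono, intro ballI)
      fix n t assume n: "exp ((\<omega> + 1) * T) * q (s n - x) < r" and t: "t \<in> N"
      have "exp ((\<omega> + 1) * t) * q (s n - x) \<le> exp ((\<omega> + 1) * T) * q (s n - x)"
        using expT[OF t, of "\<omega> + 1"] omega seminorm_nonneg[OF \<Gamma>_seminorm[OF q(1)]] by (intro mult_right_mono) auto
      then have "p (S t (s n - x)) < r" using q(2)[OF T(1)[OF t], of "s n - x"] n by simp
      then show "S t (s n - x) \<in> U" using p(3) by auto
    qed
  qed
qed

text \<open>Bounded \<tau>-limits are \<gamma>-limits, under which the equation of
  \<open>generator_iff\<close> is stable.\<close>

lemma bi_closed_generator: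
  assumes l: "\<omega> < l" shows "bi_closed \<tau> (bi_generator \<tau> S)"
  unfolding bi_closed_def
proof (intro allI impI)
  fix s x y
  assume "range s \<subseteq> dom (bi_generator \<tau> S) \<and> bounded (range s) \<and> bounded (range (\<lambda>i. the (bi_generator \<tau> S (s i)))) \<and>
        limitin \<tau> s x sequentially \<and> limitin \<tau> (\<lambda>i. the (bi_generator \<tau> S (s i))) y sequentially"
  then have dom: "\<And>i. s i \<in> dom (bi_generator \<tau> S)" and L: "limitin \<gamma> s x sequentially"
    "limitin \<gamma> (\<lambda>i. the (bi_generator \<tau> S (s i))) y sequentially"
    by (auto simp: limitin_gamma_iff)
  have eq: "Res l (l\<^sup>2 *\<^sub>R s i - the (bi_generator \<tau> S (s i))) = s i" for i
    using dom[of i] by (intro Res_of_generator[OF l]) (auto simp: dom_def)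
  have "limitin \<gamma> (\<lambda>i. Res l (l\<^sup>2 *\<^sub>R s i - the (bi_generator \<tau> S (s i)))) (Res l (l\<^sup>2 *\<^sub>R x - y)) sequentially"
    by (intro limitin_gamma_image[OF Res_linear[OF l] Res_equi[OF l]] limitin_gamma_diff limitin_gamma_scaleR L)
  then have "limitin \<gamma> s (Res l (l\<^sup>2 *\<^sub>R x - y)) sequentially" by (simp only: eq)
  then have "Res l (l\<^sup>2 *\<^sub>R x - y) = x" using L(1) by (rule gamma_limit_unique) simp
  then show "bi_generator \<tau> S x = Some y" by (simp add: generator_iff[OF l])
qed

end

section \<open>Implications between the assertions\<close>

context saks_cosine_sequence
begin

text \<open>On a bounded time interval all orbits of \<open>x\<close> are bounded in norm, uniformly
  in \<open>n\<close>, so uniform \<tau>-convergence and uniform \<gamma>-convergence agree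
  there.\<close>

lemma assertion_e_iff:
  "assertion_e sc \<tau> Sn M \<omega> S \<longleftrightarrow> saks_cosine sc \<tau> \<gamma> P S M \<omega> \<and> uniform_limit_on_compacts S"
proof
  assume e: "assertion_e sc \<tau> Sn M \<omega> S"
  have S: "saks_cosine sc \<tau> \<gamma> P S M \<omega>"
    using e F.omega F.M by (intro saks_cosineI) (auto simp: assertion_e_def)
  interpret G: saks_cosine sc \<tau> \<gamma> P S M \<omega> by (rule S)
  have "uniform_limit_on_compacts S"
    unfolding uniform_limit_on_compacts_def
  proof (intro ballI allI impI)
    fix p and x :: 'a and T \<epsilon> :: real assume p: "p \<in> \<Gamma>" and \<epsilon>: "0 < \<epsilon>"
    \<comment> \<open>Twice the orbit bound, for a difference of two orbits.\<close>
    define K where "K = 2 * (M * exp (\<omega> * T) * norm x)"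
    obtain q \<delta> where q: "q \<in> P" "0 < \<delta>" "\<And>z. norm z \<le> K \<Longrightarrow> q z < \<delta> \<Longrightarrow> p z < \<epsilon>"
      using \<Gamma>_small[OF p \<epsilon>, of K] by blast
    have "openin \<tau> {y. q y < \<delta>} \<and> 0 \<in> {y. q y < \<delta>}"
      using tau_ball[OF q(1), of 0 \<delta>] q(2) by (simp add: seminorm_zero[OF P_seminorm[OF q(1)]])
    moreover have "compact {0..T} \<and> {0..T} \<subseteq> {0..}" by auto
    ultimately have "\<forall>\<^sub>F n in sequentially. \<forall>t\<in>{0..T}. Sn n t x - S t x \<in> {y. q y < \<delta>}"
      using e unfolding assertion_e_def by blast
    then obtain N where N: "\<And>n t. n \<ge> N \<Longrightarrow> t \<in> {0..T} \<Longrightarrow> q (Sn n t x - S t x) < \<delta>"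
      unfolding eventually_sequentially by blast
    have "p (Sn n t x - S t x) < \<epsilon>" if n: "n \<ge> N" and t: "0 \<le> t" "t \<le> T" for n t
    proof (rule q(3))
      have "M * exp (\<omega> * t) * norm x \<le> M * exp (\<omega> * T) * norm x"
        using t F.omega F.M by (intro mult_right_mono mult_left_mono) (auto intro: mult_left_mono)
      then show "norm (Sn n t x - S t x) \<le> K"
        using norm_triangle_ineq4[of "Sn n t x" "S t x"] F.S_norm[OF t(1), of n x] G.S_norm[OF t(1), of x]
        by (simp add: K_def)
      show "q (Sn n t x - S t x) < \<delta>" using N[OF n] t by simp
    qed
    then show "\<exists>N. \<forall>n\<ge>N. \<forall>t. 0 \<le> t \<and> t \<le> T \<longrightarrow> p (Sn n t x - S t x) < \<epsilon>" by blast
  qed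
  with S show "saks_cosine sc \<tau> \<gamma> P S M \<omega> \<and> uniform_limit_on_compacts S" by simp
next
  assume R: "saks_cosine sc \<tau> \<gamma> P S M \<omega> \<and> uniform_limit_on_compacts S"
  then interpret G: saks_cosine sc \<tau> \<gamma> P S M \<omega> by simp
  show "assertion_e sc \<tau> Sn M \<omega> S"
    unfolding assertion_e_def
  proof (intro conjI allI impI)
    show "locally_bicontinuous_cosine sc \<tau> S" by (rule G.locally_bicontinuous)
    show "onorm (S t) \<le> M * exp (\<omega> * t)" if "0 \<le> t" for t by (rule G.onorm_S_le[OF that])
    fix x :: 'a and U and N :: "real set" assume "compact N \<and> N \<subseteq> {0..}" and U: "openin \<tau> U \<and> 0 \<in> U"
    then have N: "bounded N" "N \<subseteq> {0..}" by (auto intro: compact_imp_bounded)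
    then obtain T where "\<forall>t\<in>N. norm t \<le> T" unfolding bounded_iff by blast
    then have T: "0 \<le> t" "t \<le> T" if "t \<in> N" for t using that N by auto
    obtain p r where p: "p \<in> P" "0 < r" "{y. p (y - 0) < r} \<subseteq> U"
      using bspec[of U _ 0, OF U[THEN conjunct1, unfolded openin_tau] U[THEN conjunct2]]
      by (elim bexE exE conjE) (rule that)
    have pG: "p \<in> \<Gamma>" using p(1) P_subset_\<Gamma> by blast
    obtain n0 where n0: "\<And>n t. n \<ge> n0 \<Longrightarrow> 0 \<le> t \<Longrightarrow> t \<le> T \<Longrightarrow> p (Sn n t x - S t x) < r"
      using R pG p(2) unfolding uniform_limit_on_compacts_def by blast
    have "Sn n t x - S t x \<in> U" if "n \<ge> n0" "t \<in> N" for n t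
    proof -
      have "Sn n t x - S t x \<in> {y. p (y - 0) < r}" using n0[OF that(1)] T[OF that(2)] by simp
      then show ?thesis using p(3) by blast
    qed
    then show "\<forall>\<^sub>F n in sequentially. \<forall>t\<in>N. Sn n t x - S t x \<in> U"
      unfolding eventually_sequentially by blast
  qed
qed

text \<open>The common core of the resolvent assertions: it is derived from (b), (c) and (d), and
  the limit family is built from it.\<close>

definition resolvent_limit :: "real \<Rightarrow> ('a \<Rightarrow> 'a) \<Rightarrow> bool" where
  "resolvent_limit l R \<longleftrightarrow> (\<forall>x. limitin \<gamma> (\<lambda>n. F.Res n l x) (R x) sequentially) \<and>
     (\<forall>p\<in>\<Gamma>. \<forall>x \<epsilon>. 0 < \<epsilon> \<longrightarrow> (\<exists>y. p (x - R y) < \<epsilon>))"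

context
  fixes An :: "nat \<Rightarrow> 'a \<rightharpoonup> 'a" and l :: real
  assumes An: "\<And>n. An n = bi_generator \<tau> (Sn n)" and l: "\<omega> < l"
begin

lemma resolvent_An: "resolvent sc (of_real (l\<^sup>2)) (An n) = F.Res n l"
  unfolding An by (rule F.resolvent_generator[OF l])

lemma resolvent_limitI:
  assumes "\<And>x. limitin \<gamma> (\<lambda>n. F.Res n l x) (R x) sequentially" and d: "dense_in \<gamma> (range R)"
  shows "resolvent_limit l R"
  unfolding resolvent_limit_def
proof (intro conjI allI ballI impI assms(1))
  fix p x and \<epsilon> :: real assume p: "p \<in> \<Gamma>" and \<epsilon>: "0 < \<epsilon>"
  obtain z where "z \<in> range R" "p (z - x) < \<epsilon>" using dense_inD[OF d p \<epsilon>] .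
  then show "\<exists>y. p (x - R y) < \<epsilon>" using seminorm_minus_commute[OF \<Gamma>_seminorm[OF p]] by auto
qed

lemma assertion_c_imp_resolvent_limit:
  assumes c: "assertion_c sc \<tau> An l R" shows "resolvent_limit l R"
proof (rule resolvent_limitI)
  show "dense_in \<gamma> (range R)" using c by (auto simp: assertion_c_def intro: bi_dense_imp_dense_in)
  fix x
  have "limitin \<tau> (\<lambda>n. F.Res n l x) (R x) sequentially"
    using c unfolding assertion_c_def resolvent_An by blast
  \<comment> \<open>A norm bound uniform in \<open>n\<close> lifts the convergence from \<tau> to
    \<gamma>.\<close>
  moreover have "norm (F.Res n l x) \<le> 1 / (2 * l) * (M * norm x) * (2 / (l - \<omega>))" for n
    unfolding F.Res_def using F.l_pos[OF l] by (intro F.Phi_norm_bound[OF F.kernel_Res[OF l] l]) simp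
  ultimately show "limitin \<gamma> (\<lambda>n. F.Res n l x) (R x) sequentially"
    by (intro limitin_gammaI[OF _ always_eventually]) auto
qed

lemma assertion_d_imp_resolvent_limit:
  assumes d: "assertion_d sc \<gamma> An l R" shows "resolvent_limit l R"
proof (rule resolvent_limitI)
  show "dense_in \<gamma> (range R)" using d by (simp add: assertion_d_def)
  show "limitin \<gamma> (\<lambda>n. F.Res n l x) (R x) sequentially" for x
    using d unfolding assertion_d_def resolvent_An by blast
qed

lemma resolvent_limit_imp_assertion_e:
  assumes "resolvent_limit l R" shows "\<exists>S. assertion_e sc \<tau> Sn M \<omega> S"
proof -
  have lim: "\<And>x. limitin \<gamma> (\<lambda>n. F.Res n l x) (R x) sequentially"
    and dense: "\<And>p x \<epsilon>. p \<in> \<Gamma> \<Longrightarrow> 0 < \<epsilon> \<Longrightarrow> \<exists>y. p (x - R y) < \<epsilon>"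
    using assms unfolding resolvent_limit_def by blast+
  obtain S where "saks_cosine sc \<tau> \<gamma> P S M \<omega>" "uniform_limit_on_compacts S"
    by (rule limit_family_exists[OF l lim dense])
  then show ?thesis using assertion_e_iff by blast
qed

lemma resolvent_limit_eq:
  assumes "resolvent_limit l R" and e: "assertion_e sc \<tau> Sn M \<omega> S"
  shows "R = saks_cosine.Res sc \<gamma> S l"
proof
  fix x
  have "limitin \<gamma> (\<lambda>n. F.Res n l x) (saks_cosine.Res sc \<gamma> S l x) sequentially"
    using e l unfolding assertion_e_iff by (intro Res_limit) auto
  moreover have "limitin \<gamma> (\<lambda>n. F.Res n l x) (R x) sequentially"
    using assms(1) unfolding resolvent_limit_def by blast
  ultimately show "R x = saks_cosine.Res sc \<gamma> S l x" by (intro gamma_limit_unique) auto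
qed

lemma assertion_e_imp_assertion_c_d:
  assumes e: "assertion_e sc \<tau> Sn M \<omega> S"
  shows "assertion_c sc \<tau> An l (saks_cosine.Res sc \<gamma> S l)" "assertion_d sc \<gamma> An l (saks_cosine.Res sc \<gamma> S l)"
proof -
  have S: "saks_cosine sc \<tau> \<gamma> P S M \<omega>" "uniform_limit_on_compacts S" using e by (auto simp: assertion_e_iff)
  interpret G: saks_cosine sc \<tau> \<gamma> P S M \<omega> by (rule S)
  have lim: "limitin \<gamma> (\<lambda>n. F.Res n l x) (G.Res l x) sequentially" for x by (rule Res_limit[OF S l])
  show "assertion_c sc \<tau> An l (G.Res l)"
    unfolding assertion_c_def resolvent_An
    by (intro conjI allI G.Res_bounded_operator[OF l] limitin_gamma_imp_tau[OF lim] G.inj_Res[OF l] G.bi_dense_range_Res[OF l])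
  show "assertion_d sc \<gamma> An l (G.Res l)"
    unfolding assertion_d_def resolvent_An continuous_operator_def
    by (intro conjI allI lim G.Res_sc_linear[OF l] continuous_mapI_\<Gamma> G.Res_linear[OF l] G.Res_equi[OF l]
        G.inj_Res[OF l] bi_dense_imp_dense_in G.bi_dense_range_Res[OF l])
qed

text \<open>For \<open>x\<close> in \<open>D\<close> the difference between
  \<open>Res n l (l^2 x - A x)\<close> and \<open>x\<close> is eventually
  \<open>Res n l (An n x - A x)\<close>, which tends to 0. Since \<open>D\<close> is a core and
  \<open>l^2 - A\<close> has dense range, the vectors \<open>l^2 x - A x\<close> with
  \<open>x\<close> in \<open>D\<close> are dense, and equicontinuity gives convergence everywhere.
  The limit inverts \<open>l^2 - A\<close> from the left, so its range contains the dense domain of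
  \<open>A\<close>.\<close>

lemma assertion_b_imp_resolvent_limit:
  assumes b: "assertion_b sc \<gamma> An l A D"
  obtains R where "resolvent_limit l R" "\<forall>x\<in>dom A. R (l\<^sup>2 *\<^sub>R x - the (A x)) = x"
proof -
  have A: "linear_op sc A" and dA: "dense_in \<gamma> (dom A)" and core: "topological_core sc \<gamma> A D"
    and D: "D \<subseteq> (\<Union>k. \<Inter>n\<in>{k..}. dom (An n))"
    and lim: "\<And>x. x \<in> D \<Longrightarrow> limitin \<gamma> (\<lambda>n. the (An n x)) (the (A x)) sequentially"
    and dR: "dense_in \<gamma> (scalar_minus sc (of_real (l\<^sup>2)) A ` dom A)"
    using b unfolding assertion_b_def by blast+
  have DA: "D \<subseteq> dom A" using core by (simp add: topological_core_def)
  have sm: "scalar_minus sc (of_real (l\<^sup>2)) A = (\<lambda>x. l\<^sup>2 *\<^sub>R x - the (A x))"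
    unfolding scalar_minus_def normed_scalingD(2)[OF scaling] ..
  have on_D: "limitin \<gamma> (\<lambda>n. F.Res n l (l\<^sup>2 *\<^sub>R x - the (A x))) x sequentially" if x: "x \<in> D" for x
    unfolding limitin_gamma
  proof
    fix p assume p: "p \<in> \<Gamma>"
    obtain q where q: "q \<in> \<Gamma>" "\<And>n x. p (F.Res n l x) \<le> q x" using Res_equi_uniform[OF l p] by blast
    obtain k where xk: "x \<in> (\<Inter>n\<in>{k..}. dom (An n))" using subsetD[OF D x] by (rule UN_E)
    have k: "x \<in> dom (An n)" if "n \<ge> k" for n using xk by (rule INT_D) (simp add: that)
    have "p (F.Res n l (l\<^sup>2 *\<^sub>R x - the (A x)) - x) \<le> q (the (An n x) - the (A x))" if n: "n \<ge> k" for n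
    proof -
      have "F.Res n l (l\<^sup>2 *\<^sub>R x - the (An n x)) = x"
        using k[OF n] by (intro F.Res_of_generator[OF l]) (auto simp: An dom_def)
      moreover have "F.Res n l (l\<^sup>2 *\<^sub>R x - the (A x))
          = F.Res n l (l\<^sup>2 *\<^sub>R x - the (An n x)) + F.Res n l (the (An n x) - the (A x))"
        by (simp flip: linear_add[OF F.Res_linear[OF l]])
      ultimately have "F.Res n l (l\<^sup>2 *\<^sub>R x - the (A x)) - x = F.Res n l (the (An n x) - the (A x))"
        by simp
      then show ?thesis using q(2) by simp
    qed
    then have "\<forall>\<^sub>F n in sequentially. p (F.Res n l (l\<^sup>2 *\<^sub>R x - the (A x)) - x) \<le> q (the (An n x) - the (A x))"
      by (auto simp: eventually_sequentially)
    then show "(\<lambda>n. p (F.Res n l (l\<^sup>2 *\<^sub>R x - the (A x)) - x)) \<longlonglongrightarrow> 0"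
      using seminorm_nonneg[OF \<Gamma>_seminorm[OF p]]
      by (intro tendsto_sandwich[OF always_eventually _ tendsto_const limitin_gammaD[OF lim[OF x] q(1)]]) auto
  qed
  have core_approx: "\<exists>w\<in>D. p (w - x) + p (l\<^sup>2 *\<^sub>R (w - x) - (the (A w) - the (A x))) < \<epsilon>"
    if p: "p \<in> \<Gamma>" and \<epsilon>: "0 < \<epsilon>" and x: "x \<in> dom A" for p x \<epsilon>
  proof -
    note sn = \<Gamma>_seminorm[OF p]
    \<comment> \<open>The factor \<open>l^2 + 1\<close> collects \<open>p (w - x)\<close> itself and
      the contribution of \<open>l^2\<close> times \<open>w - x\<close>.\<close>
    have G: "(\<lambda>z. (l\<^sup>2 + 1) * p z) \<in> \<Gamma>" by (rule \<Gamma>_cmult[OF p]) simp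
    obtain w where w: "w \<in> D" "(l\<^sup>2 + 1) * p (w - x) + (l\<^sup>2 + 1) * p (the (A (w - x))) < \<epsilon>"
      using topological_coreD[OF A core x G \<epsilon>] by blast
    have wA: "w \<in> dom A" using w DA by blast
    have "p (l\<^sup>2 *\<^sub>R (w - x) - the (A (w - x))) \<le> l\<^sup>2 * p (w - x) + p (the (A (w - x)))"
      using seminorm_diff_le[OF sn, of "l\<^sup>2 *\<^sub>R (w - x)" "the (A (w - x))"] by (simp add: seminorm_scale[OF sn])
    moreover have "p (the (A (w - x))) \<le> (l\<^sup>2 + 1) * p (the (A (w - x)))"
      using mult_right_mono[of 1 "l\<^sup>2 + 1" "p (the (A (w - x)))"] seminorm_nonneg[OF sn] by simp
    ultimately have "p (w - x) + p (l\<^sup>2 *\<^sub>R (w - x) - the (A (w - x))) < \<epsilon>"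
      using w(2) by (simp add: distrib_right)
    then show ?thesis using w(1) by (intro bexI[of _ w]) (simp add: linear_opD(2)[OF A wA x])
  qed
  have conv: "\<exists>y. limitin \<gamma> (\<lambda>n. F.Res n l z) y sequentially" for z
  proof (rule gamma_Cauchy_convergent)
    fix p and \<epsilon> :: real assume p: "p \<in> \<Gamma>" and \<epsilon>: "0 < \<epsilon>"
    note sn = \<Gamma>_seminorm[OF p]
    obtain q where q: "q \<in> \<Gamma>" "\<And>n x. p (F.Res n l x) \<le> q x" using Res_equi_uniform[OF l p] by blast
    note snq = \<Gamma>_seminorm[OF q(1)]
    have \<epsilon>8: "0 < \<epsilon> / 8" using \<epsilon> by simp
    obtain u where u: "u \<in> scalar_minus sc (of_real (l\<^sup>2)) A ` dom A" "q (u - z) < \<epsilon> / 8"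
      using dense_inD[OF dR q(1) \<epsilon>8] .
    then obtain x where x: "x \<in> dom A" "u = l\<^sup>2 *\<^sub>R x - the (A x)" unfolding sm by blast
    obtain w where w: "w \<in> D" "q (w - x) + q (l\<^sup>2 *\<^sub>R (w - x) - (the (A w) - the (A x))) < \<epsilon> / 8"
      using core_approx[OF q(1) \<epsilon>8 x(1)] by blast
    define v where "v = l\<^sup>2 *\<^sub>R w - the (A w)"
    have "v - u = l\<^sup>2 *\<^sub>R (w - x) - (the (A w) - the (A x))" by (simp add: v_def x(2) algebra_simps)
    then have "q (v - u) < \<epsilon> / 8" using w(2) seminorm_nonneg[OF snq, of "w - x"] by simp
    then have qv: "q (z - v) < \<epsilon> / 4"
      using seminorm_diff_triangle[OF snq, of v z u] u(2) seminorm_minus_commute[OF snq, of z v] by simp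
    have "\<forall>\<^sub>F n in sequentially. p (F.Res n l v - w) < \<epsilon> / 4"
      by (rule order_tendstoD(2)[OF limitin_gammaD[OF on_D[OF w(1), folded v_def] p]]) (use \<epsilon> in simp)
    then obtain N where N: "\<And>n. n \<ge> N \<Longrightarrow> p (F.Res n l v - w) < \<epsilon> / 4" by (auto simp: eventually_sequentially)
    have close: "p (F.Res n l z - w) < \<epsilon> / 2" if "n \<ge> N" for n
      using seminorm_diff_triangle[OF sn, of "F.Res n l z" w "F.Res n l v"] N[OF that] q(2)[of n "z - v"] qv
      by (simp add: linear_diff[OF F.Res_linear[OF l]])
    have "p (F.Res m l z - F.Res n l z) < \<epsilon>" if "m \<ge> N" "n \<ge> N" for m n
      using seminorm_diff_triangle[OF sn, of "F.Res m l z" "F.Res n l z" w] close[OF that(1)] close[OF that(2)]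
        seminorm_minus_commute[OF sn, of w "F.Res n l z"] by simp
    then show "\<exists>N. \<forall>m\<ge>N. \<forall>n\<ge>N. p (F.Res m l z - F.Res n l z) < \<epsilon>" by blast
  qed
  define R where "R z = (SOME y. limitin \<gamma> (\<lambda>n. F.Res n l z) y sequentially)" for z
  have R: "limitin \<gamma> (\<lambda>n. F.Res n l z) (R z) sequentially" for z
    unfolding R_def using conv by (rule someI_ex)
  have R_diff: "R (y - z) = R y - R z" for y z
  proof -
    have "limitin \<gamma> (\<lambda>n. F.Res n l (y - z)) (R y - R z) sequentially"
      unfolding linear_diff[OF F.Res_linear[OF l]] by (intro limitin_gamma_diff R)
    then show ?thesis by (rule gamma_limit_unique[OF R]) simp
  qed
  have R_equi: "\<exists>q\<in>\<Gamma>. \<forall>z. p (R z) \<le> q z" if p: "p \<in> \<Gamma>" for p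
  proof -
    obtain q where q: "q \<in> \<Gamma>" "\<And>n x. p (F.Res n l x) \<le> q x" using Res_equi_uniform[OF l p] by blast
    have "p (R z) \<le> q z" for z
      by (rule tendsto_upperbound[OF limitin_gamma_seminorm[OF R p] always_eventually]) (use q(2) in auto)
    then show ?thesis using q(1) by blast
  qed
  \<comment> \<open>From \<open>D\<close> the identity extends to \<open>dom A\<close> along the
    core, since \<open>R\<close> inherits the equicontinuity of the resolvents.\<close>
  have R_A: "R (l\<^sup>2 *\<^sub>R x - the (A x)) = x" if x: "x \<in> dom A" for x
  proof -
    have "p (R (l\<^sup>2 *\<^sub>R x - the (A x)) - x) \<le> 0" if p: "p \<in> \<Gamma>" for p
    proof (rule field_le_epsilon)
      fix \<epsilon> :: real assume \<epsilon>: "0 < \<epsilon>"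
      note sn = \<Gamma>_seminorm[OF p]
      obtain q where q: "q \<in> \<Gamma>" "\<And>z. p (R z) \<le> q z" using R_equi[OF p] by blast
      obtain w where w: "w \<in> D" "(p (w - x) + q (w - x)) + (p (l\<^sup>2 *\<^sub>R (w - x) - (the (A w) - the (A x))) + q (l\<^sup>2 *\<^sub>R (w - x) - (the (A w) - the (A x)))) < \<epsilon>"
        using core_approx[OF \<Gamma>_add[OF p q(1)] \<epsilon> x] by blast
      have "R (l\<^sup>2 *\<^sub>R w - the (A w)) = w" by (rule gamma_limit_unique[OF R on_D[OF w(1)]]) simp
      then have "R (l\<^sup>2 *\<^sub>R x - the (A x)) - x = (w - x) - R ((l\<^sup>2 *\<^sub>R w - the (A w)) - (l\<^sup>2 *\<^sub>R x - the (A x)))"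
        by (simp only: R_diff) simp
      also have "(l\<^sup>2 *\<^sub>R w - the (A w)) - (l\<^sup>2 *\<^sub>R x - the (A x)) = l\<^sup>2 *\<^sub>R (w - x) - (the (A w) - the (A x))"
        by (simp add: algebra_simps)
      finally have eq: "R (l\<^sup>2 *\<^sub>R x - the (A x)) - x = (w - x) - R (l\<^sup>2 *\<^sub>R (w - x) - (the (A w) - the (A x)))" .
      have "p (R (l\<^sup>2 *\<^sub>R x - the (A x)) - x) \<le> p (w - x) + q (l\<^sup>2 *\<^sub>R (w - x) - (the (A w) - the (A x)))"
        unfolding eq using seminorm_diff_le[OF sn, of "w - x" "R (l\<^sup>2 *\<^sub>R (w - x) - (the (A w) - the (A x)))"]
          q(2)[of "l\<^sup>2 *\<^sub>R (w - x) - (the (A w) - the (A x))"] by simp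
      then show "p (R (l\<^sup>2 *\<^sub>R x - the (A x)) - x) \<le> 0 + \<epsilon>"
        using w(2) seminorm_nonneg[OF \<Gamma>_seminorm[OF q(1)], of "w - x"]
          seminorm_nonneg[OF sn, of "l\<^sup>2 *\<^sub>R (w - x) - (the (A w) - the (A x))"] by simp
    qed
    then have "R (l\<^sup>2 *\<^sub>R x - the (A x)) - x = 0" by (rule eq_0_if_\<Gamma>_0)
    then show ?thesis by simp
  qed
  have "resolvent_limit l R"
    unfolding resolvent_limit_def
  proof (intro conjI allI ballI impI R)
    fix p z and \<epsilon> :: real assume p: "p \<in> \<Gamma>" and \<epsilon>: "0 < \<epsilon>"
    obtain x where "x \<in> dom A" "p (x - z) < \<epsilon>" using dense_inD[OF dA p \<epsilon>] .
    then show "\<exists>y. p (z - R y) < \<epsilon>"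
      using R_A[of x] seminorm_minus_commute[OF \<Gamma>_seminorm[OF p], of z x] by metis
  qed
  then show ?thesis using R_A that by blast
qed

lemma assertion_a_imp_assertion_b:
  assumes a: "assertion_a sc \<tau> An l A D" shows "assertion_b sc \<gamma> An l A D"
  unfolding assertion_b_def
proof (intro conjI ballI)
  show A: "linear_op sc A" using a by (simp add: assertion_a_def)
  show "dense_in \<gamma> (dom A)" using a by (auto simp: assertion_a_def intro: bi_dense_imp_dense_in)
  show "topological_core sc \<gamma> A D" using a by (auto simp: assertion_a_def intro: bi_core_imp_topological_core)
  show D: "D \<subseteq> (\<Union>k. \<Inter>n\<in>{k..}. dom (An n))" using a by (simp add: assertion_a_def)
  show "dense_in \<gamma> (scalar_minus sc (of_real (l\<^sup>2)) A ` dom A)"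
    using a unfolding assertion_a_def by (blast intro: bi_dense_imp_dense_in)
  fix x assume x: "x \<in> D"
  have bd: "bounded {the (An n x) | n. x \<in> dom (An n)}" and L: "limitin \<tau> (\<lambda>n. the (An n x)) (the (A x)) sequentially"
    using a x unfolding assertion_a_def by blast+
  obtain K where K: "\<forall>y\<in>{the (An n x) | n. x \<in> dom (An n)}. norm y \<le> K" using bd unfolding bounded_iff by blast
  obtain k where xk: "x \<in> (\<Inter>n\<in>{k..}. dom (An n))" using subsetD[OF D x] by (rule UN_E)
    have k: "x \<in> dom (An n)" if "n \<ge> k" for n using xk by (rule INT_D) (simp add: that)
  \<comment> \<open>The bound concerns the indices at which \<open>x\<close> lies in the domain,
    which is the case from \<open>k\<close> on.\<close>
  have "norm (the (An n x)) \<le> K" if "n \<ge> k" for n using K k[OF that] by blast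
  then have "\<forall>\<^sub>F n in sequentially. norm (the (An n x)) \<le> K" by (auto simp: eventually_sequentially)
  with L show "limitin \<gamma> (\<lambda>n. the (An n x)) (the (A x)) sequentially" by (rule limitin_gammaI)
qed

text \<open>The left inverse obtained from (b) is the resolvent of the generator, so its identity on
  \<open>dom A\<close> is exactly the equation of \<open>generator_iff\<close>.\<close>

lemma generator_extends:
  assumes b: "assertion_b sc \<gamma> An l A D" and e: "assertion_e sc \<tau> Sn M \<omega> S"
  shows "A \<subseteq>\<^sub>m bi_generator \<tau> S"
proof -
  interpret G: saks_cosine sc \<tau> \<gamma> P S M \<omega> using e by (simp add: assertion_e_iff)
  obtain R where R: "resolvent_limit l R" "\<forall>x\<in>dom A. R (l\<^sup>2 *\<^sub>R x - the (A x)) = x"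
    using assertion_b_imp_resolvent_limit[OF b] .
  have "bi_generator \<tau> S x = Some (the (A x))" if "x \<in> dom A" for x
    using bspec[OF R(2) that] resolvent_limit_eq[OF R(1) e] by (simp add: G.generator_iff[OF l])
  then show ?thesis unfolding map_le_def by force
qed

text \<open>Minimality: a point of the graph of the generator is the pair of \<open>Res l z\<close>
  and \<open>l^2 Res l z - z\<close>. If \<open>z\<close> is approximated by vectors
  \<open>u = l^2 w - A w\<close>, which are dense, then \<open>w = Res l u\<close> and
  \<open>A w = l^2 w - u\<close> follow continuously. Hence the graph of \<open>A\<close>, and with
  it that of any closed extension, comes arbitrarily close.\<close>

lemma generator_graph_closure:
  assumes b: "assertion_b sc \<gamma> An l A D" and e: "assertion_e sc \<tau> Sn M \<omega> S"
  shows "is_graph_closure sc \<gamma> A (bi_generator \<tau> S)"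
proof -
  interpret G: saks_cosine sc \<tau> \<gamma> P S M \<omega> using e by (simp add: assertion_e_iff)
  note ext = generator_extends[OF b e]
  have dR: "dense_in \<gamma> (scalar_minus sc (of_real (l\<^sup>2)) A ` dom A)" using b by (simp add: assertion_b_def)
  have sm: "scalar_minus sc (of_real (l\<^sup>2)) A = (\<lambda>x. l\<^sup>2 *\<^sub>R x - the (A x))"
    unfolding scalar_minus_def normed_scalingD(2)[OF scaling] ..
  show ?thesis
    unfolding is_graph_closure_def closed_extension_def
  proof (intro conjI allI impI ext G.linear_op_generator G.graph_closed_generator[OF l])
    fix C assume C: "linear_op sc C \<and> A \<subseteq>\<^sub>m C \<and> graph_closed \<gamma> C"
    have "C x = Some y" if xy: "bi_generator \<tau> S x = Some y" for x y
    proof (rule ccontr)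
      assume ne: "C x \<noteq> Some y"
      define z where "z = l\<^sup>2 *\<^sub>R x - y"
      have xz: "G.Res l z = x" using xy by (simp add: z_def G.generator_iff[OF l])
      have op: "openin (prod_topology \<gamma> \<gamma>) (topspace (prod_topology \<gamma> \<gamma>) - {(x, y). C x = Some y})"
        using C by (simp add: graph_closed_def closedin_def)
      have mem: "(x, y) \<in> topspace (prod_topology \<gamma> \<gamma>) - {(x, y). C x = Some y}" using ne by simp
      from op[unfolded openin_prod_topology_alt, rule_format, OF mem] obtain U V where UV: "openin \<gamma> U" "openin \<gamma> V" "x \<in> U" "y \<in> V"
          "U \<times> V \<subseteq> topspace (prod_topology \<gamma> \<gamma>) - {(x, y). C x = Some y}"
        by (elim exE conjE) (rule that)
      obtain p where p: "p \<in> \<Gamma>" "{u. p (u - x) < 1} \<subseteq> U"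
        using bspec[OF UV(1)[unfolded openin_gamma] UV(3)] by blast
      obtain r where r: "r \<in> \<Gamma>" "{u. r (u - y) < 1} \<subseteq> V"
        using bspec[OF UV(2)[unfolded openin_gamma] UV(4)] by blast
      obtain p' where p': "p' \<in> \<Gamma>" "\<And>u. p (G.Res l u) \<le> p' u" using G.Res_equi[OF l p(1)] by blast
      obtain r' where r': "r' \<in> \<Gamma>" "\<And>u. r (G.Res l u) \<le> r' u" using G.Res_equi[OF l r(1)] by blast
      \<comment> \<open>Controls both coordinates at once: \<open>p'\<close> is for
        \<open>w - x\<close>, the rest for \<open>A w - y = l^2 (w - x) - (u - z)\<close>.\<close>
      have G: "(\<lambda>u. p' u + (l\<^sup>2 * r' u + r u)) \<in> \<Gamma>" by (intro \<Gamma>_add \<Gamma>_cmult p' r' r) simp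
      obtain u where u: "u \<in> scalar_minus sc (of_real (l\<^sup>2)) A ` dom A" "p' (u - z) + (l\<^sup>2 * r' (u - z) + r (u - z)) < 1"
        using dense_inD[OF dR G zero_less_one] by blast
      then obtain w where w: "w \<in> dom A" "u = l\<^sup>2 *\<^sub>R w - the (A w)" unfolding sm by blast
      have Aw: "A w = Some (the (A w))" using w(1) by (auto simp: dom_def)
      have wu: "G.Res l u = w"
        using ext w(1) Aw unfolding w(2) map_le_def by (intro G.Res_of_generator[OF l]) auto
      have wx: "w - x = G.Res l (u - z)" using wu xz by (simp add: linear_diff[OF G.Res_linear[OF l]])
      have nn: "0 \<le> p' (u - z)" "0 \<le> l\<^sup>2 * r' (u - z)" "0 \<le> r (u - z)"
        using seminorm_nonneg[OF \<Gamma>_seminorm] p'(1) r'(1) r(1) by auto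
      have "p (w - x) < 1" using p'(2)[of "u - z"] u(2) nn unfolding wx by linarith
      then have wU: "w \<in> U" using p(2) by blast
      have "the (A w) - y = l\<^sup>2 *\<^sub>R (w - x) - (u - z)" by (simp add: w(2) z_def algebra_simps)
      then have "r (the (A w) - y) \<le> l\<^sup>2 * r (w - x) + r (u - z)"
        using seminorm_diff_le[OF \<Gamma>_seminorm[OF r(1)], of "l\<^sup>2 *\<^sub>R (w - x)" "u - z"]
        by (simp add: seminorm_scale[OF \<Gamma>_seminorm[OF r(1)]])
      also have "l\<^sup>2 * r (w - x) \<le> l\<^sup>2 * r' (u - z)" unfolding wx by (intro mult_left_mono r'(2)) simp
      finally have "r (the (A w) - y) < 1" using u(2) nn by linarith
      then have "the (A w) \<in> V" using r(2) by blast
      then have "(w, the (A w)) \<in> U \<times> V" using wU by simp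
      from subsetD[OF UV(5) this] have "C w \<noteq> Some (the (A w))" by simp
      moreover have "C w = Some (the (A w))" using C w(1) Aw unfolding map_le_def by force
      ultimately show False by simp
    qed
    then show "bi_generator \<tau> S \<subseteq>\<^sub>m C" unfolding map_le_def dom_def by fastforce
  qed
qed

text \<open>As for the topological closure, with sequences: bi-density supplies bounded
  approximations \<open>u\<close>, and \<open>w = Res l u\<close> and \<open>A w\<close> remain
  bounded because \<gamma>-convergent sequences are.\<close>

lemma generator_bi_closure:
  assumes a: "assertion_a sc \<tau> An l A D" and e: "assertion_e sc \<tau> Sn M \<omega> S"
  shows "is_bi_closure sc \<tau> A (bi_generator \<tau> S)"
proof -
  interpret G: saks_cosine sc \<tau> \<gamma> P S M \<omega> using e by (simp add: assertion_e_iff)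
  note ext = generator_extends[OF assertion_a_imp_assertion_b[OF a] e]
  have dR: "bi_dense \<tau> (scalar_minus sc (of_real (l\<^sup>2)) A ` dom A)" using a by (simp add: assertion_a_def)
  have sm: "scalar_minus sc (of_real (l\<^sup>2)) A = (\<lambda>x. l\<^sup>2 *\<^sub>R x - the (A x))"
    unfolding scalar_minus_def normed_scalingD(2)[OF scaling] ..
  show ?thesis
    unfolding is_bi_closure_def closed_extension_def
  proof (intro conjI allI impI ext G.linear_op_generator G.bi_closed_generator[OF l])
    fix C assume C: "linear_op sc C \<and> A \<subseteq>\<^sub>m C \<and> bi_closed \<tau> C"
    have "C x = Some y" if xy: "bi_generator \<tau> S x = Some y" for x y
    proof -
      define z where "z = l\<^sup>2 *\<^sub>R x - y"
      have xz: "G.Res l z = x" using xy by (simp add: z_def G.generator_iff[OF l])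
      obtain u :: "nat \<Rightarrow> 'a" where u: "range u \<subseteq> scalar_minus sc (of_real (l\<^sup>2)) A ` dom A"
          "bounded (range u)" "limitin \<tau> u z sequentially"
        using dR unfolding bi_dense_def by blast
      then have Lu: "limitin \<gamma> u z sequentially" by (simp add: limitin_gamma_iff)
      have "\<forall>i. \<exists>w. w \<in> dom A \<and> u i = l\<^sup>2 *\<^sub>R w - the (A w)" using u(1) unfolding sm by blast
      then obtain w where w: "\<And>i. w i \<in> dom A" "\<And>i. u i = l\<^sup>2 *\<^sub>R w i - the (A (w i))" by metis
      have Aw: "A (w i) = Some (the (A (w i)))" for i using w(1)[of i] by (auto simp: dom_def)
      have wu: "G.Res l (u i) = w i" for i
        using ext w(1)[of i] Aw[of i] unfolding w(2) map_le_def by (intro G.Res_of_generator[OF l]) auto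
      have "limitin \<gamma> (\<lambda>i. G.Res l (u i)) (G.Res l z) sequentially"
        by (rule limitin_gamma_image[OF G.Res_linear[OF l] G.Res_equi[OF l] Lu])
      then have Lw: "limitin \<gamma> w x sequentially" by (simp only: wu xz)
      have "limitin \<gamma> (\<lambda>i. l\<^sup>2 *\<^sub>R w i - u i) (l\<^sup>2 *\<^sub>R x - z) sequentially"
        by (intro limitin_gamma_diff limitin_gamma_scaleR Lw Lu)
      then have LA: "limitin \<gamma> (\<lambda>i. the (A (w i))) y sequentially" by (simp add: w(2) z_def)
      have Cw: "C (w i) = Some (the (A (w i)))" for i using C w(1)[of i] Aw[of i] unfolding map_le_def by force
      then have "range w \<subseteq> dom C" "(\<lambda>i. the (C (w i))) = (\<lambda>i. the (A (w i)))" by auto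
      then show ?thesis
        using C Lw LA unfolding bi_closed_def limitin_gamma_iff by metis
    qed
    then show "bi_generator \<tau> S \<subseteq>\<^sub>m C" unfolding map_le_def dom_def by fastforce
  qed
qed

end

end

theorem corollary6p22:
  fixes sc :: "'k::real_normed_field \<Rightarrow> 'a::real_normed_vector \<Rightarrow> 'a"
    and \<tau> \<gamma> :: "'a topology"
    and Sn :: "nat \<Rightarrow> real \<Rightarrow> 'a \<Rightarrow> 'a"
    and An :: "nat \<Rightarrow> 'a \<rightharpoonup> 'a"
    and M \<omega> l :: real
  assumes "saks_space sc \<tau>"
    and "is_mixed_topology sc \<tau> \<gamma>"
    and "seq_complete \<gamma>"
    and "C_sequential \<gamma>"
    and "\<And>n. locally_bicontinuous_cosine sc \<tau> (Sn n)"
    and "\<And>n. An n = bi_generator \<tau> (Sn n)"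
    and "uniformly_locally_bi_equicontinuous \<tau> Sn"
    and "\<omega> \<ge> 0" and "M \<ge> 1"
    and "\<And>n t. t \<ge> 0 \<Longrightarrow> onorm (Sn n t) \<le> M * exp (\<omega> * t)"
    and "l > \<omega>"
  shows "(\<forall>n. resolvent_exists sc (of_real (l\<^sup>2)) (An n)) \<and>
    ((\<exists>A D. assertion_a sc \<tau> An l A D) \<longrightarrow> (\<exists>A D. assertion_b sc \<gamma> An l A D)) \<and>
    ((\<exists>A D. assertion_b sc \<gamma> An l A D) \<longrightarrow> (\<exists>R. assertion_c sc \<tau> An l R)) \<and>
    ((\<exists>R. assertion_c sc \<tau> An l R) \<longleftrightarrow> (\<exists>R. assertion_d sc \<gamma> An l R)) \<and>
    ((\<exists>R. assertion_d sc \<gamma> An l R) \<longleftrightarrow> (\<exists>S. assertion_e sc \<tau> Sn M \<omega> S)) \<and>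
    (\<forall>R S. assertion_c sc \<tau> An l R \<and> assertion_e sc \<tau> Sn M \<omega> S \<longrightarrow>
       resolvent_exists sc (of_real (l\<^sup>2)) (bi_generator \<tau> S) \<and>
       resolvent sc (of_real (l\<^sup>2)) (bi_generator \<tau> S) = R) \<and>
    (\<forall>A D S. assertion_b sc \<gamma> An l A D \<and> assertion_e sc \<tau> Sn M \<omega> S \<longrightarrow>
       graph_closable sc \<gamma> A \<and> is_graph_closure sc \<gamma> A (bi_generator \<tau> S)) \<and>
    (\<forall>A D S. assertion_a sc \<tau> An l A D \<and> assertion_e sc \<tau> Sn M \<omega> S \<longrightarrow>
       bi_closable sc \<tau> A \<and> is_bi_closure sc \<tau> A (bi_generator \<tau> S))"
proof -
  from assms(1)[unfolded saks_space_def, THEN conjunct2, THEN conjunct2, THEN conjunct2]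
  obtain P where P: "(\<forall>p\<in>P. is_seminorm sc p) \<and> directed_system P \<and> \<tau> = seminorm_topology P \<and>
      (\<forall>x. bdd_above ((\<lambda>p. p x) ` P) \<and> norm x = (SUP p\<in>P. p x))"
    by (elim exE) (rule that)
  interpret mixed_saks sc \<tau> \<gamma> P
  proof (rule mixed_saks.intro)
    show "normed_scaling sc" using assms(1) by (simp add: saks_space_def)
    show "is_seminorm sc p" if "p \<in> P" for p using P that by blast
    show "directed_system P" "\<tau> = seminorm_topology P" using P by blast+
    show "bdd_above ((\<lambda>p. p x) ` P)" "norm x = (SUP p\<in>P. p x)" for x
      using conjunct2[OF conjunct2[OF conjunct2[OF P]], rule_format, of x] by (rule conjunct1, rule conjunct2)
  qed (rule assms)+
  have Sn: "saks_cosine sc \<tau> \<gamma> P (Sn n) M \<omega>" for n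
    by (rule saks_cosineI[OF assms(5) assms(10) assms(8) assms(9)])
  interpret saks_cosine_sequence sc \<tau> \<gamma> P Sn M \<omega>
  proof (intro saks_cosine_sequence.intro saks_cosine_sequence_axioms.intro mixed_saks_axioms Sn)
    fix p b assume "p \<in> \<Gamma>" "\<omega> < b"
    with saks_cosine.S_sc_linear[OF Sn] saks_cosine.S_norm[OF Sn] assms(7-9)
    show "\<exists>q\<in>\<Gamma>. \<forall>n. \<forall>t\<ge>0. \<forall>x. p (Sn n t x) \<le> exp (b * t) * q x"
      by (rule exponentially_equicontinuous)
  qed
  note An = assms(6) and l = assms(11)
  have res: "resolvent_exists sc (of_real (l\<^sup>2)) (An n)" for n
    unfolding An by (rule F.resolvent_exists_generator[OF l])
  have ab: "assertion_b sc \<gamma> An l A D" if "assertion_a sc \<tau> An l A D" for A D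
    by (rule assertion_a_imp_assertion_b[OF An l that])
  have ec: "\<exists>R. assertion_c sc \<tau> An l R" and ed: "\<exists>R. assertion_d sc \<gamma> An l R"
    if "assertion_e sc \<tau> Sn M \<omega> S" for S
    using assertion_e_imp_assertion_c_d[OF An l that] by blast+
  \<comment> \<open>Apart from the passage from (a) to (b), all implications run through
    (e).\<close>
  have be: "\<exists>S. assertion_e sc \<tau> Sn M \<omega> S" if b: "assertion_b sc \<gamma> An l A D" for A D
    by (rule assertion_b_imp_resolvent_limit[OF An l b]) (rule resolvent_limit_imp_assertion_e[OF An l])
  have ce: "\<exists>S. assertion_e sc \<tau> Sn M \<omega> S" if "assertion_c sc \<tau> An l R" for R
    by (rule resolvent_limit_imp_assertion_e[OF An l assertion_c_imp_resolvent_limit[OF An l that]])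
  have de: "\<exists>S. assertion_e sc \<tau> Sn M \<omega> S" if "assertion_d sc \<gamma> An l R" for R
    by (rule resolvent_limit_imp_assertion_e[OF An l assertion_d_imp_resolvent_limit[OF An l that]])
  have gen: "resolvent_exists sc (of_real (l\<^sup>2)) (bi_generator \<tau> S) \<and>
       resolvent sc (of_real (l\<^sup>2)) (bi_generator \<tau> S) = R"
    if c: "assertion_c sc \<tau> An l R" and e: "assertion_e sc \<tau> Sn M \<omega> S" for R S
  proof -
    interpret G: saks_cosine sc \<tau> \<gamma> P S M \<omega> using e by (simp add: assertion_e_iff)
    have "R = G.Res l" by (rule resolvent_limit_eq[OF An l assertion_c_imp_resolvent_limit[OF An l c] e])
    then show ?thesis using G.resolvent_exists_generator[OF l] G.resolvent_generator[OF l] by blast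
  qed
  have gc: "is_graph_closure sc \<gamma> A (bi_generator \<tau> S)"
    if "assertion_b sc \<gamma> An l A D" "assertion_e sc \<tau> Sn M \<omega> S" for A D S
    by (rule generator_graph_closure[OF An l that])
  have bc: "is_bi_closure sc \<tau> A (bi_generator \<tau> S)"
    if "assertion_a sc \<tau> An l A D" "assertion_e sc \<tau> Sn M \<omega> S" for A D S
    by (rule generator_bi_closure[OF An l that])
  have gcl: "graph_closable sc \<gamma> A" if "is_graph_closure sc \<gamma> A C" for A C
    using that unfolding graph_closable_def is_graph_closure_def by blast
  have bcl: "bi_closable sc \<tau> A" if "is_bi_closure sc \<tau> A C" for A C
    using that unfolding bi_closable_def is_bi_closure_def by blast
  show ?thesis
  proof (intro conjI allI impI iffI)
    show "resolvent_exists sc (of_real (l\<^sup>2)) (An n)" for n by (rule res)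
    show "\<exists>A D. assertion_b sc \<gamma> An l A D" if "\<exists>A D. assertion_a sc \<tau> An l A D" using that ab by blast
    show "\<exists>R. assertion_c sc \<tau> An l R" if "\<exists>A D. assertion_b sc \<gamma> An l A D" using that be ec by blast
    show "\<exists>R. assertion_d sc \<gamma> An l R" if "\<exists>R. assertion_c sc \<tau> An l R" using that ce ed by blast
    show "\<exists>R. assertion_c sc \<tau> An l R" if "\<exists>R. assertion_d sc \<gamma> An l R" using that de ec by blast
    show "\<exists>S. assertion_e sc \<tau> Sn M \<omega> S" if "\<exists>R. assertion_d sc \<gamma> An l R" using that de by blast
    show "\<exists>R. assertion_d sc \<gamma> An l R" if "\<exists>S. assertion_e sc \<tau> Sn M \<omega> S" using that ed by blast
  qed (use gen gc bc gcl bcl in blast)+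
qed

end
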